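(* Let $\alpha\in[-\infty,1)$. Every Gibbs partition of type $\alpha$ is a unique probability mixture of the extreme Gibbs partitions of type $\alpha$; that is, for every law in $\mathcal P_\alpha$ with EPPF $p$ there is a unique Borel probability measure $Q$ on the index set of the family listed below such that $p(\lambda)=\int p_x(\lambda)\,Q(dx)$ for all compositions $\lambda$, where $p_x$ is the EPPF of the member of the family with index $x$. The extreme elements of the convex set $\mathcal P_\alpha$ are exactly: (i) the $(\alpha,|\alpha|m)$-partitions with $m\in\{1,2,\ldots,\infty\}$, if $\alpha\in[-\infty,0)$; (ii) the Ewens $(0,\theta)$-partitions with $\theta\in[0,\infty]$, if $\alpha=0$; (iii) the Poisson-Kingman $(\alpha|s)$-partitions with $s\in[0,\infty]$, if $\alpha\in(0,1)$.
   Context: An exchangeable random partition $\Pi=(\Pi_n)$ of $\mathbb N$ is a consistent sequence of random partitions $\Pi_n$ of $[n]=\{1,\ldots,n\}$ ($\Pi_n$ is obtained from $\Pi_{n+1}$ by discarding $n+1$), the law of each $\Pi_n$ being invariant under permutations of $[n]$. Its law is determined by its EPPF (exchangeable partition probability function) $p$, defined by $\mathbb P(\Pi_n=\{A_1,\ldots,A_k\})=p(|A_1|,\ldots,|A_k|)$; $p$ is a function on compositions $(\lambda_1,\ldots,\lambda_k)$ of positive integers $n$. Rising factorials: $(x)_{m\uparrow\beta}=\prod_{j=1}^m(x+(j-1)\beta)$, $(x)_{m\uparrow}=(x)_{m\uparrow 1}$, with the empty product equal to $1$; falling factorial: $(m)_{k\downarrow}=m(m-1)\cdots(m-k+1)$.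 For $\alpha\in[-\infty,1)$ put $W_j=(1-\alpha)_{j-1\uparrow}$ if $\alpha>-\infty$ and $W_j=1$ if $\alpha=-\infty$ ($j=1,2,\ldots$). A Gibbs partition of type $\alpha$ is an exchangeable random partition of $\mathbb N$ whose EPPF has the form $p(\lambda_1,\ldots,\lambda_k)=V_{n,k}\prod_{j=1}^kW_{\lambda_j}$, $n=\sum_j\lambda_j$, for some nonnegative array $(V_{n,k})_{1\le k\le n}$ with $V_{1,1}=1$. $\mathcal P_\alpha$ is the convex set of laws of all Gibbs partitions of type $\alpha$. Its topology is pointwise convergence of EPPFs. The families in the statement are the Gibbs partitions of type $\alpha$ with the following weights. - $(\alpha,|\alpha|m)$-partitions, $-\infty<\alpha<0$: for finite $m$, $V_{n,k}=\dfrac{(\theta+\alpha)_{k-1\uparrow\alpha}}{(\theta+1)_{n-1\uparrow}}$ with $\theta=m|\alpha|$; for $m=\infty$, $V_{n,k}=1(k=n)$ (the partition into singletons). - $(\alpha,|\alpha|m)$-partitions, $\alpha=-\infty$: for finite $m$, $V_{n,k}=(m)_{k\downarrow}/m^n$; for $m=\infty$, $V_{n,k}=1(k=n)$. - Ewens $(0,\theta)$-partitions ($\alpha=0$): for $0\le\theta<\infty$, $V_{n,k}=\theta^{k-1}/(\theta+1)_{n-1\uparrow}$ (with $0^0=1$, so $\theta=0$ gives the one-block partition); for $\theta=\infty$, $V_{n,k}=1(k=n)$. - $(\alpha|s)$-partitions, $0<\alpha<1$: let $f_\alpha$ be the density on $(0,\infty)$ of the $\alpha$-stable law with Laplace transform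 $\int_0^\infty e^{-\lambda x}f_\alpha(x)\,dx=\exp(-\lambda^\alpha)$. For $0<s<\infty$ put $t=s^{-1/\alpha}$; the $(\alpha|s)$-partition is the Poisson-Kingman partition $\mathrm{PK}(\rho_\alpha|t)$: given random frequencies distributed as the jumps on the time interval $[0,1]$ of a stable($\alpha$) subordinator (whose value $T$ at time $1$ has density $f_\alpha$), normalised by $T$ and conditioned on $T=t$, the integers are assigned to blocks by independent sampling from the frequencies. Explicitly it is the Gibbs partition of type $\alpha$ with $$V_{n,k}=\frac{\alpha^k}{\Gamma(n-k\alpha)\,t^{k\alpha}f_\alpha(t)}\int_0^1y^{n-1-k\alpha}f_\alpha(t(1-y))\,dy .$$ For $s=0$ it is the one-block partition ($\Pi_n=\{[n]\}$ for all $n$), and for $s=\infty$ it is the partition into singletons. *)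

theory Defs
  imports "HOL-Probability.Probability"
begin

text \<open>
  A random partition of the positive integers is a random sequence whose \<open>n\<close>-th entry is a
  partition of \<open>{1..n}\<close>.  The entry for \<open>n = 0\<close> carries no information: it is always the empty
  partition of the empty set.
\<close>

definition partition_seq_space :: "(nat \<Rightarrow> nat set set) measure" where
  "partition_seq_space = (\<Pi>\<^sub>M n\<in>UNIV. count_space {P. partition_on {1..n} P})"

definition restrict_partition :: "nat \<Rightarrow> nat set set \<Rightarrow> nat set set" where
  "restrict_partition n P = (\<lambda>A. A \<inter> {1..n}) ` P - {{}}"

definition exchangeable_partition_law :: "(nat \<Rightarrow> nat set set) measure \<Rightarrow> bool" where
  "exchangeable_partition_law M \<longleftrightarrow>
     prob_space M \<and>
     sets M = sets partition_seq_space \<and>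
     (AE \<omega> in M. \<forall>n. \<omega> n = restrict_partition n (\<omega> (Suc n))) \<and>
     (\<forall>n \<sigma> P. \<sigma> permutes {1..n} \<and> partition_on {1..n} P \<longrightarrow>
        measure M {\<omega> \<in> space M. \<omega> n = P} = measure M {\<omega> \<in> space M. \<omega> n = (`) \<sigma> ` P})"

definition composition :: "nat list \<Rightarrow> bool" where
  "composition c \<longleftrightarrow> c \<noteq> [] \<and> 0 \<notin> set c"

text \<open>
  Enumerating the blocks of a partition by a distinct list shows that this predicate determines
  \<open>p\<close> on all compositions (and forces \<open>p\<close> to be symmetric there); the values of \<open>p\<close> on other
  lists are irrelevant.
\<close>

definition has_eppf :: "(nat \<Rightarrow> nat set set) measure \<Rightarrow> (nat list \<Rightarrow> real) \<Rightarrow> bool" where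
  "has_eppf M p \<longleftrightarrow>
     (\<forall>n As. 1 \<le> n \<and> distinct As \<and> partition_on {1..n} (set As) \<longrightarrow>
        measure M {\<omega> \<in> space M. \<omega> n = set As} = p (map card As))"

definition gibbs_W :: "ereal \<Rightarrow> nat \<Rightarrow> real" where
  "gibbs_W \<alpha> j = (if \<alpha> = -\<infinity> then 1 else pochhammer (1 - real_of_ereal \<alpha>) (j - 1))"

definition gibbs_eppf :: "ereal \<Rightarrow> (nat \<Rightarrow> nat \<Rightarrow> real) \<Rightarrow> nat list \<Rightarrow> real" where
  "gibbs_eppf \<alpha> V c = V (sum_list c) (length c) * (\<Prod>j\<leftarrow>c. gibbs_W \<alpha> j)"

definition gibbs_laws :: "ereal \<Rightarrow> (nat \<Rightarrow> nat set set) measure set" where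
  "gibbs_laws \<alpha> =
     {M. exchangeable_partition_law M \<and>
         (\<exists>V. V 1 1 = 1 \<and> (\<forall>n k. 1 \<le> k \<and> k \<le> n \<longrightarrow> 0 \<le> V n k) \<and> has_eppf M (gibbs_eppf \<alpha> V))}"

text \<open>
  The library notion \<^const>\<open>extreme_point_of\<close> needs an ambient real vector space; this is
  the same notion for convex combinations of probability measures.
\<close>

definition extreme_laws :: "'a measure set \<Rightarrow> 'a measure set" where
  "extreme_laws S =
     {M \<in> S. \<forall>M1\<in>S. \<forall>M2\<in>S. \<forall>t::real. 0 < t \<and> t < 1 \<and>
        (\<forall>A\<in>sets M. measure M A = t * measure M1 A + (1 - t) * measure M2 A) \<longrightarrow>
        M1 = M \<and> M2 = M}"

definition rising :: "real \<Rightarrow> nat \<Rightarrow> real \<Rightarrow> real" where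
  "rising x m \<beta> = (\<Prod>j=1..m. x + (real j - 1) * \<beta>)"

definition singletons_V :: "nat \<Rightarrow> nat \<Rightarrow> real" where
  "singletons_V n k = (if k = n then 1 else 0)"

definition negative_V :: "real \<Rightarrow> ennreal \<Rightarrow> nat \<Rightarrow> nat \<Rightarrow> real" where
  "negative_V a m n k =
     (if m = \<infinity> then singletons_V n k
      else let \<theta> = enn2real m * \<bar>a\<bar>
           in rising (\<theta> + a) (k - 1) a / pochhammer (\<theta> + 1) (n - 1))"

definition minus_infinity_V :: "ennreal \<Rightarrow> nat \<Rightarrow> nat \<Rightarrow> real" where
  "minus_infinity_V m n k =
     (if m = \<infinity> then singletons_V n k
      else (\<Prod>i<k. enn2real m - real i) / enn2real m ^ n)"

definition ewens_V :: "ennreal \<Rightarrow> nat \<Rightarrow> nat \<Rightarrow> real" where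
  "ewens_V \<theta> n k =
     (if \<theta> = \<infinity> then singletons_V n k
      else enn2real \<theta> ^ (k - 1) / pochhammer (enn2real \<theta> + 1) (n - 1))"

text \<open>
  The weights of the Poisson-Kingman partitions involve values of the stable density at single
  points, so the density has to be the version that is continuous on \<open>(0,\<infinity>)\<close>; it is extended by
  \<open>0\<close> to the real line.  For \<open>0 < \<alpha> < 1\<close> these conditions have exactly one solution.
  The case \<open>l = 0\<close> says that the total mass is \<open>1\<close>, since \<open>0 powr a = 0\<close>.
\<close>

definition stable_density :: "real \<Rightarrow> real \<Rightarrow> real" where
  "stable_density a =
     (THE f. (\<forall>x\<le>0. f x = 0) \<and> (\<forall>x. 0 \<le> f x) \<and> continuous_on {0<..} f \<and>
        (\<forall>l\<ge>0. has_bochner_integral lborel (\<lambda>x. exp (- l * x) * f x) (exp (- (l powr a)))))"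

text \<open>
  For \<open>s = 0\<close> the weights are those of the one-block partition, whose EPPF is \<open>1\<close> on one-part
  compositions; hence \<open>V n 1\<close> is the reciprocal of \<open>gibbs_W a n\<close>.
\<close>

definition poisson_kingman_V :: "real \<Rightarrow> ennreal \<Rightarrow> nat \<Rightarrow> nat \<Rightarrow> real" where
  "poisson_kingman_V a s n k =
     (if s = 0 then (if k = 1 then 1 / pochhammer (1 - a) (n - 1) else 0)
      else if s = \<infinity> then singletons_V n k
      else let t = enn2real s powr (- 1 / a); f = stable_density a
           in a ^ k / (Gamma (real n - real k * a) * t powr (real k * a) * f t)
              * (LBINT y:{0<..<1}. y powr (real n - 1 - real k * a) * f (t * (1 - y))))"

text \<open>
  All index sets are subsets of \<open>[0,\<infinity>]\<close>.  For \<open>\<alpha> < 0\<close> the subspace \<open>{1, 2, \<dots>, \<infinity>}\<close> is the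
  one-point compactification of the discrete space \<open>{1, 2, \<dots>}\<close>.
\<close>

definition extreme_index :: "ereal \<Rightarrow> ennreal set" where
  "extreme_index \<alpha> = (if \<alpha> < 0 then insert \<infinity> (of_nat ` {1..}) else UNIV)"

definition extreme_V :: "ereal \<Rightarrow> ennreal \<Rightarrow> nat \<Rightarrow> nat \<Rightarrow> real" where
  "extreme_V \<alpha> x =
     (if \<alpha> = -\<infinity> then minus_infinity_V x
      else if \<alpha> < 0 then negative_V (real_of_ereal \<alpha>) x
      else if \<alpha> = 0 then ewens_V x
      else poisson_kingman_V (real_of_ereal \<alpha>) x)"

definition extreme_eppf :: "ereal \<Rightarrow> ennreal \<Rightarrow> nat list \<Rightarrow> real" where
  "extreme_eppf \<alpha> x = gibbs_eppf \<alpha> (extreme_V \<alpha> x)"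

end

theory Submission
  imports Defs "HOL-Real_Asymp.Real_Asymp"
begin

text \<open>
The weights of a Gibbs law of type \<open>\<alpha>\<close> satisfy the backward recursion
\<open>V n k = (n - \<alpha> k) V (n + 1) k + V (n + 1) (k + 1)\<close>, with coefficient \<open>k\<close> in place of \<open>n - \<alpha> k\<close> if
\<open>\<alpha> = -\<infinity>\<close>.  Conversely each nonnegative solution with \<open>V 1 1 = 1\<close> belongs to exactly one Gibbs law
(\<open>gibbs_law_solution\<close>, \<open>gibbs_law_exists\<close>, \<open>gibbs_eppf_determines_law\<close>).  A solution is the same thing
as a Markov chain of block counts \<open>K\<^sub>1, K\<^sub>2, \<dots>\<close>, and all these chains share their backward
transition probabilities.  The theorem thus asks for the boundary of this chain.

Let \<open>U z\<close> be solutions indexed by a compact set \<open>Z\<close>.  They form the boundary if two things hold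
(\<open>gibbs_boundary\<close>): under \<open>U z\<close> a rescaled version \<open>\<zeta> K\<^sub>\<nu>\<close> of the number of blocks converges to \<open>z\<close>,
and the backward dynamics from \<open>K\<^sub>\<nu> = \<kappa>\<close> are uniformly close to the solution with parameter
\<open>\<zeta> \<nu> \<kappa>\<close>.  Then every solution is nearly a mixture of the \<open>U z\<close> with respect to the law of
\<open>\<zeta> K\<^sub>\<nu>\<close>, so that a weak limit of these laws represents it (\<open>represents_exists\<close>).  The representing measure
is unique because, by the law of large numbers, it must be the limit of these laws
(\<open>represents_unique\<close>).

The second condition follows from the first.  A backward step leaves the number of blocks unchanged or
lowers it by one, so the backward dynamics preserve order, and a conditional tail probability is squeezed
between those for nearby parameters.  For an interval of parameters the law of large numbers is needed only
on a dense set and along a subsequence (\<open>gibbs_interval\<close>); the case of integer parameters is simpler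
(\<open>gibbs_discrete\<close>).

It remains to prove laws of large numbers.  For \<open>\<alpha> < 0\<close> the number of blocks converges to \<open>m\<close>, as its
mean distance from \<open>m\<close> is a product that tends to \<open>0\<close>.  For \<open>\<alpha> = 0\<close> it is a sum of independent
indicators and grows like \<open>\<theta>\<close> times the harmonic numbers (\<open>ewens_lln\<close>).  For \<open>0 < \<alpha> < 1\<close> write
\<open>t = s powr (- 1 / \<alpha>)\<close>; then \<open>K\<^sub>n\<close> grows like \<open>n powr \<alpha> * t powr (- \<alpha>)\<close>.  The mean square
deviation, averaged over \<open>t\<close> with the stable density, can be computed since mixtures of Poisson-Kingman
partitions of Pitman-Yor type have Gamma quotients as weights (\<open>tilted_weight_integral\<close>,
\<open>mean_square_integral\<close>).  It tends to \<open>0\<close>, which gives convergence for almost every \<open>t\<close> along a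
subsequence.

For the Poisson-Kingman partitions the recursion is an identity between fractional integrals of the stable
density; Laplace transformation turns it into a rule of differentiation (\<open>pk_numerator_rec\<close>).  The stable
law is a limit of sums of Sibuya variables (\<open>stable_law_exists\<close>), and repeated multiplication by the
variable shows that it has a continuous density (\<open>stable_density_exists\<close>).

Finally, unique representation determines the extreme laws (\<open>gibbs_family\<close>).  A member of the family is
represented by a point mass, which is no proper mixture.  An extreme law is represented by a measure
with values \<open>0\<close> and \<open>1\<close> only, as conditioning would otherwise decompose it; hence it has the weights of
one member.
\<close>

section \<open>Consistent laws of random partitions\<close>

abbreviation partitions :: "nat \<Rightarrow> nat set set set" where
  "partitions n \<equiv> {P. partition_on {1..n} P}"

definition extensions :: "nat \<Rightarrow> nat set set \<Rightarrow> nat set set set" where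
  "extensions n P = {Q \<in> partitions (Suc n). restrict_partition n Q = P}"

lemma finite_partitions: "finite (partitions n)"
  using finitely_many_partition_on[of "{1..n}"] by simp

lemma partition_restrict:
  assumes "partition_on {1..m} Q" "n \<le> m"
  shows "partition_on {1..n} (restrict_partition n Q)"
proof (rule partition_onI)
  have "\<Union> (restrict_partition n Q) = \<Union> Q \<inter> {1..n}" unfolding restrict_partition_def by blast
  then show "\<Union> (restrict_partition n Q) = {1..n}"
    unfolding partition_onD1[OF assms(1), symmetric] using assms(2) by auto
next
  fix p q assume "p \<in> restrict_partition n Q" "q \<in> restrict_partition n Q" "p \<noteq> q"
  then show "disjnt p q"
    using partition_onD2[OF assms(1)] unfolding restrict_partition_def disjoint_def disjnt_def by blast
qed (auto simp: restrict_partition_def)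

lemma restrict_restrict_partition:
  assumes "n \<le> m"
  shows "restrict_partition n (restrict_partition m Q) = restrict_partition n Q"
proof -
  have e: "(\<lambda>A. A \<inter> {1..m} \<inter> {1..n}) = (\<lambda>A. A \<inter> {1..n})" using assms by (intro ext) auto
  have "(\<lambda>A. A \<inter> {1..n}) ` ((\<lambda>A. A \<inter> {1..m}) ` Q - {{}}) - {{}}
      = (\<lambda>A. A \<inter> {1..n}) ` ((\<lambda>A. A \<inter> {1..m}) ` Q) - {{}}" by auto
  then show ?thesis unfolding restrict_partition_def by (simp only: image_image e)
qed

lemma restrict_partition_self:
  assumes "partition_on {1..n} P" shows "restrict_partition n P = P"
proof -
  have "A \<inter> {1..n} = A" if "A \<in> P" for A using partition_onD1[OF assms] that by auto
  then have "(\<lambda>A. A \<inter> {1..n}) ` P = P" by (auto simp: image_iff)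
  then show ?thesis using partition_onD3[OF assms] by (auto simp: restrict_partition_def)
qed

lemma partition_on_0: "partitions 0 = {{}}"
  by (auto simp: partition_on_def disjoint_def)

text \<open>The block of \<open>n + 1\<close> is new, or it is an old block enlarged. These are the two moves of the chain of
  partitions, and the origin of the two terms in the recursion of the Gibbs weights.\<close>

lemma extensions_eq:
  assumes P: "partition_on {1..n} P"
  shows "extensions n P = insert (insert {Suc n} P) ((\<lambda>A. insert (insert (Suc n) A) (P - {A})) ` P)"
    (is "_ = ?R")
proof -
  have notin: "Suc n \<notin> A" if "A \<in> P" for A
  proof -
    have "A \<subseteq> {1..n}" using partition_onD1[OF P] that by blast
    then show ?thesis by auto
  qed
  have ne: "A \<noteq> {}" if "A \<in> P" for A using partition_onD3[OF P] that by auto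
  have sub: "A \<subseteq> {1..n}" if "A \<in> P" for A using partition_onD1[OF P] that by auto
  have U: "\<Union>P = {1..n}" using partition_onD1[OF P] by simp
  have Suc_set: "{1..Suc n} = insert (Suc n) {1..n}" by auto
  have dis: "A \<inter> B = {}" if "A \<in> P" "B \<in> P" "A \<noteq> B" for A B
    using partition_onD2[OF P] that by (auto simp: disjoint_def)
  have self: "(\<lambda>A. A \<inter> {1..n}) ` R = R" if "R \<subseteq> P" for R
  proof -
    have "A \<inter> {1..n} = A" if "A \<in> R" for A using sub \<open>R \<subseteq> P\<close> that by blast
    then show ?thesis by (auto simp: image_iff)
  qed
  show ?thesis
  proof (intro equalityI subsetI)
    fix Q assume "Q \<in> extensions n P"
    then have Q: "partition_on {1..Suc n} Q" and rQ: "restrict_partition n Q = P"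
      by (auto simp: extensions_def)
    have "Suc n \<in> \<Union> Q" unfolding partition_onD1[OF Q, symmetric] by simp
    then obtain B where B: "B \<in> Q" "Suc n \<in> B" by blast
    have other: "A \<inter> {1..n} = A \<and> A \<noteq> {}" if "A \<in> Q" "A \<noteq> B" for A
    proof -
      have "A \<inter> B = {}" using partition_onD2[OF Q] that B by (auto simp: disjoint_def)
      then have "Suc n \<notin> A" using B by auto
      moreover have "A \<subseteq> {1..Suc n}" using partition_onD1[OF Q] that by blast
      ultimately have "A \<subseteq> {1..n}" unfolding Suc_set by auto
      then show ?thesis using partition_onD3[OF Q] that by auto
    qed
    have Bsub: "B \<subseteq> insert (Suc n) {1..n}" using partition_onD1[OF Q] B Suc_set by blast
    have im: "(\<lambda>A. A \<inter> {1..n}) ` Q = insert (B \<inter> {1..n}) (Q - {B})"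
    proof -
      have "Q = insert B (Q - {B})" using B by auto
      then have "(\<lambda>A. A \<inter> {1..n}) ` Q = insert (B \<inter> {1..n}) ((\<lambda>A. A \<inter> {1..n}) ` (Q - {B}))" by (metis image_insert)
      moreover have "(\<lambda>A. A \<inter> {1..n}) ` (Q - {B}) = Q - {B}" using other by (auto simp: image_iff)
      ultimately show ?thesis by simp
    qed
    show "Q \<in> ?R"
    proof (cases "B \<inter> {1..n} = {}")
      case True
      then have "B = {Suc n}" using Bsub B by auto
      moreover have "P = Q - {B}" using rQ im True other unfolding restrict_partition_def by auto
      ultimately show ?thesis using B by auto
    next
      case False
      have "{} \<notin> Q - {B}" using other by auto
      then have Peq: "P = insert (B \<inter> {1..n}) (Q - {B})" using rQ im False unfolding restrict_partition_def by auto
      have nin: "B \<inter> {1..n} \<notin> Q - {B}"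
      proof
        assume "B \<inter> {1..n} \<in> Q - {B}"
        then have "(B \<inter> {1..n}) \<inter> B = {}" using partition_onD2[OF Q] B by (auto simp: disjoint_def)
        then show False using False by auto
      qed
      have "insert (Suc n) (B \<inter> {1..n}) = B" using Bsub B by auto
      moreover have "P - {B \<inter> {1..n}} = Q - {B}" using Peq nin by auto
      ultimately have "Q = insert (insert (Suc n) (B \<inter> {1..n})) (P - {B \<inter> {1..n}})" using B by auto
      moreover have "B \<inter> {1..n} \<in> P" using Peq by auto
      ultimately show ?thesis by blast
    qed
  next
    fix Q assume "Q \<in> ?R"
    then consider "Q = insert {Suc n} P" | A where "A \<in> P" "Q = insert (insert (Suc n) A) (P - {A})" by auto
    then show "Q \<in> extensions n P"
    proof cases
      case 1
      have "partition_on {1..Suc n} Q" unfolding 1 Suc_set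
        by (intro partition_onI) (use U dis notin partition_onD3[OF P] in \<open>auto simp: disjnt_def\<close>)
      moreover have "restrict_partition n Q = P"
        unfolding 1 restrict_partition_def using self[of P] ne by auto
      ultimately show ?thesis by (simp add: extensions_def)
    next
      case 2
      have "partition_on {1..Suc n} Q"
      proof (rule partition_onI)
        have "\<Union> Q = insert (Suc n) (A \<union> \<Union>(P - {A}))" unfolding 2 by auto
        also have "A \<union> \<Union>(P - {A}) = \<Union>P" using 2 by auto
        finally show "\<Union> Q = {1..Suc n}" using U Suc_set by simp
      next
        fix p q assume "p \<in> Q" "q \<in> Q" "p \<noteq> q"
        then show "disjnt p q" using 2 dis notin by (auto simp: disjnt_def)
      next
        show "{} \<notin> Q" using ne 2 by auto
      qed
      moreover have "restrict_partition n Q = P"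
      proof -
        have "insert (Suc n) A \<inter> {1..n} = A" using sub[OF 2(1)] by auto
        then have "(\<lambda>A. A \<inter> {1..n}) ` Q = insert A (P - {A})"
          unfolding 2(2) image_insert self[OF Diff_subset] by simp
        then show ?thesis
          unfolding restrict_partition_def using ne[OF 2(1)] ne insert_Diff[OF 2(1)]
          by (metis Diff_insert_absorb Diff_empty partition_onD3[OF P] insert_Diff1 singletonI insert_iff)
      qed
      ultimately show ?thesis by (simp add: extensions_def)
    qed
  qed
qed

lemma extensions_distinct:
  assumes P: "partition_on {1..n} P"
  shows "insert {Suc n} P \<notin> (\<lambda>A. insert (insert (Suc n) A) (P - {A})) ` P"
    and "inj_on (\<lambda>A. insert (insert (Suc n) A) (P - {A})) P"
proof -
  have notin: "Suc n \<notin> A" if "A \<in> P" for A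
  proof -
    have "A \<subseteq> {1..n}" using partition_onD1[OF P] that by blast
    then show ?thesis by auto
  qed
  have ne: "A \<noteq> {}" if "A \<in> P" for A using partition_onD3[OF P] that by auto
  show "insert {Suc n} P \<notin> (\<lambda>A. insert (insert (Suc n) A) (P - {A})) ` P"
  proof
    assume "insert {Suc n} P \<in> (\<lambda>A. insert (insert (Suc n) A) (P - {A})) ` P"
    then obtain A where A: "A \<in> P" "insert {Suc n} P = insert (insert (Suc n) A) (P - {A})" by auto
    then have "A \<in> insert (insert (Suc n) A) (P - {A})" by blast
    then show False using notin[OF A(1)] by auto
  qed
  show "inj_on (\<lambda>A. insert (insert (Suc n) A) (P - {A})) P"
  proof (rule inj_onI)
    fix A B assume AB: "A \<in> P" "B \<in> P" "insert (insert (Suc n) A) (P - {A}) = insert (insert (Suc n) B) (P - {B})"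
    then have "insert (Suc n) A \<in> insert (insert (Suc n) B) (P - {B})" by blast
    then have "insert (Suc n) A = insert (Suc n) B" using notin by auto
    then show "A = B" using notin AB by (metis insert_ident)
  qed
qed

lemma sum_extensions:
  fixes w :: "nat set set \<Rightarrow> 'a::comm_monoid_add"
  assumes P: "partition_on {1..n} P"
  shows "sum w (extensions n P)
    = w (insert {Suc n} P) + (\<Sum>A\<in>P. w (insert (insert (Suc n) A) (P - {A})))"
proof -
  have "finite P" using P finite_elements by blast
  then show ?thesis
    using extensions_distinct[OF P] by (simp add: extensions_eq[OF P] sum.reindex)
qed

lemma finite_extensions: "finite (extensions n P)"
  using finite_partitions unfolding extensions_def by simp

lemma extensions_subset: "extensions n P \<subseteq> partitions (Suc n)"
  by (auto simp: extensions_def)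

text \<open>The law is that of a Markov chain, built with the theorem of Ionescu-Tulcea: the next partition is an
  extension of the present one, chosen with probability proportional to its weight. From a partition of
  weight \<open>0\<close>, which is visited with probability \<open>0\<close>, the chain moves to the extension by a singleton.\<close>

theorem consistent_partition_law_exists:
  fixes w :: "nat \<Rightarrow> nat set set \<Rightarrow> real"
  assumes nn: "\<And>n P. partition_on {1..n} P \<Longrightarrow> 0 \<le> w n P"
    and w0: "w 0 {} = 1"
    and add: "\<And>n P. partition_on {1..n} P \<Longrightarrow> w n P = sum (w (Suc n)) (extensions n P)"
  shows "\<exists>M. prob_space M \<and> sets M = sets partition_seq_space \<and>
     (AE \<omega> in M. \<forall>n. \<omega> n = restrict_partition n (\<omega> (Suc n))) \<and>
     (\<forall>n P. partition_on {1..n} P \<longrightarrow> measure M {\<omega>\<in>space M. \<omega> n = P} = w n P)"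
proof -
  define M where "M n = count_space (partitions n)" for n
  define k where "k n P Q = (if restrict_partition n Q = P then
      (if w n P = 0 then (if Q = insert {Suc n} P then 1 else 0) else w (Suc n) Q / w n P) else 0)" for n P Q
  define K where "K i \<omega> = (case i of 0 \<Rightarrow> point_measure (partitions 0) (\<lambda>_. 1)
     | Suc n \<Rightarrow> point_measure (partitions (Suc n)) (\<lambda>Q. ennreal (k n (\<omega> n) Q)))"
     for i and \<omega> :: "nat \<Rightarrow> nat set set"
  have k_nn: "0 \<le> k n P Q" if "partition_on {1..n} P" "partition_on {1..Suc n} Q" for n P Q
    unfolding k_def using nn that by simp
  have k_sum: "(\<Sum>Q\<in>partitions (Suc n). k n P Q) = 1" if P: "partition_on {1..n} P" for n P
  proof -
    have "(\<Sum>Q\<in>partitions (Suc n). k n P Q) = (\<Sum>Q\<in>extensions n P. k n P Q)"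
      by (rule sum.mono_neutral_right) (use finite_partitions[of "Suc n"] in \<open>auto simp: extensions_def k_def\<close>)
    also have "\<dots> = 1"
    proof (cases "w n P = 0")
      case True
      have "(\<Sum>Q\<in>extensions n P. k n P Q) = (\<Sum>Q\<in>extensions n P. if Q = insert {Suc n} P then 1 else 0)"
        by (intro sum.cong) (auto simp: k_def True extensions_def)
      also have "\<dots> = 1"
        using extensions_eq[OF P] finite_extensions[of n P] by (simp add: sum.delta)
      finally show ?thesis .
    next
      case False
      have "(\<Sum>Q\<in>extensions n P. k n P Q) = (\<Sum>Q\<in>extensions n P. w (Suc n) Q / w n P)"
        by (intro sum.cong) (auto simp: k_def False extensions_def)
      also have "\<dots> = 1" using add[OF P] False by (simp add: sum_divide_distrib[symmetric])
      finally show ?thesis .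
    qed
    finally show ?thesis .
  qed
  have em_K: "emeasure (K (Suc n) \<omega>) A = ennreal (\<Sum>Q\<in>A. k n (\<omega> n) Q)"
    if "\<omega> n \<in> partitions n" "A \<subseteq> partitions (Suc n)" for n \<omega> A
    unfolding K_def using that finite_subset[OF that(2) finite_partitions]
    by (simp add: emeasure_point_measure_finite2) (intro sum_ennreal, use k_nn in auto)
  have K0: "K 0 \<omega> = point_measure {{}} (\<lambda>_. 1)" for \<omega> by (simp only: K_def nat.case partition_on_0)
  have K0_prob: "prob_space (K 0 \<omega>)" for \<omega>
    unfolding K0 by (intro prob_spaceI) (simp add: space_point_measure emeasure_point_measure_finite)
  have KS_prob: "prob_space (K (Suc n) \<omega>)" if "\<omega> n \<in> partitions n" for n \<omega>
    using em_K[of \<omega> n "partitions (Suc n)"] that k_sum[of n "\<omega> n"]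
    by (intro prob_spaceI) (auto simp: K_def space_point_measure)
  have setsK: "sets (K i \<omega>) = sets (M i)" for i \<omega>
    by (cases i) (simp_all add: K_def M_def sets_point_measure)
  have K_meas: "K i \<in> measurable (PiM {0..<i} M) (subprob_algebra (M i))" for i
  proof -
    show "K i \<in> measurable (PiM {0..<i} M) (subprob_algebra (M i))"
    proof (cases i)
      case 0
      have "K 0 = (\<lambda>_. point_measure {{}} (\<lambda>_. 1))" using K0 by auto
      moreover have "point_measure {{}} (\<lambda>_. 1) \<in> space (subprob_algebra (M 0))"
        using K0_prob[of undefined] setsK[of 0 undefined] unfolding K0 space_subprob_algebra
        by (auto intro: prob_space_imp_subprob_space)
      ultimately show ?thesis unfolding 0 by (simp only: measurable_const)
    next
      case (Suc n)
      have 1: "(\<lambda>P. K (Suc n) (\<lambda>_. P)) \<in> measurable (M n) (subprob_algebra (M (Suc n)))"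
        unfolding M_def[of n] measurable_count_space_eq1
        using KS_prob setsK by (auto simp: space_subprob_algebra intro: prob_space_imp_subprob_space)
      have 2: "(\<lambda>\<omega>. \<omega> n) \<in> measurable (PiM {0..<Suc n} M) (M n)" by (rule measurable_component_singleton) simp
      show ?thesis unfolding Suc using measurable_compose[OF 2 1] by (simp add: K_def[abs_def])
    qed
  qed
  have K_prob: "prob_space (K i x)" if x: "x \<in> space (PiM {0..<i} M)" for i x
  proof -
    show "prob_space (K i x)"
      using K0_prob KS_prob x by (cases i) (auto simp: space_PiM PiE_iff M_def)
  qed
  interpret IT: Ionescu_Tulcea K M
    by (rule Ionescu_Tulcea.intro) (fact K_meas K_prob)+
  let ?L = "IT.PF.lim"
  let ?C = "\<lambda>n. IT.C 0 n (\<lambda>_. undefined)"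
  have "partition_seq_space = PiM UNIV M" by (simp only: partition_seq_space_def M_def[abs_def])
  then have setsL: "sets ?L = sets partition_seq_space" using IT.PF.sets_lim by (simp only:)
  have spaceL: "space ?L = space (PiM UNIV M)" by simp
  have prob: "prob_space ?L"
  proof (rule prob_spaceI)
    have e: "IT.PF.emb UNIV {} (space (PiM {} M)) = space (PiM UNIV M)"
      by (auto simp: prod_emb_def space_PiM)
    have "emeasure ?L (IT.PF.emb UNIV {} (space (PiM {} M))) = emeasure (IT.CI {}) (space (PiM {} M))"
      by (rule IT.lim) auto
    also have "\<dots> = 1" using IT.PF.prob_space_P[of "{}"] IT.PF.space_P[of "{}"] prob_space.emeasure_space_1 by fastforce
    finally show "emeasure ?L (space ?L) = 1" by (simp only: e spaceL)
  qed
  interpret L: prob_space ?L by (rule prob)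
  have und: "(\<lambda>_. undefined) \<in> space (PiM {0..<0} M)" by (simp add: space_PiM)
  have setsC: "sets (?C n) = sets (PiM {0..<n} M)" for n using IT.sets_C[OF und] by simp
  have spaceC: "space (?C n) = space (PiM {0..<n} M)" for n using IT.space_C[OF und] by simp
  have cyl: "emeasure ?L {\<omega>\<in>space ?L. restrict \<omega> {0..<n} \<in> X} = emeasure (?C n) X"
    if "X \<in> sets (PiM {0..<n} M)" for n X
  proof -
    have "{\<omega>\<in>space ?L. restrict \<omega> {0..<n} \<in> X} = IT.PF.emb UNIV {0..<n} X"
      by (auto simp: prod_emb_def space_PiM)
    then have "emeasure ?L {\<omega>\<in>space ?L. restrict \<omega> {0..<n} \<in> X} = emeasure (IT.CI {0..<n}) X"
      using IT.lim[of "{0..<n}" X] that by simp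
    also have "\<dots> = emeasure (?C n) (IT.PF.emb {0..<n} {0..<n} X)"
      using IT.emeasure_CI[of "{0..<n}" n X] that by simp
    also have "IT.PF.emb {0..<n} {0..<n} X = X" using sets.sets_into_space[OF that] by (intro prod_emb_id) (simp add: space_PiM)
    finally show ?thesis .
  qed
  have Cmeas: "Measurable.pred (PiM {0..<Suc n} M) (\<lambda>\<omega>. \<omega> n = P)" for n P
  proof -
    have "(\<lambda>\<omega>. \<omega> n) \<in> measurable (PiM {0..<Suc n} M) (M n)" by (rule measurable_component_singleton) simp
    moreover have "Measurable.pred (M n) (\<lambda>x. x = P)" by (simp add: M_def)
    ultimately show ?thesis by (rule measurable_compose)
  qed
  have Cmeas2: "Measurable.pred (PiM {0..<Suc (Suc n)} M) (\<lambda>\<omega>. \<omega> n = P \<and> \<omega> (Suc n) = Q)" for n P Q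
  proof -
    have "(\<lambda>\<omega>. \<omega> n) \<in> measurable (PiM {0..<Suc (Suc n)} M) (M n)" by (rule measurable_component_singleton) simp
    moreover have "Measurable.pred (M n) (\<lambda>x. x = P)" by (simp add: M_def)
    ultimately have "Measurable.pred (PiM {0..<Suc (Suc n)} M) (\<lambda>\<omega>. \<omega> n = P)" by (rule measurable_compose)
    then show ?thesis using Cmeas[of "Suc n" Q] by simp
  qed
  have inter: "emeasure ?L {\<omega>\<in>space ?L. \<omega> n = P \<and> \<omega> (Suc n) = Q}
      = emeasure ?L {\<omega>\<in>space ?L. \<omega> n = P} * ennreal (k n P Q)"
    if PQ: "P \<in> partitions n" "Q \<in> partitions (Suc n)" for n P Q
  proof -
    let ?X = "{\<omega> \<in> space (PiM {0..<Suc (Suc n)} M). \<omega> n = P \<and> \<omega> (Suc n) = Q}"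
    let ?Y = "{\<omega> \<in> space (PiM {0..<Suc n} M). \<omega> n = P}"
    have X: "?X \<in> sets (PiM {0..<Suc (Suc n)} M)" using Cmeas2[of n P Q] by simp
    have Y: "?Y \<in> sets (PiM {0..<Suc n} M)" using Cmeas[of n P] by simp
    have "emeasure ?L {\<omega>\<in>space ?L. \<omega> n = P \<and> \<omega> (Suc n) = Q} = emeasure ?L {\<omega>\<in>space ?L. restrict \<omega> {0..<Suc (Suc n)} \<in> ?X}"
      by (rule arg_cong[where f="emeasure ?L"]) (auto simp: space_PiM PiE_iff)
    also have "\<dots> = emeasure (?C (Suc (Suc n))) ?X" by (rule cyl[OF X])
    also have "\<dots> = emeasure (?C (Suc n) \<bind> IT.eP (Suc n)) ?X" by simp
    also have "\<dots> = (\<integral>\<^sup>+\<omega>. emeasure (IT.eP (Suc n) \<omega>) ?X \<partial>?C (Suc n))"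
      by (rule emeasure_bind[OF _ _ X])
         (use IT.space_C[OF und, of "Suc n"] IT.sets_C[OF und, of "Suc n"] prob_space.not_empty[OF IT.prob_space_C[OF und, of "Suc n"]] IT.measurable_eP[of "Suc n"] in \<open>auto simp del: IT.C.simps cong: measurable_cong_sets\<close>)
    also have "\<dots> = (\<integral>\<^sup>+\<omega>. ennreal (k n P Q) * indicator ?Y \<omega> \<partial>?C (Suc n))"
    proof (rule nn_integral_cong)
      fix \<omega> assume "\<omega> \<in> space (?C (Suc n))"
      then have w: "\<omega> \<in> space (PiM {0..<Suc n} M)" unfolding spaceC .
      then have wn: "\<omega> n \<in> partitions n" by (auto simp: space_PiM PiE_iff M_def)
      have "emeasure (IT.eP (Suc n) \<omega>) ?X = emeasure (K (Suc n) \<omega>) ((\<lambda>x. fun_upd \<omega> (Suc n) x) -` ?X \<inter> space (M (Suc n)))"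
        by (rule IT.emeasure_eP[OF w X])
      also have "(\<lambda>x. fun_upd \<omega> (Suc n) x) -` ?X \<inter> space (M (Suc n)) = (if \<omega> n = P then {Q} else {})"
        using w PQ by (auto simp: space_PiM PiE_iff M_def extensional_def)
      also have "emeasure (K (Suc n) \<omega>) \<dots> = ennreal (k n P Q) * indicator ?Y \<omega>"
        using em_K[of \<omega> n "{Q}"] wn PQ w by (auto simp: indicator_def)
      finally show "emeasure (IT.eP (Suc n) \<omega>) ?X = ennreal (k n P Q) * indicator ?Y \<omega>" .
    qed
    also have "\<dots> = ennreal (k n P Q) * emeasure (?C (Suc n)) ?Y"
      by (rule nn_integral_cmult_indicator) (simp only: setsC Y)
    also have "emeasure (?C (Suc n)) ?Y = emeasure ?L {\<omega>\<in>space ?L. restrict \<omega> {0..<Suc n} \<in> ?Y}"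
      by (rule cyl[OF Y, symmetric])
    also have "{\<omega>\<in>space ?L. restrict \<omega> {0..<Suc n} \<in> ?Y} = {\<omega>\<in>space ?L. \<omega> n = P}" by (auto simp: space_PiM PiE_iff)
    finally show ?thesis by (simp add: mult.commute)
  qed
  have Lcomp: "(\<lambda>\<omega>. \<omega> n) \<in> measurable ?L (count_space (partitions n))" for n
    unfolding measurable_cong_sets[OF IT.PF.sets_lim refl] M_def[symmetric] by (rule measurable_component_singleton) simp
  have Lev: "{\<omega>\<in>space ?L. \<omega> n = P} \<in> sets ?L" for n P
  proof -
    have "(\<lambda>\<omega>. \<omega> n) -` ({P} \<inter> partitions n) \<inter> space ?L \<in> sets ?L"
      by (rule measurable_sets[OF Lcomp[of n]]) simp
    also have "(\<lambda>\<omega>. \<omega> n) -` ({P} \<inter> partitions n) \<inter> space ?L = {\<omega>\<in>space ?L. \<omega> n = P}"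
      using measurable_space[OF Lcomp[of n]] by auto
    finally show ?thesis .
  qed
  have Lev2: "{\<omega>\<in>space ?L. \<omega> n = P \<and> \<omega> (Suc n) = Q} \<in> sets ?L" for n P Q
    using sets.Int[OF Lev[of n P] Lev[of "Suc n" Q]] by (rule back_subst[where P="\<lambda>A. A \<in> sets ?L"]) blast
  have Lin: "\<omega> n \<in> partitions n" if "\<omega> \<in> space ?L" for \<omega> n using that by (auto simp: space_PiM PiE_iff M_def)
  have marg: "measure ?L {\<omega>\<in>space ?L. \<omega> n = P} = w n P" if "P \<in> partitions n" for n P
    using that
  proof (induction n arbitrary: P)
    case 0
    then have "P = {}" using partition_on_0 by auto
    then have "{\<omega>\<in>space ?L. \<omega> 0 = P} = space ?L" using Lin[of _ 0] unfolding partition_on_0 by auto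
    then show ?case using L.prob_space w0 \<open>P = {}\<close> by simp
  next
    case (Suc n Q)
    let ?P = "restrict_partition n Q"
    have Pp: "?P \<in> partitions n" using partition_restrict[of "Suc n" Q n] Suc.prems by auto
    have "{\<omega>\<in>space ?L. \<omega> (Suc n) = Q} = (\<Union>P\<in>partitions n. {\<omega>\<in>space ?L. \<omega> n = P \<and> \<omega> (Suc n) = Q})"
      using Lin[of _ n] by auto
    then have "measure ?L {\<omega>\<in>space ?L. \<omega> (Suc n) = Q} = (\<Sum>P\<in>partitions n. measure ?L {\<omega>\<in>space ?L. \<omega> n = P \<and> \<omega> (Suc n) = Q})"
      by (simp only:) (intro L.finite_measure_finite_Union finite_partitions image_subsetI Lev2, auto simp: disjoint_family_on_def)
    also have "\<dots> = (\<Sum>P\<in>partitions n. w n P * k n P Q)"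
    proof (intro sum.cong refl)
      fix P assume P: "P \<in> partitions n"
      show "measure ?L {\<omega>\<in>space ?L. \<omega> n = P \<and> \<omega> (Suc n) = Q} = w n P * k n P Q"
        using inter[OF P Suc.prems] Suc.IH[OF P] k_nn P Suc.prems unfolding measure_def by (simp add: enn2real_mult)
    qed
    also have "\<dots> = (\<Sum>P\<in>{?P}. w n P * k n P Q)"
      by (rule sum.mono_neutral_right) (use Pp finite_partitions in \<open>auto simp: k_def\<close>)
    also have "\<dots> = w (Suc n) Q"
    proof -
      have Qe: "Q \<in> extensions n ?P" using Suc.prems by (simp add: extensions_def)
      have "w (Suc n) Q = 0" if "w n ?P = 0"
      proof -
        have "\<forall>R\<in>extensions n ?P. 0 \<le> w (Suc n) R" using nn[of "Suc n"] extensions_subset[of n ?P] by blast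
        moreover have "sum (w (Suc n)) (extensions n ?P) = 0" using add[of n ?P] Pp that by simp
        ultimately show ?thesis using sum_nonneg_eq_0_iff[OF finite_extensions[of n ?P], of "w (Suc n)"] Qe by blast
      qed
      then show ?thesis by (auto simp: k_def)
    qed
    finally show ?case .
  qed
  have AE1: "AE \<omega> in ?L. \<omega> n = restrict_partition n (\<omega> (Suc n))" for n
  proof -
    have "AE \<omega> in ?L. \<forall>P\<in>partitions n. \<forall>Q\<in>partitions (Suc n). \<not> (restrict_partition n Q \<noteq> P \<and> \<omega> n = P \<and> \<omega> (Suc n) = Q)"
    proof (intro AE_finite_allI finite_partitions)
      fix P Q assume PQ: "P \<in> partitions n" "Q \<in> partitions (Suc n)"
      show "AE \<omega> in ?L. \<not> (restrict_partition n Q \<noteq> P \<and> \<omega> n = P \<and> \<omega> (Suc n) = Q)"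
      proof (cases "restrict_partition n Q = P")
        case False
        then have "emeasure ?L {\<omega>\<in>space ?L. \<omega> n = P \<and> \<omega> (Suc n) = Q} = 0"
          using inter[OF PQ] by (simp add: k_def)
        then show ?thesis by (intro AE_I[OF _ _ Lev2[of n P Q]]) auto
      qed simp
    qed
    then show ?thesis
      using AE_space
    proof eventually_elim
      case (elim \<omega>)
      then show ?case using Lin[of \<omega> n] Lin[of \<omega> "Suc n"] by metis
    qed
  qed
  show ?thesis
    using prob setsL AE1 marg by (intro exI[of _ ?L]) (auto simp: AE_all_countable)
qed

lemma consistent_restrict:
  assumes "\<forall>n. \<omega> n = restrict_partition n (\<omega> (Suc n))" "n \<le> m" "partition_on {1..n} (\<omega> n)"
  shows "\<omega> n = restrict_partition n (\<omega> m)"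
  using assms(2)
proof (induction m rule: dec_induct)
  case base then show ?case using restrict_partition_self[OF assms(3)] by simp
next
  case (step m)
  then show ?case using assms(1) restrict_restrict_partition[of n m "\<omega> (Suc m)"] by metis
qed

lemma space_partition_seq_space: "\<omega> \<in> space partition_seq_space \<longleftrightarrow> (\<forall>n. partition_on {1..n} (\<omega> n))"
  by (auto simp: partition_seq_space_def space_PiM PiE_iff)

lemma partition_event_measurable: "{\<omega> \<in> space partition_seq_space. \<omega> n \<in> X} \<in> sets partition_seq_space"
proof -
  have c: "(\<lambda>\<omega>. \<omega> n) \<in> measurable partition_seq_space (count_space (partitions n))"
    unfolding partition_seq_space_def by (rule measurable_component_singleton) simp
  have "(\<lambda>\<omega>. \<omega> n) -` (X \<inter> partitions n) \<inter> space partition_seq_space \<in> sets partition_seq_space"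
    by (rule measurable_sets[OF c]) simp
  moreover have "(\<lambda>\<omega>. \<omega> n) -` (X \<inter> partitions n) \<inter> space partition_seq_space = {\<omega> \<in> space partition_seq_space. \<omega> n \<in> X}"
    by (auto simp: space_partition_seq_space)
  ultimately show ?thesis by simp
qed

text \<open>Under consistency the first \<open>n\<close> partitions are a function of the \<open>n\<close>-th, so the one-dimensional
  marginals determine the law.\<close>

lemma consistent_partition_law_unique:
  assumes M1: "prob_space M1" "sets M1 = sets partition_seq_space"
      "AE \<omega> in M1. \<forall>n. \<omega> n = restrict_partition n (\<omega> (Suc n))"
    and M2: "prob_space M2" "sets M2 = sets partition_seq_space"
      "AE \<omega> in M2. \<forall>n. \<omega> n = restrict_partition n (\<omega> (Suc n))"
    and eq: "\<And>n P. 1 \<le> n \<Longrightarrow> partition_on {1..n} P \<Longrightarrow>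
      measure M1 {\<omega> \<in> space M1. \<omega> n = P} = measure M2 {\<omega> \<in> space M2. \<omega> n = P}"
  shows "M1 = M2"
proof -
  let ?N = "\<lambda>n. count_space (partitions n)"
  have marginal: "emeasure M {\<omega>\<in>space M. \<omega> n \<in> X} = (\<Sum>P\<in>X \<inter> partitions n. ennreal (measure M {\<omega>\<in>space M. \<omega> n = P}))"
    if "prob_space M" "sets M = sets partition_seq_space" for M n X
  proof -
    interpret prob_space M by fact
    have sp: "space M = space partition_seq_space" using that(2) by (rule sets_eq_imp_space_eq)
    have "{\<omega>\<in>space M. \<omega> n \<in> X} = (\<Union>P\<in>X \<inter> partitions n. {\<omega>\<in>space M. \<omega> n = P})"
      unfolding sp by (auto simp: space_partition_seq_space)
    moreover have "{\<omega>\<in>space M. \<omega> n = P} \<in> sets M" for P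
      using partition_event_measurable[of n "{P}"] by (simp add: sp that)
    ultimately have "emeasure M {\<omega>\<in>space M. \<omega> n \<in> X} = (\<Sum>P\<in>X \<inter> partitions n. emeasure M {\<omega>\<in>space M. \<omega> n = P})"
      using finite_partitions[of n] by (subst sum_emeasure) (auto simp: disjoint_family_on_def)
    then show ?thesis by (simp add: emeasure_eq_measure)
  qed
  have cyl: "emeasure M (prod_emb UNIV ?N J (PiE J F))
     = (\<Sum>P\<in>{P\<in>partitions m. \<forall>j\<in>J. restrict_partition j P \<in> F j}. ennreal (measure M {\<omega>\<in>space M. \<omega> m = P}))"
    if "prob_space M" "sets M = sets partition_seq_space" "AE \<omega> in M. \<forall>n. \<omega> n = restrict_partition n (\<omega> (Suc n))"
      and J: "finite J" "\<forall>j\<in>J. j \<le> m" and F: "\<And>j. j \<in> J \<Longrightarrow> F j \<subseteq> partitions j" for M J F m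
  proof -
    have sp: "space M = space partition_seq_space" using that(2) by (rule sets_eq_imp_space_eq)
    let ?X = "{P\<in>partitions m. \<forall>j\<in>J. restrict_partition j P \<in> F j}"
    have m: "{\<omega>\<in>space M. \<omega> m \<in> ?X} \<in> sets M" using partition_event_measurable[of m ?X] by (simp add: sp that)
    have F': "PiE J F \<in> sets (PiM J ?N)" using F J by (intro sets_PiM_I_finite) auto
    have m': "prod_emb UNIV ?N J (PiE J F) \<in> sets M"
      unfolding that(2) partition_seq_space_def by (rule measurable_prod_emb[OF _ F']) simp
    have "emeasure M (prod_emb UNIV ?N J (PiE J F)) = emeasure M {\<omega>\<in>space M. \<omega> m \<in> ?X}"
    proof (rule emeasure_eq_AE[OF _ m' m])
      show "AE x in M. (x \<in> prod_emb UNIV ?N J (PiE J F)) = (x \<in> {\<omega>\<in>space M. \<omega> m \<in> ?X})"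
        using that(3) AE_space
      proof eventually_elim
        case (elim \<omega>)
        have p: "partition_on {1..n} (\<omega> n)" for n using elim(2) unfolding sp space_partition_seq_space by blast
        have r: "\<omega> j = restrict_partition j (\<omega> m)" if "j \<in> J" for j
          using consistent_restrict[OF elim(1) _ p] J that by blast
        have "\<omega> \<in> prod_emb UNIV ?N J (PiE J F) \<longleftrightarrow> (\<forall>j\<in>J. \<omega> j \<in> F j)"
          unfolding prod_emb_def using p by (auto simp: PiE_iff space_PiM)
        also have "\<dots> \<longleftrightarrow> \<omega> \<in> {\<omega>\<in>space M. \<omega> m \<in> ?X}" using r p elim(2) by auto
        finally show ?case .
      qed
    qed
    also have "\<dots> = (\<Sum>P\<in>?X. ennreal (measure M {\<omega>\<in>space M. \<omega> m = P}))"
      by (subst marginal[OF that(1,2)]) (simp add: Int_absorb2 subset_iff)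
    finally show ?thesis .
  qed
  show ?thesis
  proof (rule measure_eqI_PiM_infinite)
    show "sets M1 = sets (PiM UNIV ?N)" "sets M2 = sets (PiM UNIV ?N)"
      using M1(2) M2(2) by (simp_all add: partition_seq_space_def)
    show "finite_measure M1" using M1(1) by (rule prob_space.finite_measure)
    fix F J assume J: "finite J" "J \<subseteq> UNIV" and F: "\<And>i. i \<in> J \<Longrightarrow> F i \<in> sets (?N i)"
    \<comment> \<open>a successor, because the marginals are compared at positive levels only\<close>
    define m where "m = Suc (Max (insert 0 J))"
    have m: "\<forall>j\<in>J. j \<le> m" "1 \<le> m" using J(1) by (auto simp: m_def intro: le_SucI)
    have F': "F i \<subseteq> partitions i" if "i \<in> J" for i using F[OF that] by simp
    show "emeasure M1 (prod_emb UNIV ?N J (PiE J F)) = emeasure M2 (prod_emb UNIV ?N J (PiE J F))"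
    proof -
      have "(\<Sum>P\<in>{P\<in>partitions m. \<forall>j\<in>J. restrict_partition j P \<in> F j}. ennreal (measure M1 {\<omega>\<in>space M1. \<omega> m = P}))
        = (\<Sum>P\<in>{P\<in>partitions m. \<forall>j\<in>J. restrict_partition j P \<in> F j}. ennreal (measure M2 {\<omega>\<in>space M2. \<omega> m = P}))"
        using eq[OF m(2)] by (intro sum.cong) auto
      then show ?thesis using cyl[OF M1 J(1) m(1), of F] cyl[OF M2 J(1) m(1), of F] F' by simp
    qed
  qed
qed

section \<open>Gibbs laws and the recursion of their weights\<close>

text \<open>Adding \<open>n + 1\<close> to a block of size \<open>j\<close> multiplies the weight of a partition by \<open>j - \<alpha>\<close>, or by
  \<open>1\<close> if \<open>\<alpha> = -\<infinity>\<close>. Summed over the \<open>k\<close> blocks of a partition of \<open>{1..n}\<close> these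
  factors give \<open>gibbs_step \<alpha> n k\<close>.\<close>

definition gibbs_step :: "ereal \<Rightarrow> nat \<Rightarrow> nat \<Rightarrow> real" where
  "gibbs_step \<alpha> n k = (if \<alpha> = -\<infinity> then real k else real n - real_of_ereal \<alpha> * real k)"

definition gibbs_solution :: "(nat \<Rightarrow> nat \<Rightarrow> real) \<Rightarrow> (nat \<Rightarrow> nat \<Rightarrow> real) \<Rightarrow> bool" where
  "gibbs_solution g V \<longleftrightarrow> V 1 1 = 1 \<and> (\<forall>n k. 1 \<le> k \<and> k \<le> n \<longrightarrow> 0 \<le> V n k) \<and>
     (\<forall>n k. 1 \<le> k \<and> k \<le> n \<longrightarrow> V n k = g n k * V (Suc n) k + V (Suc n) (Suc k))"

lemma gibbs_W_pos:
  assumes "\<alpha> < 1" "1 \<le> j" shows "0 < gibbs_W \<alpha> j"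
proof (cases "\<alpha> = -\<infinity>")
  case False
  then have "real_of_ereal \<alpha> < 1" using assms(1) by (cases \<alpha>) auto
  then show ?thesis using False by (auto simp: gibbs_W_def intro!: pochhammer_pos)
qed (simp add: gibbs_W_def)

lemma gibbs_W_1: "gibbs_W \<alpha> 1 = 1" by (simp add: gibbs_W_def)

lemma gibbs_W_Suc:
  assumes "1 \<le> j"
  shows "gibbs_W \<alpha> (Suc j) = (if \<alpha> = -\<infinity> then 1 else real j - real_of_ereal \<alpha>) * gibbs_W \<alpha> j"
  using assms by (cases j) (auto simp: gibbs_W_def pochhammer_rec' algebra_simps)

definition block_weight :: "ereal \<Rightarrow> nat set set \<Rightarrow> real" where
  "block_weight \<alpha> P = (\<Prod>A\<in>P. gibbs_W \<alpha> (card A))"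

lemma partition_facts:
  assumes "partition_on {1..n} P"
  shows "finite P" "\<And>A. A \<in> P \<Longrightarrow> 1 \<le> card A" "\<And>A. A \<in> P \<Longrightarrow> Suc n \<notin> A" "\<And>A. A \<in> P \<Longrightarrow> finite A"
    "(\<Sum>A\<in>P. card A) = n" "card P \<le> n" "1 \<le> n \<Longrightarrow> 1 \<le> card P"
proof -
  show fP: "finite P" using assms finite_elements by blast
  have sub: "A \<subseteq> {1..n}" if "A \<in> P" for A using partition_onD1[OF assms] that by blast
  show fA: "finite A" if "A \<in> P" for A using sub[OF that] finite_subset by blast
  show c1: "1 \<le> card A" if "A \<in> P" for A
    using fA[OF that] partition_onD3[OF assms] that by (metis card_0_eq less_one not_le)
  show "Suc n \<notin> A" if "A \<in> P" for A using sub[OF that] by auto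
  show s: "(\<Sum>A\<in>P. card A) = n"
  proof -
    have "card {1..n} = card (\<Union> P)" using partition_onD1[OF assms] by (rule arg_cong)
    moreover have "card (\<Union> P) = sum card P"
      using card_Union_disjoint[of P] partition_onD2[OF assms] fA by (simp add: disjoint_def pairwise_def disjnt_def)
    ultimately show ?thesis by simp
  qed
  have "card P = (\<Sum>A\<in>P. 1)" by simp
  also have "\<dots> \<le> (\<Sum>A\<in>P. card A)" using c1 by (intro sum_mono) auto
  finally show "card P \<le> n" using s by simp
  show "1 \<le> card P" if "1 \<le> n"
    using s that fP by (metis card_0_eq less_one not_le sum.empty)
qed

lemma block_weight_pos: "\<alpha> < 1 \<Longrightarrow> partition_on {1..n} P \<Longrightarrow> 0 < block_weight \<alpha> P"
  unfolding block_weight_def using partition_facts(2) by (intro prod_pos gibbs_W_pos) auto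

lemma sum_gibbs_weight_extensions:
  assumes "\<alpha> < 1" and P: "partition_on {1..n} P"
  shows "(\<Sum>Q\<in>extensions n P. V (card Q) * block_weight \<alpha> Q)
    = block_weight \<alpha> P * (gibbs_step \<alpha> n (card P) * V (card P) + V (Suc (card P)))"
proof -
  note pf = partition_facts[OF P]
  let ?r = "\<lambda>j. if \<alpha> = -\<infinity> then 1 else real j - real_of_ereal \<alpha>"
  have nP: "{Suc n} \<notin> P" using pf(3) by auto
  have new: "block_weight \<alpha> (insert {Suc n} P) = block_weight \<alpha> P"
    unfolding block_weight_def using nP pf(1) by (simp add: gibbs_W_1[unfolded One_nat_def])
  have old: "block_weight \<alpha> (insert (insert (Suc n) A) (P - {A})) = block_weight \<alpha> P * ?r (card A)
      \<and> card (insert (insert (Suc n) A) (P - {A})) = card P" if A: "A \<in> P" for A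
  proof -
    have ni: "insert (Suc n) A \<notin> P - {A}" using pf(3) by auto
    have "block_weight \<alpha> (insert (insert (Suc n) A) (P - {A})) = gibbs_W \<alpha> (Suc (card A)) * (\<Prod>A\<in>P - {A}. gibbs_W \<alpha> (card A))"
      unfolding block_weight_def using ni pf(1) pf(3)[OF A] pf(4)[OF A] by simp
    also have "\<dots> = ?r (card A) * (gibbs_W \<alpha> (card A) * (\<Prod>A\<in>P - {A}. gibbs_W \<alpha> (card A)))"
      using gibbs_W_Suc[OF pf(2)[OF A]] by simp
    also have "gibbs_W \<alpha> (card A) * (\<Prod>A\<in>P - {A}. gibbs_W \<alpha> (card A)) = block_weight \<alpha> P"
      unfolding block_weight_def using pf(1) A by (simp add: prod.remove)
    finally have "block_weight \<alpha> (insert (insert (Suc n) A) (P - {A})) = block_weight \<alpha> P * ?r (card A)"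
      by (simp only: mult.commute)
    moreover have "card (insert (insert (Suc n) A) (P - {A})) = Suc (card (P - {A}))"
      using ni pf(1) by (intro card_insert_disjoint) auto
    moreover have "card P = Suc (card (P - {A}))" by (rule card.remove[OF pf(1) A])
    ultimately show ?thesis by simp
  qed
  have "(\<Sum>Q\<in>extensions n P. V (card Q) * block_weight \<alpha> Q)
     = V (Suc (card P)) * block_weight \<alpha> P + (\<Sum>A\<in>P. V (card P) * block_weight \<alpha> P * ?r (card A))"
    unfolding sum_extensions[OF P] using new old nP pf(1) by (simp add: mult.assoc)
  also have "(\<Sum>A\<in>P. V (card P) * block_weight \<alpha> P * ?r (card A)) = V (card P) * block_weight \<alpha> P * (\<Sum>A\<in>P. ?r (card A))"
    by (simp only: sum_distrib_left)
  also have "(\<Sum>A\<in>P. ?r (card A)) = gibbs_step \<alpha> n (card P)"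
    unfolding gibbs_step_def using pf(5) by (auto simp: sum_subtractf of_nat_sum[symmetric])
  finally show ?thesis by (simp add: algebra_simps)
qed

lemma has_eppf_gibbs_iff:
  "has_eppf M (gibbs_eppf \<alpha> V) \<longleftrightarrow>
    (\<forall>(n::nat) P. 1 \<le> n \<and> partition_on {1..n} P \<longrightarrow>
       measure M {\<omega> \<in> space M. \<omega> n = P} = V n (card P) * block_weight \<alpha> P)"
proof -
  have e: "gibbs_eppf \<alpha> V (map card As) = V n (card (set As)) * block_weight \<alpha> (set As)"
    if "distinct As" "partition_on {1..n} (set As)" for As n
    using partition_facts(5)[OF that(2)] that(1)
    by (simp add: gibbs_eppf_def block_weight_def distinct_card sum_list_distinct_conv_sum_set
        prod.distinct_set_conv_list o_def)
  show ?thesis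
  proof (intro iffI allI impI)
    fix n :: nat and P assume h: "has_eppf M (gibbs_eppf \<alpha> V)" "1 \<le> n \<and> partition_on {1..n} P"
    obtain As where "set As = P" "distinct As" using finite_distinct_list partition_facts(1) h(2) by metis
    then have "measure M {\<omega> \<in> space M. \<omega> n = set As} = gibbs_eppf \<alpha> V (map card As)"
      using h unfolding has_eppf_def by blast
    then show "measure M {\<omega> \<in> space M. \<omega> n = P} = V n (card P) * block_weight \<alpha> P"
      using e[of As n] h(2) \<open>set As = P\<close> \<open>distinct As\<close> by simp
  next
    assume "\<forall>(n::nat) P. 1 \<le> n \<and> partition_on {1..n} P \<longrightarrow>
       measure M {\<omega> \<in> space M. \<omega> n = P} = V n (card P) * block_weight \<alpha> P"
    then show "has_eppf M (gibbs_eppf \<alpha> V)" 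
      unfolding has_eppf_def
    proof (intro allI impI, elim conjE)
      fix n :: nat and As
      assume h: "\<forall>(n::nat) P. 1 \<le> n \<and> partition_on {1..n} P \<longrightarrow>
          measure M {\<omega> \<in> space M. \<omega> n = P} = V n (card P) * block_weight \<alpha> P"
        and As: "1 \<le> n" "distinct As" "partition_on {1..n} (set As)"
      show "measure M {\<omega> \<in> space M. \<omega> n = set As} = gibbs_eppf \<alpha> V (map card As)"
        unfolding e[OF As(2,3)] using h As by blast
    qed
  qed
qed

text \<open>The blocks are consecutive intervals whose lengths are the parts of the composition.\<close>

lemma composition_realised:
  assumes "composition c"
  obtains As where "distinct As" "partition_on {1..sum_list c} (set As)" "map card As = c"
proof -
  have "\<exists>As. distinct As \<and> partition_on {1..sum_list c} (set As) \<and> map card As = c" if "0 \<notin> set c"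
    using that
  proof (induction c rule: rev_induct)
    case Nil
    show ?case by (intro exI[of _ "[]"]) (auto simp: partition_on_def)
  next
    case (snoc x c)
    then obtain As where As: "distinct As" "partition_on {1..sum_list c} (set As)" "map card As = c" by auto
    let ?B = "{sum_list c + 1..sum_list c + x}"
    have x: "1 \<le> x" using snoc.prems by auto
    have "?B \<notin> set As"
    proof
      assume "?B \<in> set As"
      then have "?B \<subseteq> {1..sum_list c}" using partition_onD1[OF As(2)] by blast
      then show False using x by auto
    qed
    moreover have "partition_on {1..sum_list (c @ [x])} (set (As @ [?B]))"
    proof -
      have "partition_on (?B \<union> {1..sum_list c}) (insert ?B (set As))"
      proof (rule partition_onI)
        show "\<Union> (insert ?B (set As)) = ?B \<union> {1..sum_list c}" using partition_onD1[OF As(2)] by simp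
        have d: "A \<subseteq> {1..sum_list c}" if "A \<in> set As" for A using partition_onD1[OF As(2)] that by blast
        have d': "disjnt ?B A" if "A \<in> set As" for A using d[OF that] by (force simp: disjnt_def)
        show "disjnt p q" if "p \<in> insert ?B (set As)" "q \<in> insert ?B (set As)" "p \<noteq> q" for p q
        proof -
          have "disjnt p q" if "p \<in> set As" "q \<in> set As"
            using partition_onD2[OF As(2)] that \<open>p \<noteq> q\<close> by (simp add: disjoint_def disjnt_def)
          then show ?thesis using that d' by (auto simp: disjnt_sym)
        qed
        show "{} \<notin> insert ?B (set As)" using x partition_onD3[OF As(2)] by auto
      qed
      moreover have "?B \<union> {1..sum_list c} = {1..sum_list c + x}" using x by auto
      ultimately show ?thesis by simp
    qed
    ultimately show ?case using As by (intro exI[of _ "As @ [?B]"]) auto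
  qed
  then show ?thesis using assms that unfolding composition_def by blast
qed

lemma composition_exists:
  assumes "1 \<le> k" "k \<le> n"
  obtains c where "composition c" "sum_list c = n" "length c = k"
proof
  let ?c = "(n - k + 1) # replicate (k - 1) 1"
  show "composition ?c" by (auto simp: composition_def)
  show "sum_list ?c = n" "length ?c = k" using assms by (auto simp: sum_list_replicate)
qed

lemma partition_exists:
  assumes "1 \<le> k" "k \<le> n"
  obtains P where "partition_on {1..n} P" "card P = k"
  by (metis assms composition_exists composition_realised distinct_card length_map)

text \<open>By consistency the probability of a partition with \<open>k\<close> blocks is the sum of the probabilities of its
  extensions; dividing by the block weight leaves the recursion.\<close>

lemma gibbs_law_solution:
  assumes "\<alpha> < 1" "M \<in> gibbs_laws \<alpha>"
  obtains V where "gibbs_solution (gibbs_step \<alpha>) V" "has_eppf M (gibbs_eppf \<alpha> V)"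
proof -
  obtain V where ex: "exchangeable_partition_law M" and V1: "V 1 1 = 1"
    and nn: "\<forall>n k. 1 \<le> k \<and> k \<le> n \<longrightarrow> 0 \<le> V n k" and ep: "has_eppf M (gibbs_eppf \<alpha> V)"
    using assms(2) unfolding gibbs_laws_def by auto
  have prob: "prob_space M" and sM: "sets M = sets partition_seq_space"
    and cons: "AE \<omega> in M. \<forall>n. \<omega> n = restrict_partition n (\<omega> (Suc n))"
    using ex unfolding exchangeable_partition_law_def by auto
  interpret prob_space M by fact
  have sp: "space M = space partition_seq_space" using sM by (rule sets_eq_imp_space_eq)
  have ev: "{\<omega>\<in>space M. \<omega> n \<in> X} \<in> sets M" for n X using partition_event_measurable[of n X] by (simp add: sp sM)
  have ev1: "{\<omega>\<in>space M. \<omega> n = P} \<in> sets M" for n P using ev[of n "{P}"] by simp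
  have add: "measure M {\<omega>\<in>space M. \<omega> n = P} = (\<Sum>Q\<in>extensions n P. measure M {\<omega>\<in>space M. \<omega> (Suc n) = Q})" for n P
  proof -
    have "measure M {\<omega>\<in>space M. \<omega> n = P} = measure M {\<omega>\<in>space M. \<omega> (Suc n) \<in> extensions n P}"
    proof (rule measure_eq_AE[OF _ ev1 ev])
      show "AE x in M. (x \<in> {\<omega>\<in>space M. \<omega> n = P}) = (x \<in> {\<omega>\<in>space M. \<omega> (Suc n) \<in> extensions n P})"
        using cons AE_space
      proof eventually_elim
        case (elim \<omega>)
        have "\<omega> (Suc n) \<in> partitions (Suc n)" using elim(2) unfolding sp space_partition_seq_space by blast
        then show ?case using elim unfolding extensions_def by (metis (mono_tags, lifting) mem_Collect_eq)
      qed
    qed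
    also have "{\<omega>\<in>space M. \<omega> (Suc n) \<in> extensions n P} = (\<Union>Q\<in>extensions n P. {\<omega>\<in>space M. \<omega> (Suc n) = Q})" by auto
    also have "measure M \<dots> = (\<Sum>Q\<in>extensions n P. measure M {\<omega>\<in>space M. \<omega> (Suc n) = Q})"
      using ev1 by (intro finite_measure_finite_Union finite_extensions) (auto simp: disjoint_family_on_def)
    finally show ?thesis .
  qed
  have rec: "V n k = gibbs_step \<alpha> n k * V (Suc n) k + V (Suc n) (Suc k)" if nk: "1 \<le> k" "k \<le> n" for n k
  proof -
    obtain P where P: "partition_on {1..n} P" "card P = k" using partition_exists[OF nk] by blast
    have bw: "0 < block_weight \<alpha> P" by (rule block_weight_pos[OF assms(1) P(1)])
    note eq = ep[unfolded has_eppf_gibbs_iff]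
    have "V n k * block_weight \<alpha> P = measure M {\<omega>\<in>space M. \<omega> n = P}" using eq P nk by auto
    also have "\<dots> = (\<Sum>Q\<in>extensions n P. V (Suc n) (card Q) * block_weight \<alpha> Q)"
    proof (subst add, intro sum.cong refl)
      fix Q assume "Q \<in> extensions n P"
      then show "measure M {\<omega>\<in>space M. \<omega> (Suc n) = Q} = V (Suc n) (card Q) * block_weight \<alpha> Q"
        using eq extensions_subset[of n P] by auto
    qed
    also have "\<dots> = block_weight \<alpha> P * (gibbs_step \<alpha> n k * V (Suc n) k + V (Suc n) (Suc k))"
      using sum_gibbs_weight_extensions[OF assms(1) P(1), of "V (Suc n)"] P(2) by simp
    finally show ?thesis using bw by simp
  qed
  show ?thesis using that[of V] V1 nn rec ep unfolding gibbs_solution_def by blast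
qed

lemma gibbs_eppf_determines_law:
  assumes "M1 \<in> gibbs_laws \<alpha>" "M2 \<in> gibbs_laws \<alpha>"
    and "has_eppf M1 (gibbs_eppf \<alpha> V1)" "has_eppf M2 (gibbs_eppf \<alpha> V2)"
    and "\<And>n k. 1 \<le> k \<Longrightarrow> k \<le> n \<Longrightarrow> V1 n k = V2 n k"
  shows "M1 = M2"
proof (rule consistent_partition_law_unique)
  fix n :: nat and P assume P: "1 \<le> n" "partition_on {1..n} P"
  have "V1 n (card P) = V2 n (card P)" using assms(5) partition_facts(6,7)[OF P(2)] P(1) by blast
  moreover have "measure M1 {\<omega> \<in> space M1. \<omega> n = P} = V1 n (card P) * block_weight \<alpha> P"
    using assms(3) P unfolding has_eppf_gibbs_iff by blast
  moreover have "measure M2 {\<omega> \<in> space M2. \<omega> n = P} = V2 n (card P) * block_weight \<alpha> P"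
    using assms(4) P unfolding has_eppf_gibbs_iff by blast
  ultimately show "measure M1 {\<omega> \<in> space M1. \<omega> n = P} = measure M2 {\<omega> \<in> space M2. \<omega> n = P}" by simp
qed (use assms(1,2) in \<open>auto simp: gibbs_laws_def exchangeable_partition_law_def\<close>)

lemma partition_image:
  assumes "\<sigma> permutes {1..n}" "partition_on {1..n} P"
  shows "partition_on {1..n} ((`) \<sigma> ` P)" "card ((`) \<sigma> ` P) = card P" "block_weight \<alpha> ((`) \<sigma> ` P) = block_weight \<alpha> P"
proof -
  have inj: "inj \<sigma>" by (rule permutes_inj[OF assms(1)])
  have inj': "inj_on ((`) \<sigma>) P" using inj by (auto intro!: inj_onI simp: inj_image_eq_iff)
  show "partition_on {1..n} ((`) \<sigma> ` P)"
  proof (rule partition_onI)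
    have "\<Union> ((`) \<sigma> ` P) = \<sigma> ` \<Union>P" by auto
    then show "\<Union> ((`) \<sigma> ` P) = {1..n}" using partition_onD1[OF assms(2)] permutes_image[OF assms(1)] by simp
    show "disjnt p q" if pq: "p \<in> (`) \<sigma> ` P" "q \<in> (`) \<sigma> ` P" "p \<noteq> q" for p q
    proof -
      obtain A where A: "p = \<sigma> ` A" "A \<in> P" using pq(1) by (rule imageE)
      obtain B where B: "q = \<sigma> ` B" "B \<in> P" using pq(2) by (rule imageE)
      note A B
      moreover have "A \<inter> B = {}" using A B pq(3) partition_onD2[OF assms(2)] by (auto simp: disjoint_def)
      ultimately show ?thesis using image_Int[OF inj, of A B] by (simp add: disjnt_def)
    qed
    show "{} \<notin> (`) \<sigma> ` P" using partition_onD3[OF assms(2)] by auto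
  qed
  show "card ((`) \<sigma> ` P) = card P" by (rule card_image[OF inj'])
  have "card (\<sigma> ` A) = card A" for A using inj by (simp add: card_image inj_on_def)
  then show "block_weight \<alpha> ((`) \<sigma> ` P) = block_weight \<alpha> P"
    unfolding block_weight_def by (simp add: prod.reindex[OF inj'])
qed

text \<open>The recursion is the additivity along extensions that \<open>consistent_partition_law_exists\<close> asks for. The
  law is exchangeable since the weights depend on the block sizes only.\<close>

lemma gibbs_law_exists:
  assumes "\<alpha> < 1" "gibbs_solution (gibbs_step \<alpha>) V"
  obtains M where "M \<in> gibbs_laws \<alpha>" "has_eppf M (gibbs_eppf \<alpha> V)"
proof -
  define w where "w n P = (if n = 0 then 1 else V n (card P) * block_weight \<alpha> P)" for n P
  have nn: "0 \<le> w n P" if P: "partition_on {1..n} P" for n P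
  proof (cases "n = 0")
    case False
    then have "1 \<le> card P" "card P \<le> n" using partition_facts(6,7)[OF P] by auto
    then have "0 \<le> V n (card P)" using assms(2) unfolding gibbs_solution_def by blast
    then show ?thesis using False block_weight_pos[OF assms(1) P] by (simp add: w_def)
  qed (simp add: w_def)
  have add: "w n P = sum (w (Suc n)) (extensions n P)" if P: "partition_on {1..n} P" for n P
  proof (cases "n = 0")
    case False
    have "V n (card P) = gibbs_step \<alpha> n (card P) * V (Suc n) (card P) + V (Suc n) (Suc (card P))"
    proof -
      have "1 \<le> card P" "card P \<le> n" using partition_facts(6,7)[OF P] False by auto
      then show ?thesis using assms(2) unfolding gibbs_solution_def by blast
    qed
    then show ?thesis
      using sum_gibbs_weight_extensions[OF assms(1) P, of "V (Suc n)"] False by (simp add: w_def mult.commute)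
  next
    case True
    then have "P = {}" using P partition_on_0 by auto
    have V1: "V (Suc 0) (Suc 0) = 1" using assms(2) by (simp add: gibbs_solution_def)
    show ?thesis unfolding sum_extensions[OF P] using True \<open>P = {}\<close> V1
      by (simp add: w_def block_weight_def gibbs_W_1[unfolded One_nat_def])
  qed
  obtain M where M: "prob_space M" "sets M = sets partition_seq_space"
     "AE \<omega> in M. \<forall>n. \<omega> n = restrict_partition n (\<omega> (Suc n))"
     "\<forall>n P. partition_on {1..n} P \<longrightarrow> measure M {\<omega>\<in>space M. \<omega> n = P} = w n P"
    using consistent_partition_law_exists[of w] nn add by (auto simp: w_def)
  have ep: "has_eppf M (gibbs_eppf \<alpha> V)" using M(4) unfolding has_eppf_gibbs_iff by (auto simp: w_def)
  have "measure M {\<omega> \<in> space M. \<omega> n = P} = measure M {\<omega> \<in> space M. \<omega> n = (`) \<sigma> ` P}"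
    if "\<sigma> permutes {1..n} \<and> partition_on {1..n} P" for n \<sigma> P
    using partition_image[of \<sigma> n P] that M(4) by (simp add: w_def)
  then have "exchangeable_partition_law M" unfolding exchangeable_partition_law_def using M by blast
  then show ?thesis using that[of M] ep assms(2) unfolding gibbs_laws_def gibbs_solution_def by blast
qed

section \<open>The Markov chain of block counts\<close>

text \<open>Under a Gibbs law the numbers \<open>K\<^sub>1, K\<^sub>2, \<dots>\<close> of blocks form a Markov chain. All that
  matters about the type \<open>\<alpha>\<close> here is that the coefficients of the recursion are positive.\<close>

locale gibbs_chain =
  fixes g :: "nat \<Rightarrow> nat \<Rightarrow> real"
  assumes g_pos: "\<And>n k. 1 \<le> k \<Longrightarrow> k \<le> n \<Longrightarrow> 0 < g n k"
begin

abbreviation solution :: "(nat \<Rightarrow> nat \<Rightarrow> real) \<Rightarrow> bool" where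
  "solution \<equiv> gibbs_solution g"

text \<open>Generalised Stirling numbers: for the coefficients \<open>gibbs_step \<alpha>\<close>, \<open>S n k\<close> is the total block
  weight of the partitions of \<open>{1..n}\<close> into \<open>k\<close> blocks.\<close>

primrec S :: "nat \<Rightarrow> nat \<Rightarrow> real" where
  "S 0 k = (if k = 0 then 1 else 0)"
| "S (Suc n) k = (if k = 0 then 0 else g n k * S n k + S n (k - 1))"

lemma S_above: "n < k \<Longrightarrow> S n k = 0"
  by (induction n arbitrary: k) auto

lemma S_Suc_0 [simp]: "S (Suc n) 0 = 0" by simp

lemma S_pos: "1 \<le> k \<Longrightarrow> k \<le> n \<Longrightarrow> 0 < S n k"
proof (induction n arbitrary: k)
  case (Suc n)
  show ?case
  proof (cases "k \<le> n")
    case True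
    have "0 \<le> S n (k - 1)"
    proof (cases "k = 1")
      case True then show ?thesis by (cases n) simp_all
    next
      case False
      then have "1 \<le> k - 1" "k - 1 \<le> n" using Suc.prems True by auto
      then show ?thesis using Suc.IH[of "k - 1"] by linarith
    qed
    moreover have "0 < g n k * S n k" using Suc g_pos True by simp
    ultimately show ?thesis using Suc.prems by simp
  next
    case False
    then have "k = Suc n" using Suc.prems by simp
    moreover have "0 < S n n" using Suc.IH[of n] by (cases n) auto
    ultimately show ?thesis using S_above[of n "Suc n"] by simp
  qed
qed simp

lemma S_nonneg: "0 \<le> S n k"
  by (metis S.simps(1) S_Suc_0 S_above S_pos less_imp_le not_le not0_implies_Suc less_one order_refl zero_less_one_class.zero_le_one)

lemma S_diag: "S n n = 1"
  by (induction n) (simp_all add: S_above)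

text \<open>The expectation of \<open>\<phi> K\<^sub>n\<close> under the solution \<open>V\<close>.\<close>

definition E :: "(nat \<Rightarrow> nat \<Rightarrow> real) \<Rightarrow> nat \<Rightarrow> (nat \<Rightarrow> real) \<Rightarrow> real" where
  "E V n \<phi> = (\<Sum>k=1..n. S n k * V n k * \<phi> k)"

lemma solution_nonneg: "solution V \<Longrightarrow> 1 \<le> k \<Longrightarrow> k \<le> n \<Longrightarrow> 0 \<le> V n k"
  unfolding gibbs_solution_def by blast

lemma solution_rec: "solution V \<Longrightarrow> 1 \<le> k \<Longrightarrow> k \<le> n \<Longrightarrow> V n k = g n k * V (Suc n) k + V (Suc n) (Suc k)"
  unfolding gibbs_solution_def by blast

lemma S_sum_Suc:
  assumes "1 \<le> n"
  shows "(\<Sum>k=1..Suc n. S (Suc n) k * a k) = (\<Sum>k=1..n. S n k * (g n k * a k + a (Suc k)))"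
proof -
  have "(\<Sum>k=1..Suc n. S (Suc n) k * a k)
      = (\<Sum>k=1..Suc n. g n k * S n k * a k) + (\<Sum>k=1..Suc n. S n (k - 1) * a k)"
    unfolding sum.distrib[symmetric] by (intro sum.cong) (auto simp: algebra_simps)
  also have "(\<Sum>k=1..Suc n. g n k * S n k * a k) = (\<Sum>k=1..n. g n k * S n k * a k)"
    using S_above[of n "Suc n"] by simp
  also have "(\<Sum>k=1..Suc n. S n (k - 1) * a k) = (\<Sum>k=0..n. S n k * a (Suc k))"
    by (simp only: One_nat_def sum.atLeast_Suc_atMost_Suc_shift o_def diff_Suc_Suc diff_zero)
  also have "\<dots> = (\<Sum>k=1..n. S n k * a (Suc k))"
    using assms by (cases n) (simp_all add: sum.atLeast_Suc_atMost[of 0])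
  finally show ?thesis by (simp add: sum.distrib[symmetric] algebra_simps)
qed

lemma E_Suc:
  assumes "1 \<le> n"
  shows "E V (Suc n) \<phi> = (\<Sum>k=1..n. S n k * (g n k * V (Suc n) k * \<phi> k + V (Suc n) (Suc k) * \<phi> (Suc k)))"
  unfolding E_def using S_sum_Suc[OF assms, of "\<lambda>k. V (Suc n) k * \<phi> k"] by (simp add: mult.assoc)

lemma E_one:
  assumes "solution V" "1 \<le> n" shows "E V n (\<lambda>_. 1) = 1"
  using assms(2)
proof (induction n rule: dec_induct)
  case base then show ?case using assms(1) by (simp add: E_def gibbs_solution_def)
next
  case (step n)
  have "E V (Suc n) (\<lambda>_. 1) = E V n (\<lambda>_. 1)"
    unfolding E_Suc[OF step(1)] unfolding E_def
  proof (intro sum.cong refl)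
    fix k assume "k \<in> {1..n}"
    then have "V n k = g n k * V (Suc n) k + V (Suc n) (Suc k)" by (intro solution_rec[OF assms(1)]) auto
    then show "S n k * (g n k * V (Suc n) k * 1 + V (Suc n) (Suc k) * 1) = S n k * V n k * 1" by simp
  qed
  then show ?case using step by simp
qed

lemma weight_nonneg: "solution V \<Longrightarrow> k \<in> {1..n} \<Longrightarrow> 0 \<le> S n k * V n k"
  using S_nonneg solution_nonneg by simp

lemma E_mono:
  assumes "solution V" "\<And>k. 1 \<le> k \<Longrightarrow> k \<le> n \<Longrightarrow> \<phi> k \<le> \<psi> k" shows "E V n \<phi> \<le> E V n \<psi>"
  unfolding E_def using assms weight_nonneg by (intro sum_mono mult_left_mono) auto

lemma E_add: "E V n (\<lambda>k. \<phi> k + \<psi> k) = E V n \<phi> + E V n \<psi>"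
  unfolding E_def by (simp add: distrib_left sum.distrib)

lemma E_diff: "E V n (\<lambda>k. \<phi> k - \<psi> k) = E V n \<phi> - E V n \<psi>"
  unfolding E_def by (simp add: right_diff_distrib sum_subtractf)

lemma E_cmult: "E V n (\<lambda>k. c * \<phi> k) = c * E V n \<phi>"
  unfolding E_def by (simp add: sum_distrib_left mult_ac)

lemma E_const: "solution V \<Longrightarrow> 1 \<le> n \<Longrightarrow> E V n (\<lambda>_. c) = c"
  using E_cmult[of V n c "\<lambda>_. 1"] E_one by simp

lemma E_nonneg: "solution V \<Longrightarrow> (\<And>k. 1 \<le> k \<Longrightarrow> k \<le> n \<Longrightarrow> 0 \<le> \<phi> k) \<Longrightarrow> 0 \<le> E V n \<phi>"
  unfolding E_def using S_nonneg solution_nonneg[of V _ n] by (intro sum_nonneg mult_nonneg_nonneg) auto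

lemma E_abs:
  assumes "solution V" shows "\<bar>E V n \<phi>\<bar> \<le> E V n (\<lambda>k. \<bar>\<phi> k\<bar>)"
proof -
  have "\<bar>E V n \<phi>\<bar> \<le> (\<Sum>k=1..n. \<bar>S n k * V n k * \<phi> k\<bar>)" unfolding E_def by (rule sum_abs)
  also have "\<dots> = E V n (\<lambda>k. \<bar>\<phi> k\<bar>)"
    unfolding E_def using S_nonneg solution_nonneg[OF assms] by (intro sum.cong) (auto simp: abs_mult)
  finally show ?thesis .
qed

lemma E_square:
  assumes "solution V" "1 \<le> n" shows "(E V n \<phi>)\<^sup>2 \<le> E V n (\<lambda>k. (\<phi> k)\<^sup>2)"
proof -
  let ?m = "E V n \<phi>"
  have "0 \<le> E V n (\<lambda>k. (\<phi> k - ?m)\<^sup>2)" by (rule E_nonneg[OF assms(1)]) simp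
  also have "E V n (\<lambda>k. (\<phi> k - ?m)\<^sup>2) = E V n (\<lambda>k. ((\<phi> k)\<^sup>2 - (2 * ?m) * \<phi> k) + ?m\<^sup>2)"
    by (rule arg_cong[where f="E V n"]) (simp add: power2_eq_square algebra_simps fun_eq_iff)
  also have "\<dots> = E V n (\<lambda>k. (\<phi> k)\<^sup>2) - 2 * ?m * ?m + ?m\<^sup>2"
    by (simp add: E_add E_diff E_cmult E_const[OF assms])
  finally show ?thesis by (simp add: power2_eq_square)
qed

subsection \<open>Tail probabilities\<close>

definition T :: "(nat \<Rightarrow> nat \<Rightarrow> real) \<Rightarrow> nat \<Rightarrow> nat \<Rightarrow> real" where
  "T V n k = E V n (\<lambda>j. of_bool (k \<le> j))"

lemma T_bounds: "solution V \<Longrightarrow> 1 \<le> n \<Longrightarrow> 0 \<le> T V n k" "solution V \<Longrightarrow> 1 \<le> n \<Longrightarrow> T V n k \<le> 1"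
  using E_nonneg[of V n "\<lambda>j. of_bool (k \<le> j)"] E_mono[of V n "\<lambda>j. of_bool (k \<le> j)" "\<lambda>_. 1"] E_one[of V n]
  by (auto simp: T_def of_bool_def)

lemma T_le_1: "solution V \<Longrightarrow> 1 \<le> n \<Longrightarrow> k \<le> 1 \<Longrightarrow> T V n k = 1"
  using E_one[of V n] unfolding T_def E_def by (auto intro!: sum.cong elim!: back_subst[where P="\<lambda>x. x = 1"])

lemma T_above: "n < k \<Longrightarrow> T V n k = 0"
  unfolding T_def E_def by (intro sum.neutral) auto

lemma T_alt: "T V n k = (\<Sum>j\<in>{1..n} \<inter> {k..}. S n j * V n j)"
proof -
  have "(\<Sum>j\<in>{1..n} \<inter> {k..}. S n j * V n j) = (\<Sum>j\<in>{1..n}. if j \<in> {k..} then S n j * V n j else 0)"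
    by (rule sum.inter_restrict) simp
  then show ?thesis unfolding T_def E_def by (simp only:) (intro sum.cong, auto)
qed

lemma T_diff:
  assumes "1 \<le> k" "k \<le> n" shows "T V n k - T V n (Suc k) = S n k * V n k"
proof -
  have "{1..n} \<inter> {k..} = insert k ({1..n} \<inter> {Suc k..})" using assms by auto
  then show ?thesis unfolding T_alt by simp
qed

text \<open>Along the families below the tail probabilities are monotone in the parameter, while the weights need not
  be. Limits and continuity are therefore obtained for \<open>T\<close> and carried over to the weights by this
  formula.\<close>

lemma V_eq_T: "1 \<le> k \<Longrightarrow> k \<le> n \<Longrightarrow> V n k = (T V n k - T V n (Suc k)) / S n k"
  using T_diff[of k n V] S_pos[of k n] by simp

lemma solution_step_le:
  assumes "solution V" "1 \<le> k" "k \<le> n"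
  shows "V (Suc n) k \<le> V n k / g n k" "V (Suc n) (Suc k) \<le> V n k"
  using solution_rec[OF assms] solution_nonneg[OF assms(1), of k "Suc n"] solution_nonneg[OF assms(1), of "Suc k" "Suc n"]
    g_pos[OF assms(2,3)] assms(2,3) by (auto simp: field_simps)

text \<open>Descending with \<open>solution_step_le\<close>, one gets from \<open>(n, k)\<close> with \<open>k \<ge> 2\<close> to \<open>(2, 2)\<close>, and from
  \<open>(n, k)\<close> with \<open>k < n\<close> to \<open>(2, 1)\<close>. Up to a constant factor the weight at \<open>(n, k)\<close> is therefore
  bounded by the one that tends to \<open>0\<close>.\<close>

lemma tendsto_one_block:
  assumes sol: "\<forall>\<^sub>F x in F. solution (U x)" and lim: "((\<lambda>x. U x 2 2) \<longlongrightarrow> 0) F" and k: "2 \<le> k" "k \<le> n"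
  shows "((\<lambda>x. U x n k) \<longlongrightarrow> 0) F"
proof -
  have "2 \<le> n" using k by simp
  then show ?thesis using k
  proof (induction n arbitrary: k rule: dec_induct)
    case base then show ?case using lim by (metis le_antisym)
  next
    case (step n)
    show ?case
    proof (cases "k = 2")
      case True
      have "((\<lambda>x. U x n 2 / g n 2) \<longlongrightarrow> 0) F" using tendsto_divide[OF step.IH[of 2] tendsto_const[of "g n 2"]] step(1) g_pos[of 2 n] by simp
      then show ?thesis
        using sol solution_step_le(1)[of _ 2 n] solution_nonneg[of _ 2 "Suc n"] step True
        by (elim tendsto_sandwich[OF _ _ tendsto_const, rotated 2]) (auto elim!: eventually_mono)
    next
      case False
      then obtain j where j: "k = Suc j" "2 \<le> j" "j \<le> n" using step by (cases k) auto
      have "((\<lambda>x. U x n j) \<longlongrightarrow> 0) F" using step.IH j by simp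
      then show ?thesis
        using sol solution_step_le(2)[of _ j n] solution_nonneg[of _ k "Suc n"] step j
        by (elim tendsto_sandwich[OF _ _ tendsto_const, rotated 2]) (auto elim!: eventually_mono)
    qed
  qed
qed

lemma tendsto_singletons:
  assumes sol: "\<forall>\<^sub>F x in F. solution (U x)" and lim: "((\<lambda>x. U x 2 1) \<longlongrightarrow> 0) F" and k: "1 \<le> k" "k < n"
  shows "((\<lambda>x. U x n k) \<longlongrightarrow> 0) F"
proof -
  have "2 \<le> n" using k by simp
  then show ?thesis using k
  proof (induction n arbitrary: k rule: dec_induct)
    case base then have "k = 1" by simp then show ?case using lim by simp
  next
    case (step n)
    show ?case
    proof (cases "k < n")
      case True
      have "((\<lambda>x. U x n k / g n k) \<longlongrightarrow> 0) F" using tendsto_divide[OF step.IH[of k] tendsto_const[of "g n k"]] step True g_pos[of k n] by simp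
      then show ?thesis
        using sol solution_step_le(1)[of _ k n] solution_nonneg[of _ k "Suc n"] step True
        by (elim tendsto_sandwich[OF _ _ tendsto_const, rotated 2]) (auto elim!: eventually_mono)
    next
      case False
      then obtain j where j: "k = Suc j" "1 \<le> j" "j < n" using step by (cases k) auto
      have "((\<lambda>x. U x n j) \<longlongrightarrow> 0) F" using step.IH j by simp
      then show ?thesis
        using sol solution_step_le(2)[of _ j n] solution_nonneg[of _ k "Suc n"] step j
        by (elim tendsto_sandwich[OF _ _ tendsto_const, rotated 2]) (auto elim!: eventually_mono)
    qed
  qed
qed

lemma tendsto_T_one_block:
  assumes sol: "\<forall>\<^sub>F x in F. solution (U x)" and lim: "((\<lambda>x. U x 2 2) \<longlongrightarrow> 0) F" and k: "2 \<le> k"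
  shows "((\<lambda>x. T (U x) n k) \<longlongrightarrow> 0) F"
proof -
  have "((\<lambda>x. T (U x) n k) \<longlongrightarrow> (\<Sum>j\<in>{1..n} \<inter> {k..}. S n j * 0)) F"
    unfolding T_alt using k by (intro tendsto_sum tendsto_mult tendsto_const tendsto_one_block[OF sol lim]) auto
  then show ?thesis by simp
qed

lemma tendsto_T_singletons:
  assumes sol: "\<forall>\<^sub>F x in F. solution (U x)" and lim: "((\<lambda>x. U x 2 1) \<longlongrightarrow> 0) F" and k: "k \<le> n" "1 \<le> n"
  shows "((\<lambda>x. T (U x) n k) \<longlongrightarrow> 1) F"
proof -
  have "((\<lambda>x. 1 - (\<Sum>j\<in>{1..n} - {k..}. S n j * U x n j)) \<longlongrightarrow> 1 - (\<Sum>j\<in>{1..n} - {k..}. S n j * 0)) F"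
    using k by (intro tendsto_diff tendsto_sum tendsto_mult tendsto_const tendsto_singletons[OF sol lim]) auto
  moreover have "\<forall>\<^sub>F x in F. 1 - (\<Sum>j\<in>{1..n} - {k..}. S n j * U x n j) = T (U x) n k"
    using sol
  proof eventually_elim
    case (elim x)
    have "(\<Sum>j\<in>{1..n}. S n j * U x n j) = 1" using E_one[OF elim k(2)] by (simp add: E_def)
    moreover have "(\<Sum>j\<in>{1..n}. S n j * U x n j) = (\<Sum>j\<in>{1..n} \<inter> {k..}. S n j * U x n j) + (\<Sum>j\<in>{1..n} - {k..}. S n j * U x n j)"
      by (rule sum.Int_Diff) simp
    ultimately show ?case unfolding T_alt by simp
  qed
  ultimately show ?thesis by (simp add: tendsto_cong)
qed

subsection \<open>The common backward dynamics\<close>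

text \<open>Given \<open>K\<^bsub>n+1\<^esub> = \<kappa>\<close>, the previous value is \<open>\<kappa>\<close> or \<open>\<kappa> - 1\<close>, with
  probabilities that do not depend on the solution. Accordingly \<open>back_mean n \<phi> d \<kappa>\<close> is the
  conditional expectation of \<open>\<phi> K\<^sub>n\<close> given \<open>K\<^bsub>n+d\<^esub> = \<kappa>\<close>.\<close>

definition back_step :: "nat \<Rightarrow> (nat \<Rightarrow> real) \<Rightarrow> nat \<Rightarrow> real" where
  "back_step n \<phi> \<kappa> = (g n \<kappa> * S n \<kappa> * \<phi> \<kappa> + S n (\<kappa> - 1) * \<phi> (\<kappa> - 1)) / S (Suc n) \<kappa>"

primrec back_mean :: "nat \<Rightarrow> (nat \<Rightarrow> real) \<Rightarrow> nat \<Rightarrow> nat \<Rightarrow> real" where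
  "back_mean n \<phi> 0 = \<phi>"
| "back_mean n \<phi> (Suc d) = back_step (n + d) (back_mean n \<phi> d)"

lemma E_back_step:
  assumes "solution V" "1 \<le> n" shows "E V (Suc n) (back_step n \<phi>) = E V n \<phi>"
proof -
  have "E V (Suc n) (back_step n \<phi>) = (\<Sum>k=1..Suc n. V (Suc n) k * (g n k * S n k * \<phi> k + S n (k - 1) * \<phi> (k - 1)))"
    unfolding E_def back_step_def
  proof (intro sum.cong refl)
    fix k assume "k \<in> {1..Suc n}"
    then have "S (Suc n) k \<noteq> 0" using S_pos[of k "Suc n"] by auto
    then show "S (Suc n) k * V (Suc n) k * ((g n k * S n k * \<phi> k + S n (k - 1) * \<phi> (k - 1)) / S (Suc n) k) =
      V (Suc n) k * (g n k * S n k * \<phi> k + S n (k - 1) * \<phi> (k - 1))" by (simp del: S.simps)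
  qed
  also have "\<dots> = (\<Sum>k=1..Suc n. V (Suc n) k * (g n k * S n k * \<phi> k)) + (\<Sum>k=1..Suc n. V (Suc n) k * (S n (k - 1) * \<phi> (k - 1)))"
    by (simp only: sum.distrib[symmetric] distrib_left)
  also have "(\<Sum>k=1..Suc n. V (Suc n) k * (g n k * S n k * \<phi> k)) = (\<Sum>k=1..n. V (Suc n) k * (g n k * S n k * \<phi> k))"
    using S_above[of n "Suc n"] by simp
  also have "(\<Sum>k=1..Suc n. V (Suc n) k * (S n (k - 1) * \<phi> (k - 1))) = (\<Sum>k=0..n. V (Suc n) (Suc k) * (S n k * \<phi> k))"
    by (simp only: One_nat_def sum.atLeast_Suc_atMost_Suc_shift o_def diff_Suc_Suc diff_zero)
  also have "\<dots> = (\<Sum>k=1..n. V (Suc n) (Suc k) * (S n k * \<phi> k))"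
    using assms(2) by (cases n) (simp_all add: sum.atLeast_Suc_atMost[of 0])
  also have "(\<Sum>k=1..n. V (Suc n) k * (g n k * S n k * \<phi> k)) + (\<Sum>k=1..n. V (Suc n) (Suc k) * (S n k * \<phi> k))
     = (\<Sum>k=1..n. S n k * (g n k * V (Suc n) k + V (Suc n) (Suc k)) * \<phi> k)"
    by (simp add: sum.distrib[symmetric] algebra_simps)
  also have "\<dots> = E V n \<phi>"
    unfolding E_def
  proof (intro sum.cong refl)
    fix k assume "k \<in> {1..n}"
    then have "V n k = g n k * V (Suc n) k + V (Suc n) (Suc k)" by (intro solution_rec[OF assms(1)]) auto
    then show "S n k * (g n k * V (Suc n) k + V (Suc n) (Suc k)) * \<phi> k = S n k * V n k * \<phi> k" by simp
  qed
  finally show ?thesis .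
qed

lemma E_back:
  assumes "solution V" "1 \<le> n" shows "E V (n + d) (back_mean n \<phi> d) = E V n \<phi>"
  using assms by (induction d) (auto simp: E_back_step)

text \<open>\<open>back_step n \<phi> \<kappa>\<close> is an average of \<open>\<phi> (\<kappa> - 1)\<close> and \<open>\<phi> \<kappa>\<close>. Hence
  the backward dynamics preserve monotonicity, which is what makes the comparison arguments below
  possible.\<close>

lemma back_step_between:
  assumes mono: "\<And>i j. 1 \<le> i \<Longrightarrow> i \<le> j \<Longrightarrow> j \<le> n \<Longrightarrow> \<phi> i \<le> \<phi> j" and n: "1 \<le> n" "1 \<le> \<kappa>" "\<kappa> \<le> n"
  shows "back_step n \<phi> \<kappa> \<le> \<phi> \<kappa>" "\<phi> \<kappa> \<le> back_step n \<phi> (Suc \<kappa>)"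
proof -
  have "S n (\<kappa> - 1) * \<phi> (\<kappa> - 1) \<le> S n (\<kappa> - 1) * \<phi> \<kappa>"
  proof (cases "\<kappa> = 1")
    case True then show ?thesis using n by (cases n) auto
  next
    case False
    then show ?thesis using n by (intro mult_left_mono mono S_nonneg) auto
  qed
  then have "g n \<kappa> * S n \<kappa> * \<phi> \<kappa> + S n (\<kappa> - 1) * \<phi> (\<kappa> - 1) \<le> S (Suc n) \<kappa> * \<phi> \<kappa>"
    using n by (simp add: algebra_simps)
  then show "back_step n \<phi> \<kappa> \<le> \<phi> \<kappa>"
    unfolding back_step_def using S_pos[of \<kappa> "Suc n"] n by (simp add: divide_le_eq mult.commute del: S.simps)
  have "g n (Suc \<kappa>) * S n (Suc \<kappa>) * \<phi> \<kappa> \<le> g n (Suc \<kappa>) * S n (Suc \<kappa>) * \<phi> (Suc \<kappa>)"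
  proof (cases "\<kappa> = n")
    case True then show ?thesis by (simp add: S_above)
  next
    case False
    then show ?thesis using n g_pos[of "Suc \<kappa>" n] by (intro mult_left_mono mono mult_nonneg_nonneg S_nonneg) auto
  qed
  then have "S (Suc n) (Suc \<kappa>) * \<phi> \<kappa> \<le> g n (Suc \<kappa>) * S n (Suc \<kappa>) * \<phi> (Suc \<kappa>) + S n \<kappa> * \<phi> \<kappa>"
    by (simp add: algebra_simps)
  then show "\<phi> \<kappa> \<le> back_step n \<phi> (Suc \<kappa>)"
    unfolding back_step_def using S_pos[of "Suc \<kappa>" "Suc n"] n by (simp add: le_divide_eq mult.commute del: S.simps)
qed

lemma back_step_mono:
  assumes mono: "\<And>i j. 1 \<le> i \<Longrightarrow> i \<le> j \<Longrightarrow> j \<le> n \<Longrightarrow> \<phi> i \<le> \<phi> j" and n: "1 \<le> n"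
    and ij: "1 \<le> i" "i \<le> j" "j \<le> Suc n"
  shows "back_step n \<phi> i \<le> back_step n \<phi> j"
  using ij(2,3)
proof (induction j rule: dec_induct)
  case (step j)
  have "back_step n \<phi> i \<le> back_step n \<phi> j" using step by simp
  also have "\<dots> \<le> \<phi> j" using back_step_between(1)[of n \<phi> j] mono n ij step by auto
  also have "\<dots> \<le> back_step n \<phi> (Suc j)" using back_step_between(2)[of n \<phi> j] mono n ij step by auto
  finally show ?case .
qed simp

lemma back_mean_mono:
  assumes mono: "\<And>i j. 1 \<le> i \<Longrightarrow> i \<le> j \<Longrightarrow> j \<le> n \<Longrightarrow> \<phi> i \<le> \<phi> j" and n: "1 \<le> n"
    and ij: "1 \<le> i" "i \<le> j" "j \<le> n + d"
  shows "back_mean n \<phi> d i \<le> back_mean n \<phi> d j"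
  using ij
proof (induction d arbitrary: i j)
  case 0 then show ?case using mono by simp
next
  case (Suc d)
  show ?case using back_step_mono[of "n + d" "back_mean n \<phi> d" i j] Suc n by simp
qed

lemma back_step_bounds:
  assumes b: "\<And>i. 1 \<le> i \<Longrightarrow> i \<le> n \<Longrightarrow> a \<le> \<phi> i \<and> \<phi> i \<le> b" and n: "1 \<le> n" "1 \<le> \<kappa>" "\<kappa> \<le> Suc n"
  shows "a \<le> back_step n \<phi> \<kappa> \<and> back_step n \<phi> \<kappa> \<le> b"
proof -
  have 1: "g n \<kappa> * S n \<kappa> * a \<le> g n \<kappa> * S n \<kappa> * \<phi> \<kappa> \<and> g n \<kappa> * S n \<kappa> * \<phi> \<kappa> \<le> g n \<kappa> * S n \<kappa> * b"
  proof (cases "\<kappa> \<le> n")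
    case True then show ?thesis using b[of \<kappa>] n g_pos[of \<kappa> n] S_nonneg[of n \<kappa>] by (auto intro!: mult_left_mono)
  qed (simp add: S_above)
  have 2: "S n (\<kappa> - 1) * a \<le> S n (\<kappa> - 1) * \<phi> (\<kappa> - 1) \<and> S n (\<kappa> - 1) * \<phi> (\<kappa> - 1) \<le> S n (\<kappa> - 1) * b"
  proof (cases "\<kappa> = 1")
    case True then show ?thesis using n by (cases n) auto
  next
    case False then show ?thesis using b[of "\<kappa> - 1"] n S_nonneg[of n "\<kappa> - 1"] by (auto intro!: mult_left_mono)
  qed
  show ?thesis
    unfolding back_step_def using 1 2 S_pos[of \<kappa> "Suc n"] n
    by (auto simp: le_divide_eq divide_le_eq distrib_right distrib_left mult.commute)
qed

lemma back_mean_bounds: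
  assumes b: "\<And>i. 1 \<le> i \<Longrightarrow> i \<le> n \<Longrightarrow> a \<le> \<phi> i \<and> \<phi> i \<le> b" and n: "1 \<le> n" "1 \<le> \<kappa>" "\<kappa> \<le> n + d"
  shows "a \<le> back_mean n \<phi> d \<kappa> \<and> back_mean n \<phi> d \<kappa> \<le> b"
  using n(2,3)
proof (induction d arbitrary: \<kappa>)
  case (Suc d)
  then show ?case using back_step_bounds[of "n + d" a "back_mean n \<phi> d" b \<kappa>] n by simp
qed (use b in simp)

text \<open>The probability of \<open>K\<^sub>n \<ge> k\<close> given \<open>K\<^sub>\<nu> = \<kappa>\<close>.\<close>

definition H :: "nat \<Rightarrow> nat \<Rightarrow> nat \<Rightarrow> nat \<Rightarrow> real" where
  "H n k \<nu> = back_mean n (\<lambda>j. of_bool (k \<le> j)) (\<nu> - n)"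

lemma E_H: "solution V \<Longrightarrow> 1 \<le> n \<Longrightarrow> n \<le> \<nu> \<Longrightarrow> E V \<nu> (H n k \<nu>) = T V n k"
  using E_back[of V n "\<nu> - n" "\<lambda>j. of_bool (k \<le> j)"] by (simp add: H_def T_def)

lemma H_mono: "1 \<le> n \<Longrightarrow> n \<le> \<nu> \<Longrightarrow> 1 \<le> i \<Longrightarrow> i \<le> j \<Longrightarrow> j \<le> \<nu> \<Longrightarrow> H n k \<nu> i \<le> H n k \<nu> j"
  unfolding H_def by (rule back_mean_mono) (auto simp: of_bool_def)

lemma H_bounds: "1 \<le> n \<Longrightarrow> n \<le> \<nu> \<Longrightarrow> 1 \<le> i \<Longrightarrow> i \<le> \<nu> \<Longrightarrow> 0 \<le> H n k \<nu> i \<and> H n k \<nu> i \<le> 1"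
  unfolding H_def by (rule back_mean_bounds) (auto simp: of_bool_def)

lemma H_le_1: "1 \<le> n \<Longrightarrow> n \<le> \<nu> \<Longrightarrow> 1 \<le> i \<Longrightarrow> i \<le> \<nu> \<Longrightarrow> k \<le> 1 \<Longrightarrow> H n k \<nu> i = 1"
  unfolding H_def using back_mean_bounds[of n 1 "\<lambda>j. of_bool (k \<le> j)" 1 i "\<nu> - n"] by (force simp: of_bool_def)

lemma H_above: "1 \<le> n \<Longrightarrow> n \<le> \<nu> \<Longrightarrow> 1 \<le> i \<Longrightarrow> i \<le> \<nu> \<Longrightarrow> n < k \<Longrightarrow> H n k \<nu> i = 0"
  unfolding H_def using back_mean_bounds[of n 0 "\<lambda>j. of_bool (k \<le> j)" 0 i "\<nu> - n"] by (force simp: of_bool_def)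

end

section \<open>Distributions on the unit interval\<close>

lemma bounded_measurable_integrable:
  assumes "prob_space M" "f \<in> borel_measurable M" "AE x in M. \<bar>f x\<bar> \<le> (B::real)"
  shows "integrable M f"
proof -
  interpret prob_space M by fact
  show ?thesis using assms by (intro integrable_const_bound[where B=B]) auto
qed

text \<open>On a bounded interval the moments determine the characteristic function through its Taylor expansion.\<close>

lemma moments_determine_distribution:
  assumes M: "real_distribution M" "AE x in M. x \<in> {0..1::real}"
    and N: "real_distribution N" "AE x in N. x \<in> {0..1::real}"
    and eq: "\<And>p. (\<integral>x. x ^ p \<partial>M) = (\<integral>x. x ^ p \<partial>N)"
  shows "M = N"
proof (rule Levy_uniqueness[OF M(1) N(1)], rule ext)
  fix t :: real
  have approx: "cmod (char M t - (\<Sum>k\<le>n. ((\<i> * t)^k / fact k) * (\<integral>x. x ^ k \<partial>M))) \<le> 2 * (\<bar>t\<bar> ^ n / fact n)"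
    if "real_distribution M" "AE x in M. x \<in> {0..1::real}" for M n
  proof -
    interpret real_distribution M by fact
    have b: "AE x in M. \<bar>x ^ k\<bar> \<le> 1" for k using that(2) by eventually_elim (auto simp: power_le_one)
    have int: "integrable M (\<lambda>x. x ^ k)" for k
      by (rule bounded_measurable_integrable[OF _ _ b]) (auto intro: prob_space_axioms)
    have "expectation (\<lambda>x. \<bar>x\<bar> ^ n) \<le> expectation (\<lambda>x. 1)"
      using b[of n] int[of n] by (intro integral_mono_AE) (auto simp: power_abs[symmetric])
    then have "2 * \<bar>t\<bar> ^ n / fact n * expectation (\<lambda>x. \<bar>x\<bar> ^ n) \<le> 2 * \<bar>t\<bar> ^ n / fact n * 1"
      using prob_space by (intro mult_left_mono) auto
    then show ?thesis using char_approx1[of n t, OF int] by simp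
  qed
  have "cmod (char M t - char N t) \<le> 4 * (\<bar>t\<bar> ^ n / fact n)" for n
  proof -
    let ?s = "\<Sum>k\<le>n. ((\<i> * t)^k / fact k) * (\<integral>x. x ^ k \<partial>M)"
    have "cmod (char M t - char N t) \<le> cmod (char M t - ?s) + cmod (char N t - ?s)"
      using norm_triangle_ineq4[of "char M t - ?s" "char N t - ?s"] by simp
    then show ?thesis using approx[OF M, of n] approx[OF N, of n] unfolding eq by simp
  qed
  moreover have "(\<lambda>n. 4 * (\<bar>t\<bar> ^ n / fact n)) \<longlonglongrightarrow> 4 * 0"
    using summable_LIMSEQ_zero[OF summable_exp[of "\<bar>t\<bar>"]] by (intro tendsto_mult tendsto_const) (simp add: field_simps)
  ultimately have "cmod (char M t - char N t) \<le> 4 * 0"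
    by (intro LIMSEQ_le_const[where X="\<lambda>n. 4 * (\<bar>t\<bar> ^ n / fact n)"]) auto
  then show "char M t = char N t" by simp
qed

text \<open>Laws on one compact interval are tight, so that the theorem of Helly applies.\<close>

lemma unit_interval_compact:
  fixes \<mu> :: "nat \<Rightarrow> real measure"
  assumes \<mu>: "\<And>j. real_distribution (\<mu> j)" and supp: "\<And>j. AE x in \<mu> j. x \<in> {0..1}"
  obtains s M where "strict_mono (s :: nat \<Rightarrow> nat)" "real_distribution M"
    "\<forall>f B. continuous_on UNIV f \<longrightarrow> (\<forall>x. \<bar>f x\<bar> \<le> (B::real)) \<longrightarrow> (\<lambda>j. \<integral>x. f x \<partial>\<mu> (s j)) \<longlonglongrightarrow> (\<integral>x. f x \<partial>M)"
proof -
  have "tight \<mu>" unfolding tight_def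
  proof (intro conjI allI impI \<mu>)
    fix e :: real assume e: "0 < e"
    have "1 - e < measure (\<mu> n) {-1<..2}" for n
    proof -
      interpret real_distribution "\<mu> n" by (rule \<mu>)
      have "AE x in \<mu> n. x \<in> {-1<..2}" using supp[of n] by eventually_elim auto
      then have "prob {-1<..2} = 1" by (subst prob_eq_1) auto
      then show ?thesis using e by simp
    qed
    then show "\<exists>a b. a < b \<and> (\<forall>n. 1 - e < measure (\<mu> n) {a<..b})" by (intro exI[of _ "-1"] exI[of _ 2]) auto
  qed
  then obtain s M where s: "strict_mono (s :: nat \<Rightarrow> nat)" "real_distribution M" "weak_conv_m (\<mu> \<circ> id \<circ> s) M"
    using tight_imp_convergent_subsubsequence[of \<mu> id] strict_mono_id by (auto simp: id_def)
  show ?thesis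
  proof (rule that[OF s(1,2)], intro allI impI)
    fix f :: "real \<Rightarrow> real" and B assume "continuous_on UNIV f" "\<forall>x. \<bar>f x\<bar> \<le> B"
    then have "(\<lambda>j. \<integral>x. f x \<partial>(\<mu> \<circ> id \<circ> s) j) \<longlonglongrightarrow> (\<integral>x. f x \<partial>M)"
      using \<mu> s(2,3) by (intro weak_conv_imp_integral_bdd_continuous_conv[where B=B]) (auto simp: continuous_on_eq_continuous_at comp_def)
    then show "(\<lambda>j. \<integral>x. f x \<partial>\<mu> (s j)) \<longlonglongrightarrow> (\<integral>x. f x \<partial>M)" by simp
  qed
qed

section \<open>The boundary of the chain\<close>

text \<open>Conditions under which the solutions \<open>U z\<close>, with \<open>z\<close> in the compact set \<open>Z\<close>, form the boundary of
  the chain. The function \<open>\<zeta> \<nu>\<close> turns a number of blocks at level \<open>\<nu>\<close> into a point of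
  \<open>Z\<close>. By \<open>lln\<close> this point converges to \<open>z\<close> under \<open>U z\<close>; by \<open>unif\<close> the backward dynamics
  started from \<open>\<kappa>\<close> at a high level look like the solution whose parameter is \<open>\<zeta> \<nu>
  \<kappa>\<close>. Both are demanded only along a subsequence \<open>r\<close> of the levels, because the law of large
  numbers for Poisson-Kingman partitions is derived from convergence in mean.\<close>

locale gibbs_boundary = gibbs_chain +
  fixes Z :: "real set" and U :: "real \<Rightarrow> nat \<Rightarrow> nat \<Rightarrow> real" and r :: "nat \<Rightarrow> nat" and \<zeta> :: "nat \<Rightarrow> nat \<Rightarrow> real"
  assumes Z: "closed Z" "Z \<subseteq> {0..1}" "Z \<noteq> {}"
    and sol_U: "\<And>z. z \<in> Z \<Longrightarrow> solution (U z)"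
    and cont_U: "\<And>n k. 1 \<le> k \<Longrightarrow> k \<le> n \<Longrightarrow> continuous_on Z (\<lambda>z. U z n k)"
    and r: "strict_mono r"
    and \<zeta>: "\<And>\<nu> \<kappa>. 1 \<le> \<kappa> \<Longrightarrow> \<kappa> \<le> \<nu> \<Longrightarrow> \<zeta> \<nu> \<kappa> \<in> Z"
    and lln: "\<And>z. z \<in> Z \<Longrightarrow> (\<lambda>j. E (U z) (r j) (\<lambda>\<kappa>. \<bar>\<zeta> (r j) \<kappa> - z\<bar>)) \<longlonglongrightarrow> 0"
    and unif: "\<And>n k e. 1 \<le> n \<Longrightarrow> 0 < e \<Longrightarrow>
       \<forall>\<^sub>F j in sequentially. \<forall>\<kappa>\<in>{1..r j}. \<bar>H n k (r j) \<kappa> - T (U (\<zeta> (r j) \<kappa>)) n k\<bar> \<le> e"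
begin

definition represents :: "real measure \<Rightarrow> (nat \<Rightarrow> nat \<Rightarrow> real) \<Rightarrow> bool" where
  "represents Q V \<longleftrightarrow> prob_space Q \<and> sets Q = sets (restrict_space borel Z) \<and>
     (\<forall>n k. 1 \<le> k \<and> k \<le> n \<longrightarrow> has_bochner_integral Q (\<lambda>z. U z n k) (V n k))"

lemma eventually_r: "\<forall>\<^sub>F j in sequentially. n \<le> r j"
  using filterlim_subseq[OF r] by (simp add: filterlim_at_top)

lemma space_rep: "sets Q = sets (restrict_space borel Z) \<Longrightarrow> space Q = Z"
  using sets_eq_imp_space_eq[of Q "restrict_space borel Z"] by (simp add: space_restrict_space)

lemma meas_rep:
  assumes "sets Q = sets (restrict_space borel Z)" "continuous_on Z f" shows "f \<in> borel_measurable Q"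
  using borel_measurable_continuous_on_restrict[OF assms(2)] measurable_cong_sets[OF assms(1) refl] by blast

lemma integrable_rep:
  assumes "prob_space Q" "sets Q = sets (restrict_space borel Z)" "continuous_on Z f"
    "\<And>z. z \<in> Z \<Longrightarrow> \<bar>f z\<bar> \<le> (B::real)"
  shows "integrable Q f"
  using assms meas_rep[OF assms(2,3)] space_rep[OF assms(2)]
  by (intro bounded_measurable_integrable[where B=B] AE_I2) auto

lemma cont_E: "continuous_on Z (\<lambda>z. E (U z) n \<phi>)"
  unfolding E_def by (intro continuous_intros cont_U) auto

lemma cont_T: "continuous_on Z (\<lambda>z. T (U z) n k)"
  unfolding T_def by (rule cont_E)

lemma rep_E:
  assumes "represents Q V" shows "(\<integral>z. E (U z) n \<phi> \<partial>Q) = E V n \<phi>"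
proof -
  have h: "has_bochner_integral Q (\<lambda>z. U z n k) (V n k)" if "k \<in> {1..n}" for k
    using assms that unfolding represents_def by auto
  have "has_bochner_integral Q (\<lambda>z. E (U z) n \<phi>) (E V n \<phi>)"
    unfolding E_def using h by (intro has_bochner_integral_sum has_bochner_integral_mult_left has_bochner_integral_mult_right) auto
  then show ?thesis by (rule has_bochner_integral_integral_eq)
qed

text \<open>By the law of large numbers a representing measure is the limit law of \<open>\<zeta> K\<^sub>\<nu>\<close>; its
  moments are therefore determined by the solution.\<close>

lemma rep_moments:
  assumes Q: "represents Q V"
  shows "(\<lambda>j. E V (r j) (\<lambda>\<kappa>. \<zeta> (r j) \<kappa> ^ p)) \<longlonglongrightarrow> (\<integral>z. z ^ p \<partial>Q)"
proof -
  have ps: "prob_space Q" and sQ: "sets Q = sets (restrict_space borel Z)" using Q by (auto simp: represents_def)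
  interpret prob_space Q by fact
  have sp: "space Q = Z" by (rule space_rep[OF sQ])
  have "(\<lambda>j. \<integral>z. E (U z) (r j) (\<lambda>\<kappa>. \<zeta> (r j) \<kappa> ^ p) \<partial>Q) \<longlonglongrightarrow> (\<integral>z. z ^ p \<partial>Q)"
  proof (rule integral_dominated_convergence[where w="\<lambda>_. 1"])
    show "(\<lambda>z. z ^ p) \<in> borel_measurable Q" by (rule meas_rep[OF sQ]) (intro continuous_intros)
    show "(\<lambda>z. E (U z) (r j) (\<lambda>\<kappa>. \<zeta> (r j) \<kappa> ^ p)) \<in> borel_measurable Q" for j by (rule meas_rep[OF sQ cont_E])
    show "AE z in Q. norm (E (U z) (r j) (\<lambda>\<kappa>. \<zeta> (r j) \<kappa> ^ p)) \<le> 1" for j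
    proof (rule AE_I2)
      fix z assume "z \<in> space Q"
      then have z: "solution (U z)" using sp sol_U by simp
      have "\<bar>E (U z) (r j) (\<lambda>\<kappa>. \<zeta> (r j) \<kappa> ^ p)\<bar> \<le> E (U z) (r j) (\<lambda>\<kappa>. \<bar>\<zeta> (r j) \<kappa> ^ p\<bar>)" by (rule E_abs[OF z])
      also have "\<dots> \<le> E (U z) (r j) (\<lambda>\<kappa>. 1)"
      proof (rule E_mono[OF z])
        fix \<kappa> assume "1 \<le> \<kappa>" "\<kappa> \<le> r j"
        then have "\<zeta> (r j) \<kappa> \<in> {0..1}" using \<zeta> Z by blast
        then show "\<bar>\<zeta> (r j) \<kappa> ^ p\<bar> \<le> 1" by (auto simp: power_le_one)
      qed
      also have "\<dots> \<le> 1" using E_one[OF z, of "r j"] by (cases "r j") (auto simp: E_def)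
      finally show "norm (E (U z) (r j) (\<lambda>\<kappa>. \<zeta> (r j) \<kappa> ^ p)) \<le> 1" by simp
    qed
    show "AE z in Q. (\<lambda>j. E (U z) (r j) (\<lambda>\<kappa>. \<zeta> (r j) \<kappa> ^ p)) \<longlonglongrightarrow> z ^ p"
    proof (rule AE_I2)
      fix z assume "z \<in> space Q"
      then have zZ: "z \<in> Z" using sp by simp
      then have z: "solution (U z)" using sol_U by simp
      have lim: "(\<lambda>j. real p * E (U z) (r j) (\<lambda>\<kappa>. \<bar>\<zeta> (r j) \<kappa> - z\<bar>)) \<longlonglongrightarrow> 0"
        using tendsto_mult[OF tendsto_const lln[OF zZ]] by simp
      have "\<forall>\<^sub>F j in sequentially. norm (E (U z) (r j) (\<lambda>\<kappa>. \<zeta> (r j) \<kappa> ^ p) - z ^ p) \<le> real p * E (U z) (r j) (\<lambda>\<kappa>. \<bar>\<zeta> (r j) \<kappa> - z\<bar>)"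
        using eventually_r[of 1]
      proof eventually_elim
        case (elim j)
        have "E (U z) (r j) (\<lambda>\<kappa>. \<zeta> (r j) \<kappa> ^ p) - z ^ p = E (U z) (r j) (\<lambda>\<kappa>. \<zeta> (r j) \<kappa> ^ p - z ^ p)"
          using E_const[OF z elim] by (simp add: E_diff)
        then have "norm (E (U z) (r j) (\<lambda>\<kappa>. \<zeta> (r j) \<kappa> ^ p) - z ^ p) \<le> E (U z) (r j) (\<lambda>\<kappa>. \<bar>\<zeta> (r j) \<kappa> ^ p - z ^ p\<bar>)"
          using E_abs[OF z] by simp
        also have "\<dots> \<le> E (U z) (r j) (\<lambda>\<kappa>. real p * \<bar>\<zeta> (r j) \<kappa> - z\<bar>)"
        proof (rule E_mono[OF z])
          fix \<kappa> assume "1 \<le> \<kappa>" "\<kappa> \<le> r j"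
          then have "\<zeta> (r j) \<kappa> \<in> {0..1}" "z \<in> {0..1}" using \<zeta> Z zZ by blast+
          then show "\<bar>\<zeta> (r j) \<kappa> ^ p - z ^ p\<bar> \<le> real p * \<bar>\<zeta> (r j) \<kappa> - z\<bar>"
            using norm_power_diff[of "\<zeta> (r j) \<kappa>" z p] by simp
        qed
        finally show ?case by (simp add: E_cmult)
      qed
      then have "(\<lambda>j. E (U z) (r j) (\<lambda>\<kappa>. \<zeta> (r j) \<kappa> ^ p) - z ^ p) \<longlonglongrightarrow> 0" by (rule Lim_null_comparison[OF _ lim])
      then show "(\<lambda>j. E (U z) (r j) (\<lambda>\<kappa>. \<zeta> (r j) \<kappa> ^ p)) \<longlonglongrightarrow> z ^ p" by (simp add: LIM_zero_iff)
    qed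
  qed simp
  then show ?thesis by (simp add: rep_E[OF Q])
qed

lemma represents_unique:
  assumes "represents Q1 V" "represents Q2 V" shows "Q1 = Q2"
proof -
  have meas: "(\<lambda>z. z) \<in> borel_measurable Q" if "represents Q V" for Q
    using meas_rep[of Q "\<lambda>z. z"] that by (auto simp: represents_def intro: continuous_intros)
  have dist: "real_distribution (distr Q borel (\<lambda>z. z)) \<and> (AE z in distr Q borel (\<lambda>z. z). z \<in> {0..1})" if "represents Q V" for Q
  proof -
    interpret prob_space Q using that by (simp add: represents_def)
    have sp: "space Q = Z" using that space_rep by (simp add: represents_def)
    have "AE z in distr Q borel (\<lambda>z. z). z \<in> {0..1}"
      using sp Z(2) by (subst AE_distr_iff[OF meas[OF that]]) (auto intro!: AE_I2)
    then show ?thesis using meas[OF that] by (auto intro!: real_distribution_distr)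
  qed
  have mom: "(\<integral>z. z ^ p \<partial>distr Q borel (\<lambda>z. z)) = (\<integral>z. z ^ p \<partial>Q)" if "represents Q V" for Q p
    using meas[OF that] by (subst integral_distr) auto
  have "distr Q1 borel (\<lambda>z. z) = distr Q2 borel (\<lambda>z. z)"
  proof (rule moments_determine_distribution)
    fix p
    show "(\<integral>z. z ^ p \<partial>distr Q1 borel (\<lambda>z. z)) = (\<integral>z. z ^ p \<partial>distr Q2 borel (\<lambda>z. z))"
      unfolding mom[OF assms(1)] mom[OF assms(2)]
      using LIMSEQ_unique[OF rep_moments[OF assms(1)] rep_moments[OF assms(2)]] .
  qed (use dist[OF assms(1)] dist[OF assms(2)] in auto)
  then have eq: "emeasure (distr Q1 borel (\<lambda>z. z)) A = emeasure (distr Q2 borel (\<lambda>z. z)) A" for A by simp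
  have sQ: "sets Q1 = sets (restrict_space borel Z)" "sets Q2 = sets (restrict_space borel Z)" using assms by (auto simp: represents_def)
  show ?thesis
  proof (rule measure_eqI)
    show "sets Q1 = sets Q2" using sQ by simp
    fix A assume A: "A \<in> sets Q1"
    then have A': "A \<in> sets borel" "A \<subseteq> Z"
      using sQ Z(1) sets_restrict_space_iff[of Z borel A] by (auto simp: borel_closed)
    have "emeasure (distr Q borel (\<lambda>z. z)) A = emeasure Q A" if "represents Q V" for Q
      using meas[OF that] A' space_rep[of Q] that by (subst emeasure_distr) (auto simp: represents_def Int_absorb2)
    then show "emeasure Q1 A = emeasure Q2 A" using eq[of A] assms by simp
  qed
qed

text \<open>The law of \<open>\<zeta> K\<^sub>\<nu>\<close> under the solution \<open>V\<close>.\<close>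

definition level_law :: "(nat \<Rightarrow> nat \<Rightarrow> real) \<Rightarrow> nat \<Rightarrow> real measure" where
  "level_law V \<nu> = distr (point_measure {1..\<nu>} (\<lambda>\<kappa>. ennreal (S \<nu> \<kappa> * V \<nu> \<kappa>))) borel (\<zeta> \<nu>)"

lemma level_law:
  assumes V: "solution V" and \<nu>: "1 \<le> \<nu>"
  shows "real_distribution (level_law V \<nu>)" "AE z in level_law V \<nu>. z \<in> Z"
    "\<And>f. f \<in> borel_measurable borel \<Longrightarrow> (\<integral>z. f z \<partial>level_law V \<nu>) = E V \<nu> (\<lambda>\<kappa>. f (\<zeta> \<nu> \<kappa>))"
proof -
  let ?P = "point_measure {1..\<nu>} (\<lambda>\<kappa>. ennreal (S \<nu> \<kappa> * V \<nu> \<kappa>))"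
  have meas: "\<zeta> \<nu> \<in> borel_measurable ?P" by simp
  have "emeasure ?P {1..\<nu>} = ennreal (\<Sum>\<kappa>=1..\<nu>. S \<nu> \<kappa> * V \<nu> \<kappa>)"
    using sum_ennreal[of "{1..\<nu>}" "\<lambda>\<kappa>. S \<nu> \<kappa> * V \<nu> \<kappa>", OF weight_nonneg[OF V]]
    by (simp add: emeasure_point_measure_finite)
  then have P: "prob_space ?P"
    using E_one[OF V \<nu>] by (intro prob_spaceI) (simp add: space_point_measure E_def)
  show "real_distribution (level_law V \<nu>)"
    unfolding level_law_def by (rule prob_space.real_distribution_distr[OF P meas])
  show "AE z in level_law V \<nu>. z \<in> Z"
    unfolding level_law_def using \<zeta> Z(1) by (subst AE_distr_iff[OF meas]) (auto intro!: AE_I2 simp: space_point_measure borel_closed)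
  show "(\<integral>z. f z \<partial>level_law V \<nu>) = E V \<nu> (\<lambda>\<kappa>. f (\<zeta> \<nu> \<kappa>))" if "f \<in> borel_measurable borel" for f
    unfolding level_law_def integral_distr[OF meas that] E_def
    using weight_nonneg[OF V] by (subst lebesgue_integral_point_measure_finite) auto
qed

text \<open>By \<open>E_H\<close>, \<open>T V n k\<close> is the mean of \<open>H n k \<nu>\<close> over the law of \<open>K\<^sub>\<nu>\<close>, hence by
  \<open>unif\<close> nearly the mean of \<open>T (U z) n k\<close> over the law of \<open>z = \<zeta> K\<^sub>\<nu>\<close>. Any weak
  limit of these laws represents \<open>V\<close>.\<close>

lemma represents_exists:
  assumes V: "solution V" shows "\<exists>Q. represents Q V"
proof -
  obtain j0 where j0: "\<And>j. j0 \<le> j \<Longrightarrow> 1 \<le> r j" using eventually_r[of 1] by (auto simp: eventually_sequentially)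
  define \<mu> where "\<mu> j = level_law V (r (j + j0))" for j
  have \<mu>1: "real_distribution (\<mu> j)" "AE z in \<mu> j. z \<in> Z" for j
    unfolding \<mu>_def using level_law(1,2)[OF V] j0[of "j + j0"] by auto
  have supp: "AE z in \<mu> j. z \<in> {0..1}" for j using \<mu>1(2)[of j] by eventually_elim (use Z in auto)
  obtain s M where s: "strict_mono (s :: nat \<Rightarrow> nat)" and M: "real_distribution M"
    and conv': "\<forall>f B. continuous_on UNIV f \<longrightarrow> (\<forall>x. \<bar>f x\<bar> \<le> (B::real)) \<longrightarrow> (\<lambda>j. \<integral>x. f x \<partial>\<mu> (s j)) \<longlonglongrightarrow> (\<integral>x. f x \<partial>M)"
    by (rule unit_interval_compact[of \<mu>, OF \<mu>1(1) supp]) (rule that)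
  have conv: "(\<lambda>j. \<integral>x. f x \<partial>\<mu> (s j)) \<longlonglongrightarrow> (\<integral>x. f x \<partial>M)"
    if "continuous_on UNIV f" "\<And>x. \<bar>f x\<bar> \<le> B" for f and B :: real
    using conv' that by blast
  interpret M: real_distribution M by (rule M)
  \<comment> \<open>the limit does not charge the complement of the closed set \<open>Z\<close>\<close>
  define d where "d x = min 1 (infdist x Z)" for x :: real
  have d: "continuous_on UNIV d" "\<And>x. \<bar>d x\<bar> \<le> 1" "\<And>x. 0 \<le> d x"
    unfolding d_def by (auto intro!: continuous_intros simp: infdist_nonneg)
  have d0: "d x = 0 \<longleftrightarrow> x \<in> Z" for x using in_closed_iff_infdist_zero[OF Z(1,3), of x] by (auto simp: d_def min_def)
  have "(\<integral>x. d x \<partial>\<mu> j) = 0" for j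
    using \<mu>1(2)[of j] by (intro integral_eq_zero_AE) (auto simp: d0)
  then have "(\<integral>x. d x \<partial>M) = 0" using conv[OF d(1,2)] LIMSEQ_unique[OF _ tendsto_const] by simp
  moreover have "d \<in> borel_measurable borel" by (rule borel_measurable_continuous_onI[OF d(1)])
  then have "integrable M d" using d by (intro M.integrable_const_bound[where B=1]) auto
  ultimately have "AE x in M. d x = 0" using integral_nonneg_eq_0_iff_AE[of M d] d(3) by auto
  then have AEZ: "AE x in M. x \<in> Z" by (simp add: d0)
  define Q where "Q = restrict_space M Z"
  have ZM: "Z \<in> sets M" "Z \<inter> space M \<in> sets M" using Z(1) by (auto simp: borel_closed)
  have "emeasure M Z = 1" using AEZ ZM by (subst M.emeasure_eq_1_AE) auto
  then have Qp: "prob_space Q" unfolding Q_def using ZM by (intro prob_space_restrict_space) auto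
  have Qs: "sets Q = sets (restrict_space borel Z)" unfolding Q_def by (rule sets_restrict_space_cong) simp
  interpret Q: prob_space Q by (rule Qp)
  have intT: "(\<integral>z. T (U z) n k \<partial>Q) = T V n k" if n: "1 \<le> n" for n k
  proof -
    have cl: "closedin (top_of_set UNIV) Z" using Z(1) by simp
    have nT: "norm (T (U x) n k) \<le> 1" if "x \<in> Z" for x using T_bounds[OF sol_U[OF that] n, of k] by simp
    have "\<exists>G. continuous_on UNIV G \<and> (\<forall>x\<in>Z. G x = T (U x) n k) \<and> (\<forall>x. norm (G x) \<le> 1)"
      by (rule Tietze[OF cont_T[of n k] cl zero_le_one nT]) blast+
    then obtain G where G: "continuous_on UNIV G" "\<And>x. x \<in> Z \<Longrightarrow> G x = T (U x) n k" "\<And>x. norm (G x) \<le> 1"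
      by blast
    have G1: "\<bar>G x\<bar> \<le> 1" for x using G(3)[of x] by simp
    have Gm: "G \<in> borel_measurable borel" by (rule borel_measurable_continuous_onI[OF G(1)])
    have "(\<integral>z. T (U z) n k \<partial>Q) = (\<integral>x. indicator Z x *\<^sub>R T (U x) n k \<partial>M)"
      unfolding Q_def by (rule integral_restrict_space[OF ZM(2)])
    also have "\<dots> = (\<integral>x. indicator Z x *\<^sub>R G x \<partial>M)" by (rule Bochner_Integration.integral_cong) (auto simp: indicator_def G)
    also have "\<dots> = (\<integral>x. G x \<partial>M)"
    proof (rule integral_cong_AE)
      have "(\<lambda>x. indicator Z x *\<^sub>R G x) \<in> borel_measurable borel"
        using Gm Z(1) by (intro borel_measurable_scaleR borel_measurable_indicator) (auto simp: borel_closed)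
      then show "(\<lambda>x. indicator Z x *\<^sub>R G x) \<in> borel_measurable M" by simp
      show "G \<in> borel_measurable M" using Gm by simp
      show "AE x in M. indicator Z x *\<^sub>R G x = G x" using AEZ by eventually_elim simp
    qed
    finally have e1: "(\<integral>z. T (U z) n k \<partial>Q) = (\<integral>x. G x \<partial>M)" .
    have lim: "(\<lambda>j. \<integral>x. G x \<partial>\<mu> (s j)) \<longlonglongrightarrow> (\<integral>x. G x \<partial>M)" by (rule conv[OF G(1) G1])
    have lim2: "(\<lambda>j. \<integral>x. G x \<partial>\<mu> (s j)) \<longlonglongrightarrow> T V n k"
    proof (rule LIMSEQ_I)
      fix e :: real assume e: "0 < e"
      obtain N where N: "\<And>j. N \<le> j \<Longrightarrow> n \<le> r j \<and> (\<forall>\<kappa>\<in>{1..r j}. \<bar>H n k (r j) \<kappa> - T (U (\<zeta> (r j) \<kappa>)) n k\<bar> \<le> e / 2)"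
        using eventually_conj[OF eventually_r[of n] unif[OF n, of "e/2" k]] e by (auto simp: eventually_sequentially)
      show "\<exists>no. \<forall>j\<ge>no. norm ((\<integral>x. G x \<partial>\<mu> (s j)) - T V n k) < e"
      proof (intro exI allI impI)
        fix j assume "N \<le> j"
        define \<nu> where "\<nu> = r (s j + j0)"
        have Nj: "N \<le> s j + j0" using \<open>N \<le> j\<close> seq_suble[OF s, of j] by simp
        have \<nu>: "n \<le> \<nu>" "1 \<le> \<nu>" using N[OF Nj] n by (auto simp: \<nu>_def)
        have "(\<integral>x. G x \<partial>\<mu> (s j)) = E V \<nu> (\<lambda>\<kappa>. G (\<zeta> \<nu> \<kappa>))"
          unfolding \<mu>_def \<nu>_def[symmetric] by (rule level_law(3)[OF V \<nu>(2) Gm])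
        then have "\<bar>(\<integral>x. G x \<partial>\<mu> (s j)) - T V n k\<bar> = \<bar>E V \<nu> (\<lambda>\<kappa>. G (\<zeta> \<nu> \<kappa>) - H n k \<nu> \<kappa>)\<bar>"
          using E_H[OF V n \<nu>(1), of k] by (simp add: E_diff)
        also have "\<dots> \<le> E V \<nu> (\<lambda>\<kappa>. \<bar>G (\<zeta> \<nu> \<kappa>) - H n k \<nu> \<kappa>\<bar>)" by (rule E_abs[OF V])
        also have "\<dots> \<le> E V \<nu> (\<lambda>_. e / 2)"
        proof (rule E_mono[OF V])
          fix \<kappa> assume k: "1 \<le> \<kappa>" "\<kappa> \<le> \<nu>"
          then have "\<bar>H n k \<nu> \<kappa> - T (U (\<zeta> \<nu> \<kappa>)) n k\<bar> \<le> e / 2" using N[OF Nj] by (auto simp: \<nu>_def)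
          then show "\<bar>G (\<zeta> \<nu> \<kappa>) - H n k \<nu> \<kappa>\<bar> \<le> e / 2" using G(2)[OF \<zeta>[OF k]] by (simp add: abs_minus_commute)
        qed
        also have "\<dots> = e / 2" by (rule E_const[OF V \<nu>(2)])
        finally show "norm ((\<integral>x. G x \<partial>\<mu> (s j)) - T V n k) < e" using e by simp
      qed
    qed
    show ?thesis using e1 LIMSEQ_unique[OF lim lim2] by simp
  qed
  have "has_bochner_integral Q (\<lambda>z. U z n k) (V n k)" if nk: "1 \<le> k" "k \<le> n" for n k
  proof -
    have n: "1 \<le> n" using nk by simp
    have iT: "integrable Q (\<lambda>z. T (U z) n k)" for k
      using T_bounds[OF sol_U n] by (intro integrable_rep[OF Qp Qs cont_T, where B=1]) auto
    have "has_bochner_integral Q (\<lambda>z. (T (U z) n k - T (U z) n (Suc k)) / S n k) ((T V n k - T V n (Suc k)) / S n k)"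
      using iT intT[OF n] by (intro has_bochner_integral_divide_zero has_bochner_integral_diff) (auto simp: has_bochner_integral_iff)
    then show ?thesis by (simp only: V_eq_T[OF nk, symmetric])
  qed
  then have "represents Q V" unfolding represents_def using Qp Qs by blast
  then show ?thesis ..
qed

theorem represents_ex1: "solution V \<Longrightarrow> \<exists>!Q. represents Q V"
  using represents_exists represents_unique by blast

end

section \<open>Families indexed by an interval\<close>

lemma (in gibbs_chain) solution_2_2: "solution V \<Longrightarrow> V 2 2 = T V 2 2"
  using V_eq_T[of 2 2 V] T_above[of 2 "Suc 2" V] S_diag[of 2] by simp

lemma (in gibbs_chain) solution_2_1: "solution V \<Longrightarrow> V 2 1 = (1 - T V 2 2) / S 2 1"
  using V_eq_T[of 1 2 V] T_le_1[of V 2 1] by (simp add: numeral_2_eq_2[symmetric] del: S.simps)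

lemma (in gibbs_chain) T_one_block: "solution V \<Longrightarrow> V 2 2 = 0 \<Longrightarrow> 2 \<le> k \<Longrightarrow> T V n k = 0"
  using tendsto_T_one_block[of "\<lambda>_. V" sequentially k n] by (simp add: tendsto_const_iff)

lemma (in gibbs_chain) T_singletons: "solution V \<Longrightarrow> V 2 1 = 0 \<Longrightarrow> k \<le> n \<Longrightarrow> 1 \<le> n \<Longrightarrow> T V n k = 1"
  using tendsto_T_singletons[of "\<lambda>_. V" sequentially k n] by (simp add: tendsto_const_iff)

text \<open>For a family indexed by an interval the law of large numbers is needed only on a dense set \<open>D\<close> of
  parameters: monotonicity of the backward dynamics provides the rest. At the end points, the one-block
  partition and the partition into singletons, it suffices that the family comes arbitrarily close, in
  the sense of \<open>inf_22\<close> and \<open>inf_21\<close>.\<close>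

locale gibbs_interval = gibbs_chain +
  fixes D :: "real set" and U :: "real \<Rightarrow> nat \<Rightarrow> nat \<Rightarrow> real" and r :: "nat \<Rightarrow> nat" and \<zeta> :: "nat \<Rightarrow> nat \<Rightarrow> real"
  assumes sol: "\<And>z. z \<in> {0..1} \<Longrightarrow> solution (U z)"
    and cont: "\<And>n k. 1 \<le> k \<Longrightarrow> k \<le> n \<Longrightarrow> continuous_on {0<..<1} (\<lambda>z. U z n k)"
    and r: "strict_mono r"
    and \<zeta>: "\<And>\<nu> \<kappa>. \<zeta> \<nu> \<kappa> \<in> {0..1}"
    and \<zeta>_mono: "\<And>\<nu> i j. i \<le> j \<Longrightarrow> \<zeta> \<nu> i \<le> \<zeta> \<nu> j"
    and D: "D \<subseteq> {0<..<1}" "\<And>a b. 0 \<le> a \<Longrightarrow> a < b \<Longrightarrow> b \<le> 1 \<Longrightarrow> \<exists>d\<in>D. a < d \<and> d < b"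
    and good: "\<And>d. d \<in> D \<Longrightarrow> (\<lambda>j. E (U d) (r j) (\<lambda>\<kappa>. \<bar>\<zeta> (r j) \<kappa> - d\<bar>)) \<longlonglongrightarrow> 0"
    and U0: "U 0 2 2 = 0" and U1: "U 1 2 1 = 0"
    and inf_22: "\<And>e. 0 < e \<Longrightarrow> \<exists>z\<in>{0<..<1}. U z 2 2 < e"
    and inf_21: "\<And>e. 0 < e \<Longrightarrow> \<exists>z\<in>{0<..<1}. U z 2 1 < e"
begin

lemma eventually_level: "\<forall>\<^sub>F j in sequentially. n \<le> r j"
  using filterlim_subseq[OF r] by (simp add: filterlim_at_top)

lemma good_tail:
  assumes d: "d \<in> D" and \<delta>: "0 < \<delta>"
  shows "(\<lambda>j. E (U d) (r j) (\<lambda>\<kappa>. of_bool (\<delta> \<le> \<bar>\<zeta> (r j) \<kappa> - d\<bar>))) \<longlonglongrightarrow> 0"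
proof (rule tendsto_sandwich[OF _ _ tendsto_const])
  have s: "solution (U d)" using sol d D(1) by auto
  show "\<forall>\<^sub>F j in sequentially. 0 \<le> E (U d) (r j) (\<lambda>\<kappa>. of_bool (\<delta> \<le> \<bar>\<zeta> (r j) \<kappa> - d\<bar>))"
    by (intro always_eventually allI E_nonneg[OF s]) simp
  show "\<forall>\<^sub>F j in sequentially. E (U d) (r j) (\<lambda>\<kappa>. of_bool (\<delta> \<le> \<bar>\<zeta> (r j) \<kappa> - d\<bar>))
      \<le> (1 / \<delta>) * E (U d) (r j) (\<lambda>\<kappa>. \<bar>\<zeta> (r j) \<kappa> - d\<bar>)"
    unfolding E_cmult[symmetric] using \<delta>
    by (intro always_eventually allI E_mono[OF s]) (auto simp: of_bool_def divide_simps)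
  show "(\<lambda>j. (1 / \<delta>) * E (U d) (r j) (\<lambda>\<kappa>. \<bar>\<zeta> (r j) \<kappa> - d\<bar>)) \<longlonglongrightarrow> 0"
    using tendsto_mult[OF tendsto_const[of "1 / \<delta>"] good[OF d]] by simp
qed

text \<open>With high probability \<open>\<zeta> K\<^sub>\<nu>\<close> lies to the left of the midpoint under \<open>U d1\<close> and to
  the right of it under \<open>U d2\<close>, and the backward dynamics preserve order.\<close>

lemma T_mono_D:
  assumes d: "d1 \<in> D" "d2 \<in> D" "d1 < d2" and n: "1 \<le> n"
  shows "T (U d1) n k \<le> T (U d2) n k"
proof -
  define \<delta> c where "\<delta> = (d2 - d1) / 2" and "c = (d1 + d2) / 2"
  have \<delta>: "0 < \<delta>" using d by (simp add: \<delta>_def)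
  have s: "solution (U d1)" "solution (U d2)" using sol d D(1) by auto
  define p where "p d j = E (U d) (r j) (\<lambda>\<kappa>. of_bool (\<delta> \<le> \<bar>\<zeta> (r j) \<kappa> - d\<bar>))" for d j
  have "(\<lambda>j. T (U d2) n k + p d1 j + p d2 j) \<longlonglongrightarrow> T (U d2) n k + 0 + 0"
    unfolding p_def using d by (intro tendsto_add tendsto_const good_tail \<delta>)
  moreover have "\<forall>\<^sub>F j in sequentially. T (U d1) n k \<le> T (U d2) n k + p d1 j + p d2 j"
    using eventually_level[of n]
  proof eventually_elim
    case (elim j)
    define A where "A = {\<kappa>\<in>{1..r j}. \<zeta> (r j) \<kappa> < c}"
    \<comment> \<open>the largest value of \<open>H n k (r j)\<close> to the left of the midpoint \<open>c\<close>\<close>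
    define h where "h = (if A = {} then 0 else H n k (r j) (Max A))"
    have fA: "finite A" by (simp add: A_def)
    have Hb: "0 \<le> H n k (r j) \<kappa> \<and> H n k (r j) \<kappa> \<le> 1" if "1 \<le> \<kappa>" "\<kappa> \<le> r j" for \<kappa>
      by (rule H_bounds[OF n elim that])
    have MA: "1 \<le> Max A" "Max A \<le> r j" "\<zeta> (r j) (Max A) < c" if "A \<noteq> {}"
      using Max_in[OF fA that] by (auto simp: A_def)
    have h0: "0 \<le> h" "h \<le> 1" using Hb MA by (auto simp: h_def)
    have up: "H n k (r j) \<kappa> \<le> h + of_bool (\<delta> \<le> \<bar>\<zeta> (r j) \<kappa> - d1\<bar>)" if \<kappa>: "1 \<le> \<kappa>" "\<kappa> \<le> r j" for \<kappa>
    proof (cases "\<zeta> (r j) \<kappa> < c")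
      case True
      then have "\<kappa> \<in> A" using \<kappa> by (simp add: A_def)
      then have "\<kappa> \<le> Max A" "A \<noteq> {}" using fA by auto
      then have "H n k (r j) \<kappa> \<le> h" unfolding h_def using H_mono[OF n elim \<kappa>(1)] MA by auto
      then show ?thesis by (simp add: of_bool_def)
    next
      case False
      then have "\<delta> \<le> \<zeta> (r j) \<kappa> - d1" by (simp add: \<delta>_def c_def field_simps)
      then have "\<delta> \<le> \<bar>\<zeta> (r j) \<kappa> - d1\<bar>" by simp
      then show ?thesis using Hb[OF \<kappa>] h0 by simp
    qed
    have lo: "h - of_bool (\<delta> \<le> \<bar>\<zeta> (r j) \<kappa> - d2\<bar>) \<le> H n k (r j) \<kappa>" if \<kappa>: "1 \<le> \<kappa>" "\<kappa> \<le> r j" for \<kappa>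
    proof (cases "\<zeta> (r j) \<kappa> < c")
      case True
      then have "\<delta> \<le> d2 - \<zeta> (r j) \<kappa>" by (simp add: \<delta>_def c_def field_simps)
      then have "\<delta> \<le> \<bar>\<zeta> (r j) \<kappa> - d2\<bar>" by simp
      then show ?thesis using Hb[OF \<kappa>] h0 by simp
    next
      case False
      have "h \<le> H n k (r j) \<kappa>"
      proof (cases "A = {}")
        case True then show ?thesis using Hb[OF \<kappa>] by (simp add: h_def)
      next
        case A: False
        have "Max A \<le> \<kappa>" using False MA(3)[OF A] \<zeta>_mono[of \<kappa> "Max A" "r j"] by (cases "Max A \<le> \<kappa>") auto
        then show ?thesis using A H_mono[OF n elim MA(1)[OF A] _ \<kappa>(2)] by (simp add: h_def)
      qed
      then show ?thesis by (simp add: of_bool_def)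
    qed
    have rj: "1 \<le> r j" using n elim by simp
    have "T (U d1) n k \<le> h + p d1 j"
      using E_mono[OF s(1), of "r j" "H n k (r j)" "\<lambda>\<kappa>. h + of_bool (\<delta> \<le> \<bar>\<zeta> (r j) \<kappa> - d1\<bar>)"] up
        E_H[OF s(1) n elim, of k] E_const[OF s(1) rj, of h]
      by (simp add: E_add p_def)
    moreover have "h - p d2 j \<le> T (U d2) n k"
      using E_mono[OF s(2), of "r j" "\<lambda>\<kappa>. h - of_bool (\<delta> \<le> \<bar>\<zeta> (r j) \<kappa> - d2\<bar>)" "H n k (r j)"] lo
        E_H[OF s(2) n elim, of k] E_const[OF s(2) rj, of h]
      by (simp add: E_diff p_def)
    ultimately show ?case by simp
  qed
  ultimately have "T (U d1) n k \<le> T (U d2) n k + 0 + 0"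
    by (intro tendsto_lowerbound[where F=sequentially]) auto
  then show ?thesis by simp
qed

lemma cont_T_open: "continuous_on {0<..<1} (\<lambda>z. T (U z) n k)"
  unfolding T_def E_def by (intro continuous_intros cont) auto

text \<open>The inequality extends from the dense set \<open>D\<close> by continuity.\<close>

lemma T_mono_open:
  assumes z: "0 < z1" "z1 < z2" "z2 < 1" and n: "1 \<le> n"
  shows "T (U z1) n k \<le> T (U z2) n k"
proof (rule field_le_epsilon)
  fix e :: real assume e: "0 < e"
  define m where "m = (z1 + z2) / 2"
  have lim: "((\<lambda>z. T (U z) n k) \<longlongrightarrow> T (U z0) n k) (at z0)" if "z0 \<in> {0<..<1}" for z0
    using cont_T_open[of n k] that by (simp add: continuous_on_eq_continuous_at continuous_at)
  obtain a where a: "a > 0" "\<And>x. x \<noteq> z1 \<Longrightarrow> \<bar>x - z1\<bar> < a \<Longrightarrow> \<bar>T (U x) n k - T (U z1) n k\<bar> < e / 2"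
    using lim[of z1, THEN LIM_D, of "e/2"] z e by auto
  obtain b where b: "b > 0" "\<And>x. x \<noteq> z2 \<Longrightarrow> \<bar>x - z2\<bar> < b \<Longrightarrow> \<bar>T (U x) n k - T (U z2) n k\<bar> < e / 2"
    using lim[of z2, THEN LIM_D, of "e/2"] z e by auto
  have m: "z1 < m" "m < z2" using z by (auto simp: m_def)
  have "0 \<le> z1" "z1 < min m (z1 + a)" "min m (z1 + a) \<le> 1" using z a m by auto
  then obtain d1 where d1: "d1 \<in> D" "z1 < d1" "d1 < min m (z1 + a)" using D(2) by blast
  have "0 \<le> max m (z2 - b)" "max m (z2 - b) < z2" "z2 \<le> 1" using z b m by auto
  then obtain d2 where d2: "d2 \<in> D" "max m (z2 - b) < d2" "d2 < z2" using D(2) by blast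
  have "T (U d1) n k \<le> T (U d2) n k" using d1 d2 by (intro T_mono_D n) auto
  moreover have "\<bar>T (U d1) n k - T (U z1) n k\<bar> < e / 2" using d1 by (intro a(2)) auto
  moreover have "\<bar>T (U d2) n k - T (U z2) n k\<bar> < e / 2" using d2 by (intro b(2)) auto
  ultimately show "T (U z1) n k \<le> T (U z2) n k + e" by linarith
qed

lemma T_U0: "2 \<le> k \<Longrightarrow> T (U 0) n k = 0" using T_one_block[OF sol U0] by simp

lemma T_U1: "k \<le> n \<Longrightarrow> 1 \<le> n \<Longrightarrow> T (U 1) n k = 1" using T_singletons[OF sol U1] by simp

lemma T_mono:
  assumes z: "0 \<le> z1" "z1 \<le> z2" "z2 \<le> 1" and n: "1 \<le> n"
  shows "T (U z1) n k \<le> T (U z2) n k"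
proof -
  have s: "solution (U z1)" "solution (U z2)" using sol z by auto
  consider "k \<le> 1" | "n < k" | "2 \<le> k" "k \<le> n" by linarith
  then show ?thesis
  proof cases
    case 1 then show ?thesis using T_le_1[OF _ n] s by simp
  next
    case 2 then show ?thesis using T_above by simp
  next
    case 3
    note k = 3
    consider "z1 = z2" | "z1 = 0" | "z2 = 1" | "0 < z1" "z1 < z2" "z2 < 1" using z by linarith
    then show ?thesis
    proof cases
      case 2 then show ?thesis using T_U0[OF k(1)] T_bounds(1)[OF s(2) n] by simp
    next
      case 3 then show ?thesis using T_U1[OF k(2) n] T_bounds(2)[OF s(1) n] by simp
    next
      case 4 then show ?thesis using T_mono_open n by simp
    qed simp
  qed
qed

lemma ev_sol: "\<forall>\<^sub>F z in at x within {0..1}. solution (U z)"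
  using sol by (simp add: eventually_at_filter)

text \<open>By monotonicity in \<open>z\<close> the infima in \<open>inf_22\<close> and \<open>inf_21\<close> are limits at the end points.\<close>

lemma cont_T_closed:
  assumes n: "1 \<le> n" shows "continuous_on {0..1} (\<lambda>z. T (U z) n k)"
proof -
  consider "k \<le> 1" | "n < k" | "2 \<le> k" "k \<le> n" by linarith
  then show ?thesis
  proof cases
    case 1 then have "T (U z) n k = 1" if "z \<in> {0..1}" for z using T_le_1[OF sol[OF that] n] by simp
    then show ?thesis by (intro continuous_on_eq[OF continuous_on_const[of _ 1]]) simp
  next
    case 2 then show ?thesis by (simp add: T_above)
  next
    case 3
    have at0: "((\<lambda>z. T (U z) n k) \<longlongrightarrow> 0) (at 0 within {0..1})"
    proof (rule tendsto_T_one_block[OF ev_sol _ 3(1)], rule order_tendstoI)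
      fix a :: real assume "a < 0"
      then show "\<forall>\<^sub>F z in at 0 within {0..1}. a < U z 2 2"
        unfolding eventually_at_filter
        by (intro always_eventually allI impI) (metis sol solution_nonneg le_refl less_le_trans one_le_numeral)
    next
      fix a :: real assume "0 < a"
      then obtain z0 where z0: "z0 \<in> {0<..<1}" "U z0 2 2 < a" using inf_22 by blast
      have "U z 2 2 < a" if "z \<in> {0..1}" "dist z 0 < z0" for z
      proof -
        have "T (U z) 2 2 \<le> T (U z0) 2 2" using that z0 by (intro T_mono) auto
        then show ?thesis using solution_2_2[OF sol, of z] solution_2_2[OF sol, of z0] that z0 by auto
      qed
      then show "\<forall>\<^sub>F z in at 0 within {0..1}. U z 2 2 < a"
        unfolding eventually_at using z0 by (intro exI[of _ z0]) auto
    qed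
    have at1: "((\<lambda>z. T (U z) n k) \<longlongrightarrow> 1) (at 1 within {0..1})"
    proof (rule tendsto_T_singletons[OF ev_sol _ 3(2) n], rule order_tendstoI)
      fix a :: real assume "a < 0"
      then show "\<forall>\<^sub>F z in at 1 within {0..1}. a < U z 2 1"
        unfolding eventually_at_filter
        by (intro always_eventually allI impI) (metis sol solution_nonneg le_refl less_le_trans one_le_numeral)
    next
      fix a :: real assume "0 < a"
      then obtain z0 where z0: "z0 \<in> {0<..<1}" "U z0 2 1 < a" using inf_21 by blast
      have "U z 2 1 < a" if "z \<in> {0..1}" "dist z 1 < 1 - z0" for z
      proof -
        have "T (U z0) 2 2 \<le> T (U z) 2 2" using that z0 by (intro T_mono) (auto simp: dist_real_def)
        then have "(1 - T (U z) 2 2) / S 2 1 \<le> (1 - T (U z0) 2 2) / S 2 1"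
          using S_pos[of 1 2] by (intro divide_right_mono) auto
        then show ?thesis using solution_2_1[OF sol, of z] solution_2_1[OF sol, of z0] that z0 by auto
      qed
      then show "\<forall>\<^sub>F z in at 1 within {0..1}. U z 2 1 < a"
        unfolding eventually_at using z0 by (intro exI[of _ "1 - z0"]) auto
    qed
    show ?thesis unfolding continuous_on_def
    proof
      fix z :: real assume z: "z \<in> {0..1}"
      consider "z = 0" | "z = 1" | "z \<in> {0<..<1}" using z by force
      then show "((\<lambda>z. T (U z) n k) \<longlongrightarrow> T (U z) n k) (at z within {0..1})"
      proof cases
        case 1 then show ?thesis using at0 T_U0[OF 3(1)] by simp
      next
        case 2 then show ?thesis using at1 T_U1[OF 3(2) n] by simp
      next
        case 3
        then have "((\<lambda>z. T (U z) n k) \<longlongrightarrow> T (U z) n k) (at z)"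
          using cont_T_open[of n k] by (simp add: continuous_on_eq_continuous_at continuous_at)
        then show ?thesis by (rule tendsto_within_subset) simp
      qed
    qed
  qed
qed

text \<open>On \<open>{1..n}\<close> every upward closed set is a tail.\<close>

lemma upset_mono:
  assumes A: "\<And>i j. A i \<Longrightarrow> i \<le> j \<Longrightarrow> A j" and z: "0 \<le> z1" "z1 \<le> z2" "z2 \<le> 1" and n: "1 \<le> n"
  shows "E (U z1) n (\<lambda>\<kappa>. of_bool (A \<kappa>)) \<le> E (U z2) n (\<lambda>\<kappa>. of_bool (A \<kappa>))"
proof -
  have "\<exists>k0. \<forall>\<kappa>\<in>{1..n}. A \<kappa> \<longleftrightarrow> k0 \<le> \<kappa>"
  proof (cases "\<exists>\<kappa>. A \<kappa>")
    case True
    then show ?thesis using A by (intro exI[of _ "LEAST \<kappa>. A \<kappa>"]) (auto intro: LeastI Least_le)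
  qed (auto intro!: exI[of _ "Suc n"])
  then obtain k0 where k0: "\<forall>\<kappa>\<in>{1..n}. A \<kappa> \<longleftrightarrow> k0 \<le> \<kappa>" by blast
  have "E V n (\<lambda>\<kappa>. of_bool (A \<kappa>)) = T V n k0" for V
    unfolding T_def E_def using k0 by (intro sum.cong) auto
  then show ?thesis using T_mono[OF z n] by simp
qed

text \<open>By monotonicity in the parameter the upper tail under \<open>U z\<close> is at most the one under \<open>U d\<close> for some
  \<open>d \<in> D\<close> between \<open>z\<close> and \<open>z + \<delta>\<close>, where the law of large numbers is known. The lower
  tail is treated in the same way.\<close>

lemma up_tail:
  assumes z: "z \<in> {0..1}" and \<delta>: "0 < \<delta>"
  shows "(\<lambda>j. E (U z) (r j) (\<lambda>\<kappa>. of_bool (z + \<delta> < \<zeta> (r j) \<kappa>))) \<longlonglongrightarrow> 0"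
proof (cases "1 \<le> z + \<delta>")
  case True
  have "\<not> z + \<delta> < \<zeta> (r j) \<kappa>" for j \<kappa> using True \<zeta>[of "r j" \<kappa>] by auto
  then show ?thesis by (simp add: E_def)
next
  case False
  obtain d where d: "d \<in> D" "z < d" "d < z + \<delta>" using D(2)[of z "z + \<delta>"] z \<delta> False by auto
  have s: "solution (U d)" "solution (U z)" using sol d D(1) z by auto
  show ?thesis
  proof (rule tendsto_sandwich[OF _ _ tendsto_const good_tail[OF d(1), of "z + \<delta> - d"]])
    show "\<forall>\<^sub>F j in sequentially. 0 \<le> E (U z) (r j) (\<lambda>\<kappa>. of_bool (z + \<delta> < \<zeta> (r j) \<kappa>))"
      by (intro always_eventually allI E_nonneg[OF s(2)]) simp
    show "\<forall>\<^sub>F j in sequentially. E (U z) (r j) (\<lambda>\<kappa>. of_bool (z + \<delta> < \<zeta> (r j) \<kappa>))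
        \<le> E (U d) (r j) (\<lambda>\<kappa>. of_bool (z + \<delta> - d \<le> \<bar>\<zeta> (r j) \<kappa> - d\<bar>))"
      using eventually_level[of 1]
    proof eventually_elim
      case (elim j)
      have "E (U z) (r j) (\<lambda>\<kappa>. of_bool (z + \<delta> < \<zeta> (r j) \<kappa>)) \<le> E (U d) (r j) (\<lambda>\<kappa>. of_bool (z + \<delta> < \<zeta> (r j) \<kappa>))"
        using d D(1) z elim \<zeta>_mono[of _ _ "r j"] by (intro upset_mono) (auto intro: less_le_trans)
      also have "\<dots> \<le> E (U d) (r j) (\<lambda>\<kappa>. of_bool (z + \<delta> - d \<le> \<bar>\<zeta> (r j) \<kappa> - d\<bar>))"
        by (rule E_mono[OF s(1)]) (auto simp: of_bool_def)
      finally show ?case .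
    qed
  qed (use d in simp)
qed

lemma down_tail:
  assumes z: "z \<in> {0..1}" and \<delta>: "0 < \<delta>"
  shows "(\<lambda>j. E (U z) (r j) (\<lambda>\<kappa>. of_bool (\<zeta> (r j) \<kappa> < z - \<delta>))) \<longlonglongrightarrow> 0"
proof (cases "z - \<delta> \<le> 0")
  case True
  have "\<not> \<zeta> (r j) \<kappa> < z - \<delta>" for j \<kappa> using True \<zeta>[of "r j" \<kappa>] by auto
  then show ?thesis by (simp add: E_def)
next
  case False
  obtain d where d: "d \<in> D" "z - \<delta> < d" "d < z" using D(2)[of "z - \<delta>" z] z \<delta> False by auto
  have s: "solution (U d)" "solution (U z)" using sol d D(1) z by auto
  have compl: "E V n (\<lambda>\<kappa>. of_bool (\<zeta> n \<kappa> < c)) = 1 - E V n (\<lambda>\<kappa>. of_bool (c \<le> \<zeta> n \<kappa>))" if "solution V" "1 \<le> n" for V n c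
  proof -
    have "E V n (\<lambda>\<kappa>. of_bool (\<zeta> n \<kappa> < c)) = E V n (\<lambda>\<kappa>. 1 - of_bool (c \<le> \<zeta> n \<kappa>))"
      unfolding E_def by (intro sum.cong) (auto simp: of_bool_def)
    then show ?thesis using E_one[OF that] by (simp add: E_diff)
  qed
  show ?thesis
  proof (rule tendsto_sandwich[OF _ _ tendsto_const good_tail[OF d(1), of "d - (z - \<delta>)"]])
    show "\<forall>\<^sub>F j in sequentially. 0 \<le> E (U z) (r j) (\<lambda>\<kappa>. of_bool (\<zeta> (r j) \<kappa> < z - \<delta>))"
      by (intro always_eventually allI E_nonneg[OF s(2)]) simp
    show "\<forall>\<^sub>F j in sequentially. E (U z) (r j) (\<lambda>\<kappa>. of_bool (\<zeta> (r j) \<kappa> < z - \<delta>))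
        \<le> E (U d) (r j) (\<lambda>\<kappa>. of_bool (d - (z - \<delta>) \<le> \<bar>\<zeta> (r j) \<kappa> - d\<bar>))"
      using eventually_level[of 1]
    proof eventually_elim
      case (elim j)
      have "E (U d) (r j) (\<lambda>\<kappa>. of_bool (z - \<delta> \<le> \<zeta> (r j) \<kappa>)) \<le> E (U z) (r j) (\<lambda>\<kappa>. of_bool (z - \<delta> \<le> \<zeta> (r j) \<kappa>))"
        using d D(1) z elim \<zeta>_mono[of _ _ "r j"] by (intro upset_mono) (auto intro: order_trans)
      then have "E (U z) (r j) (\<lambda>\<kappa>. of_bool (\<zeta> (r j) \<kappa> < z - \<delta>)) \<le> E (U d) (r j) (\<lambda>\<kappa>. of_bool (\<zeta> (r j) \<kappa> < z - \<delta>))"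
        unfolding compl[OF s(2) elim] compl[OF s(1) elim] by simp
      also have "\<dots> \<le> E (U d) (r j) (\<lambda>\<kappa>. of_bool (d - (z - \<delta>) \<le> \<bar>\<zeta> (r j) \<kappa> - d\<bar>))"
        by (rule E_mono[OF s(1)]) (auto simp: of_bool_def)
      finally show ?case .
    qed
  qed (use d in simp)
qed

lemma lln_closed:
  assumes z: "z \<in> {0..1}"
  shows "(\<lambda>j. E (U z) (r j) (\<lambda>\<kappa>. \<bar>\<zeta> (r j) \<kappa> - z\<bar>)) \<longlonglongrightarrow> 0"
proof (rule order_tendstoI)
  have s: "solution (U z)" using sol z by simp
  fix a :: real
  show "\<forall>\<^sub>F j in sequentially. a < E (U z) (r j) (\<lambda>\<kappa>. \<bar>\<zeta> (r j) \<kappa> - z\<bar>)" if "a < 0"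
    using E_nonneg[OF s, of _ "\<lambda>\<kappa>. \<bar>\<zeta> _ \<kappa> - z\<bar>"] that by (intro always_eventually allI) (meson abs_ge_zero less_le_trans)
  show "\<forall>\<^sub>F j in sequentially. E (U z) (r j) (\<lambda>\<kappa>. \<bar>\<zeta> (r j) \<kappa> - z\<bar>) < a" if a: "0 < a"
  proof -
    define \<delta> where "\<delta> = a / 4"
    have \<delta>: "0 < \<delta>" using a by (simp add: \<delta>_def)
    show ?thesis
      using eventually_level[of 1] order_tendstoD(2)[OF up_tail[OF z \<delta>] \<delta>] order_tendstoD(2)[OF down_tail[OF z \<delta>] \<delta>]
    proof eventually_elim
      case (elim j)
      have "E (U z) (r j) (\<lambda>\<kappa>. \<bar>\<zeta> (r j) \<kappa> - z\<bar>)
          \<le> E (U z) (r j) (\<lambda>\<kappa>. \<delta> + (of_bool (z + \<delta> < \<zeta> (r j) \<kappa>) + of_bool (\<zeta> (r j) \<kappa> < z - \<delta>)))"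
      proof (rule E_mono[OF s])
        fix \<kappa>
        have "\<bar>\<zeta> (r j) \<kappa> - z\<bar> \<le> 1" using \<zeta>[of "r j" \<kappa>] z by auto
        then show "\<bar>\<zeta> (r j) \<kappa> - z\<bar> \<le> \<delta> + (of_bool (z + \<delta> < \<zeta> (r j) \<kappa>) + of_bool (\<zeta> (r j) \<kappa> < z - \<delta>))"
          using \<delta> by (auto simp: of_bool_def)
      qed
      also have "\<dots> < a" using elim E_const[OF s elim(1), of \<delta>] a by (simp add: E_add \<delta>_def)
      finally show ?case .
    qed
  qed
qed

text \<open>Put a finite grid on the unit interval. If \<open>b\<close> is a grid point slightly to the right of \<open>\<zeta> \<nu>
  \<kappa>\<close>, then under \<open>U b\<close> most of the mass of \<open>K\<^sub>\<nu>\<close> lies above \<open>\<kappa>\<close>, so that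
  by monotonicity the value of \<open>H n k \<nu>\<close> at \<open>\<kappa>\<close> hardly exceeds its mean \<open>T (U b) n k\<close>,
  which is close to the value of \<open>T\<close> at \<open>\<zeta> \<nu> \<kappa>\<close> by uniform continuity. A grid point
  to the left gives the converse inequality. Finitely many grid points make the estimate uniform in
  \<open>\<kappa>\<close>.\<close>

lemma uniform_approx:
  assumes n: "1 \<le> n" and e: "0 < e"
  shows "\<forall>\<^sub>F j in sequentially. \<forall>\<kappa>\<in>{1..r j}. \<bar>H n k (r j) \<kappa> - T (U (\<zeta> (r j) \<kappa>)) n k\<bar> \<le> e"
proof -
  consider "k \<le> 1" | "n < k" | "2 \<le> k" "k \<le> n" by linarith
  then show ?thesis
  proof cases
    case 1
    show ?thesis using eventually_level[of n]
    proof eventually_elim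
      case (elim j)
      show ?case using H_le_1[OF n elim _ _ 1] T_le_1[OF sol[OF \<zeta>] n 1] e by simp
    qed
  next
    case 2
    show ?thesis using eventually_level[of n]
    proof eventually_elim
      case (elim j)
      show ?case using H_above[OF n elim _ _ 2] T_above[OF 2] e by simp
    qed
  next
    case 3
    define G where "G z = T (U z) n k" for z
    have "uniformly_continuous_on {0..1} G"
      unfolding G_def by (intro compact_uniformly_continuous cont_T_closed n) simp
    then obtain \<eta> where \<eta>: "0 < \<eta>" "\<And>x y. x \<in> {0..1} \<Longrightarrow> y \<in> {0..1} \<Longrightarrow> \<bar>x - y\<bar> < \<eta> \<Longrightarrow> \<bar>G x - G y\<bar> < e / 2"
      unfolding uniformly_continuous_on_def dist_real_def using e by (metis abs_minus_commute half_gt_zero)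
    \<comment> \<open>the grid points used for \<open>z\<close> are at distance less than \<open>3 / N\<close> from it\<close>
    obtain N :: nat where N: "1 \<le> N" "3 / real N < \<eta>"
    proof -
      obtain N :: nat where "3 / \<eta> < real N" using reals_Archimedean2 by blast
      moreover then have "0 < real N" using \<eta>(1) by (smt (verit) divide_pos_pos)
      ultimately show ?thesis using that[of N] \<eta>(1) by (simp add: field_simps)
    qed
    define \<delta> where "\<delta> = 1 / (2 * real N)"
    have \<delta>: "0 < \<delta>" "1 / real N = 2 * \<delta>" using N by (auto simp: \<delta>_def)
    have b01: "real i / real N \<in> {0..1}" if "i \<le> N" for i using that N by simp
    have "\<forall>\<^sub>F j in sequentially. \<forall>i\<in>{0..N}.
        E (U (real i / real N)) (r j) (\<lambda>\<kappa>. of_bool (real i / real N + \<delta> < \<zeta> (r j) \<kappa>)) < e / 2 \<and>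
        E (U (real i / real N)) (r j) (\<lambda>\<kappa>. of_bool (\<zeta> (r j) \<kappa> < real i / real N - \<delta>)) < e / 2"
      using e b01 by (intro eventually_ball_finite ballI eventually_conj order_tendstoD(2)[OF up_tail[OF _ \<delta>(1)]] order_tendstoD(2)[OF down_tail[OF _ \<delta>(1)]]) auto
    then show ?thesis using eventually_level[of n]
    proof eventually_elim
      case (elim j)
      show ?case
      proof
        fix \<kappa> assume "\<kappa> \<in> {1..r j}"
        then have \<kappa>: "1 \<le> \<kappa>" "\<kappa> \<le> r j" by auto
        have rj: "1 \<le> r j" using \<kappa> by simp
        define z where "z = \<zeta> (r j) \<kappa>"
        have z: "z \<in> {0..1}" using \<zeta> by (simp add: z_def)
        define h where "h = H n k (r j) \<kappa>"
        have Hb: "0 \<le> H n k (r j) i \<and> H n k (r j) i \<le> 1" if "1 \<le> i" "i \<le> r j" for i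
          by (rule H_bounds[OF n elim(2) that])
        define i where "i = nat \<lfloor>z * real N\<rfloor>"
        have "real i \<le> z * real N" "z * real N < real i + 1" using z N by (auto simp: i_def)
        then have i: "real i / real N \<le> z" "z < real i / real N + 2 * \<delta>"
          using N unfolding \<delta>(2)[symmetric] by (auto simp: field_simps)
        have two: "3 / real N = 6 * \<delta>" using \<delta>(2) by simp
        \<comment> \<open>compare with the grid point \<open>i + 2\<close>, or with the end point \<open>1\<close>\<close>
        have up: "h \<le> G z + e"
        proof (cases "i + 2 \<le> N")
          case True
          define b where "b = real (i + 2) / real N"
          have b: "b \<in> {0..1}" "b = real i / real N + 4 * \<delta>" using b01[OF True] \<delta>(2) by (auto simp: b_def add_divide_distrib)
          have s: "solution (U b)" using sol b by simp
          have "h = E (U b) (r j) (\<lambda>_. h)" by (rule E_const[OF s rj, symmetric])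
          also have "\<dots> \<le> E (U b) (r j) (\<lambda>i. H n k (r j) i + of_bool (\<zeta> (r j) i < b - \<delta>))"
          proof (rule E_mono[OF s])
            fix l assume l: "1 \<le> l" "l \<le> r j"
            show "h \<le> H n k (r j) l + of_bool (\<zeta> (r j) l < b - \<delta>)"
            proof (cases "\<kappa> \<le> l")
              case True then show ?thesis unfolding h_def using H_mono[OF n elim(2) \<kappa>(1) True l(2), of k] by (auto simp: of_bool_def)
            next
              case False
              then have "\<zeta> (r j) l \<le> z" using \<zeta>_mono by (simp add: z_def)
              then have "\<zeta> (r j) l < b - \<delta>" using i b \<delta> by linarith
              then show ?thesis using Hb[OF \<kappa>] Hb[OF l] by (simp add: h_def)
            qed
          qed
          also have "\<dots> \<le> G b + e / 2"
          proof -
            have "E (U b) (r j) (\<lambda>i. of_bool (\<zeta> (r j) i < b - \<delta>)) < e / 2"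
              using bspec[OF elim(1), of "i + 2"] True unfolding b_def by fastforce
            then show ?thesis using E_H[OF s n elim(2), of k] by (simp add: E_add G_def)
          qed
          also have "\<dots> \<le> G z + e"
            using \<eta>(2)[of b z] b z i \<delta> N(2) two by (auto simp: abs_if split: if_splits)
          finally show ?thesis .
        next
          case False
          then have "real N \<le> real i + 1" by simp
          then have "1 \<le> real i / real N + 2 * \<delta>" using N unfolding \<delta>(2)[symmetric] by (simp add: field_simps)
          then have "\<bar>G 1 - G z\<bar> < e / 2" using \<eta>(2)[of 1 z] z i \<delta> N(2) two by auto
          then have "G 1 - G z < e / 2" by linarith
          moreover have "G 1 = 1" unfolding G_def using T_U1 3 n by simp
          moreover have "0 \<le> h" "h \<le> 1" using Hb[OF \<kappa>] by (auto simp: h_def)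
          ultimately show ?thesis using e by linarith
        qed
        \<comment> \<open>compare with the grid point \<open>i - 1\<close>, or with the end point \<open>0\<close>\<close>
        have lo: "G z - e \<le> h"
        proof (cases "i = 0")
          case False
          define b where "b = real (i - 1) / real N"
          have "i \<le> N" using i(1) z N by (auto simp: field_simps) (smt (verit) mult_left_le_one_le of_nat_0_le_iff of_nat_le_iff)
          then have iN: "i - 1 \<le> N" by simp
          have b: "b \<in> {0..1}" "b = real i / real N - 2 * \<delta>" using b01[OF iN] \<delta>(2) False by (auto simp: b_def diff_divide_distrib of_nat_diff)
          have s: "solution (U b)" using sol b by simp
          have "E (U b) (r j) (\<lambda>i. H n k (r j) i - of_bool (b + \<delta> < \<zeta> (r j) i)) \<le> E (U b) (r j) (\<lambda>_. h)"
          proof (rule E_mono[OF s])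
            fix l assume l: "1 \<le> l" "l \<le> r j"
            show "H n k (r j) l - of_bool (b + \<delta> < \<zeta> (r j) l) \<le> h"
            proof (cases "l \<le> \<kappa>")
              case True then show ?thesis unfolding h_def using H_mono[OF n elim(2) l(1) True \<kappa>(2), of k] by (auto simp: of_bool_def)
            next
              case False
              then have "z \<le> \<zeta> (r j) l" using \<zeta>_mono by (simp add: z_def)
              then have "b + \<delta> < \<zeta> (r j) l" using i b \<delta> by linarith
              then show ?thesis using Hb[OF \<kappa>] Hb[OF l] by (simp add: h_def)
            qed
          qed
          moreover have "E (U b) (r j) (\<lambda>_. h) = h" by (rule E_const[OF s rj])
          moreover have "G b - e / 2 \<le> E (U b) (r j) (\<lambda>i. H n k (r j) i - of_bool (b + \<delta> < \<zeta> (r j) i))"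
          proof -
            have "E (U b) (r j) (\<lambda>i. of_bool (b + \<delta> < \<zeta> (r j) i)) < e / 2"
              using bspec[OF elim(1), of "i - 1"] iN unfolding b_def by fastforce
            then show ?thesis using E_H[OF s n elim(2), of k] by (simp add: E_diff G_def)
          qed
          moreover have "\<bar>G b - G z\<bar> < e / 2" using \<eta>(2)[of b z] b z i \<delta> N(2) two by (auto simp: abs_if split: if_splits)
          ultimately show ?thesis by (auto simp: abs_if split: if_splits)
        next
          case True
          then have "\<bar>G 0 - G z\<bar> < e / 2" using \<eta>(2)[of 0 z] z i \<delta> N(2) two by auto
          then have "G z - G 0 < e / 2" by linarith
          moreover have "G 0 = 0" unfolding G_def using T_U0 3 by simp
          moreover have "0 \<le> h" "h \<le> 1" using Hb[OF \<kappa>] by (auto simp: h_def)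
          ultimately show ?thesis using e by linarith
        qed
        show "\<bar>H n k (r j) \<kappa> - T (U (\<zeta> (r j) \<kappa>)) n k\<bar> \<le> e"
          using up lo by (simp add: h_def G_def z_def abs_le_iff)
      qed
    qed
  qed
qed

sublocale gibbs_boundary g "{0..1}" U r \<zeta>
proof
  show "continuous_on {0..1} (\<lambda>z. U z n k)" if "1 \<le> k" "k \<le> n" for n k
  proof -
    have "continuous_on {0..1} (\<lambda>z. (T (U z) n k - T (U z) n (Suc k)) / S n k)"
      using S_pos[OF that] that by (intro continuous_intros cont_T_closed) auto
    then show ?thesis by (simp only: V_eq_T[OF that, symmetric])
  qed
qed (use sol \<zeta> r lln_closed uniform_approx in auto)

end

section \<open>Families indexed by the positive integers\<close>

definition to_unit :: "real \<Rightarrow> real" where "to_unit x = x / (x + 1)"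

lemma to_unit_less: "0 \<le> x \<Longrightarrow> x < y \<Longrightarrow> to_unit x < to_unit y"
  by (simp add: to_unit_def field_simps)

lemma to_unit_le: "0 \<le> x \<Longrightarrow> x \<le> y \<Longrightarrow> to_unit x \<le> to_unit y"
  by (simp add: to_unit_def field_simps)

lemma to_unit_range: "0 \<le> x \<Longrightarrow> to_unit x \<in> {0..<1}"
  by (simp add: to_unit_def)

lemma to_unit_lipschitz: "0 \<le> x \<Longrightarrow> 0 \<le> y \<Longrightarrow> \<bar>to_unit x - to_unit y\<bar> \<le> \<bar>x - y\<bar>"
proof -
  assume xy: "0 \<le> x" "0 \<le> y"
  have "to_unit x - to_unit y = (x - y) / ((x + 1) * (y + 1))" using xy by (simp add: to_unit_def field_simps)
  then have "\<bar>to_unit x - to_unit y\<bar> = \<bar>x - y\<bar> / ((x + 1) * (y + 1))" using xy by (simp add: abs_mult)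
  also have "\<dots> \<le> \<bar>x - y\<bar> / 1"
  proof (intro divide_left_mono)
    have "0 \<le> x * y" using xy by simp
    then show 1: "1 \<le> (x + 1) * (y + 1)" using xy by (simp add: algebra_simps)
    then show "0 < (x + 1) * (y + 1) * 1" by simp
  qed simp
  finally show ?thesis by simp
qed

lemma to_unit_tendsto_1: "(\<lambda>m. to_unit (real m)) \<longlonglongrightarrow> 1"
  unfolding to_unit_def by real_asymp

lemma (in gibbs_chain) E_level_1: "solution V \<Longrightarrow> E V 1 \<phi> = \<phi> 1"
proof -
  assume "solution V"
  then have "V 1 1 = 1" unfolding gibbs_solution_def by blast
  then show ?thesis by (simp add: E_def)
qed

lemma (in gibbs_chain) E_transition:
  assumes V: "solution V" and n: "1 \<le> n"
    and q: "\<And>k. 1 \<le> k \<Longrightarrow> k \<le> n \<Longrightarrow> V (Suc n) (Suc k) = q k * V n k"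
  shows "E V (Suc n) \<phi> = E V n (\<lambda>k. (1 - q k) * \<phi> k + q k * \<phi> (Suc k))"
  unfolding E_Suc[OF n] unfolding E_def
proof (intro sum.cong refl)
  fix k assume "k \<in> {1..n}"
  then have k: "1 \<le> k" "k \<le> n" by auto
  have e: "g n k * V (Suc n) k = (1 - q k) * V n k"
    using solution_rec[OF V k] q[OF k] by (simp add: algebra_simps)
  then show "S n k * (g n k * V (Suc n) k * \<phi> k + V (Suc n) (Suc k) * \<phi> (Suc k)) =
      S n k * V n k * ((1 - q k) * \<phi> k + q k * \<phi> (Suc k))"
    unfolding e q[OF k] by (simp only: algebra_simps)
qed

text \<open>Under the solution with parameter \<open>m\<close> a new block arises at time \<open>n + 1\<close> with probability \<open>\<rho> m
  n * (m - k)\<close>, where \<open>k\<close> is the present number of blocks. Thus the number of blocks never exceeds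
  \<open>m\<close>, and it reaches \<open>m\<close> because the \<open>\<rho> m n\<close> have an infinite sum.\<close>

locale gibbs_discrete = gibbs_chain +
  fixes U :: "real \<Rightarrow> nat \<Rightarrow> nat \<Rightarrow> real" and \<rho> :: "nat \<Rightarrow> nat \<Rightarrow> real"
  assumes sol: "\<And>m. 1 \<le> m \<Longrightarrow> solution (U (to_unit (real m)))"
    and sol1: "solution (U 1)" and U1: "U 1 2 1 = 0"
    and trans: "\<And>m n k. 1 \<le> m \<Longrightarrow> 1 \<le> k \<Longrightarrow> k \<le> n \<Longrightarrow>
       U (to_unit (real m)) (Suc n) (Suc k) = \<rho> m n * (real m - real k) * U (to_unit (real m)) n k"
    and \<rho>_diverges: "\<And>m. 1 \<le> m \<Longrightarrow> filterlim (\<lambda>n. \<Sum>i=1..<n. \<rho> m i) at_top sequentially"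
    and \<rho>_le_1: "\<And>m n. 1 \<le> m \<Longrightarrow> 1 \<le> n \<Longrightarrow> \<rho> m n \<le> 1"
    and lim_21: "(\<lambda>m. U (to_unit (real m)) 2 1) \<longlonglongrightarrow> 0"
begin

definition Z :: "real set" where "Z = insert 1 (range (\<lambda>m. to_unit (real (Suc m))))"

lemma Z_cases:
  assumes "z \<in> Z" obtains "z = 1" | m where "1 \<le> m" "z = to_unit (real m)"
  using assms unfolding Z_def by force

lemma Z_member: "1 \<le> m \<Longrightarrow> to_unit (real m) \<in> Z"
  unfolding Z_def by (cases m) auto

lemma sol_Z: "z \<in> Z \<Longrightarrow> solution (U z)"
  using sol sol1 by (elim Z_cases) auto

lemma vanish:
  assumes m: "1 \<le> m" and k: "m < k" "k \<le> n"
  shows "U (to_unit (real m)) n k = 0"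
  using k
proof (induction n arbitrary: k)
  case (Suc n)
  then obtain l where l: "k = Suc l" "m \<le> l" "l \<le> n" by (cases k) auto
  show ?case
  proof (cases "l = m")
    case True then show ?thesis using trans[OF m, of l n] l m by simp
  next
    case False then show ?thesis using trans[OF m, of l n] l m Suc.IH[of l] by simp
  qed
qed simp

text \<open>In each step the mean of \<open>m - K\<close> is multiplied by \<open>1 - \<rho> m n\<close>.\<close>

lemma E_gap:
  assumes m: "1 \<le> m" and n: "1 \<le> n"
  shows "E (U (to_unit (real m))) n (\<lambda>k. real m - real k) = (\<Prod>i=1..<n. 1 - \<rho> m i) * (real m - 1)"
  using n
proof (induction n rule: dec_induct)
  case base then show ?case using E_level_1[OF sol[OF m]] by simp
next
  case (step n)
  have "E (U (to_unit (real m))) (Suc n) (\<lambda>k. real m - real k)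
     = E (U (to_unit (real m))) n (\<lambda>k. (1 - \<rho> m n * (real m - real k)) * (real m - real k)
         + \<rho> m n * (real m - real k) * (real m - real (Suc k)))"
    by (rule E_transition[OF sol[OF m] step(1)]) (rule trans[OF m])
  also have "\<dots> = E (U (to_unit (real m))) n (\<lambda>k. (1 - \<rho> m n) * (real m - real k))"
    by (rule arg_cong[where f="E (U (to_unit (real m))) n"]) (simp add: fun_eq_iff algebra_simps)
  finally have "E (U (to_unit (real m))) (Suc n) (\<lambda>k. real m - real k)
     = E (U (to_unit (real m))) n (\<lambda>k. (1 - \<rho> m n) * (real m - real k))" .
  moreover have "(\<Prod>i=1..<Suc n. 1 - \<rho> m i) = (\<Prod>i=1..<n. 1 - \<rho> m i) * (1 - \<rho> m n)"
    using step(1) by (simp add: prod.op_ivl_Suc)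
  ultimately show ?case unfolding E_cmult using step.IH by (simp only: mult_ac)
qed

lemma E_abs_gap:
  assumes m: "1 \<le> m"
  shows "(\<lambda>n. E (U (to_unit (real m))) n (\<lambda>k. \<bar>real k - real m\<bar>)) \<longlonglongrightarrow> 0"
proof -
  let ?V = "U (to_unit (real m))"
  have lim: "(\<lambda>n. exp (- (\<Sum>i=1..<n. \<rho> m i)) * (real m - 1)) \<longlonglongrightarrow> 0 * (real m - 1)"
    using \<rho>_diverges[OF m]
    by (intro tendsto_mult tendsto_const filterlim_compose[OF exp_at_bot] filterlim_compose[OF filterlim_uminus_at_bot_at_top]) auto
  have bound: "\<forall>\<^sub>F n in sequentially. norm (E ?V n (\<lambda>k. \<bar>real k - real m\<bar>)) \<le> exp (- (\<Sum>i=1..<n. \<rho> m i)) * (real m - 1)"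
    using eventually_ge_at_top[of 1]
  proof eventually_elim
    case (elim n)
    have "E ?V n (\<lambda>k. \<bar>real k - real m\<bar>) = E ?V n (\<lambda>k. real m - real k)"
      unfolding E_def using vanish[OF m, of _ n] by (intro sum.cong refl) (auto simp: not_le abs_if)
    also have "\<dots> = (\<Prod>i=1..<n. 1 - \<rho> m i) * (real m - 1)" by (rule E_gap[OF m elim])
    also have "\<dots> \<le> (\<Prod>i=1..<n. exp (- \<rho> m i)) * (real m - 1)"
    proof (intro mult_right_mono prod_mono conjI)
      fix i assume "i \<in> {1..<n}"
      then show "0 \<le> 1 - \<rho> m i" using \<rho>_le_1[OF m, of i] by simp
      show "1 - \<rho> m i \<le> exp (- \<rho> m i)" using exp_ge_add_one_self[of "- \<rho> m i"] by simp
    qed (use m in simp)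
    also have "(\<Prod>i=1..<n. exp (- \<rho> m i)) = exp (- (\<Sum>i=1..<n. \<rho> m i))"
      by (simp add: exp_sum[symmetric] sum_negf)
    finally have "E ?V n (\<lambda>k. \<bar>real k - real m\<bar>) \<le> exp (- (\<Sum>i=1..<n. \<rho> m i)) * (real m - 1)" .
    moreover have "0 \<le> E ?V n (\<lambda>k. \<bar>real k - real m\<bar>)" by (rule E_nonneg[OF sol[OF m]]) simp
    ultimately show ?case by simp
  qed
  show ?thesis by (rule Lim_null_comparison[OF bound]) (use lim in simp)
qed

lemma isolated:
  assumes m: "1 \<le> m" shows "at (to_unit (real m)) within Z = bot"
proof -
  have "\<not> to_unit (real m) islimpt Z"
  proof
    assume "to_unit (real m) islimpt Z"
    moreover have "to_unit (real m) \<in> {to_unit (real m - 1/2)<..<to_unit (real m + 1/2)}"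
      using m by (auto intro!: to_unit_less)
    ultimately obtain y where y: "y \<in> Z" "y \<in> {to_unit (real m - 1/2)<..<to_unit (real m + 1/2)}" "y \<noteq> to_unit (real m)"
      unfolding islimpt_def using open_greaterThanLessThan by blast
    from y(1) show False
    proof (cases rule: Z_cases)
      case 1 then show False using y(2) to_unit_range[of "real m + 1/2"] by auto
    next
      case (2 m')
      have "m' \<noteq> m" using 2 y(3) by auto
      then consider "real m' \<le> real m - 1/2" | "real m + 1/2 \<le> real m'" by (cases m m' rule: linorder_cases) auto
      then show False using y(2) 2 to_unit_le[of "real m'" "real m - 1/2"] to_unit_le[of "real m + 1/2" "real m'"] by cases auto
    qed
  qed
  then show ?thesis by (simp add: trivial_limit_within)
qed

lemma cont_T_Z:
  assumes n: "1 \<le> n" shows "continuous_on Z (\<lambda>z. T (U z) n k)"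
  unfolding continuous_on_def
proof
  fix z assume "z \<in> Z"
  then show "((\<lambda>z. T (U z) n k) \<longlongrightarrow> T (U z) n k) (at z within Z)"
  proof (cases rule: Z_cases)
    case (2 m) then show ?thesis using isolated by simp
  next
    case 1
    show ?thesis
    proof (cases "k \<le> n")
      case False then show ?thesis by (simp add: T_above)
    next
      case True
      have "((\<lambda>z. T (U z) n k) \<longlongrightarrow> 1) (at 1 within Z)"
      proof (rule tendsto_T_singletons[OF _ _ True n])
        show "\<forall>\<^sub>F x in at 1 within Z. solution (U x)" using sol_Z by (simp add: eventually_at_filter)
        show "((\<lambda>x. U x 2 1) \<longlongrightarrow> 0) (at 1 within Z)"
        proof (rule tendstoI)
          fix e :: real assume "0 < e"
          then obtain M where M: "\<And>m. M \<le> m \<Longrightarrow> dist (U (to_unit (real m)) 2 1) 0 < e"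
            using lim_21 by (meson LIMSEQ_def)
          have "dist (U z 2 1) 0 < e" if "z \<in> Z" "z \<noteq> 1" "dist z 1 < 1 - to_unit (real M)" for z
            using that(1)
          proof (cases rule: Z_cases)
            case (2 m)
            have "to_unit (real M) < to_unit (real m)" using that(3) 2 to_unit_range[of "real m"] by (auto simp: dist_real_def)
            then have "M \<le> m" using to_unit_le[of "real m" "real M"] by (cases "M \<le> m") auto
            then show ?thesis using M 2 by simp
          qed (use that in simp)
          then show "\<forall>\<^sub>F x in at 1 within Z. dist (U x 2 1) 0 < e"
            unfolding eventually_at using to_unit_range[of "real M"] by (intro exI[of _ "1 - to_unit (real M)"]) auto
        qed
      qed
      then show ?thesis using T_singletons[OF sol1 U1 True n] 1 by simp
    qed
  qed
qed

lemma E_U1: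
  assumes n: "1 \<le> n" shows "E (U 1) n \<phi> = \<phi> n"
proof -
  have z: "U 1 n k = 0" if "1 \<le> k" "k < n" for k
    using tendsto_singletons[of "\<lambda>_. U 1" sequentially k n] sol1 U1 that by (simp add: tendsto_const_iff)
  have "E (U 1) n \<phi> = (\<Sum>k\<in>{n}. S n k * U 1 n k * \<phi> k)"
    for \<phi> unfolding E_def using n z by (intro sum.mono_neutral_right) auto
  then show ?thesis using E_one[OF sol1 n] by simp
qed

sublocale gibbs_boundary g Z U id "\<lambda>\<nu> \<kappa>. to_unit (real \<kappa>)"
proof
  have "compact Z" unfolding Z_def
    by (rule compact_sequence_with_limit) (rule LIMSEQ_Suc[OF to_unit_tendsto_1])
  then show "closed Z" by (rule compact_imp_closed)
  show "Z \<subseteq> {0..1}"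
  proof
    fix z assume "z \<in> Z"
    then show "z \<in> {0..1}"
    proof (cases rule: Z_cases)
      case (2 m) then show ?thesis using to_unit_range[of "real m"] by simp
    qed simp
  qed
  show "Z \<noteq> {}" by (simp add: Z_def)
  show "solution (U z)" if "z \<in> Z" for z by (rule sol_Z[OF that])
  show "continuous_on Z (\<lambda>z. U z n k)" if "1 \<le> k" "k \<le> n" for n k
  proof -
    have "continuous_on Z (\<lambda>z. (T (U z) n k - T (U z) n (Suc k)) / S n k)"
      using S_pos[OF that] that by (intro continuous_intros cont_T_Z) auto
    then show ?thesis by (simp only: V_eq_T[OF that, symmetric])
  qed
  show "strict_mono (id :: nat \<Rightarrow> nat)" by (rule strict_mono_id)
  show "to_unit (real \<kappa>) \<in> Z" if "1 \<le> \<kappa>" for \<kappa> using Z_member that .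
next
  fix z assume "z \<in> Z"
  then show "(\<lambda>j. E (U z) (id j) (\<lambda>\<kappa>. \<bar>to_unit (real \<kappa>) - z\<bar>)) \<longlonglongrightarrow> 0"
  proof (cases rule: Z_cases)
    case 1
    have "(\<lambda>j. \<bar>to_unit (real j) - 1\<bar>) \<longlonglongrightarrow> \<bar>1 - 1\<bar>" by (intro tendsto_intros to_unit_tendsto_1)
    moreover have "\<forall>\<^sub>F j in sequentially. \<bar>to_unit (real j) - 1\<bar> = E (U z) (id j) (\<lambda>\<kappa>. \<bar>to_unit (real \<kappa>) - z\<bar>)"
      using eventually_ge_at_top[of 1] by eventually_elim (simp add: 1 E_U1)
    ultimately show ?thesis by (simp add: tendsto_cong)
  next
    case (2 m)
    show ?thesis
    proof (rule tendsto_sandwich[OF _ _ tendsto_const E_abs_gap[OF 2(1)]])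
      show "\<forall>\<^sub>F j in sequentially. 0 \<le> E (U z) (id j) (\<lambda>\<kappa>. \<bar>to_unit (real \<kappa>) - z\<bar>)"
        using sol[OF 2(1)] 2 by (intro always_eventually allI E_nonneg) auto
      show "\<forall>\<^sub>F j in sequentially. E (U z) (id j) (\<lambda>\<kappa>. \<bar>to_unit (real \<kappa>) - z\<bar>) \<le> E (U (to_unit (real m))) j (\<lambda>k. \<bar>real k - real m\<bar>)"
        unfolding 2 id_apply using sol[OF 2(1)] by (intro always_eventually allI E_mono to_unit_lipschitz) auto
    qed
  qed
next
  fix n k :: nat and e :: real assume n: "1 \<le> n" and e: "0 < e"
  show "\<forall>\<^sub>F j in sequentially. \<forall>\<kappa>\<in>{1..id j}. \<bar>H n k (id j) \<kappa> - T (U (to_unit (real \<kappa>))) n k\<bar> \<le> e"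
  proof (cases "n < k")
    case True
    show ?thesis using eventually_ge_at_top[of n]
    proof eventually_elim
      case (elim j)
      show ?case using H_above[OF n elim _ _ True] T_above[OF True] e by simp
    qed
  next
    case False
    define G where "G m = T (U (to_unit (real m))) n k" for m
    have G1: "G m \<le> 1" if "1 \<le> m" for m unfolding G_def using T_bounds(2)[OF sol[OF that] n] .
    have "G \<longlonglongrightarrow> 1" unfolding G_def
      using False n by (intro tendsto_T_singletons lim_21) (auto simp: eventually_sequentially intro: sol)
    then obtain M where M: "\<And>m. M \<le> m \<Longrightarrow> 1 - e / 2 < G m" using order_tendstoD(1)[of G 1 sequentially "1 - e/2"] e by (auto simp: eventually_sequentially)
    \<comment> \<open>beyond \<open>M\<close> the solutions are within \<open>e / 2\<close> of the partition into singletons\<close>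
    define M' where "M' = max M 1"
    have small: "\<forall>\<^sub>F j in sequentially. \<forall>m\<in>{1..M'}. E (U (to_unit (real m))) j (\<lambda>k. \<bar>real k - real m\<bar>) < e / 2"
      using e by (intro eventually_ball_finite ballI order_tendstoD(2)[OF E_abs_gap]) auto
    show ?thesis using small eventually_ge_at_top[of "max n M'"]
    proof eventually_elim
      case (elim j)
      have nj: "n \<le> j" using elim by simp
      have Hb: "0 \<le> H n k j i \<and> H n k j i \<le> 1" if "1 \<le> i" "i \<le> j" for i by (rule H_bounds[OF n nj that])
      \<comment> \<open>under the solution \<open>m\<close> the chain has probably reached \<open>m\<close>, so conditioning on this value changes little\<close>
      have close: "\<bar>H n k j m - G m\<bar> \<le> e / 2" if m: "1 \<le> m" "m \<le> M'" for m
      proof -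
        let ?V = "U (to_unit (real m))"
        have mj: "m \<le> j" using m elim by simp
        have j1: "1 \<le> j" using n nj by simp
        have "\<bar>H n k j m - G m\<bar> = \<bar>E ?V j (\<lambda>i. H n k j m - H n k j i)\<bar>"
          using E_H[OF sol[OF m(1)] n nj, of k] E_const[OF sol[OF m(1)] j1] by (simp add: E_diff G_def)
        also have "\<dots> \<le> E ?V j (\<lambda>i. \<bar>H n k j m - H n k j i\<bar>)" by (rule E_abs[OF sol[OF m(1)]])
        also have "\<dots> \<le> E ?V j (\<lambda>i. \<bar>real i - real m\<bar>)"
        proof (rule E_mono[OF sol[OF m(1)]])
          fix i assume i: "1 \<le> i" "i \<le> j"
          show "\<bar>H n k j m - H n k j i\<bar> \<le> \<bar>real i - real m\<bar>"
          proof (cases "i = m")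
            case False
            then have "1 \<le> \<bar>real i - real m\<bar>" by (cases i m rule: linorder_cases) auto
            moreover have "\<bar>H n k j m - H n k j i\<bar> \<le> 1" using Hb[OF i] Hb[OF m(1) mj] by auto
            ultimately show ?thesis by simp
          qed simp
        qed
        also have "\<dots> \<le> e / 2" using elim(1) m by (auto intro: less_imp_le)
        finally show ?thesis .
      qed
      show ?case
      proof
        fix \<kappa> assume "\<kappa> \<in> {1..id j}"
        then have \<kappa>: "1 \<le> \<kappa>" "\<kappa> \<le> j" by auto
        have "\<bar>H n k j \<kappa> - G \<kappa>\<bar> \<le> e"
        proof (cases "\<kappa> \<le> M'")
          case True then show ?thesis using close[OF \<kappa>(1) True] e by simp
        next
          case False
          \<comment> \<open>both quantities are close to \<open>1\<close>, the first one by monotonicity\<close>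
          have "1 - e \<le> H n k j M'" using close[of M'] M[of M'] unfolding M'_def by (auto simp: abs_if split: if_splits)
          also have "\<dots> \<le> H n k j \<kappa>" using False \<kappa> by (intro H_mono[OF n nj]) (auto simp: M'_def)
          finally have "1 - e \<le> H n k j \<kappa>" .
          moreover have "1 - e / 2 < G \<kappa>" using M[of \<kappa>] False by (auto simp: M'_def)
          then have "1 - e \<le> G \<kappa>" using e by linarith
          ultimately show ?thesis using Hb[OF \<kappa>] G1[OF \<kappa>(1)] by auto
        qed
        then show "\<bar>H n k (id j) \<kappa> - T (U (to_unit (real \<kappa>))) n k\<bar> \<le> e" by (simp add: G_def)
      qed
    qed
  qed
qed

end

section \<open>Partitions of nonpositive type\<close>

lemma gibbs_step_chain: "\<alpha> < 1 \<Longrightarrow> gibbs_chain (gibbs_step \<alpha>)"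
proof
  fix n k :: nat assume a: "\<alpha> < 1" and k: "1 \<le> k" "k \<le> n"
  show "0 < gibbs_step \<alpha> n k"
  proof (cases "\<alpha> = -\<infinity>")
    case True then show ?thesis using k by (simp add: gibbs_step_def)
  next
    case False
    then obtain a where a: "\<alpha> = ereal a" "a < 1" using a by (cases \<alpha>) auto
    have "a * real k < 1 * real k" using a k by (intro mult_strict_right_mono) auto
    moreover have "real k \<le> real n" using k by simp
    ultimately have "a * real k < real n" by linarith
    then show ?thesis by (simp add: gibbs_step_def a)
  qed
qed

lemma singletons_solution: "gibbs_solution g singletons_V"
  by (auto simp: gibbs_solution_def singletons_V_def)

text \<open>The inverse of \<open>to_unit\<close>, with the point at infinity placed at \<open>1\<close>. It identifies each index set with
  a compact subset of the unit interval.\<close>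

definition of_unit :: "real \<Rightarrow> ennreal" where
  "of_unit z = (if 1 \<le> z then \<infinity> else ennreal (z / (1 - z)))"

lemma of_unit_to_unit: "0 \<le> x \<Longrightarrow> of_unit (to_unit x) = ennreal x"
  by (auto simp: of_unit_def to_unit_def divide_simps)

lemma of_unit_1: "of_unit 1 = \<infinity>" by (simp add: of_unit_def)

lemma rising_Suc: "rising x (Suc m) b = rising x m b * (x + real m * b)"
  unfolding rising_def by simp

lemma negative_V_solution:
  assumes a: "a < 0" and m: "1 \<le> m"
  shows "gibbs_solution (gibbs_step (ereal a)) (negative_V a (of_nat m))"
    and "\<And>n k. 1 \<le> k \<Longrightarrow> k \<le> n \<Longrightarrow> negative_V a (of_nat m) (Suc n) (Suc k)
       = (- a) / (real m * (- a) + real n) * (real m - real k) * negative_V a (of_nat m) n k"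
proof -
  define \<theta> where "\<theta> = real m * (- a)"
  have den: "real m * (- a) + real n = \<theta> + real n" for n by (simp add: \<theta>_def)
  have \<theta>: "0 < \<theta>" using a m by (simp add: \<theta>_def mult_pos_neg)
  have V: "negative_V a (of_nat m) n k = rising (\<theta> + a) (k - 1) a / pochhammer (\<theta> + 1) (n - 1)" for n k
    using a by (simp add: negative_V_def \<theta>_def Let_def)
  have poch: "pochhammer (\<theta> + 1) n = pochhammer (\<theta> + 1) (n - 1) * (\<theta> + real n)" if "1 \<le> n" for n
    using that by (cases n) (simp_all add: pochhammer_Suc algebra_simps)
  have pp: "0 < pochhammer (\<theta> + 1) n" for n using \<theta> by (intro pochhammer_pos) simp
  have rise: "rising (\<theta> + a) k a = rising (\<theta> + a) (k - 1) a * ((real m - real k) * (- a))" if "1 \<le> k" for k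
    using that by (cases k) (simp_all add: rising_Suc \<theta>_def algebra_simps)
  have rise_nn: "0 \<le> rising (\<theta> + a) k a" for k
  proof (cases "k < m")
    case True
    have "0 \<le> \<theta> + a + (real j - 1) * a" if "j \<in> {1..k}" for j
    proof -
      have "\<theta> + a + (real j - 1) * a = (real m - real j) * (- a)" by (simp add: \<theta>_def algebra_simps)
      also have "\<dots> \<ge> 0" using that True a by (intro mult_nonneg_nonneg) auto
      finally show ?thesis .
    qed
    then show ?thesis unfolding rising_def by (intro prod_nonneg) auto
  next
    case False
    have "\<theta> + a + (real m - 1) * a = 0" by (simp add: \<theta>_def algebra_simps)
    then have "rising (\<theta> + a) k a = 0" unfolding rising_def using False m by (intro prod_zero bexI[of _ m]) auto
    then show ?thesis by simp
  qed
  show trans: "negative_V a (of_nat m) (Suc n) (Suc k) = (- a) / (real m * (- a) + real n) * (real m - real k) * negative_V a (of_nat m) n k"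
    if k: "1 \<le> k" "k \<le> n" for n k
    unfolding V den using rise[OF k(1)] poch[of n] k by (simp add: mult.commute)
  show "gibbs_solution (gibbs_step (ereal a)) (negative_V a (of_nat m))"
    unfolding gibbs_solution_def
  proof (intro conjI allI impI)
    show "negative_V a (of_nat m) 1 1 = 1" by (simp add: V rising_def)
    fix n k :: nat assume k: "1 \<le> k \<and> k \<le> n"
    show "0 \<le> negative_V a (of_nat m) n k" unfolding V using rise_nn pp less_imp_le by (intro divide_nonneg_nonneg) auto
    have n: "1 \<le> n" using k by simp
    have 1: "gibbs_step (ereal a) n k * negative_V a (of_nat m) (Suc n) k
       = (real n - a * real k) / (\<theta> + real n) * negative_V a (of_nat m) n k"
      unfolding V using poch[OF n] by (simp add: gibbs_step_def mult.commute)
    have 2: "(real n - a * real k) / (\<theta> + real n) + (- a) / (real m * (- a) + real n) * (real m - real k) = 1"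
    proof -
      have "(real n - a * real k) / (\<theta> + real n) + (- a) / (real m * (- a) + real n) * (real m - real k)
        = ((real n - a * real k) + (- a) * (real m - real k)) / (\<theta> + real n)"
        unfolding den by (simp only: add_divide_distrib times_divide_eq_left)
      also have "(real n - a * real k) + (- a) * (real m - real k) = \<theta> + real n" by (simp add: \<theta>_def algebra_simps)
      finally show ?thesis using \<theta> by simp
    qed
    show "negative_V a (of_nat m) n k = gibbs_step (ereal a) n k * negative_V a (of_nat m) (Suc n) k + negative_V a (of_nat m) (Suc n) (Suc k)"
      using k unfolding 1 trans[OF conjunct1[OF k] conjunct2[OF k]] distrib_right[symmetric] 2 by simp
  qed
qed

lemma minus_infinity_V_solution:
  assumes m: "1 \<le> m"
  shows "gibbs_solution (gibbs_step (-\<infinity>)) (minus_infinity_V (of_nat m))"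
    and "\<And>n k. 1 \<le> k \<Longrightarrow> k \<le> n \<Longrightarrow> minus_infinity_V (of_nat m) (Suc n) (Suc k)
       = 1 / real m * (real m - real k) * minus_infinity_V (of_nat m) n k"
proof -
  have V: "minus_infinity_V (of_nat m) n k = (\<Prod>i<k. real m - real i) / real m ^ n" for n k
    by (simp add: minus_infinity_V_def)
  have nn: "0 \<le> (\<Prod>i<k. real m - real i)" for k
  proof (cases "k \<le> m")
    case True then show ?thesis by (intro prod_nonneg) auto
  next
    case False
    then have "(\<Prod>i<k. real m - real i) = 0" by (intro prod_zero bexI[of _ m]) auto
    then show ?thesis by (rule eq_refl[OF sym])
  qed
  show trans: "minus_infinity_V (of_nat m) (Suc n) (Suc k) = 1 / real m * (real m - real k) * minus_infinity_V (of_nat m) n k" for n k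
    unfolding V by simp
  show "gibbs_solution (gibbs_step (-\<infinity>)) (minus_infinity_V (of_nat m))"
    unfolding gibbs_solution_def
  proof (intro conjI allI impI)
    show "minus_infinity_V (of_nat m) 1 1 = 1" using m by (simp add: V)
    fix n k :: nat
    show "0 \<le> minus_infinity_V (of_nat m) n k" unfolding V using nn by simp
    show "minus_infinity_V (of_nat m) n k = gibbs_step (-\<infinity>) n k * minus_infinity_V (of_nat m) (Suc n) k + minus_infinity_V (of_nat m) (Suc n) (Suc k)"
      unfolding V gibbs_step_def using m by (simp add: field_simps)
  qed
qed

lemma ewens_V_solution:
  assumes \<theta>: "0 \<le> \<theta>"
  shows "gibbs_solution (gibbs_step 0) (ewens_V (ennreal \<theta>))"
    and "\<And>n k. 1 \<le> k \<Longrightarrow> k \<le> n \<Longrightarrow> ewens_V (ennreal \<theta>) (Suc n) (Suc k) = \<theta> / (\<theta> + real n) * ewens_V (ennreal \<theta>) n k"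
proof -
  have V: "ewens_V (ennreal \<theta>) n k = \<theta> ^ (k - 1) / pochhammer (\<theta> + 1) (n - 1)" for n k
    using \<theta> by (simp add: ewens_V_def)
  have poch: "pochhammer (\<theta> + 1) n = pochhammer (\<theta> + 1) (n - 1) * (\<theta> + real n)" if "1 \<le> n" for n
    using that by (cases n) (simp_all add: pochhammer_Suc algebra_simps)
  have pp: "0 < pochhammer (\<theta> + 1) n" for n using \<theta> by (intro pochhammer_pos) simp
  show trans: "ewens_V (ennreal \<theta>) (Suc n) (Suc k) = \<theta> / (\<theta> + real n) * ewens_V (ennreal \<theta>) n k" if k: "1 \<le> k" "k \<le> n" for n k
    unfolding V using poch[of n] k by (cases k) (simp_all add: mult.commute)
  show "gibbs_solution (gibbs_step 0) (ewens_V (ennreal \<theta>))"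
    unfolding gibbs_solution_def
  proof (intro conjI allI impI)
    show "ewens_V (ennreal \<theta>) 1 1 = 1" by (simp add: V)
    fix n k :: nat assume k: "1 \<le> k \<and> k \<le> n"
    show "0 \<le> ewens_V (ennreal \<theta>) n k" unfolding V using \<theta> pp less_imp_le by (intro divide_nonneg_nonneg) auto
    have n: "1 \<le> n" using k by simp
    have 1: "gibbs_step 0 n k * ewens_V (ennreal \<theta>) (Suc n) k = real n / (\<theta> + real n) * ewens_V (ennreal \<theta>) n k"
      unfolding V using poch[OF n] by (simp add: gibbs_step_def mult.commute)
    have 2: "real n / (\<theta> + real n) + \<theta> / (\<theta> + real n) = 1"
      using \<theta> n by (simp add: add_divide_distrib[symmetric])
    show "ewens_V (ennreal \<theta>) n k = gibbs_step 0 n k * ewens_V (ennreal \<theta>) (Suc n) k + ewens_V (ennreal \<theta>) (Suc n) (Suc k)"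
      using k unfolding 1 trans[OF conjunct1[OF k] conjunct2[OF k]] distrib_right[symmetric] 2 by simp
  qed
qed

lemma of_unit_ennreal: "z < 1 \<Longrightarrow> of_unit z = ennreal (z / (1 - z))"
  by (simp add: of_unit_def)

lemma sum_harmonic_diverges:
  assumes b: "0 < (b::real)" and m: "1 \<le> m"
  shows "filterlim (\<lambda>n. \<Sum>i=1..<n. b / (real m * b + real i)) at_top sequentially"
proof -
  let ?c = "b / (real m * b + 1)"
  have c: "0 < ?c" using b m by (intro divide_pos_pos add_nonneg_pos mult_nonneg_nonneg) auto
  have lim: "filterlim (\<lambda>n. ?c * harm (n - 1)) at_top sequentially"
    by (rule filterlim_tendsto_pos_mult_at_top[OF tendsto_const c])
       (rule filterlim_compose[OF harm_at_top filterlim_minus_const_nat_at_top])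
  have le: "?c * harm (n - 1) \<le> (\<Sum>i=1..<n. b / (real m * b + real i))" for n
  proof -
    have "?c * harm (n - 1) = (\<Sum>i=1..n-1. ?c * inverse (real i))"
      unfolding harm_def by (simp add: sum_distrib_left)
    also have "\<dots> \<le> (\<Sum>i=1..n-1. b / (real m * b + real i))"
    proof (rule sum_mono)
      fix i assume "i \<in> {1..n-1}"
      then have i: "1 \<le> real i" by simp
      have mb: "0 \<le> real m * b" using b by simp
      have "real m * b * 1 \<le> real m * b * real i" using mb i by (intro mult_left_mono) auto
      then have "real m * b + real i \<le> (real m * b + 1) * real i" by (simp add: algebra_simps)
      then have "b / ((real m * b + 1) * real i) \<le> b / (real m * b + real i)"
        using b mb i by (intro divide_left_mono mult_pos_pos add_nonneg_pos) auto
      then show "?c * inverse (real i) \<le> b / (real m * b + real i)" by (simp add: divide_inverse)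
    qed
    also have "{1..n-1} = {1..<n}" by auto
    finally show ?thesis .
  qed
  show ?thesis by (rule filterlim_at_top_mono[OF lim]) (intro always_eventually allI le)
qed

lemma of_unit_discrete: "of_unit ` insert 1 (range (\<lambda>m. to_unit (real (Suc m)))) = insert \<infinity> (of_nat ` {1..})"
proof -
  have "of_unit ` range (\<lambda>m. to_unit (real (Suc m))) = range (\<lambda>m. of_nat (Suc m) :: ennreal)"
    unfolding image_image by (intro image_cong refl) (simp add: of_unit_to_unit ennreal_of_nat_eq_real_of_nat del: of_nat_Suc)
  also have "\<dots> = of_nat ` range Suc" by (simp only: image_image)
  also have "range Suc = {1..}" by (auto simp: image_iff) (metis Suc_le_D)
  finally show ?thesis by (simp add: of_unit_1)
qed

lemma of_unit_nat: "of_unit (to_unit (real m)) = of_nat m"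
  by (simp add: of_unit_to_unit ennreal_of_nat_eq_real_of_nat)

lemma negative_boundary:
  assumes "\<alpha> < 0"
  shows "\<exists>Z r \<zeta>. gibbs_boundary (gibbs_step \<alpha>) Z (\<lambda>z. extreme_V \<alpha> (of_unit z)) r \<zeta> \<and> of_unit ` Z = extreme_index \<alpha>"
proof -
  interpret gibbs_chain "gibbs_step \<alpha>" using assms by (intro gibbs_step_chain) (auto intro: less_trans)
  have sing: "extreme_V \<alpha> (of_unit 1) = singletons_V"
    using assms by (simp add: extreme_V_def of_unit_1 minus_infinity_V_def negative_V_def fun_eq_iff)
  have "\<exists>\<rho>. gibbs_discrete (gibbs_step \<alpha>) (\<lambda>z. extreme_V \<alpha> (of_unit z)) \<rho>"
  proof (cases "\<alpha> = -\<infinity>")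
    case True
    have V: "extreme_V \<alpha> (of_unit (to_unit (real m))) = minus_infinity_V (of_nat m)" for m
      by (simp add: extreme_V_def True of_unit_nat)
    have "gibbs_discrete (gibbs_step \<alpha>) (\<lambda>z. extreme_V \<alpha> (of_unit z)) (\<lambda>m _. 1 / real m)"
    proof
      show "solution (extreme_V \<alpha> (of_unit (to_unit (real m))))" if "1 \<le> m" for m
        unfolding V using minus_infinity_V_solution(1)[OF that] True by simp
      show "solution (extreme_V \<alpha> (of_unit 1))" unfolding sing by (rule singletons_solution)
      show "extreme_V \<alpha> (of_unit 1) 2 1 = 0" unfolding sing by (simp add: singletons_V_def)
      show "extreme_V \<alpha> (of_unit (to_unit (real m))) (Suc n) (Suc k) = 1 / real m * (real m - real k) * extreme_V \<alpha> (of_unit (to_unit (real m))) n k"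
        if "1 \<le> m" "1 \<le> k" "k \<le> n" for m n k unfolding V by (rule minus_infinity_V_solution(2)[OF that])
      show "filterlim (\<lambda>n. \<Sum>i=1..<n. 1 / real m) at_top sequentially" if "1 \<le> m" for m
      proof -
        have "filterlim (\<lambda>n. real (n - 1) * (1 / real m)) at_top sequentially"
          using that by (intro filterlim_at_top_mult_tendsto_pos[OF tendsto_const])
            (auto intro!: filterlim_compose[OF filterlim_real_sequentially filterlim_minus_const_nat_at_top])
        then show ?thesis by simp
      qed
      show "1 / real m \<le> 1" if "1 \<le> m" for m using that by simp
      show "(\<lambda>m. extreme_V \<alpha> (of_unit (to_unit (real m))) 2 1) \<longlonglongrightarrow> 0"
      proof -
        have "minus_infinity_V (of_nat m) 2 1 = 1 / real m" for m by (simp add: minus_infinity_V_def power2_eq_square)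
        then show ?thesis unfolding V using lim_1_over_n by simp
      qed
    qed
    then show ?thesis by blast
  next
    case False
    then obtain a where a: "\<alpha> = ereal a" "a < 0" using assms by (cases \<alpha>) auto
    have V: "extreme_V \<alpha> (of_unit (to_unit (real m))) = negative_V a (of_nat m)" for m
      using assms by (simp add: extreme_V_def a of_unit_nat)
    have "gibbs_discrete (gibbs_step \<alpha>) (\<lambda>z. extreme_V \<alpha> (of_unit z)) (\<lambda>m n. (- a) / (real m * (- a) + real n))"
    proof
      show "solution (extreme_V \<alpha> (of_unit (to_unit (real m))))" if "1 \<le> m" for m
        unfolding V unfolding a using negative_V_solution(1)[OF a(2) that] .
      show "solution (extreme_V \<alpha> (of_unit 1))" unfolding sing by (rule singletons_solution)
      show "extreme_V \<alpha> (of_unit 1) 2 1 = 0" unfolding sing by (simp add: singletons_V_def)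
      show "extreme_V \<alpha> (of_unit (to_unit (real m))) (Suc n) (Suc k) = (- a) / (real m * (- a) + real n) * (real m - real k) * extreme_V \<alpha> (of_unit (to_unit (real m))) n k"
        if "1 \<le> m" "1 \<le> k" "k \<le> n" for m n k unfolding V by (rule negative_V_solution(2)[OF a(2) that])
      show "filterlim (\<lambda>n. \<Sum>i=1..<n. (- a) / (real m * (- a) + real i)) at_top sequentially" if "1 \<le> m" for m
        using sum_harmonic_diverges[of "- a" m] a that by simp
      show "(- a) / (real m * (- a) + real n) \<le> 1" if "1 \<le> m" "1 \<le> n" for m n
      proof -
        have "1 * (- a) \<le> real m * (- a)" using that a by (intro mult_right_mono) auto
        moreover have "0 \<le> real m * (- a)" using a by (intro mult_nonneg_nonneg) auto
        moreover have "1 \<le> real n" using that by simp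
        ultimately show ?thesis by (subst divide_le_eq_1_pos) linarith+
      qed
      have "(\<lambda>m. 1 / (real m * \<bar>a\<bar> + 1)) \<longlonglongrightarrow> 0" using a(2) by real_asymp
      then show "(\<lambda>m. extreme_V \<alpha> (of_unit (to_unit (real m))) 2 1) \<longlonglongrightarrow> 0"
        unfolding V negative_V_def by (simp add: Let_def rising_def)
    qed
    then show ?thesis by blast
  qed
  then obtain \<rho> where "gibbs_discrete (gibbs_step \<alpha>) (\<lambda>z. extreme_V \<alpha> (of_unit z)) \<rho>" by blast
  then interpret gibbs_discrete "gibbs_step \<alpha>" "\<lambda>z. extreme_V \<alpha> (of_unit z)" \<rho> .
  have "of_unit ` Z = extreme_index \<alpha>"
    unfolding Z_def of_unit_discrete extreme_index_def using assms by simp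
  then show ?thesis using gibbs_boundary_axioms by blast
qed

lemma of_unit_interval: "of_unit ` {0..1} = UNIV"
proof (intro equalityI subsetI UNIV_I)
  fix x :: ennreal
  show "x \<in> of_unit ` {0..1}"
  proof (cases x)
    case (real r)
    then have "x = of_unit (to_unit r)" by (simp add: of_unit_to_unit)
    then show ?thesis using to_unit_range[of r] real by auto
  next
    case top
    then have "x = of_unit 1" by (simp add: of_unit_1)
    then show ?thesis by auto
  qed
qed

subsection \<open>Ewens partitions\<close>

text \<open>A new block arises at time \<open>n + 1\<close> with probability \<open>\<theta> / (\<theta> + n)\<close>, whatever the present
  number of blocks. So \<open>K\<^sub>n\<close> is a sum of independent indicators: its variance is at most its
  mean, and its mean differs from \<open>\<theta> * harm n\<close> by a bounded amount.\<close>

lemma ewens_lln: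
  assumes \<theta>: "0 < \<theta>"
  shows "(\<lambda>n. gibbs_chain.E (gibbs_step 0) (ewens_V (ennreal \<theta>)) n (\<lambda>k. (real k / harm n - \<theta>)\<^sup>2)) \<longlonglongrightarrow> 0"
proof -
  interpret gibbs_chain "gibbs_step 0" by (rule gibbs_step_chain) simp
  let ?V = "ewens_V (ennreal \<theta>)"
  have sol: "solution ?V" using ewens_V_solution(1)[of \<theta>] \<theta> by simp
  define p where "p n = \<theta> / (\<theta> + real n)" for n
  define m where "m n = (\<Sum>j<n. p j)" for n
  have p: "0 \<le> p n" "p n \<le> 1" for n using \<theta> by (auto simp: p_def divide_simps)
  \<comment> \<open>each step adds \<open>p n * (1 - p n)\<close> to the variance\<close>
  have var: "E ?V n (\<lambda>k. (real k - m n)\<^sup>2) \<le> m n" if "1 \<le> n" for n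
    using that
  proof (induction n rule: dec_induct)
    case base
    then show ?case using \<theta> E_level_1[OF sol, unfolded One_nat_def] by (simp add: m_def p_def)
  next
    case (step n)
    have "E ?V (Suc n) (\<lambda>k. (real k - m (Suc n))\<^sup>2)
      = E ?V n (\<lambda>k. (1 - p n) * (real k - m (Suc n))\<^sup>2 + p n * (real (Suc k) - m (Suc n))\<^sup>2)"
      using ewens_V_solution(2)[of \<theta> _ n] \<theta> by (intro E_transition[OF sol step(1)]) (simp add: p_def)
    also have "\<dots> = E ?V n (\<lambda>k. (real k - m n)\<^sup>2 + p n * (1 - p n))"
      by (rule arg_cong[where f="E ?V n"]) (simp add: fun_eq_iff m_def power2_eq_square algebra_simps)
    also have "\<dots> = E ?V n (\<lambda>k. (real k - m n)\<^sup>2) + p n * (1 - p n)"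
      by (simp add: E_add E_const[OF sol step(1)])
    also have "\<dots> \<le> m n + p n * 1" using step.IH p[of n] by (intro add_mono mult_left_mono) auto
    finally show ?case by (simp add: m_def)
  qed
  \<comment> \<open>the \<open>j\<close>-th difference is at most \<open>C / 2\<close> divided by \<open>(j + 1)\<^sup>2\<close>, and these bounds telescope\<close>
  define C where "C = \<theta> * \<bar>1 - \<theta>\<bar> / min \<theta> 1 * 2"
  have C: "0 \<le> C" using \<theta> by (simp add: C_def)
  have diff: "\<bar>m n - \<theta> * harm n\<bar> \<le> C" for n
  proof -
    have "m n - \<theta> * harm n = (\<Sum>j<n. p j - \<theta> * inverse (real (Suc j)))"
      unfolding m_def harm_altdef by (simp add: sum_subtractf sum_distrib_left)
    then have "\<bar>m n - \<theta> * harm n\<bar> \<le> (\<Sum>j<n. \<bar>p j - \<theta> * inverse (real (Suc j))\<bar>)" by (simp only: sum_abs)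
    also have "\<dots> \<le> (\<Sum>j<n. C * (inverse (real (Suc j)) - inverse (real (Suc (Suc j)))))"
    proof (rule sum_mono)
      fix j
      let ?x = "real j + 1" and ?c = "min \<theta> 1"
      have c: "0 < ?c" using \<theta> by simp
      have "p j - \<theta> * inverse (real (Suc j)) = \<theta> * (1 - \<theta>) / ((\<theta> + real j) * ?x)"
        using \<theta> by (simp add: p_def divide_simps) (simp add: algebra_simps)
      then have "\<bar>p j - \<theta> * inverse (real (Suc j))\<bar> = \<theta> * \<bar>1 - \<theta>\<bar> / ((\<theta> + real j) * ?x)"
        using \<theta> by (simp add: abs_mult)
      also have "\<dots> \<le> \<theta> * \<bar>1 - \<theta>\<bar> / ((?c * ?x) * ?x)"
      proof (intro divide_left_mono mult_right_mono)
        have "?c * ?x = ?c * real j + ?c" by (simp add: algebra_simps)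
        also have "\<dots> \<le> 1 * real j + \<theta>" by (intro add_mono mult_right_mono) auto
        finally show "?c * ?x \<le> \<theta> + real j" by simp
      qed (use \<theta> c in auto)
      also have "\<dots> = \<theta> * \<bar>1 - \<theta>\<bar> / ?c * (1 / (?x * ?x))" by simp
      also have "\<dots> \<le> \<theta> * \<bar>1 - \<theta>\<bar> / ?c * (2 * (inverse (real (Suc j)) - inverse (real (Suc (Suc j)))))"
      proof (intro mult_left_mono)
        show "1 / (?x * ?x) \<le> 2 * (inverse (real (Suc j)) - inverse (real (Suc (Suc j))))"
          by (simp add: divide_simps) (simp add: algebra_simps)
      qed (use \<theta> in simp)
      finally show "\<bar>p j - \<theta> * inverse (real (Suc j))\<bar> \<le> C * (inverse (real (Suc j)) - inverse (real (Suc (Suc j))))"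
        by (simp add: C_def mult.assoc)
    qed
    also have "\<dots> = C * (1 - inverse (real (Suc n)))"
      unfolding sum_distrib_left[symmetric] sum_lessThan_telescope'[of "\<lambda>j. inverse (real (Suc j))"] by simp
    also have "\<dots> \<le> C * 1" using C by (intro mult_left_mono) auto
    finally show ?thesis by simp
  qed
  have lim: "(\<lambda>n. (2 * (\<theta> * harm n + C) + 2 * C\<^sup>2) / (harm n)\<^sup>2) \<longlonglongrightarrow> 0"
  proof -
    have "((\<lambda>x::real. (2 * (\<theta> * x + C) + 2 * C\<^sup>2) / x\<^sup>2) \<longlongrightarrow> 0) at_top" by real_asymp
    then show ?thesis by (rule filterlim_compose[OF _ harm_at_top])
  qed
  show ?thesis
  proof (rule tendsto_sandwich[OF _ _ tendsto_const lim])
    show "\<forall>\<^sub>F n in sequentially. 0 \<le> E ?V n (\<lambda>k. (real k / harm n - \<theta>)\<^sup>2)"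
      by (intro always_eventually allI E_nonneg[OF sol]) simp
    show "\<forall>\<^sub>F n in sequentially. E ?V n (\<lambda>k. (real k / harm n - \<theta>)\<^sup>2) \<le> (2 * (\<theta> * harm n + C) + 2 * C\<^sup>2) / (harm n)\<^sup>2"
      using eventually_ge_at_top[of 1]
    proof eventually_elim
      case (elim n)
      have h: "0 < (harm n :: real)" using elim by simp
      have "E ?V n (\<lambda>k. (real k / harm n - \<theta>)\<^sup>2) \<le> E ?V n (\<lambda>k. (1 / (harm n)\<^sup>2) * (2 * (real k - m n)\<^sup>2 + 2 * C\<^sup>2))"
      proof (rule E_mono[OF sol])
        fix k
        have "real k / harm n - \<theta> = (real k - \<theta> * harm n) / harm n"
          using less_imp_neq[OF h, THEN not_sym] by (simp add: diff_divide_distrib)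
        then have "(real k / harm n - \<theta>)\<^sup>2 = (1 / (harm n)\<^sup>2) * (real k - \<theta> * harm n)\<^sup>2"
          by (simp only: power_divide) simp
        also have "(real k - \<theta> * harm n)\<^sup>2 \<le> 2 * (real k - m n)\<^sup>2 + 2 * (m n - \<theta> * harm n)\<^sup>2"
          using zero_le_power2[of "(real k - m n) - (m n - \<theta> * harm n)"] by (simp add: power2_eq_square algebra_simps)
        also have "(m n - \<theta> * harm n)\<^sup>2 \<le> C\<^sup>2" using diff[of n] C by (metis abs_le_square_iff abs_of_nonneg)
        finally show "(real k / harm n - \<theta>)\<^sup>2 \<le> (1 / (harm n)\<^sup>2) * (2 * (real k - m n)\<^sup>2 + 2 * C\<^sup>2)"
          using h by (simp add: mult_left_mono divide_right_mono)
      qed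
      also have "\<dots> = (1 / (harm n)\<^sup>2) * (2 * E ?V n (\<lambda>k. (real k - m n)\<^sup>2) + 2 * C\<^sup>2)"
        by (simp only: E_cmult E_add E_const[OF sol elim])
      also have "\<dots> \<le> (1 / (harm n)\<^sup>2) * (2 * (\<theta> * harm n + C) + 2 * C\<^sup>2)"
        using var[OF elim] diff[of n] by (intro mult_left_mono add_mono) auto
      finally show ?case by simp
    qed
  qed
qed

text \<open>The function \<open>to_unit\<close> is Lipschitz, so mean square convergence survives the compactification.\<close>

lemma (in gibbs_chain) to_unit_lln:
  assumes sol: "solution V" and x: "0 \<le> x" and r: "strict_mono (r :: nat \<Rightarrow> nat)" and a: "\<And>n. 0 \<le> a n"
    and lim: "(\<lambda>j. E V (r j) (\<lambda>k. (real k / a (r j) - x)\<^sup>2)) \<longlonglongrightarrow> 0"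
  shows "(\<lambda>j. E V (r j) (\<lambda>k. \<bar>to_unit (real k / a (r j)) - to_unit x\<bar>)) \<longlonglongrightarrow> 0"
proof (rule tendsto_sandwich[OF _ _ tendsto_const])
  show "(\<lambda>j. sqrt (E V (r j) (\<lambda>k. (real k / a (r j) - x)\<^sup>2))) \<longlonglongrightarrow> 0"
    using tendsto_real_sqrt[OF lim] by simp
  show "\<forall>\<^sub>F j in sequentially. 0 \<le> E V (r j) (\<lambda>k. \<bar>to_unit (real k / a (r j)) - to_unit x\<bar>)"
    by (intro always_eventually allI E_nonneg[OF sol]) simp
  show "\<forall>\<^sub>F j in sequentially. E V (r j) (\<lambda>k. \<bar>to_unit (real k / a (r j)) - to_unit x\<bar>)
      \<le> sqrt (E V (r j) (\<lambda>k. (real k / a (r j) - x)\<^sup>2))"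
    using filterlim_subseq[OF r, unfolded filterlim_at_top, rule_format, of 1]
  proof eventually_elim
    case (elim j)
    have "E V (r j) (\<lambda>k. \<bar>to_unit (real k / a (r j)) - to_unit x\<bar>) \<le> E V (r j) (\<lambda>k. \<bar>real k / a (r j) - x\<bar>)"
      using a x by (intro E_mono[OF sol] to_unit_lipschitz) auto
    also have "\<dots> \<le> sqrt (E V (r j) (\<lambda>k. (real k / a (r j) - x)\<^sup>2))"
      using E_square[OF sol elim, of "\<lambda>k. \<bar>real k / a (r j) - x\<bar>"] by (intro real_le_rsqrt) simp
    finally show ?case .
  qed
qed

lemma to_unit_scale_range: "0 \<le> (a::real) \<Longrightarrow> to_unit (real k / a) \<in> {0..1}"
  using to_unit_range[of "real k / a"] by auto

lemma to_unit_scale_mono: "0 \<le> (a::real) \<Longrightarrow> i \<le> j \<Longrightarrow> to_unit (real i / a) \<le> to_unit (real j / a)"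
  by (intro to_unit_le divide_right_mono) auto

lemma to_unit_inverse: "z < 1 \<Longrightarrow> to_unit (z / (1 - z)) = z"
  by (simp add: to_unit_def divide_simps)

lemma ewens_boundary:
  "\<exists>Z r \<zeta>. gibbs_boundary (gibbs_step 0) Z (\<lambda>z. extreme_V 0 (of_unit z)) r \<zeta> \<and> of_unit ` Z = extreme_index 0"
proof -
  interpret gibbs_chain "gibbs_step 0" by (rule gibbs_step_chain) simp
  define U where "U z = extreme_V 0 (of_unit z)" for z
  have U: "U z = ewens_V (ennreal (z / (1 - z)))" if "z < 1" for z
    using that by (simp add: U_def extreme_V_def of_unit_ennreal)
  have U1: "U 1 = singletons_V" by (simp add: U_def extreme_V_def of_unit_1 ewens_V_def fun_eq_iff)
  have sol: "solution (U z)" if "z \<in> {0..1}" for z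
  proof (cases "z = 1")
    case True then show ?thesis using U1 singletons_solution by simp
  next
    case False then show ?thesis using U ewens_V_solution(1)[of "z / (1 - z)"] that by simp
  qed
  interpret gibbs_interval "gibbs_step 0" "{0<..<1}" U id "\<lambda>n k. to_unit (real k / harm n)"
  proof
    show "solution (U z)" if "z \<in> {0..1}" for z by (rule sol[OF that])
    show "continuous_on {0<..<1} (\<lambda>z. U z n k)" for n k
    proof (rule continuous_on_eq)
      show "continuous_on {0<..<1} (\<lambda>z::real. (z / (1 - z)) ^ (k - 1) / pochhammer (z / (1 - z) + 1) (n - 1))"
      proof (intro continuous_intros ballI)
        show "pochhammer (z / (1 - z) + 1) (n - 1) \<noteq> 0" if "z \<in> {0<..<1}" for z :: real
          using that by (intro less_imp_neq[THEN not_sym] pochhammer_pos add_nonneg_pos divide_nonneg_nonneg) auto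
      qed auto
      show "(z / (1 - z)) ^ (k - 1) / pochhammer (z / (1 - z) + 1) (n - 1) = U z n k" if "z \<in> {0<..<1}" for z
        using that by (simp add: U ewens_V_def)
    qed
    show "strict_mono (id :: nat \<Rightarrow> nat)" by (rule strict_mono_id)
    show "to_unit (real k / harm n) \<in> {0..1}" for n k by (rule to_unit_scale_range[OF harm_nonneg])
    show "to_unit (real i / harm n) \<le> to_unit (real j / harm n)" if "i \<le> j" for n i j
      by (rule to_unit_scale_mono[OF harm_nonneg that])
    show "\<exists>d\<in>{0<..<1}. a < d \<and> d < b" if "0 \<le> a" "a < b" "b \<le> 1" for a b :: real
      using that by (intro bexI[of _ "(a + b) / 2"]) auto
    show "(\<lambda>j. E (U z) (id j) (\<lambda>\<kappa>. \<bar>to_unit (real \<kappa> / harm (id j)) - z\<bar>)) \<longlonglongrightarrow> 0" if z: "z \<in> {0<..<1}" for z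
    proof -
      let ?\<theta> = "z / (1 - z)"
      have \<theta>: "0 < ?\<theta>" using z by simp
      have "(\<lambda>j. E (U z) (id j) (\<lambda>\<kappa>. \<bar>to_unit (real \<kappa> / harm (id j)) - to_unit ?\<theta>\<bar>)) \<longlonglongrightarrow> 0"
      proof (rule to_unit_lln)
        show "solution (U z)" using sol z by simp
        show "(\<lambda>j. E (U z) (id j) (\<lambda>k. (real k / harm (id j) - ?\<theta>)\<^sup>2)) \<longlonglongrightarrow> 0"
          using ewens_lln[OF \<theta>] U[of z] z by simp
      qed (use \<theta> strict_mono_id harm_nonneg in auto)
      then show ?thesis using to_unit_inverse[of z] z by simp
    qed
    show "U 0 2 2 = 0" by (simp add: U ewens_V_def)
    show "U 1 2 1 = 0" by (simp add: U1 singletons_V_def)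
    have U22: "U z 2 2 = z" "U z 2 1 = 1 - z" if "z \<in> {0<..<1}" for z
      using that by (auto simp: U ewens_V_def divide_simps)
    show "\<exists>z\<in>{0<..<1}. U z 2 2 < e" if "0 < e" for e
    proof
      show "U (min e 1 / 2) 2 2 < e" using U22(1)[of "min e 1 / 2"] that by (auto simp: min_def)
    qed (use that in auto)
    show "\<exists>z\<in>{0<..<1}. U z 2 1 < e" if "0 < e" for e
    proof
      show "U (1 - min e 1 / 2) 2 1 < e" using U22(2)[of "1 - min e 1 / 2"] that by (auto simp: min_def)
    qed (use that in auto)
  qed auto
  have "of_unit ` {0..1} = extreme_index 0" by (simp add: of_unit_interval extreme_index_def)
  then show ?thesis using gibbs_boundary_axioms unfolding U_def by blast
qed

section \<open>Laplace transforms\<close>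

definition laplace :: "real measure \<Rightarrow> real \<Rightarrow> ennreal" where
  "laplace M l = (\<integral>\<^sup>+x. ennreal (exp (- (l * x))) \<partial>M)"

lemma exp_tilt_inverse:
  assumes M: "sets M = sets borel" and c: "0 < (c::real)"
  shows "density (distr (distr (density M (\<lambda>x. ennreal (exp (- x) / c))) borel (\<lambda>x. exp (- x))) borel (\<lambda>y. - ln y))
     (\<lambda>x. ennreal (c * exp x)) = M"
proof -
  let ?N = "density M (\<lambda>x. ennreal (exp (- x) / c))"
  have [measurable_cong]: "sets M = sets borel" by fact
  have "distr (distr ?N borel (\<lambda>x. exp (- x))) borel (\<lambda>y. - ln y) = distr ?N borel ((\<lambda>y. - ln y) \<circ> (\<lambda>x. exp (- x)))"
    by (rule distr_distr) measurable
  also have "\<dots> = distr ?N ?N (\<lambda>x. x)" using M by (intro distr_cong) auto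
  also have "\<dots> = ?N" by (rule distr_id)
  finally have "density (distr (distr ?N borel (\<lambda>x. exp (- x))) borel (\<lambda>y. - ln y)) (\<lambda>x. ennreal (c * exp x))
     = density ?N (\<lambda>x. ennreal (c * exp x))" by simp
  also have "\<dots> = density M (\<lambda>x. ennreal (exp (- x) / c) * ennreal (c * exp x))"
    by (rule density_density_eq) measurable
  also have "(\<lambda>x. ennreal (exp (- x) / c) * ennreal (c * exp x)) = (\<lambda>_. 1)"
  proof
    fix x
    have "exp (- x) / c * (c * exp x) = 1" using c by (simp add: exp_minus)
    then show "ennreal (exp (- x) / c) * ennreal (c * exp x) = 1"
      using c by (simp add: ennreal_mult'[symmetric] del: times_divide_eq_left)
  qed
  finally show ?thesis by (simp add: density_1)
qed

text \<open>After an exponential tilt and the substitution \<open>y = exp (- x)\<close> the values of the Laplace transform at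
  the positive integers become the moments of a distribution on the unit interval.\<close>

lemma laplace_unique:
  assumes M1: "sets M1 = sets borel" "AE x in M1. 0 \<le> x"
    and M2: "sets M2 = sets borel" "AE x in M2. 0 \<le> x"
    and eq: "\<And>l. 0 < l \<Longrightarrow> laplace M1 l = laplace M2 l"
    and fin: "\<And>l. 0 < l \<Longrightarrow> laplace M1 l < \<infinity>"
  shows "M1 = M2"
proof (cases "laplace M1 1 = 0")
  case True
  have "emeasure M A = 0" if "laplace M 1 = 0" "sets M = sets borel" for M A
  proof -
    have [measurable_cong]: "sets M = sets borel" by fact
    have "AE x in M. ennreal (exp (- (1 * x))) = 0"
      using that(1) unfolding laplace_def by (subst (asm) nn_integral_0_iff_AE) auto
    then have "AE x in M. False" by eventually_elim simp
    then have "emeasure M (space M) = 0" by (simp add: eventually_False ae_filter_eq_bot_iff)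
    then show ?thesis using emeasure_space[of M A] by simp
  qed
  then show ?thesis using True eq[of 1] M1 M2 by (intro measure_eqI) auto
next
  case False
  define c where "c = enn2real (laplace M1 1)"
  have c: "0 < c" "laplace M1 1 = ennreal c" "laplace M2 1 = ennreal c"
    using False fin[of 1] eq[of 1] by (auto simp: c_def enn2real_positive_iff less_top zero_less_iff_neq_zero)
  let ?P = "\<lambda>M. distr (density M (\<lambda>x. ennreal (exp (- x) / c))) borel (\<lambda>x. exp (- x))"
  have P: "real_distribution (?P M)" "AE y in ?P M. y \<in> {0..1}"
      "(\<integral>y. y ^ p \<partial>?P M) = enn2real (laplace M (real p + 1) / ennreal c)"
    if M: "sets M = sets borel" "AE x in M. 0 \<le> x" "laplace M 1 = ennreal c" for M p
  proof -
    have [measurable_cong]: "sets M = sets borel" by fact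
    let ?N = "density M (\<lambda>x. ennreal (exp (- x) / c))"
    have int: "(\<integral>\<^sup>+x. ennreal (exp (- (real q * x))) \<partial>?N) = laplace M (real q + 1) / ennreal c" for q :: nat
    proof -
      have "(\<integral>\<^sup>+x. ennreal (exp (- (real q * x))) \<partial>?N) = (\<integral>\<^sup>+x. ennreal (exp (- x) / c) * ennreal (exp (- (real q * x))) \<partial>M)"
        by (rule nn_integral_density) measurable
      also have "\<dots> = (\<integral>\<^sup>+x. ennreal (exp (- ((real q + 1) * x))) / ennreal c \<partial>M)"
        using c by (intro nn_integral_cong) (simp add: ennreal_mult'[symmetric] divide_ennreal exp_add[symmetric] algebra_simps)
      also have "\<dots> = laplace M (real q + 1) / ennreal c"
        unfolding laplace_def by (rule nn_integral_divide) measurable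
      finally show ?thesis .
    qed
    have "emeasure ?N (space ?N) = 1"
    proof -
      have "emeasure ?N (space ?N) = (\<integral>\<^sup>+x. 1 \<partial>?N)" by simp
      also have "\<dots> = (\<integral>\<^sup>+x. ennreal (exp (- (real 0 * x))) \<partial>?N)" by (intro nn_integral_cong) simp
      also have "\<dots> = 1" unfolding int using M(3) c by (simp add: ennreal_divide_self)
      finally show ?thesis .
    qed
    then have N: "prob_space ?N" by (rule prob_spaceI)
    have meas: "(\<lambda>x. exp (- x)) \<in> borel_measurable ?N" by measurable
    show "real_distribution (?P M)" by (rule prob_space.real_distribution_distr[OF N meas])
    have "AE x in ?N. 0 \<le> x" using M(2) by (subst AE_density) (auto elim: eventually_mono)
    then show AE01: "AE y in ?P M. y \<in> {0..1}"
      by (subst AE_distr_iff[OF meas]) (auto elim: eventually_mono)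
    have "(\<integral>y. y ^ p \<partial>?P M) = enn2real (\<integral>\<^sup>+y. ennreal (y ^ p) \<partial>?P M)"
      using AE01 by (intro integral_eq_nn_integral) (auto elim: eventually_mono)
    also have "(\<integral>\<^sup>+y. ennreal (y ^ p) \<partial>?P M) = (\<integral>\<^sup>+x. ennreal (exp (- x) ^ p) \<partial>?N)"
      by (rule nn_integral_distr[OF meas]) measurable
    also have "\<dots> = (\<integral>\<^sup>+x. ennreal (exp (- (real p * x))) \<partial>?N)"
      by (intro nn_integral_cong) (simp add: exp_of_nat_mult[symmetric])
    finally show "(\<integral>y. y ^ p \<partial>?P M) = enn2real (laplace M (real p + 1) / ennreal c)" unfolding int .
  qed
  have "?P M1 = ?P M2"
  proof (rule moments_determine_distribution)
    show "(\<integral>y. y ^ p \<partial>?P M1) = (\<integral>y. y ^ p \<partial>?P M2)" for p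
      unfolding P(3)[OF M1 c(2)] P(3)[OF M2 c(3)] using eq[of "real p + 1"] by simp
  qed (use P(1,2)[OF M1 c(2)] P(1,2)[OF M2 c(3)] in auto)
  then show ?thesis using exp_tilt_inverse[OF M1(1) c(1)] exp_tilt_inverse[OF M2(1) c(1)] by metis
qed

text \<open>Differentiation under the integral sign, by dominated convergence of the difference quotients.\<close>

lemma laplace_derivative:
  assumes M: "sets M = sets borel" "AE x in M. 0 \<le> x"
    and L: "\<And>l. 0 < l \<Longrightarrow> laplace M l = ennreal (L l)" "\<And>l. 0 < l \<Longrightarrow> 0 \<le> L l"
    and der: "(L has_real_derivative - D) (at l)" and l: "0 < l"
  shows "laplace (density M (\<lambda>x. ennreal x)) l = ennreal D"
proof -
  have [measurable_cong]: "sets M = sets borel" by fact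
  define h where "h n = inverse (real (Suc n))" for n
  have h: "0 < h n" for n by (simp add: h_def)
  have h0: "h \<longlonglongrightarrow> 0" unfolding h_def by (rule LIMSEQ_inverse_real_of_nat)
  define q where "q n x = (exp (- (l * x)) - exp (- ((l + h n) * x))) / h n" for n x
  have q_eq: "q n x = exp (- (l * x)) * ((1 - exp (- (h n * x))) / h n)" for n x
    unfolding q_def by (simp add: right_diff_distrib exp_add[symmetric] algebra_simps)
  \<comment> \<open>the majorant comes from \<open>x \<le> 2 / l * exp (l / 2 * x)\<close>\<close>
  have lim1: "(\<lambda>n. \<integral>\<^sup>+x. ennreal (q n x) \<partial>M) \<longlonglongrightarrow> (\<integral>\<^sup>+x. ennreal (exp (- (l * x)) * x) \<partial>M)"
  proof (rule nn_integral_dominated_convergence[where w="\<lambda>x. ennreal (2 / l * exp (- (l / 2 * x)))"])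
    show "(\<lambda>x. ennreal (q n x)) \<in> borel_measurable M" for n unfolding q_def by measurable
    show "(\<lambda>x. ennreal (exp (- (l * x)) * x)) \<in> borel_measurable M" by measurable
    show "(\<lambda>x. ennreal (2 / l * exp (- (l / 2 * x)))) \<in> borel_measurable M" by measurable
    have "(\<integral>\<^sup>+x. ennreal (2 / l * exp (- (l / 2 * x))) \<partial>M) = ennreal (2 / l) * laplace M (l / 2)"
      unfolding laplace_def
    proof (subst nn_integral_cmult[symmetric])
      show "(\<integral>\<^sup>+x. ennreal (2 / l * exp (- (l / 2 * x))) \<partial>M) = (\<integral>\<^sup>+x. ennreal (2 / l) * ennreal (exp (- (l / 2 * x))) \<partial>M)"
        using l by (intro nn_integral_cong ennreal_mult') simp
    qed measurable
    also have "\<dots> < \<infinity>" using L(1)[of "l/2"] l by (simp add: ennreal_mult_less_top)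
    finally show "(\<integral>\<^sup>+x. ennreal (2 / l * exp (- (l / 2 * x))) \<partial>M) < \<infinity>" .
    show "AE x in M. ennreal (q n x) \<le> ennreal (2 / l * exp (- (l / 2 * x)))" for n
      using M(2)
    proof eventually_elim
      case (elim x)
      have "1 - exp (- (h n * x)) \<le> h n * x" using exp_ge_add_one_self[of "- (h n * x)"] by simp
      then have "(1 - exp (- (h n * x))) / h n \<le> x" using h[of n] by (simp add: divide_le_eq mult.commute)
      then have "q n x \<le> exp (- (l * x)) * x" unfolding q_eq by (intro mult_left_mono) auto
      also have "exp (- (l * x)) * x \<le> exp (- (l * x)) * (2 / l * exp (l / 2 * x))"
      proof (intro mult_left_mono)
        have "l / 2 * x \<le> exp (l / 2 * x)" using exp_ge_add_one_self[of "l / 2 * x"] by linarith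
        then have "2 / l * (l / 2 * x) \<le> 2 / l * exp (l / 2 * x)" using l by (intro mult_left_mono) auto
        then show "x \<le> 2 / l * exp (l / 2 * x)" using l by simp
      qed simp
      also have "\<dots> = 2 / l * (exp (- (l * x)) * exp (l / 2 * x))" by simp
      also have "exp (- (l * x)) * exp (l / 2 * x) = exp (- (l / 2 * x))" unfolding exp_add[symmetric] by simp
      finally show ?case by (rule ennreal_leI)
    qed
    show "AE x in M. (\<lambda>n. ennreal (q n x)) \<longlonglongrightarrow> ennreal (exp (- (l * x)) * x)"
    proof (intro AE_I2 tendsto_ennrealI)
      fix x :: real
      have "((\<lambda>t. 1 - exp (- (t * x))) has_real_derivative x) (at 0)"
        by (auto intro!: derivative_eq_intros)
      then have "((\<lambda>t. (1 - exp (- (t * x))) / t) \<longlongrightarrow> x) (at 0)"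
        by (simp add: DERIV_def)
      then have "(\<lambda>n. (1 - exp (- (h n * x))) / h n) \<longlonglongrightarrow> x"
        by (rule filterlim_compose) (use h0 h in \<open>auto simp: filterlim_at intro!: always_eventually less_imp_neq[THEN not_sym]\<close>)
      then show "(\<lambda>n. q n x) \<longlonglongrightarrow> exp (- (l * x)) * x"
        unfolding q_eq by (intro tendsto_mult tendsto_const)
    qed
  qed
  have int_q: "(\<integral>\<^sup>+x. ennreal (q n x) \<partial>M) = ennreal ((L l - L (l + h n)) / h n)" for n
  proof -
    have lh: "0 < l + h n" using l h[of n] by simp
    have "(\<integral>\<^sup>+x. ennreal (q n x) \<partial>M)
        = (\<integral>\<^sup>+x. (ennreal (exp (- (l * x))) - ennreal (exp (- ((l + h n) * x)))) * ennreal (1 / h n) \<partial>M)"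
      unfolding q_def using h[of n] by (intro nn_integral_cong) (simp add: ennreal_minus ennreal_mult''[symmetric])
    also have "\<dots> = (\<integral>\<^sup>+x. (ennreal (exp (- (l * x))) - ennreal (exp (- ((l + h n) * x)))) \<partial>M) * ennreal (1 / h n)"
      by (rule nn_integral_multc) measurable
    also have "(\<integral>\<^sup>+x. (ennreal (exp (- (l * x))) - ennreal (exp (- ((l + h n) * x)))) \<partial>M) = laplace M l - laplace M (l + h n)"
      unfolding laplace_def
    proof (rule nn_integral_diff)
      show "(\<integral>\<^sup>+x. ennreal (exp (- ((l + h n) * x))) \<partial>M) \<noteq> \<infinity>"
        using L(1)[OF lh] unfolding laplace_def by simp
      show "AE x in M. ennreal (exp (- ((l + h n) * x))) \<le> ennreal (exp (- (l * x)))"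
        using M(2) by eventually_elim (use h[of n] in \<open>auto intro!: ennreal_leI simp: algebra_simps\<close>)
    qed measurable
    also have "\<dots> = ennreal (L l - L (l + h n))"
      unfolding L(1)[OF l] L(1)[OF lh] by (rule ennreal_minus[OF L(2)[OF lh]])
    finally show ?thesis using h[of n] by (simp add: ennreal_mult''[symmetric])
  qed
  have lim2: "(\<lambda>n. ennreal ((L l - L (l + h n)) / h n)) \<longlonglongrightarrow> ennreal D"
  proof (rule tendsto_ennrealI)
    have "((\<lambda>t. (L (l + t) - L l) / t) \<longlongrightarrow> - D) (at 0)" using der by (simp add: DERIV_def)
    then have "(\<lambda>n. (L (l + h n) - L l) / h n) \<longlonglongrightarrow> - D"
      by (rule filterlim_compose) (use h0 h in \<open>auto simp: filterlim_at intro!: always_eventually less_imp_neq[THEN not_sym]\<close>)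
    from tendsto_minus[OF this] show "(\<lambda>n. (L l - L (l + h n)) / h n) \<longlonglongrightarrow> D"
      by (simp add: minus_divide_left)
  qed
  have "laplace (density M (\<lambda>x. ennreal x)) l = (\<integral>\<^sup>+x. ennreal x * ennreal (exp (- (l * x))) \<partial>M)"
    unfolding laplace_def by (rule nn_integral_density) measurable
  also have "\<dots> = (\<integral>\<^sup>+x. ennreal (exp (- (l * x)) * x) \<partial>M)"
    by (intro nn_integral_cong) (simp add: ennreal_mult'' mult.commute ennreal_mult')
  also have "\<dots> = ennreal D" using LIMSEQ_unique[OF lim1] lim2 unfolding int_q by simp
  finally show ?thesis .
qed

subsection \<open>Fractional integrals\<close>

text \<open>The kernel of fractional integration of order \<open>b\<close>.\<close>

definition power_kernel :: "real \<Rightarrow> real \<Rightarrow> real" where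
  "power_kernel b x = (if 0 < x then x powr (b - 1) / Gamma b else 0)"

lemma power_kernel_nonneg: "0 < b \<Longrightarrow> 0 \<le> power_kernel b x"
  using Gamma_real_pos[of b] by (auto simp: power_kernel_def)

lemma power_kernel_measurable [measurable]: "power_kernel b \<in> borel_measurable borel"
  unfolding power_kernel_def by measurable

lemma gamma_nn_integral:
  assumes b: "0 < b" and l: "0 < l"
  shows "(\<integral>\<^sup>+x. ennreal (exp (- (l * x)) * power_kernel b x) \<partial>lborel) = ennreal (l powr (- b))"
proof -
  let ?f = "\<lambda>t. ennreal (indicator {0..} t * t powr (b - 1) / exp t)"
  have G: "0 < Gamma b" using b by (rule Gamma_real_pos)
  have "ennreal (Gamma b) = (\<integral>\<^sup>+t. ?f t \<partial>lborel)" by (rule Gamma_conv_nn_integral_real[OF b])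
  also have "\<dots> = ennreal l * (\<integral>\<^sup>+x. ?f (0 + l * x) \<partial>lborel)"
    using nn_integral_real_affine[of ?f l 0] l by simp
  also have "(\<integral>\<^sup>+x. ?f (0 + l * x) \<partial>lborel)
      = (\<integral>\<^sup>+x. ennreal (l powr (b - 1) * Gamma b) * ennreal (exp (- (l * x)) * power_kernel b x) \<partial>lborel)"
  proof (intro nn_integral_cong)
    fix x :: real
    show "?f (0 + l * x) = ennreal (l powr (b - 1) * Gamma b) * ennreal (exp (- (l * x)) * power_kernel b x)"
    proof (cases "0 < x")
      case True
      have "indicator {0..} (l * x) * (l * x) powr (b - 1) / exp (l * x)
        = l powr (b - 1) * Gamma b * (exp (- (l * x)) * power_kernel b x)"
        using True l G by (simp add: power_kernel_def powr_mult exp_minus field_simps)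
      then show ?thesis using G l by (simp add: ennreal_mult'[symmetric])
    next
      case False
      then have "x = 0 \<or> l * x < 0" using l by (auto simp: mult_pos_neg not_less le_less)
      then show ?thesis using False by (auto simp: power_kernel_def)
    qed
  qed
  also have "\<dots> = ennreal (l powr (b - 1) * Gamma b) * (\<integral>\<^sup>+x. ennreal (exp (- (l * x)) * power_kernel b x) \<partial>lborel)"
    by (rule nn_integral_cmult) measurable
  finally have "ennreal (Gamma b) = ennreal (l * (l powr (b - 1) * Gamma b)) * (\<integral>\<^sup>+x. ennreal (exp (- (l * x)) * power_kernel b x) \<partial>lborel)"
    using l G by (simp add: ennreal_mult' mult.assoc)
  also have "l * (l powr (b - 1) * Gamma b) = l powr b * Gamma b"
    using l by (simp add: powr_diff)
  finally have e: "ennreal (Gamma b) = ennreal (l powr b * Gamma b) * (\<integral>\<^sup>+x. ennreal (exp (- (l * x)) * power_kernel b x) \<partial>lborel)" .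
  have "ennreal (l powr (- b)) = ennreal (1 / (l powr b * Gamma b)) * ennreal (Gamma b)"
    using l G by (simp add: ennreal_mult'[symmetric] powr_minus divide_simps)
  also have "\<dots> = ennreal (1 / (l powr b * Gamma b)) * ennreal (l powr b * Gamma b) * (\<integral>\<^sup>+x. ennreal (exp (- (l * x)) * power_kernel b x) \<partial>lborel)"
    by (subst e) (simp only: mult.assoc)
  also have "ennreal (1 / (l powr b * Gamma b)) * ennreal (l powr b * Gamma b) = 1"
    using l G by (simp add: ennreal_mult'[symmetric])
  finally show ?thesis by simp
qed

text \<open>The fractional integral of order \<open>b\<close> of a measure, in the sense of Riemann and Liouville.\<close>

definition frac_integral :: "real \<Rightarrow> real measure \<Rightarrow> real \<Rightarrow> ennreal" where
  "frac_integral b M x = (\<integral>\<^sup>+u. ennreal (power_kernel b (x - u)) \<partial>M)"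

lemma frac_integral_measurable:
  assumes "sigma_finite_measure M" and [measurable_cong]: "sets M = sets borel"
  shows "frac_integral b M \<in> borel_measurable borel"
proof -
  interpret sigma_finite_measure M by fact
  show ?thesis unfolding frac_integral_def[abs_def] by measurable
qed

lemma laplace_frac_integral:
  assumes M: "sigma_finite_measure M" "sets M = sets borel" and b: "0 < b" and l: "0 < l"
  shows "laplace (density lborel (frac_integral b M)) l = ennreal (l powr (- b)) * laplace M l"
proof -
  interpret sigma_finite_measure M by fact
  have [measurable_cong]: "sets M = sets borel" by fact
  note frac_integral_measurable[OF M, measurable]
  interpret P: pair_sigma_finite lborel M by standard
  have "laplace (density lborel (frac_integral b M)) l
      = (\<integral>\<^sup>+x. frac_integral b M x * ennreal (exp (- (l * x))) \<partial>lborel)"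
    unfolding laplace_def by (rule nn_integral_density) measurable
  also have "\<dots> = (\<integral>\<^sup>+x. \<integral>\<^sup>+u. ennreal (exp (- (l * x)) * power_kernel b (x - u)) \<partial>M \<partial>lborel)"
    unfolding frac_integral_def
    by (intro nn_integral_cong, subst nn_integral_multc[symmetric]) (auto intro!: nn_integral_cong simp: ennreal_mult' ennreal_mult'' mult.commute)
  also have "\<dots> = (\<integral>\<^sup>+u. \<integral>\<^sup>+x. ennreal (exp (- (l * x)) * power_kernel b (x - u)) \<partial>lborel \<partial>M)"
    by (rule P.Fubini'[symmetric]) measurable
  also have "\<dots> = (\<integral>\<^sup>+u. ennreal (l powr (- b)) * ennreal (exp (- (l * u))) \<partial>M)"
  proof (intro nn_integral_cong)
    fix u :: real
    have "(\<integral>\<^sup>+x. ennreal (exp (- (l * x)) * power_kernel b (x - u)) \<partial>lborel)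
        = (\<integral>\<^sup>+x. ennreal (exp (- (l * (u + 1 * x))) * power_kernel b ((u + 1 * x) - u)) \<partial>lborel)"
      using nn_integral_real_affine[of "\<lambda>x. ennreal (exp (- (l * x)) * power_kernel b (x - u))" 1 u] by simp
    also have "\<dots> = (\<integral>\<^sup>+x. ennreal (exp (- (l * u))) * ennreal (exp (- (l * x)) * power_kernel b x) \<partial>lborel)"
      by (intro nn_integral_cong) (simp add: ennreal_mult'[symmetric] exp_add[symmetric] distrib_left mult.assoc[symmetric] add.commute)
    also have "\<dots> = ennreal (exp (- (l * u))) * ennreal (l powr (- b))"
      unfolding gamma_nn_integral[OF b l, symmetric] by (rule nn_integral_cmult) measurable
    finally show "(\<integral>\<^sup>+x. ennreal (exp (- (l * x)) * power_kernel b (x - u)) \<partial>lborel) = ennreal (l powr (- b)) * ennreal (exp (- (l * u)))"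
      by (simp only: mult.commute)
  qed
  also have "\<dots> = ennreal (l powr (- b)) * laplace M l"
    unfolding laplace_def by (rule nn_integral_cmult) measurable
  finally show ?thesis .
qed

text \<open>This is the substitution \<open>v = x powr a\<close> in the Gamma integral, done by writing \<open>exp (- (x powr a))\<close>
  as the integral of \<open>exp (- v)\<close> over \<open>v \<ge> x powr a\<close> and interchanging the integrals.\<close>

lemma stretched_exponential_integral:
  assumes a: "0 < a" and c: "0 < c"
  shows "(\<integral>\<^sup>+x. ennreal (if 0 < x then x powr (a * c - 1) * exp (- (x powr a)) else 0) \<partial>lborel) = ennreal (Gamma c / a)"
proof -
  let ?k = "\<lambda>x. if 0 < x then x powr (a * c - 1) else (0::real)"
  have tail: "(\<integral>\<^sup>+v. ennreal (exp (- v)) * indicator {y..} v \<partial>lborel) = ennreal (exp (- y))" for y :: real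
  proof -
    have "((\<lambda>v::real. - exp (- v)) \<longlongrightarrow> 0) at_top" by real_asymp
    then have "(\<integral>\<^sup>+v. ennreal (exp (- v)) * indicator {y..} v \<partial>lborel) = 0 - (- exp (- y))"
      by (intro nn_integral_FTC_atLeast) (auto intro!: derivative_eq_intros)
    then show ?thesis by simp
  qed
  have "(\<integral>\<^sup>+x. ennreal (if 0 < x then x powr (a * c - 1) * exp (- (x powr a)) else 0) \<partial>lborel)
      = (\<integral>\<^sup>+x. \<integral>\<^sup>+v. ennreal (?k x) * (ennreal (exp (- v)) * indicator {x powr a..} v) \<partial>lborel \<partial>lborel)"
  proof (intro nn_integral_cong)
    fix x :: real
    have "(\<integral>\<^sup>+v. ennreal (?k x) * (ennreal (exp (- v)) * indicator {x powr a..} v) \<partial>lborel)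
      = ennreal (?k x) * (\<integral>\<^sup>+v. ennreal (exp (- v)) * indicator {x powr a..} v \<partial>lborel)"
      by (rule nn_integral_cmult) measurable
    then show "ennreal (if 0 < x then x powr (a * c - 1) * exp (- (x powr a)) else 0)
      = (\<integral>\<^sup>+v. ennreal (?k x) * (ennreal (exp (- v)) * indicator {x powr a..} v) \<partial>lborel)"
      unfolding tail by (auto simp: ennreal_mult')
  qed
  also have "\<dots> = (\<integral>\<^sup>+v. \<integral>\<^sup>+x. ennreal (?k x) * (ennreal (exp (- v)) * indicator {x powr a..} v) \<partial>lborel \<partial>lborel)"
  proof (rule lborel_pair.Fubini'[symmetric])
    have "(\<lambda>(x, v). indicator {x powr a..} v :: ennreal) = (\<lambda>p. indicator {p. fst p powr a \<le> snd p} p)"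
      by (auto simp: fun_eq_iff indicator_def)
    moreover have "{p \<in> space (borel \<Otimes>\<^sub>M (borel :: real measure)). fst p powr a \<le> snd p} \<in> sets (borel \<Otimes>\<^sub>M (borel :: real measure))"
      by measurable
    then have "{p. fst p powr a \<le> snd p} \<in> sets (borel \<Otimes>\<^sub>M (borel :: real measure))"
      by (simp add: space_pair_measure)
    ultimately have [measurable]: "(\<lambda>(x, v). indicator {x powr a..} v :: ennreal) \<in> borel_measurable (borel \<Otimes>\<^sub>M borel)"
      by simp
    show "case_prod (\<lambda>x v. ennreal (?k x) * (ennreal (exp (- v)) * indicator {x powr a..} v)) \<in> borel_measurable (lborel \<Otimes>\<^sub>M lborel)"
      by measurable
  qed
  also have "\<dots> = (\<integral>\<^sup>+v. ennreal (indicator {0..} v * v powr ((c + 1) - 1) / exp v) * ennreal (1 / (a * c)) \<partial>lborel)"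
  proof (intro nn_integral_cong)
    fix v :: real
    show "(\<integral>\<^sup>+x. ennreal (?k x) * (ennreal (exp (- v)) * indicator {x powr a..} v) \<partial>lborel)
      = ennreal (indicator {0..} v * v powr ((c + 1) - 1) / exp v) * ennreal (1 / (a * c))"
    proof (cases "0 \<le> v")
      case False
      then have "indicator {x powr a..} v = (0::ennreal)" for x by (auto simp: indicator_def dest: order_trans[OF powr_ge_zero])
      then show ?thesis using False by simp
    next
      case True
      let ?y = "v powr (1 / a)"
      have iff: "x powr a \<le> v \<longleftrightarrow> x \<le> ?y" if "0 < x" for x
      proof -
        have y: "?y powr a = v" using a True by (simp add: powr_powr)
        show ?thesis
        proof
          assume "x powr a \<le> v"
          then have "(x powr a) powr (1 / a) \<le> ?y" using a that by (intro powr_mono2) auto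
          then show "x \<le> ?y" using a that by (simp add: powr_powr)
        next
          assume "x \<le> ?y"
          then have "x powr a \<le> ?y powr a" using a that by (intro powr_mono2) auto
          then show "x powr a \<le> v" unfolding y .
        qed
      qed
      have "(\<integral>\<^sup>+x. ennreal (?k x) * (ennreal (exp (- v)) * indicator {x powr a..} v) \<partial>lborel)
        = (\<integral>\<^sup>+x. ennreal (exp (- v)) * (ennreal (x powr (a * c - 1)) * indicator {0..?y} x) \<partial>lborel)"
      proof (intro nn_integral_cong)
        fix x :: real
        show "ennreal (?k x) * (ennreal (exp (- v)) * indicator {x powr a..} v)
          = ennreal (exp (- v)) * (ennreal (x powr (a * c - 1)) * indicator {0..?y} x)"
          using iff[of x] by (cases "0 < x"; cases "x = 0") (auto simp: indicator_def mult.commute)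
      qed
      also have "\<dots> = ennreal (exp (- v)) * (\<integral>\<^sup>+x. ennreal (x powr (a * c - 1)) * indicator {0..?y} x \<partial>lborel)"
        by (rule nn_integral_cmult) measurable
      also have "(\<integral>\<^sup>+x. ennreal (x powr (a * c - 1)) * indicator {0..?y} x \<partial>lborel) = ennreal (?y powr ((a * c - 1) + 1) / ((a * c - 1) + 1))"
        using a c by (intro nn_integral_has_integral_lebesgue' has_integral_powr_from_0) auto
      also have "?y powr ((a * c - 1) + 1) = v powr c" using a by (simp add: powr_powr)
      finally show ?thesis using True a c
        by (simp add: ennreal_mult'[symmetric] ennreal_mult''[symmetric] exp_minus divide_inverse mult.commute mult.left_commute)
    qed
  qed
  also have "\<dots> = (\<integral>\<^sup>+v. ennreal (indicator {0..} v * v powr ((c + 1) - 1) / exp v) \<partial>lborel) * ennreal (1 / (a * c))"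
    by (rule nn_integral_multc) measurable
  also have "(\<integral>\<^sup>+v. ennreal (indicator {0..} v * v powr ((c + 1) - 1) / exp v) \<partial>lborel) = ennreal (Gamma (c + 1))"
    using c by (intro Gamma_conv_nn_integral_real[symmetric]) simp
  also have "Gamma (c + 1) = c * Gamma c"
    using c by (intro Gamma_plus1) (auto elim!: nonpos_Ints_cases)
  finally show ?thesis using a c Gamma_real_pos[OF c] by (simp add: ennreal_mult''[symmetric])
qed

section \<open>The one-sided stable law\<close>

text \<open>The distribution on the positive integers with generating function \<open>1 - (1 - z) powr a\<close>, named after
  Sibuya.\<close>

definition sibuya :: "real \<Rightarrow> nat \<Rightarrow> real" where
  "sibuya a n = (if n = 0 then 0 else (-1) ^ (n + 1) * (a gchoose n))"

lemma sibuya_nonneg: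
  assumes a: "0 < a" "a < 1" shows "0 \<le> sibuya a n"
proof (cases n)
  case (Suc m)
  have "sibuya a n = - (((-1) ^ n * (-1) ^ n) * pochhammer (- a) n / fact n)"
    unfolding sibuya_def gbinomial_pochhammer using Suc by (simp add: mult.assoc)
  also have "((-1) ^ n * (-1) ^ n :: real) = 1" by (simp flip: power_mult_distrib)
  also have "pochhammer (- a) n = - (a * pochhammer (1 - a) m)" unfolding Suc by (simp add: pochhammer_rec)
  finally have "sibuya a n = a * pochhammer (1 - a) m / fact n" by simp
  then show ?thesis using a by (simp add: pochhammer_nonneg)
qed (simp add: sibuya_def)

lemma sibuya_sums:
  assumes z: "0 \<le> z" "z < 1" shows "(\<lambda>n. sibuya a n * z ^ n) sums (1 - (1 - z) powr a)"
proof -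
  have "(\<lambda>n. (a gchoose n) * (- z) ^ n) sums (1 + - z) powr a" using z by (intro gen_binomial_real) simp
  then have "(\<lambda>n. (if n = 0 then 1 else 0) - (a gchoose n) * (- z) ^ n) sums (1 - (1 - z) powr a)"
    by (intro sums_diff) (auto intro: sums_single[of 0 "\<lambda>_. 1", simplified])
  also have "(\<lambda>n. (if n = 0 then 1 else 0) - (a gchoose n) * (- z) ^ n) = (\<lambda>n. sibuya a n * z ^ n)"
    by (auto simp: fun_eq_iff sibuya_def power_minus[of z])
  finally show ?thesis .
qed

text \<open>The coefficients are nonnegative, so one may let \<open>z\<close> tend to \<open>1\<close> in the power series.\<close>

lemma sibuya_sums_1:
  assumes a: "0 < a" "a < 1" shows "sibuya a sums 1"
proof -
  note nn = sibuya_nonneg[OF a]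
  have part: "(\<Sum>n<N. sibuya a n) \<le> 1" for N
  proof -
    have le: "(\<Sum>n<N. sibuya a n * z ^ n) \<le> 1" if z: "0 \<le> z" "z < 1" for z
    proof -
      have "(\<Sum>n<N. sibuya a n * z ^ n) \<le> (\<Sum>n. sibuya a n * z ^ n)"
        using sibuya_sums[OF z, of a] nn z by (intro sum_le_suminf) (auto simp: sums_iff)
      also have "\<dots> = 1 - (1 - z) powr a" using sibuya_sums[OF z, of a] by (simp add: sums_iff)
      finally show ?thesis by (smt (verit) powr_ge_zero)
    qed
    have "((\<lambda>z. \<Sum>n<N. sibuya a n * z ^ n) \<longlongrightarrow> (\<Sum>n<N. sibuya a n * 1 ^ n)) (at_left 1)"
      by (intro tendsto_intros)
    moreover have "\<forall>\<^sub>F z in at_left 1. (\<Sum>n<N. sibuya a n * z ^ n) \<le> 1"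
      by (rule eventually_at_leftI[of 0]) (use le in auto)
    ultimately show ?thesis by (intro tendsto_upperbound[where F="at_left (1::real)"]) auto
  qed
  have sm: "summable (sibuya a)" by (rule summableI_nonneg_bounded[OF nn part])
  have "(\<Sum>n. sibuya a n) \<le> 1" using part sm by (intro suminf_le_const) auto
  moreover have "1 \<le> (\<Sum>n. sibuya a n)"
  proof (rule tendsto_upperbound)
    show "((\<lambda>z. 1 - (1 - z) powr a) \<longlongrightarrow> 1) (at_left 1)"
    proof -
      have "((\<lambda>z::real. 1 - (1 - z) powr a) \<longlongrightarrow> 1 - 0 powr a) (at_left 1)"
        using a by (intro tendsto_diff tendsto_const tendsto_powr2) (auto intro!: tendsto_eq_intros eventually_at_leftI[of 0])
      then show ?thesis by simp
    qed
    show "\<forall>\<^sub>F z in at_left 1. 1 - (1 - z) powr a \<le> (\<Sum>n. sibuya a n)"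
    proof (rule eventually_at_leftI[of 0])
      fix z :: real assume "z \<in> {0<..<1}"
      then have z: "0 \<le> z" "z < 1" by auto
      have "1 - (1 - z) powr a = (\<Sum>n. sibuya a n * z ^ n)" using sibuya_sums[OF z, of a] by (simp add: sums_iff)
      also have "\<dots> \<le> (\<Sum>n. sibuya a n)"
        using sibuya_sums[OF z, of a] sm nn z by (intro suminf_le) (auto simp: sums_iff mult_left_le power_le_one)
      finally show "1 - (1 - z) powr a \<le> (\<Sum>n. sibuya a n)" .
    qed simp
  qed simp
  ultimately show ?thesis using sm by (simp add: sums_iff)
qed

definition sibuya_pmf :: "real \<Rightarrow> nat pmf" where
  "sibuya_pmf a = embed_pmf (sibuya a)"

primrec sibuya_sum_pmf :: "real \<Rightarrow> nat \<Rightarrow> nat pmf" where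
  "sibuya_sum_pmf a 0 = return_pmf 0"
| "sibuya_sum_pmf a (Suc k) = map_pmf (\<lambda>(x, y). x + y) (pair_pmf (sibuya_sum_pmf a k) (sibuya_pmf a))"

lemma sibuya_pgf:
  assumes a: "0 < a" "a < 1" and z: "0 \<le> z" "z < 1"
  shows "(\<integral>\<^sup>+n. ennreal (z ^ n) \<partial>sibuya_pmf a) = ennreal (1 - (1 - z) powr a)"
proof -
  note nn = sibuya_nonneg[OF a]
  have one: "(\<integral>\<^sup>+n. ennreal (sibuya a n) \<partial>count_space UNIV) = 1"
    using sibuya_sums_1[OF a] nn by (simp add: nn_integral_count_space_nat suminf_ennreal2 sums_iff)
  have pmf: "pmf (sibuya_pmf a) n = sibuya a n" for n
    unfolding sibuya_pmf_def by (rule pmf_embed_pmf[OF nn one])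
  have "(\<integral>\<^sup>+n. ennreal (z ^ n) \<partial>sibuya_pmf a) = (\<integral>\<^sup>+n. ennreal (sibuya a n) * ennreal (z ^ n) \<partial>count_space UNIV)"
    by (subst nn_integral_measure_pmf) (simp add: pmf)
  also have "\<dots> = (\<Sum>n. ennreal (sibuya a n * z ^ n))"
    using nn by (simp add: nn_integral_count_space_nat ennreal_mult')
  also have "\<dots> = ennreal (\<Sum>n. sibuya a n * z ^ n)"
    using nn z sibuya_sums[OF z, of a] by (intro suminf_ennreal2) (auto simp: sums_iff)
  finally show ?thesis using sibuya_sums[OF z, of a] by (simp add: sums_iff)
qed

lemma sibuya_sum_pgf:
  assumes a: "0 < a" "a < 1" and z: "0 \<le> z" "z < 1"
  shows "(\<integral>\<^sup>+n. ennreal (z ^ n) \<partial>sibuya_sum_pmf a k) = ennreal ((1 - (1 - z) powr a) ^ k)"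
proof (induction k)
  case (Suc k)
  have nn: "0 \<le> 1 - (1 - z) powr a" using z a powr_le_one_le[of "1 - z" a] by (simp add: powr_le1)
  have "(\<integral>\<^sup>+n. ennreal (z ^ n) \<partial>sibuya_sum_pmf a (Suc k))
      = (\<integral>\<^sup>+x. \<integral>\<^sup>+y. ennreal (z ^ x) * ennreal (z ^ y) \<partial>sibuya_pmf a \<partial>sibuya_sum_pmf a k)"
    using z by (simp add: nn_integral_pair_pmf' power_add ennreal_mult')
  also have "\<dots> = (\<integral>\<^sup>+x. ennreal (z ^ x) * ennreal (1 - (1 - z) powr a) \<partial>sibuya_sum_pmf a k)"
    by (simp add: nn_integral_cmult sibuya_pgf[OF a z])
  also have "\<dots> = ennreal ((1 - (1 - z) powr a) ^ k) * ennreal (1 - (1 - z) powr a)"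
    by (simp add: nn_integral_multc Suc)
  finally show ?case using nn by (simp add: ennreal_mult'[symmetric] mult.commute)
qed simp

text \<open>The sequence consists of the Laplace transforms, at \<open>l\<close>, of the sums of \<open>k + 1\<close> independent Sibuya
  variables divided by \<open>(k + 1) powr (1 / a)\<close>.\<close>

lemma stable_laplace_limit:
  assumes a: "0 < a" "a < 1" and l: "0 < (l::real)"
  shows "(\<lambda>k. (1 - (1 - exp (- (l / real (Suc k) powr (1 / a)))) powr a) ^ Suc k) \<longlonglongrightarrow> exp (- (l powr a))"
proof -
  define N where "N k = real (Suc k) powr (1 / a)" for k
  have N: "0 < N k" "N k powr a = real (Suc k)" for k using a by (simp_all add: N_def powr_powr)
  have Ninf: "filterlim N at_top sequentially"
    unfolding N_def using a by real_asymp
  define u where "u k = (1 - exp (- (l / N k))) powr a" for k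
  have e: "0 < 1 - exp (- (l / N k))" "1 - exp (- (l / N k)) < 1" for k using l N(1)[of k] by auto
  have u: "0 < u k" "u k < 1" for k
    using e[of k] a powr_less_mono2[of a "1 - exp (- (l / N k))" 1] by (auto simp: u_def)
  have ku: "(\<lambda>k. real (Suc k) * u k) \<longlonglongrightarrow> l powr a"
  proof -
    have "((\<lambda>x. x * (1 - exp (- (l / x)))) \<longlongrightarrow> l) at_top" by real_asymp
    then have "(\<lambda>k. N k * (1 - exp (- (l / N k)))) \<longlonglongrightarrow> l" by (rule filterlim_compose[OF _ Ninf])
    then have "(\<lambda>k. (N k * (1 - exp (- (l / N k)))) powr a) \<longlonglongrightarrow> l powr a" using l by (intro tendsto_intros) auto
    moreover have "(N k * (1 - exp (- (l / N k)))) powr a = real (Suc k) * u k" for k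
      using N[of k] e[of k] by (simp add: powr_mult u_def)
    ultimately show ?thesis by simp
  qed
  have u0: "u \<longlonglongrightarrow> 0"
  proof -
    have "(\<lambda>k. (real (Suc k) * u k) * inverse (real (Suc k))) \<longlonglongrightarrow> l powr a * 0"
      by (intro tendsto_mult ku LIMSEQ_inverse_real_of_nat)
    moreover have "(\<lambda>k. (real (Suc k) * u k) * inverse (real (Suc k))) = u" by (simp add: fun_eq_iff del: of_nat_Suc)
    ultimately show ?thesis by (simp only: mult_zero_right)
  qed
  have "((\<lambda>x::real. ln (1 - x) / x) \<longlongrightarrow> -1) (at 0)" by real_asymp
  then have "(\<lambda>k. ln (1 - u k) / u k) \<longlonglongrightarrow> -1"
    by (rule filterlim_compose) (use u0 u(1) in \<open>auto simp: filterlim_at intro!: always_eventually less_imp_neq[THEN not_sym]\<close>)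
  then have "(\<lambda>k. exp ((real (Suc k) * u k) * (ln (1 - u k) / u k))) \<longlonglongrightarrow> exp (l powr a * -1)"
    by (intro tendsto_intros ku)
  moreover have "exp ((real (Suc k) * u k) * (ln (1 - u k) / u k)) = (1 - u k) ^ Suc k" for k
  proof -
    have "exp ((real (Suc k) * u k) * (ln (1 - u k) / u k)) = exp (real (Suc k) * ln (1 - u k))" using u(1)[of k] by simp
    also have "\<dots> = (1 - u k) ^ Suc k" using u(2)[of k] by (subst exp_of_nat_mult) simp
    finally show ?thesis .
  qed
  ultimately show ?thesis unfolding u_def N_def by simp
qed

text \<open>The stable law is the limit law of normalised sums of Sibuya variables. To have a compact space, the
  limit is taken on the unit interval after the substitution \<open>y = exp (- x)\<close>; there \<open>c\<close> is only a
  truncation that makes all functions bounded and continuous on the whole line.\<close>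

lemma stable_law_exists:
  assumes a: "0 < a" "a < 1"
  obtains \<mu> where "prob_space \<mu>" "sets \<mu> = sets borel" "AE x in \<mu>. 0 \<le> x"
    "\<And>l. 0 < l \<Longrightarrow> laplace \<mu> l = ennreal (exp (- (l powr a)))"
proof -
  define y where "y k n = exp (- (real n / real (Suc k) powr (1 / a)))" for k n :: nat
  define \<nu> where "\<nu> k = distr (measure_pmf (sibuya_sum_pmf a (Suc k))) borel (y k)" for k
  have y01: "y k n \<in> {0..1}" for k n by (simp add: y_def)
  have ymeas: "y k \<in> borel_measurable (measure_pmf p)" for k p by simp
  have rd: "real_distribution (\<nu> k)" for k
    unfolding \<nu>_def by (intro prob_space.real_distribution_distr measure_pmf.prob_space_axioms ymeas)
  have supp: "AE x in \<nu> k. x \<in> {0..1}" for k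
    unfolding \<nu>_def using y01 by (subst AE_distr_iff[OF ymeas]) auto
  have meas01: "{x. 0 \<le> x \<and> x \<le> (1::real)} \<in> sets borel" by measurable
  obtain s M where s: "strict_mono (s :: nat \<Rightarrow> nat)" and M: "real_distribution M"
    and conv: "\<forall>f B. continuous_on UNIV f \<longrightarrow> (\<forall>x. \<bar>f x\<bar> \<le> (B::real)) \<longrightarrow> (\<lambda>j. \<integral>x. f x \<partial>\<nu> (s j)) \<longlonglongrightarrow> (\<integral>x. f x \<partial>M)"
    by (rule unit_interval_compact[of \<nu>, OF rd supp]) (rule that)
  interpret M: real_distribution M by (rule M)
  define c where "c x = max 0 (min 1 x)" for x :: real
  have c: "0 \<le> c x" "c x \<le> 1" for x unfolding c_def by auto
  have c_cont: "continuous_on UNIV c" unfolding c_def by (intro continuous_intros)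
  have cm[measurable]: "c \<in> borel_measurable borel" unfolding c_def[abs_def] by measurable
  have cont: "continuous_on UNIV (\<lambda>x. c x powr l)" if "0 < l" for l
    using that c by (intro continuous_on_powr' continuous_intros c_cont) auto
  have bnd: "\<bar>c x powr l\<bar> \<le> 1" if "0 < l" for x l using that c[of x] by (simp add: powr_le1)
  have int\<nu>: "(\<integral>x. c x powr l \<partial>\<nu> k) = (1 - (1 - exp (- (l / real (Suc k) powr (1 / a)))) powr a) ^ Suc k" if l: "0 < l" for l k
  proof -
    let ?z = "exp (- (l / real (Suc k) powr (1 / a)))"
    have z: "0 \<le> ?z" "?z < 1" using l by auto
    have nn: "0 \<le> (1 - (1 - ?z) powr a) ^ Suc k" using z a by (intro zero_le_power) (simp add: powr_le1)
    have cy: "c (y k n) powr l = ?z ^ n" for n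
      using y01[of k n] by (simp add: c_def y_def powr_def exp_of_nat_mult[symmetric])
    have "(\<integral>x. c x powr l \<partial>\<nu> k) = (\<integral>n. ?z ^ n \<partial>sibuya_sum_pmf a (Suc k))"
      unfolding \<nu>_def by (subst integral_distr) (auto simp: cy simp del: sibuya_sum_pmf.simps)
    also have "\<dots> = enn2real (\<integral>\<^sup>+n. ennreal (?z ^ n) \<partial>sibuya_sum_pmf a (Suc k))"
      by (rule integral_eq_nn_integral) auto
    also have "\<dots> = (1 - (1 - ?z) powr a) ^ Suc k"
      unfolding sibuya_sum_pgf[OF a z] using nn by (rule enn2real_ennreal)
    finally show ?thesis .
  qed
  have intM: "(\<integral>x. c x powr l \<partial>M) = exp (- (l powr a))" if l: "0 < l" for l
  proof (rule LIMSEQ_unique)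
    show "(\<lambda>j. \<integral>x. c x powr l \<partial>\<nu> (s j)) \<longlonglongrightarrow> (\<integral>x. c x powr l \<partial>M)"
      using conv cont[OF l] bnd[OF l] by blast
    show "(\<lambda>j. \<integral>x. c x powr l \<partial>\<nu> (s j)) \<longlonglongrightarrow> exp (- (l powr a))"
      unfolding int\<nu>[OF l] using LIMSEQ_subseq_LIMSEQ[OF stable_laplace_limit[OF a l] s] by (simp add: o_def)
  qed
  \<comment> \<open>letting \<open>l\<close> tend to \<open>0\<close>: no mass escapes to infinity\<close>
  have pos: "AE x in M. 0 < c x"
  proof -
    have "(\<lambda>n. \<integral>x. c x powr inverse (real (Suc n)) \<partial>M) \<longlonglongrightarrow> (\<integral>x. indicator {x. 0 < c x} x \<partial>M)"
    proof (rule integral_dominated_convergence[where w="\<lambda>_. 1"])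
      show "AE x in M. (\<lambda>n. c x powr inverse (real (Suc n))) \<longlonglongrightarrow> indicator {x. 0 < c x} x"
      proof (rule AE_I2)
        fix x
        show "(\<lambda>n. c x powr inverse (real (Suc n))) \<longlonglongrightarrow> indicator {x. 0 < c x} x"
        proof (cases "0 < c x")
          case True
          have "(\<lambda>n. c x powr inverse (real (Suc n))) \<longlonglongrightarrow> c x powr 0"
            using True by (intro tendsto_powr tendsto_const LIMSEQ_inverse_real_of_nat) auto
          then show ?thesis using True by simp
        next
          case False
          then have "c x = 0" using c[of x] by simp
          then show ?thesis by simp
        qed
      qed
      show "AE x in M. norm (c x powr inverse (real (Suc n))) \<le> 1" for n
        using bnd[of "inverse (real (Suc n))"] by (intro AE_I2) simp
    qed (use cm in \<open>auto intro!: borel_measurable_indicator\<close>)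
    moreover have "(\<lambda>n. \<integral>x. c x powr inverse (real (Suc n)) \<partial>M) \<longlonglongrightarrow> 1"
    proof -
      have "(\<lambda>n. exp (- (inverse (real (Suc n)) powr a))) \<longlonglongrightarrow> exp (- (0 powr a))"
        using a by (intro tendsto_intros tendsto_powr2 LIMSEQ_inverse_real_of_nat) auto
      then show ?thesis by (simp add: intM)
    qed
    ultimately have "(\<integral>x. indicator {x. 0 < c x} x \<partial>M) = (1::real)" by (rule LIMSEQ_unique)
    moreover have "{x. 0 < c x} \<in> sets borel" by measurable
    ultimately have "M.prob {x. 0 < c x} = 1" by simp
    then show ?thesis by (subst (asm) M.prob_eq_1) auto
  qed
  define \<mu> where "\<mu> = distr M borel (\<lambda>x. - ln (c x))"
  have [measurable]: "(\<lambda>x. - ln (c x)) \<in> borel_measurable M" by measurable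
  show ?thesis
  proof (rule that[of \<mu>])
    show "prob_space \<mu>" unfolding \<mu>_def by (rule M.prob_space_distr) measurable
    show "sets \<mu> = sets borel" by (simp add: \<mu>_def)
    show "AE x in \<mu>. 0 \<le> x"
      unfolding \<mu>_def using pos c(2) by (subst AE_distr_iff) (auto elim!: eventually_mono)
    show "laplace \<mu> l = ennreal (exp (- (l powr a)))" if l: "0 < l" for l
    proof -
      have "laplace \<mu> l = (\<integral>\<^sup>+x. ennreal (exp (- (l * (- ln (c x))))) \<partial>M)"
        unfolding laplace_def \<mu>_def by (rule nn_integral_distr) measurable
      also have "\<dots> = (\<integral>\<^sup>+x. ennreal (c x powr l) \<partial>M)"
        using pos by (intro nn_integral_cong_AE) (auto elim!: eventually_mono simp: powr_def)
      also have "\<dots> = ennreal (\<integral>x. c x powr l \<partial>M)"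
        using bnd[OF l] by (intro nn_integral_eq_integral M.integrable_const_bound[where B=1]) auto
      finally show ?thesis unfolding intM[OF l] .
    qed
  qed
qed

lemma continuous_AE_eq:
  fixes f g :: "real \<Rightarrow> real"
  assumes cont: "continuous_on {0<..} f" "continuous_on {0<..} g"
    and ae: "AE x in lborel. f x = g x" and x: "0 < x"
  shows "f x = g x"
proof (rule ccontr)
  assume ne: "f x \<noteq> g x"
  let ?S = "{x \<in> {0<..}. f x - g x \<in> - {0}}"
  have "open ?S"
    by (rule continuous_open_preimage[of "{0<..}" "\<lambda>x. f x - g x" "- {0}", unfolded vimage_def Int_def, simplified mem_Collect_eq])
       (intro continuous_intros cont, auto)
  moreover have "x \<in> ?S" using x ne by simp
  moreover have "negligible ?S"
  proof -
    obtain N where N: "{x \<in> space lborel. \<not> f x = g x} \<subseteq> N" "N \<in> null_sets lborel"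
      using ae unfolding eventually_ae_filter by auto
    have "N \<in> null_sets lebesgue" using N(2) by (rule null_sets_completionI)
    then have "negligible N" by (simp add: negligible_iff_null_sets)
    then show ?thesis by (rule negligible_subset) (use N(1) in auto)
  qed
  ultimately show False using open_not_negligible by blast
qed

lemma laplace_density:
  assumes "f \<in> borel_measurable borel"
  shows "laplace (density lborel f) l = (\<integral>\<^sup>+x. f x * ennreal (exp (- (l * x))) \<partial>lborel)"
  unfolding laplace_def using assms by (intro nn_integral_density) auto

lemma laplace_determines_continuous:
  fixes f g :: "real \<Rightarrow> real"
  assumes f: "f \<in> borel_measurable borel" "\<And>x. 0 \<le> f x" "\<And>x. x \<le> 0 \<Longrightarrow> f x = 0" "continuous_on {0<..} f"
    and g: "g \<in> borel_measurable borel" "\<And>x. 0 \<le> g x" "\<And>x. x \<le> 0 \<Longrightarrow> g x = 0" "continuous_on {0<..} g"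
    and eq: "\<And>l. 0 < l \<Longrightarrow> laplace (density lborel f) l = laplace (density lborel g) l"
    and fin: "\<And>l. 0 < l \<Longrightarrow> laplace (density lborel f) l < \<infinity>"
  shows "f x = g x"
proof (cases "0 < x")
  case True
  have [measurable]: "f \<in> borel_measurable borel" "g \<in> borel_measurable borel" by fact+
  have ae: "AE x in density lborel (\<lambda>x. ennreal (h x)). 0 \<le> x" if [measurable]: "h \<in> borel_measurable borel" and h0: "\<And>x. x \<le> 0 \<Longrightarrow> h x = 0" for h :: "real \<Rightarrow> real"
  proof (subst AE_density)
    have "0 \<le> x" if "0 < ennreal (h x)" for x
    proof (rule ccontr)
      assume "\<not> 0 \<le> x"
      then have "h x = 0" using h0[of x] by simp
      then show False using that by simp
    qed
    then show "AE x in lborel. 0 < ennreal (h x) \<longrightarrow> 0 \<le> x" by (intro AE_I2) blast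
  qed simp
  have "density lborel (\<lambda>x. ennreal (f x)) = density lborel (\<lambda>x. ennreal (g x))"
    by (rule laplace_unique[OF _ ae[OF f(1,3)] _ ae[OF g(1,3)] eq fin]) auto
  then have "AE x in lborel. ennreal (f x) = ennreal (g x)"
    by (subst (asm) sigma_finite_measure.density_unique_iff[OF sigma_finite_lborel]) auto
  then have "AE x in lborel. f x = g x" using f(2) g(2) by (auto elim!: eventually_mono simp: ennreal_inj)
  then show ?thesis by (rule continuous_AE_eq[OF f(4) g(4) _ True])
qed (use f(3) g(3) in simp)

subsection \<open>The stable density\<close>

lemma power_kernel_le:
  assumes b: "1 < b" and x: "x \<le> X" and X: "0 < X"
  shows "power_kernel b x \<le> X powr (b - 1) / Gamma b"
  using assms Gamma_real_pos[of b] by (auto simp: power_kernel_def intro!: divide_right_mono powr_mono2 divide_nonneg_pos)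

lemma power_kernel_isCont: "1 < b \<Longrightarrow> isCont (power_kernel b) x"
proof -
  assume b: "1 < b"
  have e: "power_kernel b = (\<lambda>x. max 0 x powr (b - 1) / Gamma b)"
    using b by (auto simp: power_kernel_def fun_eq_iff max_def)
  have "continuous_on UNIV (\<lambda>x::real. max 0 x powr (b - 1) / Gamma b)"
  proof (intro continuous_on_divide continuous_on_powr' continuous_on_max continuous_on_const continuous_on_id ballI)
    have "0 < Gamma b" using b by (intro Gamma_real_pos) simp
    then show "Gamma b \<noteq> 0" by simp
  qed (use b in auto)
  then show ?thesis unfolding e by (simp add: continuous_on_eq_continuous_at)
qed

text \<open>For an order above \<open>1\<close> the kernel is continuous and locally bounded, so the fractional integral of a
  probability measure is a continuous function. The last inequality controls it near \<open>0\<close>.\<close>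

lemma real_frac_integral:
  assumes \<mu>: "prob_space \<mu>" "sets \<mu> = sets borel" "AE u in \<mu>. 0 \<le> u" and b: "1 < b"
  defines "R \<equiv> (\<lambda>x. \<integral>u. power_kernel b (x - u) \<partial>\<mu>)"
  shows "frac_integral b \<mu> x = ennreal (R x)" "0 \<le> R x" "x \<le> 0 \<Longrightarrow> R x = 0" "isCont R x"
    "0 < x \<Longrightarrow> R x \<le> x powr (b - 1) / Gamma b * measure \<mu> {..x}"
proof -
  interpret prob_space \<mu> by fact
  have [measurable_cong]: "sets \<mu> = sets borel" by fact
  have b0: "0 < b" using b by simp
  have bound: "AE u in \<mu>. norm (power_kernel b (y - u)) \<le> X powr (b - 1) / Gamma b" if "y \<le> X" "0 < X" for y X
    using \<mu>(3) by eventually_elim (use power_kernel_le[OF b _ that(2)] power_kernel_nonneg[OF b0] that(1) in auto)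
  have int: "integrable \<mu> (\<lambda>u. power_kernel b (y - u))" for y
    using bound[of y "max 1 y"] by (intro integrable_const_bound[where B="max 1 y powr (b - 1) / Gamma b"]) auto
  show "frac_integral b \<mu> x = ennreal (R x)"
    unfolding frac_integral_def R_def using int power_kernel_nonneg[OF b0] by (intro nn_integral_eq_integral) auto
  show "0 \<le> R x" unfolding R_def using power_kernel_nonneg[OF b0] by (intro Bochner_Integration.integral_nonneg) auto
  show "R x = 0" if "x \<le> 0"
  proof -
    have "AE u in \<mu>. power_kernel b (x - u) = 0"
      using \<mu>(3) by eventually_elim (use that in \<open>simp add: power_kernel_def\<close>)
    then show ?thesis unfolding R_def by (rule integral_eq_zero_AE)
  qed
  show "isCont R x"
    unfolding continuous_at_sequentially
  proof (intro allI impI)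
    fix y :: "nat \<Rightarrow> real" assume y: "y \<longlonglongrightarrow> x"
    then have "bounded (range y)" by (rule convergent_imp_bounded)
    then obtain X where X: "\<And>n. norm (y n) \<le> X" "0 < X" unfolding bounded_pos by auto
    have yX: "y n \<le> X" for n using X(1)[of n] by simp
    show "(R \<circ> y) \<longlonglongrightarrow> R x"
      unfolding R_def o_def
    proof (rule integral_dominated_convergence[where w="\<lambda>_. X powr (b - 1) / Gamma b"])
      show "AE u in \<mu>. (\<lambda>n. power_kernel b (y n - u)) \<longlonglongrightarrow> power_kernel b (x - u)"
        using y by (intro AE_I2 isCont_tendsto_compose[OF power_kernel_isCont[OF b]] tendsto_intros)
      show "AE u in \<mu>. norm (power_kernel b (y n - u)) \<le> X powr (b - 1) / Gamma b" for n
        using bound[OF yX X(2)] .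
    qed auto
  qed
  show "R x \<le> x powr (b - 1) / Gamma b * measure \<mu> {..x}" if x: "0 < x"
  proof -
    have "R x \<le> (\<integral>u. x powr (b - 1) / Gamma b * indicator {..x} u \<partial>\<mu>)"
      unfolding R_def
    proof (rule integral_mono_AE[OF int])
      show "integrable \<mu> (\<lambda>u. x powr (b - 1) / Gamma b * indicator {..x} u)" by (intro integrable_mult_right integrable_real_indicator) (auto simp: less_top[symmetric])
      show "AE u in \<mu>. power_kernel b (x - u) \<le> x powr (b - 1) / Gamma b * indicator {..x} u"
        using bound[OF order_refl x]
      proof eventually_elim
        case (elim u)
        then show ?case by (cases "u \<le> x") (auto simp: power_kernel_def)
      qed
    qed
    also have "\<dots> = x powr (b - 1) / Gamma b * measure \<mu> {..x}" by simp
    finally show ?thesis .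
  qed
qed

text \<open>Multiplying the stable law \<open>n\<close> times by \<open>x\<close> gives a combination of its fractional integrals, with the
  same coefficients \<open>S n k\<close> as for the numbers of blocks of a Gibbs partition of type \<open>a\<close>: on the
  side of Laplace transforms this is repeated differentiation of \<open>exp (- (l powr a))\<close>. For large \<open>n\<close>
  all orders \<open>n - k a\<close> exceed \<open>1\<close>, and the combination has a continuous density \<open>F\<close>; then \<open>F x / x
  ^ n\<close> is the stable density.\<close>

lemma stable_density_exists:
  assumes a: "0 < a" "a < 1"
  obtains f where "\<And>x. x \<le> 0 \<Longrightarrow> f x = 0" "\<And>x. 0 \<le> f x" "continuous_on UNIV f"
    "\<And>l. 0 < l \<Longrightarrow> laplace (density lborel (\<lambda>x. ennreal (f x))) l = ennreal (exp (- (l powr a)))"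
    "(\<integral>\<^sup>+x. ennreal (f x) \<partial>lborel) = 1"
proof -
  obtain \<mu> where \<mu>: "prob_space \<mu>" "sets \<mu> = sets borel" "AE x in \<mu>. 0 \<le> x"
    and lap: "\<And>l. 0 < l \<Longrightarrow> laplace \<mu> l = ennreal (exp (- (l powr a)))"
    by (rule stable_law_exists[OF a]) (rule that)
  have [measurable_cong]: "sets \<mu> = sets borel" by (rule \<mu>(2))
  interpret \<mu>: prob_space \<mu> by (rule \<mu>(1))
  have sf: "sigma_finite_measure \<mu>" by unfold_locales
  interpret gibbs_chain "gibbs_step (ereal a)" using a by (intro gibbs_step_chain) (simp add: one_ereal_def)
  have step: "gibbs_step (ereal a) n k = real n - a * real k" for n k by (simp add: gibbs_step_def)
  define G where "G n l = (\<Sum>k=1..n. S n k * (a ^ k * l powr (real k * a - real n))) * exp (- (l powr a))" for n l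
  have G_nn: "0 \<le> G n l" for n l
    unfolding G_def using S_nonneg a by (intro mult_nonneg_nonneg sum_nonneg) auto
  have G_der: "(G n has_real_derivative - G (Suc n) l) (at l)" if n: "1 \<le> n" and l: "0 < l" for n l
  proof -
    have "(G n has_real_derivative
        (\<Sum>k=1..n. S n k * (a ^ k * ((real k * a - real n) * l powr (real k * a - real n - 1)))) * exp (- (l powr a))
        + (\<Sum>k=1..n. S n k * (a ^ k * l powr (real k * a - real n))) * (exp (- (l powr a)) * - (a * l powr (a - 1)))) (at l)"
      unfolding G_def[abs_def] using l by (auto intro!: derivative_eq_intros sum.cong)
    also have "(\<Sum>k=1..n. S n k * (a ^ k * ((real k * a - real n) * l powr (real k * a - real n - 1)))) * exp (- (l powr a))
        + (\<Sum>k=1..n. S n k * (a ^ k * l powr (real k * a - real n))) * (exp (- (l powr a)) * - (a * l powr (a - 1)))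
      = - ((\<Sum>k=1..n. S n k * ((real n - a * real k) * (a ^ k * l powr (real k * a - real (Suc n)))
            + a ^ Suc k * l powr (real (Suc k) * a - real (Suc n)))) * exp (- (l powr a)))"
    proof -
      have p: "l powr (real k * a - real n) * l powr (a - 1) = l powr (real (Suc k) * a - real (Suc n))" for k
        unfolding powr_add[symmetric] by (rule arg_cong[where f="\<lambda>x. l powr x"]) (simp add: algebra_simps)
      have q: "l powr (real k * a - real n - 1) = l powr (real k * a - real (Suc n))" for k
        by (rule arg_cong[where f="\<lambda>x. l powr x"]) simp
      have gen: "X * e + Y * (e * - z) = - (W * e)" if "X + Y * - z = - W" for X Y W e z :: real
      proof -
        have "X * e + Y * (e * - z) = (X + Y * - z) * e" by (simp add: algebra_simps)
        then show ?thesis unfolding that by simp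
      qed
      have "(\<Sum>k=1..n. S n k * (a ^ k * ((real k * a - real n) * l powr (real k * a - real n - 1))))
          + (\<Sum>k=1..n. S n k * (a ^ k * l powr (real k * a - real n))) * - (a * l powr (a - 1))
        = - (\<Sum>k=1..n. S n k * ((real n - a * real k) * (a ^ k * l powr (real k * a - real (Suc n)))
            + a ^ Suc k * l powr (real (Suc k) * a - real (Suc n))))"
        unfolding q p[symmetric] sum_distrib_right sum.distrib[symmetric] sum_negf[symmetric]
        by (intro sum.cong refl) (simp add: algebra_simps)
      then show ?thesis by (rule gen)
    qed
    also have "\<dots> = - G (Suc n) l"
      unfolding G_def S_sum_Suc[OF n] step by simp
    finally show ?thesis .
  qed
  define M where "M n = density \<mu> (\<lambda>x. ennreal x ^ n)" for n
  have M_sets: "sets (M n) = sets borel" for n by (simp add: M_def \<mu>(2))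
  have M_AE: "AE x in M n. 0 \<le> x" for n
    unfolding M_def using \<mu>(3) by (subst AE_density) (auto elim!: eventually_mono)
  have M_Suc: "M (Suc n) = density (M n) (\<lambda>x. ennreal x)" for n
    unfolding M_def by (subst density_density_eq) (auto simp: mult.commute)
  have lapM: "laplace (M n) l = ennreal (G n l)" if "1 \<le> n" "0 < l" for n l
    using that
  proof (induction n arbitrary: l rule: dec_induct)
    case base
    have M1: "M 1 = density \<mu> (\<lambda>x. ennreal x)" by (simp add: M_def)
    have "((\<lambda>l. exp (- (l powr a))) has_real_derivative - G 1 l) (at l)"
      using base by (auto intro!: derivative_eq_intros simp: G_def algebra_simps)
    then show ?case unfolding M1 by (intro laplace_derivative[OF \<mu>(2,3) lap]) (use base in auto)
  next
    case (step n)
    show ?case unfolding M_Suc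
      by (rule laplace_derivative[OF M_sets M_AE step.IH G_nn G_der[OF step(1)]]) (use step in auto)
  qed
  obtain n :: nat where n: "1 < real n * (1 - a)"
  proof -
    obtain n :: nat where "1 / (1 - a) < real n" using reals_Archimedean2 by blast
    then show ?thesis using that[of n] a by (simp add: field_simps)
  qed
  have n1: "1 \<le> n" using n by (cases n) auto
  have ord: "1 < real n - real k * a" if "k \<in> {1..n}" for k
  proof -
    have "real k * a \<le> real n * a" using that a by (intro mult_right_mono) auto
    then show ?thesis using n by (simp add: algebra_simps)
  qed
  define R where "R b x = (\<integral>u. power_kernel b (x - u) \<partial>\<mu>)" for b x
  note R = real_frac_integral[OF \<mu>, folded R_def]
  define F where "F x = (\<Sum>k=1..n. S n k * a ^ k * R (real n - real k * a) x)" for x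
  have co: "0 \<le> S n k * a ^ k" for k using S_nonneg a by simp
  have F_nn: "0 \<le> F x" for x unfolding F_def using R(2)[OF ord] by (intro sum_nonneg mult_nonneg_nonneg[OF co]) auto
  have F_0: "F x = 0" if "x \<le> 0" for x unfolding F_def using R(3)[OF ord that] by (intro sum.neutral) auto
  have F_cont: "isCont F x" for x unfolding F_def[abs_def] using R(4)[OF ord] by (intro continuous_intros) auto
  have F_meas[measurable]: "F \<in> borel_measurable borel"
    using F_cont by (intro borel_measurable_continuous_onI) (simp add: continuous_on_eq_continuous_at)
  have F_eq: "ennreal (F x) = (\<Sum>k=1..n. ennreal (S n k * a ^ k) * frac_integral (real n - real k * a) \<mu> x)" for x
  proof -
    have "(\<Sum>k=1..n. ennreal (S n k * a ^ k) * frac_integral (real n - real k * a) \<mu> x)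
        = (\<Sum>k=1..n. ennreal (S n k * a ^ k * R (real n - real k * a) x))"
    proof (intro sum.cong refl)
      fix k assume k: "k \<in> {1..n}"
      show "ennreal (S n k * a ^ k) * frac_integral (real n - real k * a) \<mu> x = ennreal (S n k * a ^ k * R (real n - real k * a) x)"
        using R(1)[OF ord[OF k], of x] ennreal_mult'[OF co, of k "R (real n - real k * a) x"] by simp
    qed
    also have "\<dots> = ennreal (F x)"
      unfolding F_def using R(2)[OF ord] by (intro sum_ennreal mult_nonneg_nonneg[OF co]) auto
    finally show ?thesis by simp
  qed
  have lapF: "laplace (density lborel (\<lambda>x. ennreal (F x))) l = ennreal (G n l)" if l: "0 < l" for l
  proof -
    note [measurable] = frac_integral_measurable[OF sf \<mu>(2)]
    have "laplace (density lborel (\<lambda>x. ennreal (F x))) l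
       = (\<integral>\<^sup>+x. (\<Sum>k=1..n. ennreal (S n k * a ^ k) * (frac_integral (real n - real k * a) \<mu> x * ennreal (exp (- (l * x))))) \<partial>lborel)"
      by (subst laplace_density) (auto simp: F_eq sum_distrib_right mult.assoc)
    also have "\<dots> = (\<Sum>k=1..n. ennreal (S n k * a ^ k) * laplace (density lborel (frac_integral (real n - real k * a) \<mu>)) l)"
      by (subst nn_integral_sum) (auto simp: nn_integral_cmult laplace_density)
    also have "\<dots> = (\<Sum>k=1..n. ennreal (S n k * (a ^ k * l powr (real k * a - real n)) * exp (- (l powr a))))"
    proof (intro sum.cong refl)
      fix k assume k: "k \<in> {1..n}"
      have "0 < real n - real k * a" using ord[OF k] by simp
      then have "laplace (density lborel (frac_integral (real n - real k * a) \<mu>)) l = ennreal (l powr - (real n - real k * a)) * ennreal (exp (- (l powr a)))"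
        by (simp add: laplace_frac_integral[OF sf \<mu>(2) _ l] lap[OF l])
      then show "ennreal (S n k * a ^ k) * laplace (density lborel (frac_integral (real n - real k * a) \<mu>)) l
          = ennreal (S n k * (a ^ k * l powr (real k * a - real n)) * exp (- (l powr a)))"
        using co[of k] by (simp add: ennreal_mult'[symmetric] mult.assoc)
    qed
    also have "\<dots> = ennreal (G n l)"
      unfolding G_def sum_distrib_right using S_nonneg a by (intro sum_ennreal) auto
    finally show ?thesis .
  qed
  have MF: "M n = density lborel (\<lambda>x. ennreal (F x))"
  proof (rule laplace_unique[OF M_sets M_AE])
    show "AE x in density lborel (\<lambda>x. ennreal (F x)). 0 \<le> x"
    proof (subst AE_density)
      have "0 \<le> x" if "0 < ennreal (F x)" for x using F_0[of x] that by (cases "0 \<le> x") auto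
      then show "AE x in lborel. 0 < ennreal (F x) \<longrightarrow> 0 \<le> x" by (intro AE_I2) blast
    qed simp
  qed (use lapM[OF n1] lapF in auto)
  define f where "f x = (if 0 < x then F x / x ^ n else 0)" for x
  have f_meas[measurable]: "f \<in> borel_measurable borel" unfolding f_def by measurable
  \<comment> \<open>an atom at \<open>0\<close> would keep the Laplace transform away from \<open>0\<close>\<close>
  have pos: "AE x in \<mu>. 0 < x"
  proof -
    have le: "measure \<mu> {0} \<le> exp (- (l powr a))" if l: "0 < l" for l
    proof -
      have "emeasure \<mu> {0} = (\<integral>\<^sup>+x. indicator {0} x \<partial>\<mu>)" using \<mu>(2) by simp
      also have "\<dots> \<le> laplace \<mu> l" unfolding laplace_def by (intro nn_integral_mono) (auto simp: indicator_def)
      finally show ?thesis unfolding lap[OF l] by (simp add: \<mu>.emeasure_eq_measure)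
    qed
    have "((\<lambda>l. exp (- (l powr a))) \<longlongrightarrow> 0) at_top" using a by real_asymp
    then have "measure \<mu> {0} \<le> 0"
      by (rule tendsto_lowerbound) (use le in \<open>auto intro!: eventually_mono[OF eventually_gt_at_top[of 0]]\<close>)
    then have "emeasure \<mu> {0} = 0" by (simp add: \<mu>.emeasure_eq_measure measure_le_0_iff)
    then have "AE x in \<mu>. x \<notin> {0}" using \<mu>(2) by (intro AE_not_in) (auto simp: null_sets_def)
    then show ?thesis using \<mu>(3) by eventually_elim auto
  qed
  have f_law: "density lborel (\<lambda>x. ennreal (f x)) = \<mu>"
  proof -
    let ?w = "\<lambda>x. ennreal (if 0 < x then 1 / x ^ n else 0)"
    have "density lborel (\<lambda>x. ennreal (f x)) = density (density lborel (\<lambda>x. ennreal (F x))) ?w"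
      using F_nn by (subst density_density_eq) (auto simp: f_def ennreal_mult'[symmetric] intro!: arg_cong[where f="density lborel"])
    also have "\<dots> = density \<mu> (\<lambda>x. ennreal x ^ n * ?w x)"
      unfolding MF[symmetric] M_def by (subst density_density_eq) auto
    also have "\<dots> = density \<mu> (\<lambda>_. 1)"
    proof (rule density_cong)
      show "AE x in \<mu>. ennreal x ^ n * ?w x = 1"
        using pos by eventually_elim (auto simp: ennreal_power ennreal_mult'[symmetric])
    qed auto
    finally show ?thesis by (simp add: density_1)
  qed
  \<comment> \<open>Chernoff bound with \<open>l = 1 / x\<close>: near \<open>0\<close> the law, and with it \<open>F\<close>, decays faster than any power\<close>
  have F_le: "F x \<le> (\<Sum>k=1..n. S n k * a ^ k / Gamma (real n - real k * a)) * exp (1 - x powr (- a))" if x: "0 < x" "x < 1" for x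
  proof -
    have mx: "measure \<mu> {..x} \<le> exp (1 - x powr (- a))"
    proof -
      have "ennreal (exp (- 1)) * emeasure \<mu> {..x} = (\<integral>\<^sup>+u. ennreal (exp (- 1)) * indicator {..x} u \<partial>\<mu>)"
        using \<mu>(2) by (subst nn_integral_cmult_indicator) auto
      also have "\<dots> \<le> laplace \<mu> (1 / x)"
        unfolding laplace_def using x by (intro nn_integral_mono) (auto simp: indicator_def divide_simps)
      also have "\<dots> = ennreal (exp (- (x powr (- a))))"
        using x by (subst lap) (auto simp: powr_divide powr_minus_divide)
      finally have "exp (- 1) * measure \<mu> {..x} \<le> exp (- (x powr (- a)))"
        by (simp add: \<mu>.emeasure_eq_measure ennreal_mult'[symmetric])
      then have "exp 1 * (exp (- 1) * measure \<mu> {..x}) \<le> exp 1 * exp (- (x powr (- a)))" by (intro mult_left_mono) auto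
      then show ?thesis by (simp add: mult.assoc[symmetric] exp_minus[of 1] exp_add[symmetric] exp_diff exp_minus divide_inverse)
    qed
    show ?thesis unfolding F_def sum_distrib_right
    proof (rule sum_mono)
      fix k assume k: "k \<in> {1..n}"
      let ?b = "real n - real k * a"
      have G0: "0 < Gamma ?b" using ord[OF k] by (intro Gamma_real_pos) simp
      have "R ?b x \<le> x powr (?b - 1) / Gamma ?b * measure \<mu> {..x}" by (rule R(5)[OF ord[OF k] x(1)])
      also have "\<dots> \<le> 1 / Gamma ?b * exp (1 - x powr (- a))"
        using x G0 mx ord[OF k] by (intro mult_mono divide_right_mono) (auto simp: powr_le1)
      finally have "S n k * a ^ k * R ?b x \<le> S n k * a ^ k * (1 / Gamma ?b * exp (1 - x powr (- a)))"
        using co by (intro mult_left_mono)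
      then show "S n k * a ^ k * R ?b x \<le> S n k * a ^ k / Gamma ?b * exp (1 - x powr (- a))" by simp
    qed
  qed
  define C where "C = (\<Sum>k=1..n. S n k * a ^ k / Gamma (real n - real k * a))"
  have f_nn: "0 \<le> f x" for x using F_nn by (simp add: f_def)
  have f_lim0: "(f \<longlongrightarrow> 0) (at_right 0)"
  proof (rule tendsto_sandwich[OF _ _ tendsto_const])
    have "((\<lambda>x. C * (x powr (- real n) * exp (1 - x powr (- a)))) \<longlongrightarrow> C * 0) (at_right 0)"
    proof (intro tendsto_mult tendsto_const)
      show "((\<lambda>x. x powr (- real n) * exp (1 - x powr (- a))) \<longlongrightarrow> 0) (at_right 0)" using a by real_asymp
    qed
    then show "((\<lambda>x. C * (x powr (- real n) * exp (1 - x powr (- a)))) \<longlongrightarrow> 0) (at_right 0)" by simp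
    show "\<forall>\<^sub>F x in at_right 0. f x \<le> C * (x powr (- real n) * exp (1 - x powr (- a)))"
    proof (rule eventually_at_rightI[of 0 1])
      fix x :: real assume "x \<in> {0<..<1}"
      then have x: "0 < x" "x < 1" by auto
      have "f x \<le> C * exp (1 - x powr (- a)) / x ^ n" using F_le[OF x] x by (auto simp: f_def C_def intro!: divide_right_mono)
      also have "\<dots> = C * (x powr (- real n) * exp (1 - x powr (- a)))"
        using x by (simp add: powr_minus powr_realpow divide_inverse)
      finally show "f x \<le> C * (x powr (- real n) * exp (1 - x powr (- a)))" .
    qed simp
  qed (use f_nn in auto)
  have f_cont: "isCont f x" for x
  proof -
    consider "0 < x" | "x < 0" | "x = 0" by linarith
    then show ?thesis
    proof cases
      case 1
      have "isCont (\<lambda>x. F x / x ^ n) x" using 1 F_cont by (intro continuous_intros) auto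
      moreover have "\<forall>\<^sub>F y in nhds x. F y / y ^ n = f y"
      proof -
        have "\<forall>\<^sub>F y in nhds x. y \<in> {0<..}" using 1 by (intro eventually_nhds_in_open) auto
        then show ?thesis by eventually_elim (simp add: f_def)
      qed
      ultimately show ?thesis by (subst isCont_cong[of _ "\<lambda>x. F x / x ^ n"]) (auto elim: eventually_mono)
    next
      case 2
      have "\<forall>\<^sub>F y in nhds x. f y = 0"
    proof -
        have "\<forall>\<^sub>F y in nhds x. y \<in> {..<0}" using 2 by (intro eventually_nhds_in_open) auto
        then show ?thesis by eventually_elim (simp add: f_def)
      qed
      then show ?thesis by (subst isCont_cong[of _ "\<lambda>x. 0"]) auto
    next
      case 3
      have "(f \<longlongrightarrow> 0) (at_left 0)"
        by (rule tendsto_eventually) (auto simp: f_def intro!: eventually_at_leftI[of "-1"])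
      then have "(f \<longlongrightarrow> 0) (at 0)" using f_lim0 by (rule filterlim_split_at)
      then show ?thesis using 3 by (simp add: continuous_at f_def)
    qed
  qed
  show ?thesis
  proof (rule that[of f])
    show "f x = 0" if "x \<le> 0" for x using that by (simp add: f_def)
    show "0 \<le> f x" for x by (rule f_nn)
    show "continuous_on UNIV f" using f_cont by (simp add: continuous_on_eq_continuous_at)
    show "laplace (density lborel (\<lambda>x. ennreal (f x))) l = ennreal (exp (- (l powr a)))" if "0 < l" for l
      unfolding f_law by (rule lap[OF that])
    have "emeasure (density lborel (\<lambda>x. ennreal (f x))) UNIV = 1"
      unfolding f_law using \<mu>.emeasure_space_1 sets_eq_imp_space_eq[OF \<mu>(2)] by simp
    then show "(\<integral>\<^sup>+x. ennreal (f x) \<partial>lborel) = 1" by (subst (asm) emeasure_density) auto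
  qed
qed

text \<open>The density just found satisfies the defining conditions, and no other function does, since a continuous
  density is determined by its Laplace transform.\<close>

lemma stable_density:
  assumes a: "0 < a" "a < 1"
  shows "x \<le> 0 \<Longrightarrow> stable_density a x = 0" "0 \<le> stable_density a x" "continuous_on UNIV (stable_density a)"
    "0 < l \<Longrightarrow> laplace (density lborel (\<lambda>x. ennreal (stable_density a x))) l = ennreal (exp (- (l powr a)))"
proof -
  obtain f where f0: "\<And>x. x \<le> 0 \<Longrightarrow> f x = 0" and fnn: "\<And>x. 0 \<le> f x" and fc: "continuous_on UNIV f"
    and fl: "\<And>l. 0 < l \<Longrightarrow> laplace (density lborel (\<lambda>x. ennreal (f x))) l = ennreal (exp (- (l powr a)))"
    and f1: "(\<integral>\<^sup>+x. ennreal (f x) \<partial>lborel) = 1"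
    by (rule stable_density_exists[OF a]) (rule that)
  have fm[measurable]: "f \<in> borel_measurable borel" by (rule borel_measurable_continuous_onI[OF fc])
  have eq: "stable_density a = f"
    unfolding stable_density_def
  proof (rule the_equality)
    show "(\<forall>x\<le>0. f x = 0) \<and> (\<forall>x. 0 \<le> f x) \<and> continuous_on {0<..} f \<and>
        (\<forall>l\<ge>0. has_bochner_integral lborel (\<lambda>x. exp (- l * x) * f x) (exp (- (l powr a))))"
    proof (intro conjI allI impI)
      show "continuous_on {0<..} f" by (rule continuous_on_subset[OF fc]) simp
      fix l :: real assume l: "0 \<le> l"
      have "(\<integral>\<^sup>+x. ennreal (exp (- l * x) * f x) \<partial>lborel) = ennreal (exp (- (l powr a)))"
      proof (cases "l = 0")
        case True then show ?thesis using f1 by simp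
      next
        case False
        then have "laplace (density lborel (\<lambda>x. ennreal (f x))) l = ennreal (exp (- (l powr a)))" using l fl by simp
        then show ?thesis by (simp add: laplace_density ennreal_mult' ennreal_mult'' mult.commute)
      qed
      then show "has_bochner_integral lborel (\<lambda>x. exp (- l * x) * f x) (exp (- (l powr a)))"
        using fnn by (intro has_bochner_integral_nn_integral) auto
    qed (use f0 fnn in auto)
  next
    fix g assume g: "(\<forall>x\<le>0. g x = 0) \<and> (\<forall>x. 0 \<le> g x) \<and> continuous_on {0<..} g \<and>
        (\<forall>l\<ge>0. has_bochner_integral lborel (\<lambda>x. exp (- l * x) * g x) (exp (- (l powr a))))"
    then have gb: "has_bochner_integral lborel (\<lambda>x. exp (- l * x) * g x) (exp (- (l powr a)))" if "0 \<le> l" for l using that by blast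
    have "(\<lambda>x. exp (- 0 * x) * g x) \<in> borel_measurable lborel" by (rule borel_measurable_has_bochner_integral[OF gb]) simp
    then have gm[measurable]: "g \<in> borel_measurable borel" by simp
    have gl: "laplace (density lborel (\<lambda>x. ennreal (g x))) l = ennreal (exp (- (l powr a)))" if l: "0 < l" for l
    proof -
      have "laplace (density lborel (\<lambda>x. ennreal (g x))) l = (\<integral>\<^sup>+x. ennreal (exp (- l * x) * g x) \<partial>lborel)"
        by (subst laplace_density) (auto simp: ennreal_mult' ennreal_mult'' mult.commute)
      also have "\<dots> = ennreal (\<integral>x. exp (- l * x) * g x \<partial>lborel)"
        using gb[of l] l g by (intro nn_integral_eq_integral) (auto simp: has_bochner_integral_iff)
      finally show ?thesis using gb[of l] l by (simp add: has_bochner_integral_iff)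
    qed
    show "g = f"
    proof
      fix x
      show "g x = f x"
        by (rule laplace_determines_continuous)
           (use g gl fl f0 fnn continuous_on_subset[OF fc, of "{0<..}"] in auto)
    qed
  qed
  show "x \<le> 0 \<Longrightarrow> stable_density a x = 0" "0 \<le> stable_density a x" "continuous_on UNIV (stable_density a)"
    "0 < l \<Longrightarrow> laplace (density lborel (\<lambda>x. ennreal (stable_density a x))) l = ennreal (exp (- (l powr a)))"
    unfolding eq using f0 fnn fc fl by auto
qed

section \<open>Poisson-Kingman partitions\<close>

locale stable_index =
  fixes a :: real
  assumes a: "0 < a" "a < 1"
begin

abbreviation f :: "real \<Rightarrow> real" where "f \<equiv> stable_density a"

lemma f_facts: "x \<le> 0 \<Longrightarrow> f x = 0" "0 \<le> f x" "continuous_on UNIV f" "isCont f x"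
  using stable_density(1-3)[OF a] by (auto simp: continuous_on_eq_continuous_at)

lemma f_measurable [measurable]: "f \<in> borel_measurable borel"
  by (rule borel_measurable_continuous_onI[OF f_facts(3)])

lemma f_laplace: "0 < l \<Longrightarrow> laplace (density lborel (\<lambda>x. ennreal (f x))) l = ennreal (exp (- (l powr a)))"
  by (rule stable_density(4)[OF a])

text \<open>The fractional integral of order \<open>b\<close> of the stable density.\<close>

definition frac :: "real \<Rightarrow> real \<Rightarrow> real" where
  "frac b t = (\<integral>u. power_kernel b u * f (t - u) \<partial>lborel)"

lemma power_kernel_integrable:
  assumes b: "0 < b" and T: "0 < T"
  shows "integrable lborel (\<lambda>u. power_kernel b u * indicator {0..T} u)"
proof (rule integrableI_nonneg)
  have G: "0 < Gamma b" using b by (rule Gamma_real_pos)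
  show "AE u in lborel. 0 \<le> power_kernel b u * indicator {0..T} u"
    using power_kernel_nonneg[OF b] by (intro AE_I2) simp
  have "(\<integral>\<^sup>+u. ennreal (power_kernel b u * indicator {0..T} u) \<partial>lborel)
     = (\<integral>\<^sup>+u. ennreal (1 / Gamma b) * (ennreal (u powr (b - 1)) * indicator {0..T} u) \<partial>lborel)"
    using G by (intro nn_integral_cong) (auto simp: power_kernel_def indicator_def ennreal_mult'[symmetric])
  also have "\<dots> = ennreal (1 / Gamma b) * (\<integral>\<^sup>+u. ennreal (u powr (b - 1)) * indicator {0..T} u \<partial>lborel)"
    by (rule nn_integral_cmult) measurable
  also have "(\<integral>\<^sup>+u. ennreal (u powr (b - 1)) * indicator {0..T} u \<partial>lborel) = ennreal (T powr ((b - 1) + 1) / ((b - 1) + 1))"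
    using b T by (intro nn_integral_has_integral_lebesgue' has_integral_powr_from_0) auto
  finally show "(\<integral>\<^sup>+u. ennreal (power_kernel b u * indicator {0..T} u) \<partial>lborel) < \<infinity>"
    by (simp add: ennreal_mult_less_top)
qed measurable

lemma frac_bound:
  assumes b: "0 < b" and T: "0 < T"
  obtains w where "integrable lborel w" "\<And>t u. t \<le> T \<Longrightarrow> norm (power_kernel b u * f (t - u)) \<le> w u"
proof -
  have "bounded (f ` {0..T})"
    by (intro compact_imp_bounded compact_continuous_image continuous_on_subset[OF f_facts(3)]) auto
  then obtain C where C0: "0 < C" "\<forall>y\<in>f ` {0..T}. norm y \<le> C"
    unfolding bounded_pos by blast
  have C: "f x \<le> C" if "x \<in> {0..T}" for x
  proof -
    have "norm (f x) \<le> C" using C0(2) that by blast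
    then show ?thesis by simp
  qed
  have fC: "f x \<le> C" if "x \<le> T" for x
    using C[of x] C0(1) that f_facts(1)[of x] by (cases "0 \<le> x") auto
  show ?thesis
  proof (rule that[of "\<lambda>u. C * (power_kernel b u * indicator {0..T} u)"])
    show "integrable lborel (\<lambda>u. C * (power_kernel b u * indicator {0..T} u))"
      by (intro integrable_mult_right power_kernel_integrable b T)
    fix t u assume t: "t \<le> T"
    show "norm (power_kernel b u * f (t - u)) \<le> C * (power_kernel b u * indicator {0..T} u)"
    proof (cases "u \<in> {0..T}")
      case True
      have "power_kernel b u * f (t - u) \<le> power_kernel b u * C"
        using True t power_kernel_nonneg[OF b] by (intro mult_left_mono fC) auto
      then show ?thesis using True power_kernel_nonneg[OF b] f_facts(2) by (simp add: abs_mult mult.commute)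
    next
      case False
      then have "power_kernel b u = 0 \<or> f (t - u) = 0" using t f_facts(1)[of "t - u"] by (auto simp: power_kernel_def)
      then show ?thesis using False by auto
    qed
  qed
qed

lemma frac_integrable: "0 < b \<Longrightarrow> integrable lborel (\<lambda>u. power_kernel b u * f (t - u))"
proof -
  assume b: "0 < b"
  obtain w where w: "integrable lborel w" "\<And>s u. s \<le> max 1 t \<Longrightarrow> norm (power_kernel b u * f (s - u)) \<le> w u"
    by (rule frac_bound[OF b, of "max 1 t"]) (auto intro: that)
  show ?thesis
  proof (rule Bochner_Integration.integrable_bound[OF w(1)])
    show "AE u in lborel. norm (power_kernel b u * f (t - u)) \<le> norm (w u)"
      using w(2)[of t] by (intro AE_I2) (smt (verit) norm_ge_zero real_norm_def)
  qed measurable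
qed

lemma frac_nonneg: "0 < b \<Longrightarrow> 0 \<le> frac b t"
  unfolding frac_def using power_kernel_nonneg f_facts(2) by (intro Bochner_Integration.integral_nonneg) auto

lemma frac_0: "t \<le> 0 \<Longrightarrow> frac b t = 0"
proof -
  assume t: "t \<le> 0"
  have e: "power_kernel b u * f (t - u) = 0" for u
    using t f_facts(1)[of "t - u"] by (cases "0 < u") (auto simp: power_kernel_def)
  show ?thesis unfolding frac_def e by simp
qed

lemma frac_isCont:
  assumes b: "0 < b" shows "isCont (frac b) t"
  unfolding continuous_at_sequentially
proof (intro allI impI)
  fix y :: "nat \<Rightarrow> real" assume y: "y \<longlonglongrightarrow> t"
  then have "bounded (range y)" by (rule convergent_imp_bounded)
  then obtain X where X: "\<And>n. norm (y n) \<le> X" "0 < X" unfolding bounded_pos by auto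
  have yX: "y n \<le> X" for n using X(1)[of n] by simp
  obtain w where w: "integrable lborel w" "\<And>s u. s \<le> X \<Longrightarrow> norm (power_kernel b u * f (s - u)) \<le> w u"
    by (rule frac_bound[OF b X(2)]) (auto intro: that)
  show "(frac b \<circ> y) \<longlonglongrightarrow> frac b t"
    unfolding frac_def o_def
  proof (rule integral_dominated_convergence[OF _ _ w(1)])
    show "AE u in lborel. (\<lambda>n. power_kernel b u * f (y n - u)) \<longlonglongrightarrow> power_kernel b u * f (t - u)"
      using y by (intro AE_I2 tendsto_mult tendsto_const isCont_tendsto_compose[OF f_facts(4)] tendsto_intros)
    show "AE u in lborel. norm (power_kernel b u * f (y n - u)) \<le> w u" for n
      using w(2)[OF yX] by (intro AE_I2)
  qed measurable
qed

lemma frac_cont: "0 < b \<Longrightarrow> continuous_on A (frac b)"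
  using frac_isCont by (simp add: continuous_at_imp_continuous_on)

lemma frac_measurable [measurable]: "0 < b \<Longrightarrow> frac b \<in> borel_measurable borel"
  by (intro borel_measurable_continuous_onI frac_cont)

lemma frac_laplace:
  assumes b: "0 < b" and l: "0 < l"
  shows "laplace (density lborel (\<lambda>t. ennreal (frac b t))) l = ennreal (l powr (- b) * exp (- (l powr a)))"
proof -
  let ?M = "density lborel (\<lambda>x. ennreal (f x))"
  have sf: "sigma_finite_measure ?M"
    by (subst sigma_finite_measure.sigma_finite_iff_density_finite[OF sigma_finite_lborel]) auto
  have e: "frac_integral b ?M t = ennreal (frac b t)" for t
  proof -
    have "frac_integral b ?M t = (\<integral>\<^sup>+u. ennreal (f u) * ennreal (power_kernel b (t - u)) \<partial>lborel)"
      unfolding frac_integral_def by (rule nn_integral_density) measurable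
    also have "\<dots> = ennreal \<bar>- 1\<bar> * (\<integral>\<^sup>+u. ennreal (f (t + - 1 * u)) * ennreal (power_kernel b (t - (t + - 1 * u))) \<partial>lborel)"
      by (rule nn_integral_real_affine) auto
    also have "\<dots> = (\<integral>\<^sup>+u. ennreal (power_kernel b u * f (t - u)) \<partial>lborel)"
      using power_kernel_nonneg[OF b] by (simp add: ennreal_mult' mult.commute)
    also have "\<dots> = ennreal (frac b t)"
      unfolding frac_def using power_kernel_nonneg[OF b] f_facts(2)
      by (intro nn_integral_eq_integral frac_integrable b) auto
    finally show ?thesis .
  qed
  have "laplace (density lborel (frac_integral b ?M)) l = ennreal (l powr (- b)) * laplace ?M l"
    by (rule laplace_frac_integral[OF sf _ b l]) simp
  then show ?thesis unfolding e f_laplace[OF l] by (simp add: ennreal_mult'[symmetric])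
qed

text \<open>Up to the factor \<open>t ^ n * f t\<close> these are the weights of the Poisson-Kingman partition with parameter
  \<open>t\<close>. Their Laplace transforms in \<open>t\<close> are elementary functions, and all identities between them are
  proved there.\<close>

definition pk_numerator :: "nat \<Rightarrow> nat \<Rightarrow> real \<Rightarrow> real" where
  "pk_numerator n k t = a ^ k * frac (real n - real k * a) t"

lemma order_pos: "1 \<le> k \<Longrightarrow> k \<le> n \<Longrightarrow> 0 < real n - real k * a"
proof -
  assume k: "1 \<le> k" "k \<le> n"
  have "real k * a < real k * 1" using k a by (intro mult_strict_left_mono) auto
  moreover have "real k \<le> real n" using k by simp
  ultimately show ?thesis by linarith
qed

lemma pk_numerator_facts:
  assumes k: "1 \<le> k" "k \<le> n"
  shows "0 \<le> pk_numerator n k t" "t \<le> 0 \<Longrightarrow> pk_numerator n k t = 0" "continuous_on A (pk_numerator n k)" "pk_numerator n k \<in> borel_measurable borel"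
    "0 < l \<Longrightarrow> laplace (density lborel (\<lambda>t. ennreal (pk_numerator n k t))) l = ennreal (a ^ k * l powr (real k * a - real n) * exp (- (l powr a)))"
proof -
  note b = order_pos[OF k]
  show "0 \<le> pk_numerator n k t" unfolding pk_numerator_def using frac_nonneg[OF b] a by simp
  show "pk_numerator n k t = 0" if "t \<le> 0" unfolding pk_numerator_def using frac_0[OF that] by simp
  show "continuous_on A (pk_numerator n k)" for A unfolding pk_numerator_def[abs_def] by (intro continuous_intros frac_cont b)
  then show [measurable]: "pk_numerator n k \<in> borel_measurable borel" by (intro borel_measurable_continuous_onI)
  note [measurable] = frac_measurable[OF b]
  show "laplace (density lborel (\<lambda>t. ennreal (pk_numerator n k t))) l = ennreal (a ^ k * l powr (real k * a - real n) * exp (- (l powr a)))" if l: "0 < l"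
  proof -
    have "laplace (density lborel (\<lambda>t. ennreal (pk_numerator n k t))) l
      = (\<integral>\<^sup>+t. ennreal (a ^ k) * (ennreal (frac (real n - real k * a) t) * ennreal (exp (- (l * t)))) \<partial>lborel)"
      using a by (subst laplace_density) (auto simp: pk_numerator_def ennreal_mult' mult.assoc)
    also have "\<dots> = ennreal (a ^ k) * laplace (density lborel (\<lambda>t. ennreal (frac (real n - real k * a) t))) l"
      by (subst nn_integral_cmult) (auto simp: laplace_density)
    finally show ?thesis using a by (simp add: frac_laplace[OF b l] ennreal_mult'[symmetric] mult.assoc)
  qed
qed

lemma times_laplace:
  assumes h: "h \<in> borel_measurable borel" "\<And>t. t \<le> 0 \<Longrightarrow> h t = 0"
    and L: "\<And>l. 0 < l \<Longrightarrow> laplace (density lborel (\<lambda>t. ennreal (h t))) l = ennreal (L l)" "\<And>l. 0 < l \<Longrightarrow> 0 \<le> L l"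
    and der: "(L has_real_derivative - D) (at l)" and l: "0 < l"
  shows "laplace (density lborel (\<lambda>t. ennreal (t * h t))) l = ennreal D"
proof -
  have [measurable]: "h \<in> borel_measurable borel" by fact
  let ?M = "density lborel (\<lambda>t. ennreal (h t))"
  have "AE t in ?M. 0 \<le> t"
  proof (subst AE_density)
    have "0 \<le> t" if "0 < ennreal (h t)" for t
    proof (rule ccontr)
      assume "\<not> 0 \<le> t"
      then have "h t = 0" using h(2)[of t] by simp
      then show False using that by simp
    qed
    then show "AE x in lborel. 0 < ennreal (h x) \<longrightarrow> 0 \<le> x" by (intro AE_I2) blast
  qed simp
  then have "laplace (density ?M (\<lambda>t. ennreal t)) l = ennreal D"
    by (intro laplace_derivative[OF _ _ L der l]) auto
  also have "density ?M (\<lambda>t. ennreal t) = density lborel (\<lambda>t. ennreal (h t) * ennreal t)"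
    by (rule density_density_eq) measurable
  also have "(\<lambda>t. ennreal (h t) * ennreal t) = (\<lambda>t. ennreal (t * h t))"
  proof
    fix t show "ennreal (h t) * ennreal t = ennreal (t * h t)"
      using h(2)[of t] by (cases "0 \<le> t") (auto simp: ennreal_mult' mult.commute)
  qed
  finally show ?thesis .
qed

text \<open>After Laplace transformation this is the rule for differentiating \<open>l powr (k a - n) * exp (- (l powr
  a))\<close>.\<close>

lemma pk_numerator_rec:
  assumes k: "1 \<le> k" "k \<le> n"
  shows "t * pk_numerator n k t = (real n - a * real k) * pk_numerator (Suc n) k t + pk_numerator (Suc n) (Suc k) t"
proof (rule laplace_determines_continuous[where f="\<lambda>t. t * pk_numerator n k t" and g="\<lambda>t. (real n - a * real k) * pk_numerator (Suc n) k t + pk_numerator (Suc n) (Suc k) t"])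
  have k1: "k \<le> Suc n" "1 \<le> Suc k" "Suc k \<le> Suc n" using k by auto
  note G0 = pk_numerator_facts[OF k] and G1 = pk_numerator_facts[OF k(1) k1(1)] and G2 = pk_numerator_facts[OF k1(2,3)]
  note [measurable] = G0(4) G1(4) G2(4)
  have c: "0 \<le> real n - a * real k" using order_pos[OF k] by (simp add: mult.commute)
  show "(\<lambda>t. t * pk_numerator n k t) \<in> borel_measurable borel" by measurable
  show "(\<lambda>t. (real n - a * real k) * pk_numerator (Suc n) k t + pk_numerator (Suc n) (Suc k) t) \<in> borel_measurable borel" by measurable
  show "0 \<le> t * pk_numerator n k t" for t using G0(1,2)[of t] by (cases "0 \<le> t") auto
  show "0 \<le> (real n - a * real k) * pk_numerator (Suc n) k t + pk_numerator (Suc n) (Suc k) t" for t using G1(1) G2(1) c by simp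
  show "t \<le> 0 \<Longrightarrow> t * pk_numerator n k t = 0" for t using G0(2) by simp
  show "t \<le> 0 \<Longrightarrow> (real n - a * real k) * pk_numerator (Suc n) k t + pk_numerator (Suc n) (Suc k) t = 0" for t using G1(2) G2(2) by simp
  show "continuous_on {0<..} (\<lambda>t. t * pk_numerator n k t)" by (intro continuous_intros G0(3))
  show "continuous_on {0<..} (\<lambda>t. (real n - a * real k) * pk_numerator (Suc n) k t + pk_numerator (Suc n) (Suc k) t)"
    by (intro continuous_intros G1(3) G2(3))
  define D where "D l = (real n - a * real k) * (a ^ k * l powr (real k * a - real (Suc n)) * exp (- (l powr a)))
      + a ^ Suc k * l powr (real (Suc k) * a - real (Suc n)) * exp (- (l powr a))" for l
  have lap1: "laplace (density lborel (\<lambda>t. ennreal (t * pk_numerator n k t))) l = ennreal (D l)" if l: "0 < l" for l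
  proof (rule times_laplace[OF G0(4,2,5) _ _ l])
    show "0 \<le> a ^ k * l powr (real k * a - real n) * exp (- (l powr a))" for l using a by simp
    have p: "l powr (real k * a - real n) * l powr (a - 1) = l powr (real (Suc k) * a - real (Suc n))"
      unfolding powr_add[symmetric] by (rule arg_cong[where f="\<lambda>x. l powr x"]) (simp add: algebra_simps)
    have q: "l powr (real k * a - real n - 1) = l powr (real k * a - real (Suc n))"
      by (rule arg_cong[where f="\<lambda>x. l powr x"]) simp
    have "((\<lambda>l. a ^ k * l powr (real k * a - real n) * exp (- (l powr a))) has_real_derivative
       a ^ k * ((real k * a - real n) * l powr (real k * a - real n - 1)) * exp (- (l powr a))
       + a ^ k * l powr (real k * a - real n) * (exp (- (l powr a)) * - (a * l powr (a - 1)))) (at l)"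
      using l by (auto intro!: derivative_eq_intros)
    also have "a ^ k * ((real k * a - real n) * l powr (real k * a - real n - 1)) * exp (- (l powr a))
       + a ^ k * l powr (real k * a - real n) * (exp (- (l powr a)) * - (a * l powr (a - 1))) = - D l"
      unfolding q D_def p[symmetric] by (simp add: algebra_simps)
    finally show "((\<lambda>l. a ^ k * l powr (real k * a - real n) * exp (- (l powr a))) has_real_derivative - D l) (at l)" .
  qed
  have lap2: "laplace (density lborel (\<lambda>t. ennreal ((real n - a * real k) * pk_numerator (Suc n) k t + pk_numerator (Suc n) (Suc k) t))) l = ennreal (D l)" if l: "0 < l" for l
  proof -
    have "laplace (density lborel (\<lambda>t. ennreal ((real n - a * real k) * pk_numerator (Suc n) k t + pk_numerator (Suc n) (Suc k) t))) l
      = (\<integral>\<^sup>+t. ennreal (real n - a * real k) * (ennreal (pk_numerator (Suc n) k t) * ennreal (exp (- (l * t))))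
          + ennreal (pk_numerator (Suc n) (Suc k) t) * ennreal (exp (- (l * t))) \<partial>lborel)"
      using c G1(1) G2(1) by (subst laplace_density) (auto simp: ennreal_mult' distrib_right mult.assoc)
    also have "\<dots> = ennreal (real n - a * real k) * laplace (density lborel (\<lambda>t. ennreal (pk_numerator (Suc n) k t))) l
          + laplace (density lborel (\<lambda>t. ennreal (pk_numerator (Suc n) (Suc k) t))) l"
      by (subst nn_integral_add) (auto simp: nn_integral_cmult laplace_density)
    also have "\<dots> = ennreal (D l)"
      unfolding G1(5)[OF l] G2(5)[OF l] D_def using c a by (simp add: ennreal_mult'[symmetric])
    finally show ?thesis .
  qed
  show "laplace (density lborel (\<lambda>t. ennreal (t * pk_numerator n k t))) l
    = laplace (density lborel (\<lambda>t. ennreal ((real n - a * real k) * pk_numerator (Suc n) k t + pk_numerator (Suc n) (Suc k) t))) l" if "0 < l" for l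
    using lap1[OF that] lap2[OF that] by simp
  show "laplace (density lborel (\<lambda>t. ennreal (t * pk_numerator n k t))) l < \<infinity>" if "0 < l" for l
    using lap1[OF that] by simp
qed

lemma pk_numerator_1_1: "t * f t = pk_numerator 1 1 t"
proof (rule laplace_determines_continuous[where f="\<lambda>t. t * f t"])
  have k: "(1::nat) \<le> 1" by simp
  note G = pk_numerator_facts[OF k k]
  show "(\<lambda>t. t * f t) \<in> borel_measurable borel" by measurable
  show "pk_numerator 1 1 \<in> borel_measurable borel" by (rule G(4))
  show "0 \<le> t * f t" for t using f_facts(1,2)[of t] by (cases "0 \<le> t") auto
  show "0 \<le> pk_numerator 1 1 t" for t by (rule G(1))
  show "t \<le> 0 \<Longrightarrow> t * f t = 0" for t using f_facts(1) by simp
  show "t \<le> 0 \<Longrightarrow> pk_numerator 1 1 t = 0" for t by (rule G(2))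
  show "continuous_on {0<..} (\<lambda>t. t * f t)" by (intro continuous_intros continuous_on_subset[OF f_facts(3)]) simp
  show "continuous_on {0<..} (pk_numerator 1 1)" by (rule G(3))
  have lap: "laplace (density lborel (\<lambda>t. ennreal (t * f t))) l = ennreal (a ^ 1 * l powr (real 1 * a - real 1) * exp (- (l powr a)))" if l: "0 < l" for l
  proof (rule times_laplace[OF f_measurable f_facts(1) f_laplace _ _ l])
    show "((\<lambda>l. exp (- (l powr a))) has_real_derivative - (a ^ 1 * l powr (real 1 * a - real 1) * exp (- (l powr a)))) (at l)"
      using l by (auto intro!: derivative_eq_intros)
  qed auto
  show "laplace (density lborel (\<lambda>t. ennreal (t * f t))) l = laplace (density lborel (\<lambda>t. ennreal (pk_numerator 1 1 t))) l" if "0 < l" for l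
    using lap[OF that] G(5)[OF that] by simp
  show "laplace (density lborel (\<lambda>t. ennreal (t * f t))) l < \<infinity>" if "0 < l" for l using lap[OF that] by simp
qed

text \<open>If \<open>f\<close> vanished at \<open>t > 0\<close>, then by \<open>t * f t = pk_numerator 1 1 t\<close> it would vanish almost
  everywhere below \<open>t\<close>. Its Laplace transform would then decay like \<open>exp (- (l * t))\<close>, which is far
  smaller than \<open>exp (- (l powr a))\<close>.\<close>

lemma f_pos:
  assumes t: "0 < t" shows "0 < f t"
proof (rule ccontr)
  assume "\<not> 0 < f t"
  then have "f t = 0" using f_facts(2)[of t] by simp
  then have "frac (1 - a) t = 0" using pk_numerator_1_1[of t] a by (simp add: pk_numerator_def)
  have b: "0 < 1 - a" using a by simp
  have "AE u in lborel. power_kernel (1 - a) u * f (t - u) = 0"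
    using \<open>frac (1 - a) t = 0\<close> power_kernel_nonneg[OF b] f_facts(2)
    unfolding frac_def by (subst (asm) integral_nonneg_eq_0_iff_AE[OF frac_integrable[OF b]]) auto
  then have ae: "AE u in lborel. u < t \<longrightarrow> f u = 0"
  proof -
    assume "AE u in lborel. power_kernel (1 - a) u * f (t - u) = 0"
    then have "AE u in distr lborel borel (\<lambda>u. t + - 1 * u). power_kernel (1 - a) (t - u) * f u = 0"
      by (subst AE_distr_iff) auto
    moreover have "distr lborel borel (\<lambda>u. t + - 1 * u) = lborel"
    proof -
      have "lborel = density (distr lborel borel (\<lambda>u. t + - 1 * u)) (\<lambda>_. ennreal \<bar>- 1\<bar>)"
        by (rule lborel_real_affine) simp
      then show ?thesis by (simp only: abs_minus_cancel abs_one ennreal_1 density_1)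
    qed
    ultimately have "AE u in lborel. power_kernel (1 - a) (t - u) * f u = 0" by (simp only:)
    then show ?thesis
      using Gamma_real_pos[OF b] by (auto elim!: eventually_mono simp: power_kernel_def)
  qed
  have le: "exp (- (l powr a)) \<le> exp (- ((l - 1) * t)) * exp (- (1 powr a))" if l: "1 < l" for l
  proof -
    have "ennreal (exp (- (l powr a))) = (\<integral>\<^sup>+x. ennreal (f x) * ennreal (exp (- (l * x))) \<partial>lborel)"
      using f_laplace[of l] l by (simp add: laplace_density)
    also have "\<dots> \<le> (\<integral>\<^sup>+x. ennreal (exp (- ((l - 1) * t))) * (ennreal (f x) * ennreal (exp (- (1 * x)))) \<partial>lborel)"
    proof (rule nn_integral_mono_AE)
      show "AE x in lborel. ennreal (f x) * ennreal (exp (- (l * x)))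
          \<le> ennreal (exp (- ((l - 1) * t))) * (ennreal (f x) * ennreal (exp (- (1 * x))))"
        using ae
      proof eventually_elim
        case (elim x)
        show ?case
        proof (cases "x < t")
          case True then show ?thesis using elim by simp
        next
          case False
          have "(l - 1) * t \<le> (l - 1) * x" using False l by (intro mult_left_mono) auto
          then have "exp (- (l * x)) \<le> exp (- ((l - 1) * t)) * exp (- (1 * x))"
            unfolding exp_add[symmetric] by (simp add: algebra_simps)
          then have "f x * exp (- (l * x)) \<le> exp (- ((l - 1) * t)) * (f x * exp (- (1 * x)))"
            using f_facts(2)[of x] mult_left_mono[of "exp (- (l * x))" "exp (- ((l - 1) * t)) * exp (- (1 * x))" "f x"] by (simp add: mult_ac)
          then show ?thesis using f_facts(2)[of x] by (simp add: ennreal_mult'[symmetric] ennreal_leI)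
        qed
      qed
    qed
    also have "\<dots> = ennreal (exp (- ((l - 1) * t))) * ennreal (exp (- (1 powr a)))"
      using f_laplace[of 1] by (subst nn_integral_cmult) (auto simp: laplace_density)
    finally show ?thesis by (simp add: ennreal_mult'[symmetric])
  qed
  have "((\<lambda>l. exp (- ((l - 1) * t)) * exp (- (1 powr a)) * exp (l powr a)) \<longlongrightarrow> 0) at_top"
    using a t by real_asymp
  then have "\<forall>\<^sub>F l in at_top. exp (- ((l - 1) * t)) * exp (- (1 powr a)) * exp (l powr a) < 1"
    by (rule order_tendstoD) simp
  then obtain l where l: "1 < l" "exp (- ((l - 1) * t)) * exp (- (1 powr a)) * exp (l powr a) < 1"
    using eventually_happens'[OF _ eventually_conj[OF eventually_gt_at_top[of 1]]] trivial_limit_at_top_linorder by blast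
  have "exp (- (l powr a)) * exp (l powr a) < 1"
    using le[OF l(1)] l(2) by (smt (verit) mult_right_mono exp_ge_zero)
  then show False by (simp add: exp_minus)
qed

definition pk_weight :: "real \<Rightarrow> nat \<Rightarrow> nat \<Rightarrow> real" where
  "pk_weight t n k = pk_numerator n k t / (t ^ n * f t)"

lemma pk_weight_1_1: assumes t: "0 < t" shows "pk_weight t 1 1 = 1"
proof -
  have "t * f t \<noteq> 0" using t f_pos[OF t] by simp
  then show ?thesis unfolding pk_weight_def pk_numerator_1_1[symmetric] by simp
qed

lemma pk_weight_solution:
  assumes t: "0 < t" shows "gibbs_solution (gibbs_step (ereal a)) (pk_weight t)"
  unfolding gibbs_solution_def
proof (intro conjI allI impI)
  have ft: "0 < f t" by (rule f_pos[OF t])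
  show "pk_weight t 1 1 = 1" by (rule pk_weight_1_1[OF t])
  fix n k :: nat assume k: "1 \<le> k \<and> k \<le> n"
  show "0 \<le> pk_weight t n k" unfolding pk_weight_def using pk_numerator_facts(1)[of k n t] k t ft by simp
  have "pk_numerator n k t / (t ^ n * f t) = (t * pk_numerator n k t) / (t ^ Suc n * f t)" using t by simp
  also have "\<dots> = (real n - a * real k) * (pk_numerator (Suc n) k t / (t ^ Suc n * f t)) + pk_numerator (Suc n) (Suc k) t / (t ^ Suc n * f t)"
    using pk_numerator_rec[of k n t] k by (simp add: add_divide_distrib)
  finally show "pk_weight t n k = gibbs_step (ereal a) n k * pk_weight t (Suc n) k + pk_weight t (Suc n) (Suc k)"
    by (simp add: pk_weight_def gibbs_step_def)
qed

lemma pk_weight_cont: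
  assumes k: "1 \<le> k" "k \<le> n" shows "continuous_on {0<..} (\<lambda>t. pk_weight t n k)"
  unfolding pk_weight_def
proof (intro continuous_on_divide continuous_on_mult continuous_on_power continuous_on_id pk_numerator_facts(3)[OF k] ballI)
  show "continuous_on {0<..} f" by (rule continuous_on_subset[OF f_facts(3)]) simp
  show "t ^ n * f t \<noteq> 0" if "t \<in> {0<..}" for t using that f_pos[of t] by simp
qed

text \<open>The substitution \<open>u = t * y\<close> turns the integral over the unit interval into a fractional integral.\<close>

lemma poisson_kingman_V_eq:
  assumes s: "0 < s" and k: "1 \<le> k" "k \<le> n"
  shows "poisson_kingman_V a (ennreal s) n k = pk_weight (s powr (- 1 / a)) n k"
proof -
  define t where "t = s powr (- 1 / a)"
  have t: "0 < t" using s by (simp add: t_def)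
  define b where "b = real n - real k * a"
  have b: "0 < b" using order_pos[OF k] by (simp add: b_def)
  have G: "0 < Gamma b" by (rule Gamma_real_pos[OF b])
  have "frac b t = \<bar>t\<bar> *\<^sub>R (\<integral>y. power_kernel b (0 + t * y) * f (t - (0 + t * y)) \<partial>lborel)"
    unfolding frac_def by (rule lborel_integral_real_affine) (use t in simp)
  also have "(\<integral>y. power_kernel b (0 + t * y) * f (t - (0 + t * y)) \<partial>lborel)
      = (\<integral>y. (t powr (b - 1) / Gamma b) * (indicator {0<..<1} y *\<^sub>R (y powr (b - 1) * f (t * (1 - y)))) \<partial>lborel)"
  proof (intro Bochner_Integration.integral_cong refl)
    fix y :: real
    show "power_kernel b (0 + t * y) * f (t - (0 + t * y)) = (t powr (b - 1) / Gamma b) * (indicator {0<..<1} y *\<^sub>R (y powr (b - 1) * f (t * (1 - y))))"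
    proof (cases "y \<in> {0<..<1}")
      case True
      then show ?thesis using t by (simp add: power_kernel_def powr_mult right_diff_distrib)
    next
      case False
      then have "y \<le> 0 \<or> 1 \<le> y" by auto
      then show ?thesis
      proof
        assume "y \<le> 0"
        then have "\<not> 0 < t * y" using t by (simp add: mult_nonneg_nonpos not_less)
        then show ?thesis using False by (simp add: power_kernel_def)
      next
        assume "1 \<le> y"
        then have "t - t * y \<le> 0" using t by simp
        then show ?thesis using False f_facts(1)[of "t - t * y"] by simp
      qed
    qed
  qed
  also have "\<dots> = (t powr (b - 1) / Gamma b) * (LBINT y:{0<..<1}. y powr (b - 1) * f (t * (1 - y)))"
    unfolding set_lebesgue_integral_def by (rule integral_mult_right_zero)
  finally have "frac b t = t powr b / Gamma b * (LBINT y:{0<..<1}. y powr (b - 1) * f (t * (1 - y)))"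
    using t by (simp add: powr_diff)
  then have I: "(LBINT y:{0<..<1}. y powr (b - 1) * f (t * (1 - y))) = Gamma b * t powr (- b) * frac b t"
    using t G by (simp add: powr_minus field_simps)
  have tn: "t powr (real k * a) * t powr b = t ^ n"
    unfolding powr_add[symmetric] b_def using t by (simp add: powr_realpow)
  have fin: "ennreal s \<noteq> 0" "ennreal s \<noteq> \<infinity>" "enn2real (ennreal s) = s" using s by auto
  have "poisson_kingman_V a (ennreal s) n k
      = a ^ k / (Gamma b * t powr (real k * a) * f t) * (LBINT y:{0<..<1}. y powr (b - 1) * f (t * (1 - y)))"
    unfolding poisson_kingman_V_def Let_def fin(3) t_def[symmetric] b_def using fin by (simp add: algebra_simps)
  also have "\<dots> = a ^ k * frac b t / ((t powr (real k * a) * t powr b) * f t)"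
    unfolding I using G t f_pos[OF t] by (simp add: powr_minus field_simps)
  finally show ?thesis unfolding tn by (simp add: pk_weight_def pk_numerator_def b_def t_def)
qed

subsection \<open>Mixtures of Pitman-Yor type\<close>

text \<open>Integrated over \<open>t\<close> and normalised, these are the weights of the mixture of the Poisson-Kingman
  partitions with mixing density proportional to \<open>t powr (- \<theta>) * f t\<close>, that is, of the
  Pitman-Yor partition with parameters \<open>(a, \<theta>)\<close>.\<close>

definition tilted_weight :: "real \<Rightarrow> nat \<Rightarrow> nat \<Rightarrow> real \<Rightarrow> real" where
  "tilted_weight \<theta> n k t = (if 0 < t then t powr (- \<theta>) * f t * pk_weight t n k else 0)"

lemma tilted_weight_eq: "0 < t \<Longrightarrow> tilted_weight \<theta> n k t = t powr (- (real n + \<theta>)) * pk_numerator n k t"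
proof -
  assume t: "0 < t"
  have e: "t powr (- (real n + \<theta>)) = t powr (- \<theta>) / t ^ n"
    using t by (simp add: minus_add_distrib powr_diff powr_realpow flip: diff_conv_add_uminus) (simp add: powr_add powr_minus powr_realpow field_simps)
  show ?thesis unfolding e using t f_pos[OF t] by (simp add: tilted_weight_def pk_weight_def)
qed

lemma tilted_weight_nonneg: "1 \<le> k \<Longrightarrow> k \<le> n \<Longrightarrow> 0 \<le> tilted_weight \<theta> n k t"
  using pk_numerator_facts(1)[of k n t] f_facts(2)[of t] by (auto simp: tilted_weight_def pk_weight_def)

lemma tilted_weight_measurable: "1 \<le> k \<Longrightarrow> k \<le> n \<Longrightarrow> tilted_weight \<theta> n k \<in> borel_measurable borel"
proof -
  assume k: "1 \<le> k" "k \<le> n"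
  note [measurable] = pk_numerator_facts(4)[OF k]
  show ?thesis unfolding tilted_weight_def[abs_def] pk_weight_def by measurable
qed

text \<open>Writing \<open>t powr (- p)\<close> as a Gamma integral turns the integral over \<open>t\<close> into the integral of an
  explicit Laplace transform against \<open>l powr (p - 1)\<close>.\<close>

lemma tilted_weight_integral:
  assumes k: "1 \<le> k" "k \<le> n" and \<theta>: "- a < \<theta>"
  shows "has_bochner_integral lborel (tilted_weight \<theta> n k) (a ^ k * Gamma (real k + \<theta> / a) / (a * Gamma (real n + \<theta>)))"
proof -
  define p where "p = real n + \<theta>"
  define c where "c = real k + \<theta> / a"
  have p: "0 < p" using \<theta> k a by (simp add: p_def)
  have c: "0 < c"
  proof -
    have "a * 1 \<le> a * real k" using k a by (intro mult_left_mono) auto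
    then have "0 < a * real k + \<theta>" using \<theta> by linarith
    then have "0 < (a * real k + \<theta>) / a" using a(1) by (rule divide_pos_pos)
    also have "(a * real k + \<theta>) / a = c" using a by (simp add: c_def add_divide_distrib)
    finally show ?thesis .
  qed
  have Gp: "0 < Gamma p" "0 < Gamma c" using p c by (auto intro: Gamma_real_pos)
  note g = pk_numerator_facts[OF k]
  note [measurable] = g(4) tilted_weight_measurable[OF k]
  have "(\<integral>\<^sup>+t. ennreal (tilted_weight \<theta> n k t) \<partial>lborel)
      = (\<integral>\<^sup>+t. \<integral>\<^sup>+l. ennreal (pk_numerator n k t) * ennreal (exp (- (l * t)) * power_kernel p l) \<partial>lborel \<partial>lborel)"
  proof (intro nn_integral_cong)
    fix t :: real
    show "ennreal (tilted_weight \<theta> n k t) = (\<integral>\<^sup>+l. ennreal (pk_numerator n k t) * ennreal (exp (- (l * t)) * power_kernel p l) \<partial>lborel)"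
    proof (cases "0 < t")
      case True
      have "(\<integral>\<^sup>+l. ennreal (pk_numerator n k t) * ennreal (exp (- (l * t)) * power_kernel p l) \<partial>lborel)
        = ennreal (pk_numerator n k t) * (\<integral>\<^sup>+l. ennreal (exp (- (t * l)) * power_kernel p l) \<partial>lborel)"
        by (subst nn_integral_cmult[symmetric]) (auto simp: mult.commute)
      also have "\<dots> = ennreal (pk_numerator n k t) * ennreal (t powr (- p))" by (simp only: gamma_nn_integral[OF p True])
      also have "\<dots> = ennreal (tilted_weight \<theta> n k t)"
        unfolding tilted_weight_eq[OF True] p_def using g(1) by (simp add: ennreal_mult'[symmetric] mult.commute)
      finally show ?thesis by simp
    next
      case False then show ?thesis using g(2)[of t] by (simp add: tilted_weight_def)
    qed
  qed
  also have "\<dots> = (\<integral>\<^sup>+l. \<integral>\<^sup>+t. ennreal (pk_numerator n k t) * ennreal (exp (- (l * t)) * power_kernel p l) \<partial>lborel \<partial>lborel)"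
    by (rule lborel_pair.Fubini'[symmetric]) measurable
  also have "\<dots> = (\<integral>\<^sup>+l. ennreal (a ^ k / Gamma p) * ennreal (if 0 < l then l powr (a * c - 1) * exp (- (l powr a)) else 0) \<partial>lborel)"
  proof (intro nn_integral_cong)
    fix l :: real
    show "(\<integral>\<^sup>+t. ennreal (pk_numerator n k t) * ennreal (exp (- (l * t)) * power_kernel p l) \<partial>lborel)
      = ennreal (a ^ k / Gamma p) * ennreal (if 0 < l then l powr (a * c - 1) * exp (- (l powr a)) else 0)"
    proof (cases "0 < l")
      case True
      have "(\<integral>\<^sup>+t. ennreal (pk_numerator n k t) * ennreal (exp (- (l * t)) * power_kernel p l) \<partial>lborel)
        = ennreal (power_kernel p l) * laplace (density lborel (\<lambda>t. ennreal (pk_numerator n k t))) l"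
        using power_kernel_nonneg[OF p, of l]
        by (subst laplace_density, measurable, subst nn_integral_cmult[symmetric]) (auto intro!: nn_integral_cong simp: ennreal_mult' mult_ac)
      also have "\<dots> = ennreal (power_kernel p l * (a ^ k * l powr (real k * a - real n) * exp (- (l powr a))))"
        unfolding g(5)[OF True] using power_kernel_nonneg[OF p, of l] by (rule ennreal_mult'[symmetric])
      also have "power_kernel p l * (a ^ k * l powr (real k * a - real n) * exp (- (l powr a)))
        = a ^ k / Gamma p * ((l powr (p - 1) * l powr (real k * a - real n)) * exp (- (l powr a)))"
        using True by (simp add: power_kernel_def)
      also have "l powr (p - 1) * l powr (real k * a - real n) = l powr (a * c - 1)"
        unfolding powr_add[symmetric] using a by (intro arg_cong[where f="\<lambda>x. l powr x"]) (simp add: p_def c_def field_simps)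
      finally show ?thesis using True a Gp by (simp add: ennreal_mult'[symmetric])
    next
      case False then show ?thesis by (simp add: power_kernel_def)
    qed
  qed
  also have "\<dots> = ennreal (a ^ k / Gamma p) * ennreal (Gamma c / a)"
    by (subst nn_integral_cmult) (simp_all add: stretched_exponential_integral[OF a(1) c])
  also have "\<dots> = ennreal (a ^ k * Gamma c / (a * Gamma p))"
    using a Gp by (simp add: ennreal_mult'[symmetric] mult.commute)
  finally have "(\<integral>\<^sup>+t. ennreal (tilted_weight \<theta> n k t) \<partial>lborel) = ennreal (a ^ k * Gamma c / (a * Gamma p))" .
  then show ?thesis
    unfolding p_def[symmetric] c_def[symmetric]
    using tilted_weight_nonneg[OF k] a Gp by (intro has_bochner_integral_nn_integral) auto
qed

lemma Gamma_Suc_real: assumes "0 < x" shows "Gamma (1 + x) = x * Gamma (x::real)"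
proof -
  have "x \<notin> \<int>\<^sub>\<le>\<^sub>0" using assms by (auto elim!: nonpos_Ints_cases)
  then show ?thesis using Gamma_plus1[of x] by (simp add: add.commute)
qed

lemma tilted_weight_ratio:
  assumes \<theta>: "- a < \<theta>" "- 1 < \<theta>"
  defines "m \<equiv> (\<integral>t. tilted_weight \<theta> 1 1 t \<partial>lborel)"
  shows "0 < m" "(\<integral>t. tilted_weight \<theta> 2 2 t \<partial>lborel) = (a + \<theta>) / (1 + \<theta>) * m" "(\<integral>t. tilted_weight \<theta> 2 1 t \<partial>lborel) = 1 / (1 + \<theta>) * m"
proof -
  have x: "0 < 1 + \<theta> / a" using \<theta> a by (simp add: field_simps)
  have G: "0 < Gamma (1 + \<theta> / a)" "0 < Gamma (1 + \<theta>)" using x \<theta> by (auto intro: Gamma_real_pos)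
  have m: "m = Gamma (1 + \<theta> / a) / Gamma (1 + \<theta>)"
    unfolding m_def using has_bochner_integral_integral_eq[OF tilted_weight_integral[of 1 1 \<theta>]] \<theta> a by simp
  show "0 < m" unfolding m using G by simp
  have e1: "Gamma (2 + \<theta>) = (1 + \<theta>) * Gamma (1 + \<theta>)" using Gamma_Suc_real[of "1 + \<theta>"] \<theta> by (simp add: add.assoc[symmetric])
  have e2: "Gamma (2 + \<theta> / a) = (1 + \<theta> / a) * Gamma (1 + \<theta> / a)" using Gamma_Suc_real[OF x] by (simp add: add.assoc[symmetric])
  have "(\<integral>t. tilted_weight \<theta> 2 2 t \<partial>lborel) = a * Gamma (2 + \<theta> / a) / Gamma (2 + \<theta>)"
    using has_bochner_integral_integral_eq[OF tilted_weight_integral[of 2 2 \<theta>]] \<theta> a by (simp add: power2_eq_square)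
  also have "\<dots> = (a * (1 + \<theta> / a)) / (1 + \<theta>) * m" unfolding e1 e2 m by simp
  also have "a * (1 + \<theta> / a) = a + \<theta>" using a by (simp add: field_simps)
  finally show "(\<integral>t. tilted_weight \<theta> 2 2 t \<partial>lborel) = (a + \<theta>) / (1 + \<theta>) * m" .
  have "(\<integral>t. tilted_weight \<theta> 2 1 t \<partial>lborel) = Gamma (1 + \<theta> / a) / Gamma (2 + \<theta>)"
    using has_bochner_integral_integral_eq[OF tilted_weight_integral[of 1 2 \<theta>]] \<theta> a by simp
  then show "(\<integral>t. tilted_weight \<theta> 2 1 t \<partial>lborel) = 1 / (1 + \<theta>) * m" unfolding e1 m by simp
qed

lemma tilted_weight_bound:
  assumes k: "1 \<le> k" "k \<le> 2" and \<theta>: "- a < \<theta>" and le: "\<And>t. 0 < t \<Longrightarrow> e \<le> pk_weight t 2 k"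
  shows "e * (\<integral>t. tilted_weight \<theta> 1 1 t \<partial>lborel) \<le> (\<integral>t. tilted_weight \<theta> 2 k t \<partial>lborel)"
proof -
  have "(\<integral>t. e * tilted_weight \<theta> 1 1 t \<partial>lborel) \<le> (\<integral>t. tilted_weight \<theta> 2 k t \<partial>lborel)"
  proof (rule integral_mono)
    show "integrable lborel (\<lambda>t. e * tilted_weight \<theta> 1 1 t)"
      using tilted_weight_integral[of 1 1 \<theta>] \<theta> by (intro integrable_mult_right) (auto simp: has_bochner_integral_iff)
    show "integrable lborel (\<lambda>t. tilted_weight \<theta> 2 k t)"
      using tilted_weight_integral[OF k \<theta>] by (simp add: has_bochner_integral_iff)
    show "e * tilted_weight \<theta> 1 1 t \<le> tilted_weight \<theta> 2 k t" for t
    proof (cases "0 < t")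
      case True
      have "pk_weight t 1 1 = 1" by (rule pk_weight_1_1[OF True])
      moreover have "e * (t powr (- \<theta>) * f t) \<le> pk_weight t 2 k * (t powr (- \<theta>) * f t)"
        using le[OF True] f_facts(2)[of t] by (intro mult_right_mono) auto
      ultimately show ?thesis using True by (simp add: tilted_weight_def mult.commute)
    qed (simp add: tilted_weight_def)
  qed
  then show ?thesis by simp
qed

text \<open>The mean of \<open>pk_weight t 2 2\<close> under the mixture with parameter \<open>\<theta>\<close> is \<open>(a + \<theta>) / (1 +
  \<theta>)\<close>, which tends to \<open>0\<close> as \<open>\<theta>\<close> decreases to \<open>- a\<close>.\<close>

lemma pk_weight_small_22:
  assumes e: "0 < e" obtains t where "0 < t" "pk_weight t 2 2 < e"
proof (rule ccontr)
  assume "\<not> thesis"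
  then have le: "e \<le> pk_weight t 2 2" if "0 < t" for t using that \<open>\<And>t. 0 < t \<Longrightarrow> pk_weight t 2 2 < e \<Longrightarrow> thesis\<close> by (meson not_le)
  \<comment> \<open>with \<open>\<theta> = d - a\<close> the mean is below \<open>d / (1 - a)\<close>\<close>
  define d where "d = e * (1 - a) / 2"
  have d: "0 < d" using e a by (simp add: d_def)
  have \<theta>: "- a < d - a" "- 1 < d - a" using d a by auto
  note r = tilted_weight_ratio[OF \<theta>]
  have "e * (\<integral>t. tilted_weight (d - a) 1 1 t \<partial>lborel) \<le> (\<integral>t. tilted_weight (d - a) 2 2 t \<partial>lborel)"
    by (rule tilted_weight_bound) (use \<theta> le in auto)
  then have "e \<le> d / (1 + (d - a))" unfolding r(2) using mult_le_cancel_right_pos[OF r(1), of e "(a + (d - a)) / (1 + (d - a))"] by simp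
  also have "\<dots> < d / (1 - a)" using d a by (intro divide_strict_left_mono mult_pos_pos) auto
  also have "\<dots> = e / 2" using a(2) unfolding d_def by (simp add: divide_simps)
  finally show False using e by simp
qed

text \<open>Here the mean is \<open>1 / (1 + \<theta>)\<close>, which tends to \<open>0\<close> as \<open>\<theta>\<close> grows.\<close>

lemma pk_weight_small_21:
  assumes e: "0 < e" obtains t where "0 < t" "pk_weight t 2 1 < e"
proof (rule ccontr)
  assume "\<not> thesis"
  then have le: "e \<le> pk_weight t 2 1" if "0 < t" for t using that \<open>\<And>t. 0 < t \<Longrightarrow> pk_weight t 2 1 < e \<Longrightarrow> thesis\<close> by (meson not_le)
  have \<theta>: "- a < 1 / e" "- 1 < 1 / e" using e a by (auto intro: less_trans[of _ 0])
  note r = tilted_weight_ratio[OF \<theta>]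
  have "e * (\<integral>t. tilted_weight (1 / e) 1 1 t \<partial>lborel) \<le> (\<integral>t. tilted_weight (1 / e) 2 1 t \<partial>lborel)"
    by (rule tilted_weight_bound) (use \<theta> le in auto)
  then have "e \<le> 1 / (1 + 1 / e)" unfolding r(3) using mult_le_cancel_right_pos[OF r(1), of e "1 / (1 + 1 / e)"] by blast
  then have "e * (1 + 1 / e) \<le> 1" using e by (simp add: pos_le_divide_eq add_pos_pos)
  then show False using e by (simp add: algebra_simps)
qed

subsection \<open>The law of large numbers\<close>

sublocale gibbs_chain "gibbs_step (ereal a)"
  using a by (intro gibbs_step_chain) (simp add: one_ereal_def)

text \<open>This is asymptotic to \<open>n powr a\<close>. With the quotient of Gamma functions in its place the mean square
  deviation below has a closed form.\<close>

definition scale :: "nat \<Rightarrow> real" where "scale n = Gamma (real n + a) / Gamma (real n)"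

lemma scale_nonneg: "0 \<le> scale n"
  using a Gamma_real_pos[of "real n + a"] Gamma_real_pos[of "real n"] by (cases n) (auto simp: scale_def)

lemma inverse_scale_tendsto: "(\<lambda>n. 1 / scale n) \<longlonglongrightarrow> 0"
proof -
  have Ga: "0 < Gamma a" using a by (intro Gamma_real_pos)
  have na: "a \<notin> \<int>\<^sub>\<le>\<^sub>0" using a by (auto elim!: nonpos_Ints_cases)
  have "((\<lambda>n. Gamma_series' a n * exp (- (a * ln (real n))) / Gamma a) \<longlonglongrightarrow> Gamma a * 0 / Gamma a)"
  proof (intro tendsto_divide tendsto_mult Gamma_series'_LIMSEQ tendsto_const)
    show "(\<lambda>n. exp (- (a * ln (real n)))) \<longlonglongrightarrow> 0" using a by real_asymp
  qed (use Ga in simp)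
  moreover have "\<forall>\<^sub>F n in sequentially. Gamma_series' a n * exp (- (a * ln (real n))) / Gamma a = 1 / scale n"
    using eventually_gt_at_top[of 0]
  proof eventually_elim
    case (elim n)
    have "Gamma (real n) = fact (n - 1)" using Gamma_fact[of "n - 1", where ?'a=real] elim by (simp add: of_nat_diff)
    moreover have "Gamma (real n + a) = pochhammer a n * Gamma a"
      using pochhammer_Gamma[OF na, of n] Ga by (simp add: add.commute)
    moreover have "pochhammer a n \<noteq> 0" using pochhammer_pos[OF a(1), of n] by simp
    ultimately show ?case
      using Ga by (simp add: scale_def Gamma_series'_def exp_minus field_simps)
  qed
  ultimately show ?thesis by (simp add: tendsto_cong)
qed

text \<open>Gamma is logarithmically convex, and \<open>n + a\<close> is the midpoint of \<open>n\<close> and \<open>n + 2 * a\<close>.\<close>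

lemma Gamma_square_le:
  assumes n: "1 \<le> n"
  shows "Gamma (real n + a) ^ 2 \<le> Gamma (real n) * Gamma (real n + 2 * a)"
proof -
  let ?x = "real n" and ?y = "real n + 2 * a"
  have G: "0 < Gamma ?x" "0 < Gamma ?y" "0 < Gamma (real n + a)" using n a by (auto intro!: Gamma_real_pos)
  have "(ln \<circ> Gamma) ((1 - 1/2) *\<^sub>R ?x + (1/2) *\<^sub>R ?y) \<le> (1 - 1/2) * (ln \<circ> Gamma) ?x + (1/2) * (ln \<circ> Gamma) ?y"
    by (rule convex_onD[OF log_convex_Gamma_real]) (use n a in auto)
  moreover have "(1 - 1/2) *\<^sub>R ?x + (1/2) *\<^sub>R ?y = real n + a" by (simp add: field_simps)
  ultimately have "2 * ln (Gamma (real n + a)) \<le> ln (Gamma ?x) + ln (Gamma ?y)" by simp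
  then have "ln (Gamma (real n + a) ^ 2) \<le> ln (Gamma ?x * Gamma ?y)" using G by (simp add: ln_realpow ln_mult)
  then show ?thesis using G by (subst (asm) ln_le_cancel_iff) auto
qed

text \<open>The mean square of \<open>K\<^sub>n / scale n - t powr (- a)\<close> under the solution \<open>pk_weight t\<close>, weighted
  with the stable density at \<open>t\<close>.\<close>

definition mean_square :: "nat \<Rightarrow> real \<Rightarrow> real" where
  "mean_square n t = (if 0 < t then f t * E (pk_weight t) n (\<lambda>k. (real k / scale n - t powr (- a))\<^sup>2) else 0)"

lemma mean_square_nonneg: "0 \<le> mean_square n t"
  using E_nonneg[OF pk_weight_solution, of t n "\<lambda>k. (real k / scale n - t powr (- a))\<^sup>2"] f_facts(2)[of t]
  by (auto simp: mean_square_def)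

lemma order_gt: "- a < real r * a"
proof -
  have "0 \<le> real r * a" using a by simp
  then show ?thesis using a(1) by linarith
qed

text \<open>The probabilities of the numbers of blocks add up to \<open>1\<close> under the mixture with parameter \<open>\<theta> =
  r * a\<close>.\<close>

lemma total_tilted_weight:
  fixes r :: nat
  assumes n: "1 \<le> n"
  shows "(\<Sum>k=1..n. S n k * (a ^ k * Gamma (real k + real r) / a)) = Gamma (real n + real r * a) * (Gamma (1 + real r) / Gamma (1 + real r * a))"
proof -
  have \<theta>: "- a < real r * a" by (rule order_gt)
  have ra: "real r * a / a = real r" using a by simp
  have Gn: "0 < Gamma (real n + real r * a)" using n a by (intro Gamma_real_pos add_pos_nonneg) auto
  have "has_bochner_integral lborel (\<lambda>t. \<Sum>k=1..n. S n k * tilted_weight (real r * a) n k t)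
      (\<Sum>k=1..n. S n k * (a ^ k * Gamma (real k + real r * a / a) / (a * Gamma (real n + real r * a))))"
    using tilted_weight_integral[OF _ _ \<theta>] by (intro has_bochner_integral_sum has_bochner_integral_mult_right) auto
  moreover have "(\<lambda>t. \<Sum>k=1..n. S n k * tilted_weight (real r * a) n k t) = tilted_weight (real r * a) 1 1"
  proof
    fix t
    show "(\<Sum>k=1..n. S n k * tilted_weight (real r * a) n k t) = tilted_weight (real r * a) 1 1 t"
    proof (cases "0 < t")
      case True
      have one: "pk_weight t 1 1 = 1" by (rule pk_weight_1_1[OF True])
      have "(\<Sum>k=1..n. S n k * tilted_weight (real r * a) n k t) = t powr (- (real r * a)) * f t * E (pk_weight t) n (\<lambda>_. 1)"
        using True by (simp add: tilted_weight_def E_def sum_distrib_left mult_ac)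
      then show ?thesis using True one E_one[OF pk_weight_solution[OF True] n] by (simp add: tilted_weight_def)
    qed (simp add: tilted_weight_def)
  qed
  ultimately have "(\<Sum>k=1..n. S n k * (a ^ k * Gamma (real k + real r * a / a) / (a * Gamma (real n + real r * a))))
     = a ^ 1 * Gamma (real 1 + real r * a / a) / (a * Gamma (real 1 + real r * a))"
    using has_bochner_integral_eq[OF _ tilted_weight_integral[of 1 1, OF _ _ \<theta>]] by simp
  then have "(\<Sum>k=1..n. S n k * (a ^ k * Gamma (real k + real r) / a)) / Gamma (real n + real r * a) = Gamma (1 + real r) / Gamma (1 + real r * a)"
    unfolding ra sum_divide_distrib using a by (simp add: divide_simps)
  then show ?thesis using Gn by (simp add: field_simps)
qed

text \<open>Expanding the square and using the functional equation of Gamma, one expresses the integral by the sums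
  \<open>B 1\<close> and \<open>B 2\<close> that \<open>total_tilted_weight\<close> evaluates for \<open>r = 1\<close> and \<open>r = 2\<close>. By
  log-convexity of Gamma the terms with \<open>B 2\<close> together are at most \<open>0\<close>, and the term with \<open>B 1\<close> is
  of order \<open>1 / scale n\<close>.\<close>

lemma mean_square_integral:
  assumes n: "1 \<le> n"
  shows "integrable lborel (mean_square n)" "(\<integral>t. mean_square n t \<partial>lborel) \<le> 1 / Gamma (1 + a) / scale n"
proof -
  let ?A = "scale n"
  define J where "J r k = a ^ k * Gamma (real k + real r) / (a * Gamma (real n + real r * a))" for r k :: nat
  have G: "0 < Gamma (real n)" "0 < Gamma (real n + a)" "0 < Gamma (real n + 2 * a)" using n a by (auto intro!: Gamma_real_pos)
  have A: "0 < ?A" using G by (simp add: scale_def)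
  have hJ: "has_bochner_integral lborel (tilted_weight (real r * a) n k) (J r k)" if "k \<in> {1..n}" for r k
  proof -
    have ra: "real r * a / a = real r" using a by simp
    show ?thesis using tilted_weight_integral[of k n "real r * a", OF _ _ order_gt] that unfolding J_def ra by simp
  qed
  have "has_bochner_integral lborel
      (\<lambda>t. \<Sum>k=1..n. S n k * ((real k / ?A)\<^sup>2 * tilted_weight (real 0 * a) n k t - (2 * (real k / ?A)) * tilted_weight (real 1 * a) n k t + tilted_weight (real 2 * a) n k t))
      (\<Sum>k=1..n. S n k * ((real k / ?A)\<^sup>2 * J 0 k - (2 * (real k / ?A)) * J 1 k + J 2 k))" (is "has_bochner_integral _ ?h ?v")
    using hJ by (intro has_bochner_integral_sum has_bochner_integral_mult_right has_bochner_integral_add has_bochner_integral_diff)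
  moreover have "?h = mean_square n"
  proof
    fix t
    show "?h t = mean_square n t"
    proof (cases "0 < t")
      case True
      have p: "t powr (- (2 * a)) = (t powr (- a))\<^sup>2" using True by (simp add: power2_eq_square powr_add[symmetric])
      have "mean_square n t = (\<Sum>k=1..n. f t * (S n k * pk_weight t n k * (real k / ?A - t powr (- a))\<^sup>2))"
        using True by (simp add: mean_square_def E_def sum_distrib_left)
      also have "\<dots> = ?h t"
        using True p by (intro sum.cong refl) (simp add: tilted_weight_def power2_eq_square algebra_simps)
      finally show ?thesis by simp
    qed (simp add: tilted_weight_def mean_square_def)
  qed
  ultimately have int: "has_bochner_integral lborel (mean_square n) ?v" by simp
  then show "integrable lborel (mean_square n)" by (simp add: has_bochner_integral_iff)
  define B where "B r = (\<Sum>k=1..n. S n k * (a ^ k * Gamma (real k + real r) / a))" for r :: nat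
  \<comment> \<open>the common denominator \<open>scale n\<^sup>2 * Gamma n\<close> of the square and of the mixed term\<close>
  define Q where "Q = ?A * Gamma (real n + a)"
  have Q: "0 < Q" using A G by (simp add: Q_def)
  have Q2: "Q = ?A\<^sup>2 * Gamma (real n)" using G by (simp add: Q_def scale_def power2_eq_square)
  have "?v = (\<Sum>k=1..n. (S n k * (a ^ k * Gamma (real k + real 1) / a) - S n k * (a ^ k * Gamma (real k + real 2) / a)) / Q
      + S n k * (a ^ k * Gamma (real k + real 2) / a) / Gamma (real n + 2 * a))"
  proof (intro sum.cong refl)
    fix k assume "k \<in> {1..n}"
    then have k: "0 < real k" by simp
    have g1: "Gamma (real k + 1) = real k * Gamma (real k)" using Gamma_Suc_real[OF k] by (simp add: add.commute)
    have g2: "Gamma (real k + 2) = (real k + 1) * Gamma (real k + 1)" using Gamma_Suc_real[of "real k + 1"] k by (simp add: add_ac)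
    define X where "X = a ^ k * Gamma (real k + 2) / a"
    define Y where "Y = a ^ k * Gamma (real k + 1) / a"
    have e0: "(real k / ?A)\<^sup>2 * J 0 k = (X - Y) / Q"
      unfolding J_def X_def Y_def Q2 g2 g1 by (simp add: power2_eq_square algebra_simps add_divide_distrib)
    have e1: "(2 * (real k / ?A)) * J 1 k = 2 * ((X - Y) / Q)"
    proof -
      have "X - Y = real k * Y" unfolding X_def Y_def g2 by (simp add: algebra_simps add_divide_distrib)
      then show ?thesis unfolding J_def Y_def Q_def by (simp add: mult_ac)
    qed
    have e2: "J 2 k = X / Gamma (real n + 2 * a)" unfolding J_def X_def by simp
    have XY: "a ^ k * Gamma (real k + real 2) / a = X" "a ^ k * Gamma (real k + real 1) / a = Y" unfolding X_def Y_def by simp_all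
    show "S n k * ((real k / ?A)\<^sup>2 * J 0 k - (2 * (real k / ?A)) * J 1 k + J 2 k)
      = (S n k * (a ^ k * Gamma (real k + real 1) / a) - S n k * (a ^ k * Gamma (real k + real 2) / a)) / Q
      + S n k * (a ^ k * Gamma (real k + real 2) / a) / Gamma (real n + 2 * a)"
      unfolding e0 e1 e2 XY by (simp add: algebra_simps diff_divide_distrib)
  qed
  also have "\<dots> = (B 1 - B 2) / Q + B 2 / Gamma (real n + 2 * a)"
    unfolding B_def sum.distrib sum_divide_distrib[symmetric] sum_subtractf ..
  also have "\<dots> \<le> B 1 / Q"
  proof -
    have "Gamma (real n + 2 * a) \<ge> Q"
      using Gamma_square_le[OF n] G by (simp add: Q_def scale_def power2_eq_square divide_le_eq mult.commute)
    moreover have "0 \<le> B 2" unfolding B_def using S_nonneg a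
      by (intro sum_nonneg mult_nonneg_nonneg divide_nonneg_pos) (auto intro!: less_imp_le[OF Gamma_real_pos])
    ultimately have "B 2 / Gamma (real n + 2 * a) \<le> B 2 / Q" using Q by (intro divide_left_mono mult_pos_pos) (use G in auto)
    then show ?thesis by (simp add: diff_divide_distrib)
  qed
  also have "B 1 / Q = 1 / Gamma (1 + a) / ?A"
    using total_tilted_weight[OF n, of 1] G Gamma_fact[of 1, where ?'a=real] by (simp add: B_def Q_def)
  finally show "(\<integral>t. mean_square n t \<partial>lborel) \<le> 1 / Gamma (1 + a) / scale n"
    using has_bochner_integral_integral_eq[OF int] by simp
qed

text \<open>Convergence in mean implies almost everywhere convergence along a subsequence. It yields a dense set of
  good parameters, which is all that \<open>gibbs_interval\<close> demands.\<close>

lemma lln_along_subsequence: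
  obtains r where "strict_mono (r :: nat \<Rightarrow> nat)"
    "AE t in lborel. 0 < t \<longrightarrow> (\<lambda>j. E (pk_weight t) (r j) (\<lambda>k. (real k / scale (r j) - t powr (- a))\<^sup>2)) \<longlonglongrightarrow> 0"
proof -
  have "(\<lambda>n. \<integral>t. norm (mean_square (Suc n) t) \<partial>lborel) \<longlonglongrightarrow> 0"
  proof (rule tendsto_sandwich[OF _ _ tendsto_const])
    show "\<forall>\<^sub>F n in sequentially. 0 \<le> (\<integral>t. norm (mean_square (Suc n) t) \<partial>lborel)" by (intro always_eventually allI) simp
    show "\<forall>\<^sub>F n in sequentially. (\<integral>t. norm (mean_square (Suc n) t) \<partial>lborel) \<le> 1 / Gamma (1 + a) * (1 / scale (Suc n))"
      using mean_square_integral(2)[of "Suc _"] mean_square_nonneg by (intro always_eventually allI) simp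
    show "(\<lambda>n. 1 / Gamma (1 + a) * (1 / scale (Suc n))) \<longlonglongrightarrow> 0"
      using tendsto_mult[OF tendsto_const LIMSEQ_Suc[OF inverse_scale_tendsto], of "1 / Gamma (1 + a)"] by simp
  qed
  moreover have "integrable lborel (mean_square (Suc n))" for n by (rule mean_square_integral(1)) simp
  ultimately obtain r where r: "strict_mono (r :: nat \<Rightarrow> nat)" "AE t in lborel. (\<lambda>n. mean_square (Suc (r n)) t) \<longlonglongrightarrow> 0"
    using tendsto_L1_AE_subseq[of lborel "\<lambda>n. mean_square (Suc n)"] by blast
  show ?thesis
  proof (rule that[of "\<lambda>n. Suc (r n)"])
    show "strict_mono (\<lambda>n. Suc (r n))" using r(1) by (simp add: strict_mono_def)
    show "AE t in lborel. 0 < t \<longrightarrow> (\<lambda>j. E (pk_weight t) (Suc (r j)) (\<lambda>k. (real k / scale (Suc (r j)) - t powr (- a))\<^sup>2)) \<longlonglongrightarrow> 0"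
      using r(2)
    proof eventually_elim
      case (elim t)
      show ?case
      proof
        assume t: "0 < t"
        have "(\<lambda>j. mean_square (Suc (r j)) t / f t) \<longlonglongrightarrow> 0 / f t" using elim f_pos[OF t] by (intro tendsto_divide tendsto_const) auto
        then show "(\<lambda>j. E (pk_weight t) (Suc (r j)) (\<lambda>k. (real k / scale (Suc (r j)) - t powr (- a))\<^sup>2)) \<longlonglongrightarrow> 0"
          using t f_pos[OF t] by (simp add: mean_square_def)
      qed
    qed
  qed
qed

lemma AE_lborel_dense:
  assumes "AE t in lborel. P t" "c < d" obtains t where "c < t" "t < d" "P (t :: real)"
proof (rule ccontr)
  assume "\<not> thesis"
  then have "\<not> P t" if "c < t" "t < d" for t using that \<open>\<And>t. c < t \<Longrightarrow> t < d \<Longrightarrow> P t \<Longrightarrow> thesis\<close> by blast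
  then have "AE t in lborel. t \<notin> {c<..<d}" using assms(1) by (auto elim: eventually_mono)
  then have "emeasure lborel {c<..<d} = 0" by (subst (asm) AE_iff_measurable[where N="{c<..<d}"]) auto
  then show False using assms(2) by simp
qed

lemma pk_boundary:
  "\<exists>Z r \<zeta>. gibbs_boundary (gibbs_step (ereal a)) Z (\<lambda>z. extreme_V (ereal a) (of_unit z)) r \<zeta> \<and> of_unit ` Z = extreme_index (ereal a)"
proof -
  obtain r where r: "strict_mono (r :: nat \<Rightarrow> nat)"
    "AE t in lborel. 0 < t \<longrightarrow> (\<lambda>j. E (pk_weight t) (r j) (\<lambda>k. (real k / scale (r j) - t powr (- a))\<^sup>2)) \<longlonglongrightarrow> 0"
    by (rule lln_along_subsequence) (rule that)
  let ?good = "\<lambda>t. (\<lambda>j. E (pk_weight t) (r j) (\<lambda>k. (real k / scale (r j) - t powr (- a))\<^sup>2)) \<longlonglongrightarrow> 0"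
  define U where "U z = extreme_V (ereal a) (of_unit z)" for z
  define \<tau> where "\<tau> z = (z / (1 - z)) powr (- 1 / a)" for z :: real
  have a0: "\<not> a \<le> 0" "\<not> a < 0" "a \<noteq> 0" using a by auto
  have PK: "U z = poisson_kingman_V a (of_unit z)" for z
    unfolding U_def extreme_V_def using a0 by (simp add: zero_ereal_def)
  have \<tau>_pos: "0 < \<tau> z" if "z \<in> {0<..<1}" for z using that by (simp add: \<tau>_def)
  have U: "U z n k = pk_weight (\<tau> z) n k" if "z \<in> {0<..<1}" "1 \<le> k" "k \<le> n" for z n k
    unfolding PK \<tau>_def using that by (simp add: of_unit_ennreal poisson_kingman_V_eq)
  have E_U: "E (U z) n \<phi> = E (pk_weight (\<tau> z)) n \<phi>" if "z \<in> {0<..<1}" for z n \<phi>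
    unfolding E_def using U[OF that] by (intro sum.cong) auto
  have U1: "U 1 = singletons_V" by (simp add: PK of_unit_1 poisson_kingman_V_def fun_eq_iff)
  have U0: "U 0 n k = (if k = 1 then 1 / pochhammer (1 - a) (n - 1) else 0)" for n k
    by (simp add: PK of_unit_def poisson_kingman_V_def)
  have sol: "solution (U z)" if z: "z \<in> {0..1}" for z
  proof -
    consider "z = 0" | "z = 1" | "z \<in> {0<..<1}" using z by force
    then show ?thesis
    proof cases
      case 1
      have pp: "0 < pochhammer (1 - a) n" for n using a by (intro pochhammer_pos) simp
      show ?thesis unfolding gibbs_solution_def 1
      proof (intro conjI allI impI)
        fix n k :: nat assume k: "1 \<le> k \<and> k \<le> n"
        show "0 \<le> U 0 n k" using pp[of "n - 1"] by (simp add: U0)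
        obtain m where m: "n = Suc m" using k by (cases n) auto
        show "U 0 n k = gibbs_step (ereal a) n k * U 0 (Suc n) k + U 0 (Suc n) (Suc k)"
        proof (cases "k = 1")
          case True
          have "0 < 1 - a + real m" using a by simp
          then have "1 / pochhammer (1 - a) m = (1 - a + real m) / (pochhammer (1 - a) m * (1 - a + real m))" by simp
          then show ?thesis using True by (simp add: U0 m pochhammer_Suc gibbs_step_def algebra_simps)
        qed (use k in \<open>simp add: U0\<close>)
      qed (simp add: U0)
    next
      case 2 then show ?thesis using U1 singletons_solution by simp
    next
      case 3
      have "gibbs_solution (gibbs_step (ereal a)) (pk_weight (\<tau> z))" by (rule pk_weight_solution[OF \<tau>_pos[OF 3]])
      moreover have "U z 1 1 = pk_weight (\<tau> z) 1 1" using U[OF 3] by simp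
      ultimately show ?thesis unfolding gibbs_solution_def using U[OF 3] by (metis (no_types, lifting) le_SucI Suc_le_mono le_add1 plus_1_eq_Suc)
    qed
  qed
  have inv1: "to_unit (t powr (- a)) \<in> {0<..<1}" "\<tau> (to_unit (t powr (- a))) = t" if t: "0 < t" for t
  proof -
    have s: "0 < t powr (- a)" using t by simp
    define x where "x = t powr (- a)"
    have x: "0 < x" using s by (simp add: x_def)
    show "to_unit (t powr (- a)) \<in> {0<..<1}" unfolding x_def[symmetric] using x by (simp add: to_unit_def)
    have "to_unit (t powr (- a)) / (1 - to_unit (t powr (- a))) = t powr (- a)"
      unfolding x_def[symmetric] using x by (simp add: to_unit_def divide_simps)
    then show "\<tau> (to_unit (t powr (- a))) = t" unfolding \<tau>_def using t a by (simp add: powr_powr)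
  qed
  have inv2: "to_unit (\<tau> z powr (- a)) = z" if z: "z \<in> {0<..<1}" for z
  proof -
    have "\<tau> z powr (- a) = z / (1 - z)" unfolding \<tau>_def using z a by (simp add: powr_powr)
    then show ?thesis using z by (simp add: to_unit_inverse)
  qed
  define D where "D = {z \<in> {0<..<1}. ?good (\<tau> z)}"
  interpret gibbs_interval "gibbs_step (ereal a)" D U r "\<lambda>n k. to_unit (real k / scale n)"
  proof
    show "solution (U z)" if "z \<in> {0..1}" for z by (rule sol[OF that])
    show "continuous_on {0<..<1} (\<lambda>z. U z n k)" if k: "1 \<le> k" "k \<le> n" for n k
    proof (rule continuous_on_eq)
      show "continuous_on {0<..<1} (\<lambda>z. pk_weight (\<tau> z) n k)"
      proof (rule continuous_on_compose2[OF pk_weight_cont[OF k]])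
        show "continuous_on {0<..<1} \<tau>" unfolding \<tau>_def by (intro continuous_intros) auto
      qed (use \<tau>_pos in auto)
      show "pk_weight (\<tau> z) n k = U z n k" if "z \<in> {0<..<1}" for z using U[OF that k] by simp
    qed
    show "strict_mono r" by (rule r(1))
    show "to_unit (real k / scale n) \<in> {0..1}" for n k by (rule to_unit_scale_range[OF scale_nonneg])
    show "to_unit (real i / scale n) \<le> to_unit (real j / scale n)" if "i \<le> j" for n i j
      by (rule to_unit_scale_mono[OF scale_nonneg that])
    show "D \<subseteq> {0<..<1}" by (auto simp: D_def)
    show "\<exists>d\<in>D. x < d \<and> d < y" if xy: "0 \<le> x" "x < y" "y \<le> 1" for x y :: real
    proof -
      obtain z1 where z1: "x < z1" "z1 < y" using dense[OF xy(2)] by blast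
      obtain z2 where z2: "z1 < z2" "z2 < y" using dense[OF z1(2)] by blast
      have z: "z1 \<in> {0<..<1}" "z2 \<in> {0<..<1}" using z1 z2 xy by auto
      have "z1 / (1 - z1) < z2 / (1 - z2)" using z z2 by (simp add: divide_simps) (simp add: algebra_simps)
      then have "\<tau> z2 < \<tau> z1" unfolding \<tau>_def using z a by (intro powr_less_mono2_neg) auto
      then obtain t where t: "\<tau> z2 < t" "t < \<tau> z1" "0 < t \<longrightarrow> ?good t"
        using AE_lborel_dense[OF r(2)] by blast
      have t0: "0 < t" using t \<tau>_pos[OF z(2)] by simp
      let ?d = "to_unit (t powr (- a))"
      have "t powr (- a) < \<tau> z2 powr (- a)" "\<tau> z1 powr (- a) < t powr (- a)"
        using t t0 \<tau>_pos[OF z(2)] a by (auto intro!: powr_less_mono2_neg)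
      then have "?d < z2" "z1 < ?d"
        using to_unit_less[of "t powr (- a)" "\<tau> z2 powr (- a)"] to_unit_less[of "\<tau> z1 powr (- a)" "t powr (- a)"] inv2[OF z(1)] inv2[OF z(2)] by auto
      moreover have "?d \<in> D" unfolding D_def using inv1[OF t0] t(3) t0 by simp
      ultimately show ?thesis using z1 z2 by (intro bexI[of _ ?d]) auto
    qed
    show "(\<lambda>j. E (U d) (r j) (\<lambda>\<kappa>. \<bar>to_unit (real \<kappa> / scale (r j)) - d\<bar>)) \<longlonglongrightarrow> 0" if "d \<in> D" for d
    proof -
      have d: "d \<in> {0<..<1}" "?good (\<tau> d)" using that by (auto simp: D_def)
      have "(\<lambda>j. E (pk_weight (\<tau> d)) (r j) (\<lambda>\<kappa>. \<bar>to_unit (real \<kappa> / scale (r j)) - to_unit (\<tau> d powr (- a))\<bar>)) \<longlonglongrightarrow> 0"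
        by (rule to_unit_lln[OF pk_weight_solution[OF \<tau>_pos[OF d(1)]] _ r(1) scale_nonneg d(2)]) simp
      then show ?thesis unfolding E_U[OF d(1)] inv2[OF d(1)] .
    qed
    show "U 0 2 2 = 0" by (simp add: U0)
    show "U 1 2 1 = 0" by (simp add: U1 singletons_V_def)
    show "\<exists>z\<in>{0<..<1}. U z 2 2 < e" if e: "0 < e" for e
    proof -
      obtain t where t: "0 < t" "pk_weight t 2 2 < e" by (rule pk_weight_small_22[OF e])
      show ?thesis using inv1[OF t(1)] U[OF inv1(1)[OF t(1)], of 2 2] t(2) by (intro bexI[of _ "to_unit (t powr (- a))"]) auto
    qed
    show "\<exists>z\<in>{0<..<1}. U z 2 1 < e" if e: "0 < e" for e
    proof -
      obtain t where t: "0 < t" "pk_weight t 2 1 < e" by (rule pk_weight_small_21[OF e])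
      show ?thesis using inv1[OF t(1)] U[OF inv1(1)[OF t(1)], of 1 2] t(2) by (intro bexI[of _ "to_unit (t powr (- a))"]) auto
    qed
  qed
  have "of_unit ` {0..1} = extreme_index (ereal a)" using a0 by (simp add: of_unit_interval extreme_index_def)
  then show ?thesis using gibbs_boundary_axioms unfolding U_def by blast
qed

end

section \<open>Mixtures and extreme laws\<close>

text \<open>A toss of a coin decides from which of the two laws to sample.\<close>

definition mix_measure :: "real \<Rightarrow> 'a measure \<Rightarrow> 'a measure \<Rightarrow> 'a measure" where
  "mix_measure t M1 M2 = measure_pmf (bernoulli_pmf t) \<bind> (\<lambda>b. if b then M1 else M2)"

lemma mix_measure:
  assumes t: "0 \<le> t" "t \<le> 1" and P: "prob_space M1" "prob_space M2" and S: "sets M2 = sets M1"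
  shows "prob_space (mix_measure t M1 M2)" "sets (mix_measure t M1 M2) = sets M1"
    "A \<in> sets M1 \<Longrightarrow> measure (mix_measure t M1 M2) A = t * measure M1 A + (1 - t) * measure M2 A"
    "has_bochner_integral M1 f v1 \<Longrightarrow> has_bochner_integral M2 f v2 \<Longrightarrow> (\<And>x. x \<in> space M1 \<Longrightarrow> 0 \<le> (f x :: real)) \<Longrightarrow>
       has_bochner_integral (mix_measure t M1 M2) f (t * v1 + (1 - t) * v2)"
proof -
  let ?K = "\<lambda>b. if b then M1 else M2"
  have K: "?K \<in> measurable (measure_pmf (bernoulli_pmf t)) (subprob_algebra M1)"
    using P S by (auto simp: measurable_pmf_measure1 space_subprob_algebra prob_space_imp_subprob_space)
  show s: "sets (mix_measure t M1 M2) = sets M1" unfolding mix_measure_def using S by (intro sets_bind) auto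
  have nn: "(\<integral>\<^sup>+x. g x \<partial>mix_measure t M1 M2) = ennreal t * (\<integral>\<^sup>+x. g x \<partial>M1) + ennreal (1 - t) * (\<integral>\<^sup>+x. g x \<partial>M2)"
    if "g \<in> borel_measurable M1" for g
    unfolding mix_measure_def nn_integral_bind[OF that K] using t by (simp add: mult.commute)
  have em: "emeasure (mix_measure t M1 M2) A = ennreal t * emeasure M1 A + ennreal (1 - t) * emeasure M2 A" if "A \<in> sets M1" for A
    using nn[of "indicator A"] that s S by simp
  show "prob_space (mix_measure t M1 M2)"
  proof (rule prob_spaceI)
    have "space (mix_measure t M1 M2) = space M1" "space M2 = space M1" using s S by (auto dest: sets_eq_imp_space_eq)
    then show "emeasure (mix_measure t M1 M2) (space (mix_measure t M1 M2)) = 1"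
      using em[of "space M1"] prob_space.emeasure_space_1[OF P(1)] prob_space.emeasure_space_1[OF P(2)] t
      by (simp add: ennreal_plus[symmetric] del: ennreal_plus)
  qed
  show "measure (mix_measure t M1 M2) A = t * measure M1 A + (1 - t) * measure M2 A" if "A \<in> sets M1"
    unfolding measure_def em[OF that] using t P
    by (simp add: finite_measure.emeasure_eq_measure prob_space.axioms(1)
        prob_space.finite_measure ennreal_mult'[symmetric] ennreal_plus[symmetric] del: ennreal_plus)
  show "has_bochner_integral (mix_measure t M1 M2) f (t * v1 + (1 - t) * v2)"
    if f: "has_bochner_integral M1 f v1" "has_bochner_integral M2 f v2" "\<And>x. x \<in> space M1 \<Longrightarrow> 0 \<le> f x"
  proof -
    have sp: "space M2 = space M1" "space (mix_measure t M1 M2) = space M1" using s S by (auto dest: sets_eq_imp_space_eq)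
    have fm: "f \<in> borel_measurable M1" using f(1) by (simp add: has_bochner_integral_iff borel_measurable_integrable)
    have v: "0 \<le> v1" "0 \<le> v2"
      using f sp by (auto simp: has_bochner_integral_iff intro!: Bochner_Integration.integral_nonneg)
    have I: "(\<integral>\<^sup>+x. ennreal (f x) \<partial>M') = ennreal v" if "has_bochner_integral M' f v" "space M' = space M1" for M' v
    proof -
      have "integrable M' f" "v = (\<integral>x. f x \<partial>M')" using that(1) by (auto simp: has_bochner_integral_iff)
      moreover have "AE x in M'. 0 \<le> f x" using f(3) that(2) by (intro AE_I2) simp
      ultimately show ?thesis using nn_integral_eq_integral[of M' f] by simp
    qed
    have "(\<integral>\<^sup>+x. ennreal (f x) \<partial>M1) = ennreal v1" "(\<integral>\<^sup>+x. ennreal (f x) \<partial>M2) = ennreal v2"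
      using I[OF f(1)] I[OF f(2) sp(1)] by simp_all
    then have "(\<integral>\<^sup>+x. ennreal (f x) \<partial>mix_measure t M1 M2) = ennreal (t * v1 + (1 - t) * v2)"
      using nn[of "\<lambda>x. ennreal (f x)"] fm t v by (simp add: ennreal_mult'[symmetric] ennreal_plus[symmetric] del: ennreal_plus)
    moreover have "f \<in> borel_measurable (mix_measure t M1 M2)" using fm measurable_cong_sets[OF s refl] by blast
    ultimately show ?thesis using f(3) sp v t by (intro has_bochner_integral_nn_integral) (auto intro!: AE_I2)
  qed
qed

lemma conditional_decomposition:
  assumes Q: "prob_space Q" and B: "B \<in> sets Q" "0 < measure Q B" "measure Q B < 1"
  shows "prob_space (uniform_measure Q B)" "prob_space (uniform_measure Q (space Q - B))"
    "mix_measure (measure Q B) (uniform_measure Q B) (uniform_measure Q (space Q - B)) = Q"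
proof -
  interpret prob_space Q by (rule Q)
  let ?C = "space Q - B"
  have C: "?C \<in> sets Q" "measure Q ?C = 1 - measure Q B" using B by (auto simp: prob_compl)
  have e: "emeasure Q B \<noteq> 0" "emeasure Q ?C \<noteq> 0" using B C by (auto simp: emeasure_eq_measure)
  show p: "prob_space (uniform_measure Q B)" "prob_space (uniform_measure Q ?C)"
    using e by (auto intro!: prob_space_uniform_measure)
  have t: "0 \<le> measure Q B" "measure Q B \<le> 1" using B by auto
  note m = mix_measure[OF t p, simplified]
  interpret R: prob_space "mix_measure (measure Q B) (uniform_measure Q B) (uniform_measure Q ?C)" by (rule m(1))
  show "mix_measure (measure Q B) (uniform_measure Q B) (uniform_measure Q ?C) = Q"
  proof (rule measure_eqI)
    show "sets (mix_measure (measure Q B) (uniform_measure Q B) (uniform_measure Q ?C)) = sets Q" by (rule m(2))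
    fix A assume "A \<in> sets (mix_measure (measure Q B) (uniform_measure Q B) (uniform_measure Q ?C))"
    then have A: "A \<in> sets Q" using m(2) by simp
    have "measure (mix_measure (measure Q B) (uniform_measure Q B) (uniform_measure Q ?C)) A
       = measure Q B * (measure Q (B \<inter> A) / measure Q B) + (1 - measure Q B) * (measure Q (?C \<inter> A) / measure Q ?C)"
      using m(3)[OF A] A B e by (simp add: measure_uniform_measure)
    also have "\<dots> = measure Q (B \<inter> A) + measure Q (?C \<inter> A)" using B C(2) by simp
    also have "\<dots> = measure Q ((B \<inter> A) \<union> (?C \<inter> A))" using A B C by (intro finite_measure_Union[symmetric]) auto
    also have "(B \<inter> A) \<union> (?C \<inter> A) = A" using sets.sets_into_space[OF A] by auto
    finally show "emeasure (mix_measure (measure Q B) (uniform_measure Q B) (uniform_measure Q ?C)) A = emeasure Q A"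
      by (simp add: R.emeasure_eq_measure emeasure_eq_measure)
  qed
qed

text \<open>\<open>V n k\<close> times a block weight that does not depend on \<open>V\<close> is a probability.\<close>

lemma gibbs_solution_bounded:
  assumes "\<alpha> < 1" "1 \<le> k" "k \<le> n"
  obtains C where "\<And>V. gibbs_solution (gibbs_step \<alpha>) V \<Longrightarrow> \<bar>V n k\<bar> \<le> C"
proof -
  obtain P where P: "partition_on {1..n} P" "card P = k" by (rule partition_exists[OF assms(2,3)])
  have w: "0 < block_weight \<alpha> P" by (rule block_weight_pos[OF assms(1) P(1)])
  show ?thesis
  proof (rule that[of "1 / block_weight \<alpha> P"])
    fix V assume V: "gibbs_solution (gibbs_step \<alpha>) V"
    obtain M where M: "M \<in> gibbs_laws \<alpha>" "has_eppf M (gibbs_eppf \<alpha> V)" by (rule gibbs_law_exists[OF assms(1) V])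
    interpret prob_space M using M(1) by (simp add: gibbs_laws_def exchangeable_partition_law_def)
    have n: "1 \<le> n" using assms by simp
    have "measure M {\<omega> \<in> space M. \<omega> n = P} = V n (card P) * block_weight \<alpha> P"
      using M(2) P(1) n unfolding has_eppf_gibbs_iff by blast
    then have "V n (card P) * block_weight \<alpha> P \<le> 1" using prob_le_1[of "{\<omega> \<in> space M. \<omega> n = P}"] by simp
    moreover have "0 \<le> V n k" using V assms unfolding gibbs_solution_def by blast
    ultimately show "\<bar>V n k\<bar> \<le> 1 / block_weight \<alpha> P" using w P(2) by (simp add: pos_le_divide_eq)
  qed
qed

lemma eppf_determines_weights:
  assumes "\<alpha> < 1" "has_eppf M (gibbs_eppf \<alpha> V1)" "has_eppf M (gibbs_eppf \<alpha> V2)" "1 \<le> k" "k \<le> n"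
  shows "V1 n k = V2 n k"
proof -
  obtain P where P: "partition_on {1..n} P" "card P = k" by (rule partition_exists[OF assms(4,5)])
  have n: "1 \<le> n" using assms by simp
  have e: "measure M {\<omega> \<in> space M. \<omega> n = P} = V1 n (card P) * block_weight \<alpha> P"
    "measure M {\<omega> \<in> space M. \<omega> n = P} = V2 n (card P) * block_weight \<alpha> P"
    using assms(2,3) P(1) n unfolding has_eppf_gibbs_iff by blast+
  have "V1 n (card P) * block_weight \<alpha> P = V2 n (card P) * block_weight \<alpha> P" unfolding e(1)[symmetric] by (rule e(2))
  then show ?thesis using block_weight_pos[OF assms(1) P(1)] P(2) by simp
qed

text \<open>The mixture of the two laws is again consistent, so only the marginals have to be compared.\<close>

lemma gibbs_law_mixture:
  assumes "M \<in> gibbs_laws \<alpha>" "M1 \<in> gibbs_laws \<alpha>" "M2 \<in> gibbs_laws \<alpha>" and t: "0 < t" "t < 1"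
    and e: "has_eppf M (gibbs_eppf \<alpha> V)" "has_eppf M1 (gibbs_eppf \<alpha> V1)" "has_eppf M2 (gibbs_eppf \<alpha> V2)"
    and V: "\<And>n k. 1 \<le> k \<Longrightarrow> k \<le> n \<Longrightarrow> V n k = t * V1 n k + (1 - t) * V2 n k"
    and A: "A \<in> sets M"
  shows "measure M A = t * measure M1 A + (1 - t) * measure M2 A"
proof -
  let ?R = "mix_measure t M1 M2"
  have L: "prob_space M'" "sets M' = sets partition_seq_space" "AE \<omega> in M'. \<forall>n. \<omega> n = restrict_partition n (\<omega> (Suc n))"
    if "M' \<in> gibbs_laws \<alpha>" for M' using that by (auto simp: gibbs_laws_def exchangeable_partition_law_def)
  have S: "sets M2 = sets M1" using L(2) assms(2,3) by simp
  have t': "0 \<le> t" "t \<le> 1" using t by auto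
  note m = mix_measure[OF t' L(1)[OF assms(2)] L(1)[OF assms(3)] S]
  have Rs: "sets ?R = sets partition_seq_space" using m(2) L(2)[OF assms(2)] by simp
  have "M = ?R"
  proof (rule consistent_partition_law_unique)
    show "prob_space M" "sets M = sets partition_seq_space" "AE \<omega> in M. \<forall>n. \<omega> n = restrict_partition n (\<omega> (Suc n))"
      using L[OF assms(1)] by blast+
    show "prob_space ?R" "sets ?R = sets partition_seq_space" by (rule m(1), rule Rs)
    let ?c = "\<lambda>\<omega> :: nat \<Rightarrow> nat set set. \<forall>n. \<omega> n = restrict_partition n (\<omega> (Suc n))"
    obtain N1 where N1: "{\<omega> \<in> space M1. \<not> ?c \<omega>} \<subseteq> N1" "emeasure M1 N1 = 0" "N1 \<in> sets M1" using L(3)[OF assms(2)] by (rule AE_E)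
    obtain N2 where N2: "{\<omega> \<in> space M2. \<not> ?c \<omega>} \<subseteq> N2" "emeasure M2 N2 = 0" "N2 \<in> sets M2" using L(3)[OF assms(3)] by (rule AE_E)
    have sp: "space M2 = space M1" "space ?R = space M1" using S m(2) by (auto dest: sets_eq_imp_space_eq)
    have N: "N1 \<inter> N2 \<in> sets M1" using N1 N2 S by auto
    have "measure M1 (N1 \<inter> N2) = 0" "measure M2 (N1 \<inter> N2) = 0"
      using emeasure_mono[of "N1 \<inter> N2" N1 M1] emeasure_mono[of "N1 \<inter> N2" N2 M2] N1 N2 by (auto simp: measure_def)
    then have "measure ?R (N1 \<inter> N2) = 0" using m(3)[OF N] by simp
    then have "N1 \<inter> N2 \<in> null_sets ?R" using N m(2) by (simp add: null_sets_def finite_measure.emeasure_eq_measure[OF prob_space.finite_measure[OF m(1)]])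
    moreover have "{\<omega> \<in> space ?R. \<not> ?c \<omega>} \<subseteq> N1 \<inter> N2" using N1(1) N2(1) sp by auto
    ultimately show "AE \<omega> in ?R. ?c \<omega>" by (rule AE_I')
    fix n :: nat and P assume P: "1 \<le> n" "partition_on {1..n} P"
    have k: "1 \<le> card P" "card P \<le> n" using partition_facts(6,7)[OF P(2)] P(1) by auto
    have mm: "measure M' {\<omega> \<in> space M'. \<omega> n = P} = V' n (card P) * block_weight \<alpha> P" if "has_eppf M' (gibbs_eppf \<alpha> V')" for M' V'
      using that P unfolding has_eppf_gibbs_iff by blast
    have "space M1 = space partition_seq_space" using L(2)[OF assms(2)] by (rule sets_eq_imp_space_eq)
    then have ev: "{\<omega> \<in> space M1. \<omega> n = P} \<in> sets M1" using partition_event_measurable[of n "{P}"] L(2)[OF assms(2)] by simp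
    have "measure ?R {\<omega> \<in> space M1. \<omega> n = P} = t * measure M1 {\<omega> \<in> space M1. \<omega> n = P} + (1 - t) * measure M2 {\<omega> \<in> space M2. \<omega> n = P}"
      using m(3)[OF ev] sp by simp
    also have "\<dots> = V n (card P) * block_weight \<alpha> P" unfolding mm[OF e(2)] mm[OF e(3)] V[OF k] by (simp add: algebra_simps)
    finally show "measure M {\<omega> \<in> space M. \<omega> n = P} = measure ?R {\<omega> \<in> space ?R. \<omega> n = P}"
      unfolding mm[OF e(1)] sp(2) by simp
  qed
  moreover have "A \<in> sets M1" using A L(2)[OF assms(1)] L(2)[OF assms(2)] by simp
  ultimately show ?thesis using m(3) by simp
qed

definition mixes_to :: "'i measure \<Rightarrow> ('i \<Rightarrow> nat \<Rightarrow> nat \<Rightarrow> real) \<Rightarrow> (nat \<Rightarrow> nat \<Rightarrow> real) \<Rightarrow> bool" where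
  "mixes_to Q U V \<longleftrightarrow> prob_space Q \<and> (\<forall>n k. 1 \<le> k \<and> k \<le> n \<longrightarrow> has_bochner_integral Q (\<lambda>x. U x n k) (V n k))"

text \<open>The passage from unique mixtures to extreme laws does not depend on the nature of the family or of its
  index set.\<close>

locale gibbs_family =
  fixes \<alpha> :: ereal and N :: "'i measure" and U :: "'i \<Rightarrow> nat \<Rightarrow> nat \<Rightarrow> real"
  assumes less_1: "\<alpha> < 1"
    and solution_U: "\<And>x. x \<in> space N \<Longrightarrow> gibbs_solution (gibbs_step \<alpha>) (U x)"
    and measurable_U: "\<And>n k. 1 \<le> k \<Longrightarrow> k \<le> n \<Longrightarrow> (\<lambda>x. U x n k) \<in> borel_measurable N"
    and mixture_ex1: "\<And>V. gibbs_solution (gibbs_step \<alpha>) V \<Longrightarrow> \<exists>!Q. sets Q = sets N \<and> mixes_to Q U V"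
begin

lemma U_nonneg: "x \<in> space N \<Longrightarrow> 1 \<le> k \<Longrightarrow> k \<le> n \<Longrightarrow> 0 \<le> U x n k"
  using solution_U unfolding gibbs_solution_def by blast

lemma U_integrable:
  assumes Q: "prob_space Q" "sets Q = sets N" and k: "1 \<le> k" "k \<le> n" shows "integrable Q (\<lambda>x. U x n k)"
proof -
  obtain C where C: "\<And>V. gibbs_solution (gibbs_step \<alpha>) V \<Longrightarrow> \<bar>V n k\<bar> \<le> C" by (rule gibbs_solution_bounded[OF less_1 k]) (rule that)
  have sp: "space Q = space N" by (rule sets_eq_imp_space_eq[OF Q(2)])
  have "(\<lambda>x. U x n k) \<in> borel_measurable Q" using measurable_U[OF k] measurable_cong_sets[OF Q(2) refl] by blast
  moreover have "AE x in Q. norm (U x n k) \<le> C" using C[OF solution_U] sp by (intro AE_I2) simp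
  ultimately show ?thesis by (intro finite_measure.integrable_const_bound[OF prob_space.finite_measure[OF Q(1)]])
qed

lemma mixture_solution:
  assumes Q: "prob_space Q" "sets Q = sets N"
  shows "gibbs_solution (gibbs_step \<alpha>) (\<lambda>n k. \<integral>x. U x n k \<partial>Q)"
  unfolding gibbs_solution_def
proof (intro conjI allI impI)
  interpret prob_space Q by (rule Q(1))
  have sp: "space Q = space N" by (rule sets_eq_imp_space_eq[OF Q(2)])
  have "U x 1 1 = 1" if "x \<in> space Q" for x using solution_U that unfolding sp gibbs_solution_def by blast
  then have "(\<integral>x. U x 1 1 \<partial>Q) = (\<integral>x. 1 \<partial>Q)" by (intro Bochner_Integration.integral_cong) auto
  then show "(\<integral>x. U x 1 1 \<partial>Q) = 1" by (simp add: prob_space)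
  fix n k :: nat assume k: "1 \<le> k \<and> k \<le> n"
  then have k1: "1 \<le> k" "k \<le> n" "k \<le> Suc n" "1 \<le> Suc k" "Suc k \<le> Suc n" by auto
  show "0 \<le> (\<integral>x. U x n k \<partial>Q)" using U_nonneg k sp by (intro Bochner_Integration.integral_nonneg) auto
  have "(\<integral>x. U x n k \<partial>Q) = (\<integral>x. gibbs_step \<alpha> n k * U x (Suc n) k + U x (Suc n) (Suc k) \<partial>Q)"
  proof (intro Bochner_Integration.integral_cong refl)
    fix x assume "x \<in> space Q"
    then show "U x n k = gibbs_step \<alpha> n k * U x (Suc n) k + U x (Suc n) (Suc k)"
      using solution_U k unfolding sp gibbs_solution_def by blast
  qed
  also have "\<dots> = gibbs_step \<alpha> n k * (\<integral>x. U x (Suc n) k \<partial>Q) + (\<integral>x. U x (Suc n) (Suc k) \<partial>Q)"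
    using U_integrable[OF Q k1(1,3)] U_integrable[OF Q k1(4,5)] by simp
  finally show "(\<integral>x. U x n k \<partial>Q) = gibbs_step \<alpha> n k * (\<integral>x. U x (Suc n) k \<partial>Q) + (\<integral>x. U x (Suc n) (Suc k) \<partial>Q)" .
qed

lemma mixes_to_integral:
  assumes "prob_space Q" "sets Q = sets N" shows "mixes_to Q U (\<lambda>n k. \<integral>x. U x n k \<partial>Q)"
  using assms U_integrable unfolding mixes_to_def by (auto simp: has_bochner_integral_iff)

lemma mixes_to_unique:
  assumes V: "gibbs_solution (gibbs_step \<alpha>) V" and "mixes_to Q1 U V1" "sets Q1 = sets N" "mixes_to Q2 U V2" "sets Q2 = sets N"
    and "\<And>n k. 1 \<le> k \<Longrightarrow> k \<le> n \<Longrightarrow> V1 n k = V n k" "\<And>n k. 1 \<le> k \<Longrightarrow> k \<le> n \<Longrightarrow> V2 n k = V n k"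
  shows "Q1 = Q2"
proof -
  have "mixes_to Q1 U V" "mixes_to Q2 U V" using assms unfolding mixes_to_def by auto
  then show ?thesis using mixture_ex1[OF V] assms(3,5) by blast
qed

text \<open>The values of the EPPF on compositions differ from the weights by positive factors only, and every weight
  occurs.\<close>

lemma mixture_law_ex1:
  assumes M: "M \<in> gibbs_laws \<alpha>" "has_eppf M p"
  shows "\<exists>!Q. prob_space Q \<and> sets Q = sets N \<and> (\<forall>c. composition c \<longrightarrow> has_bochner_integral Q (\<lambda>x. gibbs_eppf \<alpha> (U x) c) (p c))"
proof -
  obtain V where V: "gibbs_solution (gibbs_step \<alpha>) V" "has_eppf M (gibbs_eppf \<alpha> V)" by (rule gibbs_law_solution[OF less_1 M(1)])
  have p: "p c = gibbs_eppf \<alpha> V c" and c: "1 \<le> length c" "length c \<le> sum_list c" if cc: "composition c" for c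
  proof -
    obtain As where As: "distinct As" "partition_on {1..sum_list c} (set As)" "map card As = c" by (rule composition_realised[OF cc])
    show l: "1 \<le> length c" using cc by (cases c) (auto simp: composition_def)
    have "1 * length c \<le> sum_list c" if "0 \<notin> set c" using that by (induction c) auto
    then show l2: "length c \<le> sum_list c" using cc by (simp add: composition_def)
    have n: "1 \<le> sum_list c" using l l2 by simp
    have "measure M {\<omega> \<in> space M. \<omega> (sum_list c) = set As} = p (map card As)"
      "measure M {\<omega> \<in> space M. \<omega> (sum_list c) = set As} = gibbs_eppf \<alpha> V (map card As)"
      using M(2) V(2) As n unfolding has_eppf_def by blast+
    then show "p c = gibbs_eppf \<alpha> V c" using As(3) by simp
  qed
  have W: "0 < (\<Prod>j\<leftarrow>c. gibbs_W \<alpha> j)" if "composition c" for c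
  proof -
    have "0 \<notin> set c" using that by (simp add: composition_def)
    then show ?thesis using gibbs_W_pos[OF less_1] by (induction c) (auto simp: Suc_le_eq)
  qed
  have "(\<forall>c. composition c \<longrightarrow> has_bochner_integral Q (\<lambda>x. gibbs_eppf \<alpha> (U x) c) (p c))
     \<longleftrightarrow> (\<forall>n k. 1 \<le> k \<and> k \<le> n \<longrightarrow> has_bochner_integral Q (\<lambda>x. U x n k) (V n k))" (is "?L \<longleftrightarrow> ?R") for Q
  proof
    assume L: ?L
    show ?R
    proof (intro allI impI)
      fix n k :: nat assume k: "1 \<le> k \<and> k \<le> n"
      obtain c where c: "composition c" "sum_list c = n" "length c = k" using composition_exists k by blast
      let ?w = "\<Prod>j\<leftarrow>c. gibbs_W \<alpha> j"
      have "has_bochner_integral Q (\<lambda>x. gibbs_eppf \<alpha> (U x) c * (1 / ?w)) (p c * (1 / ?w))"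
        using L c(1) by (intro has_bochner_integral_mult_left) blast
      moreover have "gibbs_eppf \<alpha> X c * (1 / ?w) = X n k" for X using W[OF c(1)] c by (simp add: gibbs_eppf_def)
      ultimately show "has_bochner_integral Q (\<lambda>x. U x n k) (V n k)" unfolding p[OF c(1)] by simp
    qed
  next
    assume R: ?R
    show ?L
    proof (intro allI impI)
      fix l assume l: "composition l"
      have "has_bochner_integral Q (\<lambda>x. U x (sum_list l) (length l)) (V (sum_list l) (length l))"
        using R c[OF l] by blast
      then show "has_bochner_integral Q (\<lambda>x. gibbs_eppf \<alpha> (U x) l) (p l)"
        unfolding p[OF l] gibbs_eppf_def by (intro has_bochner_integral_mult_left)
    qed
  qed
  then have e: "prob_space Q \<and> sets Q = sets N \<and> (\<forall>c. composition c \<longrightarrow> has_bochner_integral Q (\<lambda>x. gibbs_eppf \<alpha> (U x) c) (p c))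
      \<longleftrightarrow> sets Q = sets N \<and> mixes_to Q U V" for Q unfolding mixes_to_def by blast
  show ?thesis unfolding e by (rule mixture_ex1[OF V(1)])
qed

lemma member_law_ex1:
  assumes "x \<in> space N" shows "\<exists>!M. M \<in> gibbs_laws \<alpha> \<and> has_eppf M (gibbs_eppf \<alpha> (U x))"
proof -
  obtain M where M: "M \<in> gibbs_laws \<alpha>" "has_eppf M (gibbs_eppf \<alpha> (U x))"
    by (rule gibbs_law_exists[OF less_1 solution_U[OF assms]])
  then show ?thesis using gibbs_eppf_determines_law by blast
qed

lemma law_convex_combination_weights:
  assumes L: "M \<in> gibbs_laws \<alpha>" "M1 \<in> gibbs_laws \<alpha>" "M2 \<in> gibbs_laws \<alpha>"
    and e: "has_eppf M (gibbs_eppf \<alpha> V)" "has_eppf M1 (gibbs_eppf \<alpha> V1)" "has_eppf M2 (gibbs_eppf \<alpha> V2)"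
    and comb: "\<forall>A\<in>sets M. measure M A = t * measure M1 A + (1 - t) * measure M2 A"
    and k: "1 \<le> k" "k \<le> n"
  shows "V n k = t * V1 n k + (1 - t) * V2 n k"
proof -
  obtain P where P: "partition_on {1..n} P" "card P = k" by (rule partition_exists[OF k])
  have S: "sets M' = sets partition_seq_space" if "M' \<in> gibbs_laws \<alpha>" for M'
    using that by (simp add: gibbs_laws_def exchangeable_partition_law_def)
  have sp: "space M' = space partition_seq_space" if "M' \<in> gibbs_laws \<alpha>" for M' by (rule sets_eq_imp_space_eq[OF S[OF that]])
  have mm: "measure M' {\<omega> \<in> space partition_seq_space. \<omega> n = P} = V' n k * block_weight \<alpha> P"
    if "has_eppf M' (gibbs_eppf \<alpha> V')" "M' \<in> gibbs_laws \<alpha>" for M' V'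
    using that(1) P k unfolding has_eppf_gibbs_iff sp[OF that(2)] by auto
  have "{\<omega> \<in> space partition_seq_space. \<omega> n = P} \<in> sets M" using partition_event_measurable[of n "{P}"] S[OF L(1)] by simp
  then have "V n k * block_weight \<alpha> P = t * (V1 n k * block_weight \<alpha> P) + (1 - t) * (V2 n k * block_weight \<alpha> P)"
    using comb mm[OF e(1) L(1)] mm[OF e(2) L(2)] mm[OF e(3) L(3)] by simp
  then have "V n k * block_weight \<alpha> P = (t * V1 n k + (1 - t) * V2 n k) * block_weight \<alpha> P" by (simp add: algebra_simps)
  then show ?thesis using block_weight_pos[OF less_1 P(1)] by simp
qed

text \<open>If \<open>M\<close> is a mixture of \<open>M1\<close> and \<open>M2\<close>, then so are the representing measures. By uniqueness the
  mixture of these is the point mass at \<open>x\<close>, and a point mass is a mixture of copies of itself only.\<close>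

lemma member_extreme:
  assumes x: "x \<in> space N" and M: "M \<in> gibbs_laws \<alpha>" "has_eppf M (gibbs_eppf \<alpha> (U x))"
  shows "M \<in> extreme_laws (gibbs_laws \<alpha>)"
proof -
  have "M1 = M \<and> M2 = M"
    if M12: "M1 \<in> gibbs_laws \<alpha>" "M2 \<in> gibbs_laws \<alpha>" and t: "0 < t" "t < 1"
      and comb: "\<forall>A\<in>sets M. measure M A = t * measure M1 A + (1 - t) * measure M2 A" for M1 M2 and t :: real
  proof -
    obtain V1 where V1: "gibbs_solution (gibbs_step \<alpha>) V1" "has_eppf M1 (gibbs_eppf \<alpha> V1)" by (rule gibbs_law_solution[OF less_1 M12(1)])
    obtain V2 where V2: "gibbs_solution (gibbs_step \<alpha>) V2" "has_eppf M2 (gibbs_eppf \<alpha> V2)" by (rule gibbs_law_solution[OF less_1 M12(2)])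
    obtain Q1 where Q1: "sets Q1 = sets N" "mixes_to Q1 U V1" using mixture_ex1[OF V1(1)] by blast
    obtain Q2 where Q2: "sets Q2 = sets N" "mixes_to Q2 U V2" using mixture_ex1[OF V2(1)] by blast
    have P: "prob_space Q1" "prob_space Q2" using Q1 Q2 by (auto simp: mixes_to_def)
    interpret Q1: prob_space Q1 by (rule P)
    interpret Q2: prob_space Q2 by (rule P)
    have S: "sets Q2 = sets Q1" using Q1 Q2 by simp
    have t': "0 \<le> t" "t \<le> 1" using t by auto
    note m = mix_measure[OF t' P S]
    have sp: "space Q1 = space N" "space Q2 = space N" using Q1 Q2 by (auto dest: sets_eq_imp_space_eq)
    have R: "mixes_to (mix_measure t Q1 Q2) U (\<lambda>n k. t * V1 n k + (1 - t) * V2 n k)"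
      unfolding mixes_to_def
    proof (intro conjI allI impI m(1) m(4))
      fix n k :: nat assume k: "1 \<le> k \<and> k \<le> n"
      show "has_bochner_integral Q1 (\<lambda>x. U x n k) (V1 n k)" "has_bochner_integral Q2 (\<lambda>x. U x n k) (V2 n k)"
        using Q1(2) Q2(2) k unfolding mixes_to_def by blast+
      show "0 \<le> U y n k" if "y \<in> space Q1" for y using U_nonneg k that sp by simp
    qed
    have D: "mixes_to (return N x) U (U x)" unfolding mixes_to_def
    proof (intro conjI allI impI)
      show "prob_space (return N x)" by (rule prob_space_return[OF x])
      fix n k :: nat assume k: "1 \<le> k \<and> k \<le> n"
      then have m: "(\<lambda>y. U y n k) \<in> borel_measurable N" and k': "1 \<le> k" "k \<le> n" using measurable_U by auto
      have "(\<integral>\<^sup>+y. ennreal (U y n k) \<partial>return N x) = ennreal (U x n k)" using m x by (intro nn_integral_return) auto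
      then show "has_bochner_integral (return N x) (\<lambda>y. U y n k) (U x n k)"
        using m x U_nonneg[OF _ k'] by (intro has_bochner_integral_nn_integral) (auto intro!: AE_I2)
    qed
    have R_eq: "mix_measure t Q1 Q2 = return N x"
    proof (rule mixes_to_unique[OF solution_U[OF x] R _ D])
      show "sets (mix_measure t Q1 Q2) = sets N" using m(2) Q1(1) by simp
      show "t * V1 n k + (1 - t) * V2 n k = U x n k" if "1 \<le> k" "k \<le> n" for n k
        by (rule law_convex_combination_weights[OF M(1) M12 M(2) V1(2) V2(2) comb that, symmetric])
    qed simp_all
    have dirac: "Q = return N x" if Q: "prob_space Q" "sets Q = sets N"
      and meas: "\<And>A. A \<in> sets N \<Longrightarrow> measure Q A = indicator A x" for Q
    proof (rule measure_eqI)
      fix A assume "A \<in> sets Q"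
      then show "emeasure Q A = emeasure (return N x) A"
        using meas[of A] Q(2) finite_measure.emeasure_eq_measure[OF prob_space.finite_measure[OF Q(1)]] by (simp add: indicator_def)
    qed (use Q(2) in simp)
    have both: "measure Q1 A = indicator A x \<and> measure Q2 A = indicator A x" if A: "A \<in> sets N" for A
    proof -
      have "t * measure Q1 A + (1 - t) * measure Q2 A = measure (return N x) A" using m(3)[of A] A Q1(1) R_eq by simp
      also have "\<dots> = indicator A x" using A by (simp add: measure_return)
      finally have eq: "t * measure Q1 A + (1 - t) * measure Q2 A = indicator A x" .
      have u: "measure Q1 A \<le> 1" "measure Q2 A \<le> 1" "0 \<le> measure Q1 A" "0 \<le> measure Q2 A" by auto
      show ?thesis
      proof (cases "x \<in> A")
        case True
        have "t * (1 - measure Q1 A) + (1 - t) * (1 - measure Q2 A) = 0" using eq True by (simp add: algebra_simps)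
        moreover have "0 \<le> t * (1 - measure Q1 A)" "0 \<le> (1 - t) * (1 - measure Q2 A)" using t u by auto
        ultimately have "t * (1 - measure Q1 A) = 0" "(1 - t) * (1 - measure Q2 A) = 0" by linarith+
        then show ?thesis using t True by simp
      next
        case False
        moreover have "0 \<le> t * measure Q1 A" "0 \<le> (1 - t) * measure Q2 A" using t u by auto
        ultimately have "t * measure Q1 A = 0" "(1 - t) * measure Q2 A = 0" using eq False by (simp_all only: indicator_simps)
        then show ?thesis using t False by simp
      qed
    qed
    have "Q1 = return N x" "Q2 = return N x" using both by (auto intro!: dirac P Q1(1) Q2(1))
    then have "V1 n k = U x n k" "V2 n k = U x n k" if "1 \<le> k" "k \<le> n" for n k
      using Q1(2) Q2(2) D that has_bochner_integral_eq unfolding mixes_to_def by blast+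
    then show ?thesis
      using gibbs_eppf_determines_law[OF M12(1) M(1) V1(2) M(2)] gibbs_eppf_determines_law[OF M12(2) M(1) V2(2) M(2)] by blast
  qed
  then show ?thesis using M(1) unfolding extreme_laws_def by blast
qed

text \<open>Conditioning the representing measure of \<open>M\<close> on a set \<open>B\<close> of probability strictly between \<open>0\<close> and
  \<open>1\<close>, and on its complement, would write \<open>M\<close> as a mixture of two laws; as \<open>M\<close> is extreme, both
  would be \<open>M\<close>, and by uniqueness conditioning on \<open>B\<close> would not change the measure. So the measure
  takes the values \<open>0\<close> and \<open>1\<close> only, under it every weight is almost surely constant, and any \<open>x\<close>
  outside a null set has the weights of \<open>M\<close>.\<close>

lemma extreme_member:
  assumes M: "M \<in> extreme_laws (gibbs_laws \<alpha>)"
  obtains x where "x \<in> space N" "has_eppf M (gibbs_eppf \<alpha> (U x))"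
proof -
  have Mg: "M \<in> gibbs_laws \<alpha>" using M by (simp add: extreme_laws_def)
  obtain V where V: "gibbs_solution (gibbs_step \<alpha>) V" "has_eppf M (gibbs_eppf \<alpha> V)" by (rule gibbs_law_solution[OF less_1 Mg])
  obtain Q where Q: "sets Q = sets N" "mixes_to Q U V" using mixture_ex1[OF V(1)] by blast
  have P: "prob_space Q" using Q by (simp add: mixes_to_def)
  interpret prob_space Q by (rule P)
  have sp: "space Q = space N" by (rule sets_eq_imp_space_eq[OF Q(1)])
  \<comment> \<open>a set of intermediate probability would split \<open>M\<close>\<close>
  have zero_one: "measure Q B = 0 \<or> measure Q B = 1" if B: "B \<in> sets Q" for B
  proof (rule ccontr)
    assume "\<not> ?thesis"
    then have b: "0 < measure Q B" "measure Q B < 1" using prob_le_1[of B] by (auto simp: zero_less_measure_iff less_le)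
    let ?b = "measure Q B" and ?Q1 = "uniform_measure Q B" and ?Q2 = "uniform_measure Q (space Q - B)"
    define V1 where "V1 n k = (\<integral>x. U x n k \<partial>?Q1)" for n k
    define V2 where "V2 n k = (\<integral>x. U x n k \<partial>?Q2)" for n k
    note d = conditional_decomposition[OF P B b]
    have s: "sets ?Q1 = sets N" "sets ?Q2 = sets N" "sets ?Q2 = sets ?Q1" using Q(1) by simp_all
    have r: "mixes_to ?Q1 U V1" "mixes_to ?Q2 U V2"
      using mixes_to_integral[OF d(1) s(1)] mixes_to_integral[OF d(2) s(2)] by (simp_all add: V1_def[abs_def] V2_def[abs_def])
    have sol: "gibbs_solution (gibbs_step \<alpha>) V1" "gibbs_solution (gibbs_step \<alpha>) V2"
      using mixture_solution[OF d(1) s(1)] mixture_solution[OF d(2) s(2)] by (simp_all add: V1_def[abs_def] V2_def[abs_def])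
    obtain M1 where M1: "M1 \<in> gibbs_laws \<alpha>" "has_eppf M1 (gibbs_eppf \<alpha> V1)" by (rule gibbs_law_exists[OF less_1 sol(1)])
    obtain M2 where M2: "M2 \<in> gibbs_laws \<alpha>" "has_eppf M2 (gibbs_eppf \<alpha> V2)" by (rule gibbs_law_exists[OF less_1 sol(2)])
    have b': "0 \<le> ?b" "?b \<le> 1" using b by auto
    have "V n k = ?b * V1 n k + (1 - ?b) * V2 n k" if k: "1 \<le> k" "k \<le> n" for n k
    proof (rule has_bochner_integral_eq)
      show "has_bochner_integral Q (\<lambda>x. U x n k) (V n k)" using Q(2) k unfolding mixes_to_def by blast
      have "has_bochner_integral (mix_measure ?b ?Q1 ?Q2) (\<lambda>x. U x n k) (?b * V1 n k + (1 - ?b) * V2 n k)"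
        by (rule mix_measure(4)[OF b' d(1,2) s(3)]) (use r k U_nonneg sp in \<open>auto simp: mixes_to_def\<close>)
      then show "has_bochner_integral Q (\<lambda>x. U x n k) (?b * V1 n k + (1 - ?b) * V2 n k)" unfolding d(3) .
    qed
    then have "\<forall>A\<in>sets M. measure M A = ?b * measure M1 A + (1 - ?b) * measure M2 A"
      using gibbs_law_mixture[OF Mg M1(1) M2(1) b V(2) M1(2) M2(2)] by blast
    then have "M1 = M" using M M1(1) M2(1) b unfolding extreme_laws_def by blast
    then have "V1 n k = V n k" if "1 \<le> k" "k \<le> n" for n k
      using eppf_determines_weights[OF less_1 _ V(2) that] M1(2) by blast
    then have "?Q1 = Q" by (intro mixes_to_unique[OF V(1) r(1) s(1) Q(2,1)]) auto
    moreover have "measure ?Q1 B = 1" using B b by (simp add: measure_uniform_measure emeasure_eq_measure)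
    ultimately show False using b by simp
  qed
  have ae: "AE x in Q. U x n k = V n k" if k: "1 \<le> k" "k \<le> n" for n k
  proof -
    let ?f = "\<lambda>x. U x n k - V n k"
    have i: "integrable Q (\<lambda>x. U x n k)" "(\<integral>x. U x n k \<partial>Q) = V n k"
      using Q(2) k by (auto simp: mixes_to_def has_bochner_integral_iff)
    have fm: "?f \<in> borel_measurable Q" and fi: "integrable Q ?f" and f0: "(\<integral>x. ?f x \<partial>Q) = 0" using i by (auto simp: prob_space)
    have B: "{x \<in> space Q. 0 \<le> ?f x} \<in> sets Q" using fm by measurable
    from zero_one[OF B] show ?thesis
    proof
      assume "measure Q {x \<in> space Q. 0 \<le> ?f x} = 1"
      then have "AE x in Q. x \<in> {x \<in> space Q. 0 \<le> ?f x}" by (rule iffD2[OF AE_in_set_eq_1[OF B]])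
      then have pos: "AE x in Q. 0 \<le> ?f x" by eventually_elim simp
      have "AE x in Q. ?f x = 0" by (rule iffD1[OF integral_nonneg_eq_0_iff_AE[OF fi pos] f0])
      then show ?thesis by eventually_elim simp
    next
      assume "measure Q {x \<in> space Q. 0 \<le> ?f x} = 0"
      then have "AE x in Q. x \<notin> {x \<in> space Q. 0 \<le> ?f x}" using B by (subst AE_iff_null_sets[symmetric, OF B]) (simp add: null_sets_def emeasure_eq_measure)
      then have neg: "AE x in Q. 0 \<le> - ?f x" using AE_space by eventually_elim auto
      have "(\<integral>x. - ?f x \<partial>Q) = 0" unfolding Bochner_Integration.integral_minus f0 by simp
      then have "AE x in Q. - ?f x = 0" by (rule iffD1[OF integral_nonneg_eq_0_iff_AE[OF integrable_minus[OF fi] neg]])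
      then show ?thesis by eventually_elim simp
    qed
  qed
  have "AE x in Q. \<forall>n k. 1 \<le> k \<longrightarrow> k \<le> n \<longrightarrow> U x n k = V n k" using ae by (simp add: AE_all_countable)
  then have "\<exists>x\<in>space Q. \<forall>n k. 1 \<le> k \<longrightarrow> k \<le> n \<longrightarrow> U x n k = V n k"
  proof (rule contrapos_pp)
    assume "\<not> (\<exists>x\<in>space Q. \<forall>n k. 1 \<le> k \<longrightarrow> k \<le> n \<longrightarrow> U x n k = V n k)"
    then have "AE x in Q. \<not> (\<forall>n k. 1 \<le> k \<longrightarrow> k \<le> n \<longrightarrow> U x n k = V n k)" by (intro AE_I2) blast
    then show "\<not> (AE x in Q. \<forall>n k. 1 \<le> k \<longrightarrow> k \<le> n \<longrightarrow> U x n k = V n k)" using AE_contr by blast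
  qed
  then obtain x where x: "x \<in> space N" "\<And>n k. 1 \<le> k \<Longrightarrow> k \<le> n \<Longrightarrow> U x n k = V n k" using sp by blast
  obtain M' where M': "M' \<in> gibbs_laws \<alpha>" "has_eppf M' (gibbs_eppf \<alpha> (U x))" by (rule gibbs_law_exists[OF less_1 solution_U[OF x(1)]])
  have "M' = M" by (rule gibbs_eppf_determines_law[OF M'(1) Mg M'(2) V(2) x(2)])
  then show ?thesis using that x(1) M'(2) by blast
qed

theorem extreme_laws_eq:
  "extreme_laws (gibbs_laws \<alpha>) = {M \<in> gibbs_laws \<alpha>. \<exists>x\<in>space N. has_eppf M (gibbs_eppf \<alpha> (U x))}"
proof (intro subset_antisym subsetI)
  fix M assume M: "M \<in> extreme_laws (gibbs_laws \<alpha>)"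
  obtain x where "x \<in> space N" "has_eppf M (gibbs_eppf \<alpha> (U x))" by (rule extreme_member[OF M])
  moreover have "M \<in> gibbs_laws \<alpha>" using M by (simp add: extreme_laws_def)
  ultimately show "M \<in> {M \<in> gibbs_laws \<alpha>. \<exists>x\<in>space N. has_eppf M (gibbs_eppf \<alpha> (U x))}" by blast
next
  fix M assume "M \<in> {M \<in> gibbs_laws \<alpha>. \<exists>x\<in>space N. has_eppf M (gibbs_eppf \<alpha> (U x))}"
  then obtain x where "x \<in> space N" "M \<in> gibbs_laws \<alpha>" "has_eppf M (gibbs_eppf \<alpha> (U x))" by blast
  then show "M \<in> extreme_laws (gibbs_laws \<alpha>)" by (rule member_extreme)
qed

end

section \<open>Transport to the index sets of the theorem\<close>

definition unit_of :: "ennreal \<Rightarrow> real" where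
  "unit_of x = (if x = \<infinity> then 1 else to_unit (enn2real x))"

lemma of_unit_unit_of: "of_unit (unit_of x) = x"
proof (cases "x = \<infinity>")
  case False
  then have "ennreal (enn2real x) = x" by (simp add: ennreal_enn2real less_top)
  then show ?thesis using False by (simp add: unit_of_def of_unit_to_unit)
qed (simp add: unit_of_def of_unit_1)

lemma unit_of_of_unit: "z \<in> {0..1} \<Longrightarrow> unit_of (of_unit z) = z"
  by (cases "z = 1") (auto simp: of_unit_1 unit_of_def of_unit_ennreal to_unit_inverse)

lemma measurable_of_unit: "of_unit \<in> borel_measurable borel"
  unfolding of_unit_def[abs_def] by measurable

lemma measurable_unit_of: "unit_of \<in> borel_measurable borel"
  unfolding unit_of_def[abs_def] to_unit_def by measurable

lemma extreme_boundary:
  assumes "\<alpha> < 1"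
  obtains Z r \<zeta> where "gibbs_boundary (gibbs_step \<alpha>) Z (\<lambda>z. extreme_V \<alpha> (of_unit z)) r \<zeta>" "of_unit ` Z = extreme_index \<alpha>"
proof -
  consider "\<alpha> < 0" | "\<alpha> = 0" | "0 < \<alpha>" by fastforce
  then have "\<exists>Z r \<zeta>. gibbs_boundary (gibbs_step \<alpha>) Z (\<lambda>z. extreme_V \<alpha> (of_unit z)) r \<zeta> \<and> of_unit ` Z = extreme_index \<alpha>"
  proof cases
    case 1 then show ?thesis by (rule negative_boundary)
  next
    case 2 then show ?thesis using ewens_boundary by simp
  next
    case 3
    then obtain a where \<alpha>: "\<alpha> = ereal a" "0 < a" "a < 1" using assms by (cases \<alpha>) auto
    interpret stable_index a by unfold_locales (use \<alpha> in auto)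
    show ?thesis unfolding \<alpha>(1) by (rule pk_boundary)
  qed
  then show ?thesis using that by blast
qed

text \<open>The boundary was parametrised by a subset of the unit interval. The Borel isomorphisms \<open>of_unit\<close> and
  \<open>unit_of\<close> carry the representing measures over to the index set of the theorem.\<close>

lemma extreme_family:
  assumes "\<alpha> < 1"
  shows "gibbs_family \<alpha> (restrict_space borel (extreme_index \<alpha>)) (extreme_V \<alpha>)"
proof -
  let ?I = "extreme_index \<alpha>"
  obtain Z r \<zeta> where B: "gibbs_boundary (gibbs_step \<alpha>) Z (\<lambda>z. extreme_V \<alpha> (of_unit z)) r \<zeta>" and ZI: "of_unit ` Z = ?I"
    by (rule extreme_boundary[OF assms])
  interpret gibbs_boundary "gibbs_step \<alpha>" Z "\<lambda>z. extreme_V \<alpha> (of_unit z)" r \<zeta> by (rule B)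
  let ?NI = "restrict_space borel ?I" and ?NZ = "restrict_space borel Z"
  have inv: "unit_of (of_unit z) = z" if "z \<in> Z" for z using that Z(2) by (intro unit_of_of_unit) auto
  have unit_Z: "unit_of x \<in> Z" if "x \<in> ?I" for x using that inv unfolding ZI[symmetric] by auto
  have m: "of_unit \<in> measurable ?NZ ?NI" "unit_of \<in> measurable ?NI ?NZ"
    using unit_Z ZI by (auto intro!: measurable_restrict_space3 measurable_of_unit measurable_unit_of)
  have U_meas: "(\<lambda>z. extreme_V \<alpha> (of_unit z) n k) \<in> borel_measurable ?NZ" if "1 \<le> k" "k \<le> n" for n k
    by (rule borel_measurable_continuous_on_restrict[OF cont_U[OF that]])
  have V_meas: "(\<lambda>x. extreme_V \<alpha> x n k) \<in> borel_measurable ?NI" if "1 \<le> k" "k \<le> n" for n k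
    using measurable_compose[OF m(2) U_meas[OF that]] by (simp add: of_unit_unit_of)
  have to_index: "sets (distr Q ?NI of_unit) = sets ?NI \<and> mixes_to (distr Q ?NI of_unit) (extreme_V \<alpha>) V"
    if Q: "represents Q V" for Q V
  proof -
    have s: "sets Q = sets ?NZ" and p: "prob_space Q" using Q by (auto simp: represents_def)
    have mQ: "of_unit \<in> measurable Q ?NI" using m(1) measurable_cong_sets[OF s refl] by blast
    have "has_bochner_integral (distr Q ?NI of_unit) (\<lambda>x. extreme_V \<alpha> x n k) (V n k)" if k: "1 \<le> k" "k \<le> n" for n k
      using Q k unfolding represents_def by (intro has_bochner_integral_distr[OF V_meas[OF k] mQ]) blast
    then show ?thesis using prob_space.prob_space_distr[OF p mQ] by (simp add: mixes_to_def)
  qed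
  have from_index: "represents (distr Q ?NZ unit_of) V" if Q: "sets Q = sets ?NI" "mixes_to Q (extreme_V \<alpha>) V" for Q V
  proof -
    have p: "prob_space Q" using Q by (simp add: mixes_to_def)
    have mQ: "unit_of \<in> measurable Q ?NZ" using m(2) measurable_cong_sets[OF Q(1) refl] by blast
    have "has_bochner_integral (distr Q ?NZ unit_of) (\<lambda>z. extreme_V \<alpha> (of_unit z) n k) (V n k)" if k: "1 \<le> k" "k \<le> n" for n k
    proof (rule has_bochner_integral_distr[OF U_meas[OF k] mQ])
      show "has_bochner_integral Q (\<lambda>x. extreme_V \<alpha> (of_unit (unit_of x)) n k) (V n k)"
        unfolding of_unit_unit_of using Q(2) k unfolding mixes_to_def by blast
    qed
    then show ?thesis using prob_space.prob_space_distr[OF p mQ] by (simp add: represents_def)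
  qed
  have round: "distr (distr Q ?NZ unit_of) ?NI of_unit = Q" if Q: "sets Q = sets ?NI" for Q
  proof -
    have mQ: "unit_of \<in> measurable Q ?NZ" using m(2) measurable_cong_sets[OF Q refl] by blast
    have "distr (distr Q ?NZ unit_of) ?NI of_unit = distr Q ?NI (\<lambda>x. x)"
      unfolding distr_distr[OF m(1) mQ] by (intro distr_cong) (simp_all add: of_unit_unit_of)
    also have "\<dots> = Q" using Q by (intro distr_id2) simp
    finally show ?thesis .
  qed
  show ?thesis
  proof
    show "\<alpha> < 1" by fact
    show "gibbs_solution (gibbs_step \<alpha>) (extreme_V \<alpha> x)" if "x \<in> space ?NI" for x
      using sol_U that unfolding space_restrict_space ZI[symmetric] by auto
    show "(\<lambda>x. extreme_V \<alpha> x n k) \<in> borel_measurable ?NI" if "1 \<le> k" "k \<le> n" for n k by (rule V_meas[OF that])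
    fix V assume V: "gibbs_solution (gibbs_step \<alpha>) V"
    obtain Q0 where Q0: "represents Q0 V" using represents_exists[OF V] by blast
    show "\<exists>!Q. sets Q = sets ?NI \<and> mixes_to Q (extreme_V \<alpha>) V"
    proof (rule ex1I)
      show "sets (distr Q0 ?NI of_unit) = sets ?NI \<and> mixes_to (distr Q0 ?NI of_unit) (extreme_V \<alpha>) V" by (rule to_index[OF Q0])
      fix Q assume Q: "sets Q = sets ?NI \<and> mixes_to Q (extreme_V \<alpha>) V"
      have "represents (distr Q ?NZ unit_of) V" using from_index Q by blast
      then have "distr Q ?NZ unit_of = Q0" using represents_ex1[OF V] Q0 by blast
      then show "Q = distr Q0 ?NI of_unit" using round Q by metis
    qed
  qed
qed

theorem theorem12:
  fixes \<alpha> :: ereal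
  assumes "\<alpha> < 1"
  shows
    "(\<forall>M\<in>gibbs_laws \<alpha>. \<forall>p. has_eppf M p \<longrightarrow>
        (\<exists>!Q. prob_space Q \<and> sets Q = sets (restrict_space borel (extreme_index \<alpha>)) \<and>
              (\<forall>c. composition c \<longrightarrow>
                 has_bochner_integral Q (\<lambda>x. extreme_eppf \<alpha> x c) (p c)))) \<and>
     (\<forall>x\<in>extreme_index \<alpha>. \<exists>!M. M \<in> gibbs_laws \<alpha> \<and> has_eppf M (extreme_eppf \<alpha> x)) \<and>
     extreme_laws (gibbs_laws \<alpha>) =
       {M \<in> gibbs_laws \<alpha>. \<exists>x\<in>extreme_index \<alpha>. has_eppf M (extreme_eppf \<alpha> x)}"
proof -
  interpret gibbs_family \<alpha> "restrict_space borel (extreme_index \<alpha>)" "extreme_V \<alpha>"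
    by (rule extreme_family[OF assms])
  have sp: "space (restrict_space borel (extreme_index \<alpha>)) = extreme_index \<alpha>" by (simp add: space_restrict_space)
  show ?thesis
    unfolding extreme_eppf_def using mixture_law_ex1 member_law_ex1 extreme_laws_eq unfolding sp by blast
qed

end
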